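(* Let $a,b,c,n$ be positive integers with $a+b=n$. If $c=n-1$ or $c=n-2$, then $$\operatorname{ind}\mathfrak{p}_n^{\mathrm C}((a,b)\mid(c))=\gcd(a+b,\,b+c)-1.$$
   Context: The ground field is algebraically closed of characteristic zero. Index. For a Lie algebra $\mathfrak{g}$, $\operatorname{ind}\mathfrak{g}=\min_{f\in\mathfrak{g}^*}\dim\ker(B_f)$, where $B_f(x,y)=f([x,y])$ for $x,y\in\mathfrak{g}$. Symplectic Lie algebra. $\mathfrak{sp}(2n)$ is the Lie algebra of $2n\times 2n$ block matrices $\begin{bmatrix}A&B\\C&-\widehat{A}\end{bmatrix}$ with $A,B,C$ of size $n\times n$, $B=\widehat{B}$, $C=\widehat{C}$, where $\widehat{X}$ is the transpose of $X$ with respect to the antidiagonal. Use the triangular decomposition $\mathfrak{sp}(2n)=\mathfrak{u}_+\oplus\mathfrak{h}\oplus\mathfrak{u}_-$ into strictly upper triangular, diagonal, and strictly lower triangular matrices. Let $\Pi=\{\alpha_1,\dots,\alpha_n\}$ be the simple roots in the standard order with $\alpha_n$ the exceptional (long) root: writing $\epsilon_i$ for the $i$-th diagonal entry functional on $\mathfrak h$, $\alpha_i=\epsilon_i-\epsilon_{i+1}$ for $i<n$ and $\alpha_n=2\epsilon_n$. Let $\mathfrak{g}_\alpha$ denote the root space of $\alpha$. Seaweeds. For $\Psi,\Psi'\subseteq\Pi$, $\mathfrak{p}_n^{\mathrm C}(\Psi\mid\Psi')$ is the (standard) seaweed subalgebra $\mathfrak{p}\cap\mathfrak{p}'$ of $\mathfrak{sp}(2n)$,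 where $\mathfrak{p}\supseteq\mathfrak{h}\oplus\mathfrak{u}_+$ and $\mathfrak{p}'\supseteq\mathfrak{h}\oplus\mathfrak{u}_-$ are the parabolic subalgebras determined by $\Psi=\{\alpha\in\Pi:\mathfrak{g}_{-\alpha}\not\subseteq\mathfrak{p}\}$ and $\Psi'=\{\alpha\in\Pi:\mathfrak{g}_{\alpha}\not\subseteq\mathfrak{p}'\}$. Let $C_{\leq n}$ be the set of finite strings of positive integers (possibly the empty string $\emptyset$) with sum at most $n$. For $\underline{a}=(a_1,\dots,a_m)\in C_{\leq n}$ put $\varphi_{\mathrm C}(\underline{a})=\{\alpha_{a_1},\alpha_{a_1+a_2},\dots,\alpha_{a_1+\dots+a_m}\}$ (with $\varphi_{\mathrm C}(\emptyset)=\emptyset$), and define $\mathfrak{p}_n^{\mathrm C}(\underline{a}\mid\underline{b})=\mathfrak{p}_n^{\mathrm C}(\varphi_{\mathrm C}(\underline{a})\mid\varphi_{\mathrm C}(\underline{b}))$. *)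

theory Defs
  imports
    "HOL-Computational_Algebra.Polynomial"
    "Jordan_Normal_Form.VS_Connect"
begin

section \<open>The index of a Lie algebra\<close>

text \<open>A Lie algebra is given by a vector space \<open>V\<close> (a module record over the field
  \<^const>\<open>class_ring\<close>) together with a bracket. Functionals are only constrained on
  the carrier; their values elsewhere are irrelevant.\<close>

definition linear_functionals :: "('k::field, 'v) module \<Rightarrow> ('v \<Rightarrow> 'k) set" where
  "linear_functionals V =
    {f. (\<forall>x\<in>carrier V. \<forall>y\<in>carrier V. f (x \<oplus>\<^bsub>V\<^esub> y) = f x + f y) \<and>
        (\<forall>c. \<forall>x\<in>carrier V. f (c \<odot>\<^bsub>V\<^esub> x) = c * f x)}"

definition form_kernel ::
    "('k::field, 'v) module \<Rightarrow> ('v \<Rightarrow> 'v \<Rightarrow> 'v) \<Rightarrow> ('v \<Rightarrow> 'k) \<Rightarrow> 'v set" where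
  "form_kernel V br f = {x \<in> carrier V. \<forall>y\<in>carrier V. f (br x y) = 0}"

definition lie_index :: "('k::field, 'v) module \<Rightarrow> ('v \<Rightarrow> 'v \<Rightarrow> 'v) \<Rightarrow> nat" where
  "lie_index V br =
    (LEAST d. \<exists>f\<in>linear_functionals V.
       d = vectorspace.dim class_ring (V\<lparr>carrier := form_kernel V br f\<rparr>))"

section \<open>The symplectic Lie algebra\<close>

definition antitranspose :: "'a mat \<Rightarrow> 'a mat" where
  "antitranspose X = mat (dim_col X) (dim_row X)
     (\<lambda>(i, j). X $$ (dim_row X - 1 - j, dim_col X - 1 - i))"

definition commutator :: "'k::field mat \<Rightarrow> 'k mat \<Rightarrow> 'k mat" where
  "commutator X Y = X * Y - Y * X"

definition sp :: "nat \<Rightarrow> 'k::field mat set" where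
  "sp n = {four_block_mat A B C (- antitranspose A) | A B C.
     A \<in> carrier_mat n n \<and> B \<in> carrier_mat n n \<and> C \<in> carrier_mat n n \<and>
     B = antitranspose B \<and> C = antitranspose C}"

definition sp_diag :: "nat \<Rightarrow> 'k::field mat set" where
  "sp_diag n = {X \<in> sp n. diagonal_mat X}"

definition sp_upper :: "nat \<Rightarrow> 'k::field mat set" where
  "sp_upper n = {X \<in> sp n. \<forall>i<2 * n. \<forall>j<2 * n. j \<le> i \<longrightarrow> X $$ (i, j) = 0}"

definition sp_lower :: "nat \<Rightarrow> 'k::field mat set" where
  "sp_lower n = {X \<in> sp n. \<forall>i<2 * n. \<forall>j<2 * n. i \<le> j \<longrightarrow> X $$ (i, j) = 0}"

definition lie_subalgebra :: "nat \<Rightarrow> 'k::field mat set \<Rightarrow> bool" where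
  "lie_subalgebra n L \<longleftrightarrow>
     VectorSpace.subspace class_ring L (module_mat TYPE('k) (2 * n) (2 * n)) \<and>
     L \<subseteq> sp n \<and> (\<forall>X\<in>L. \<forall>Y\<in>L. commutator X Y \<in> L)"

section \<open>Roots\<close>

text \<open>Indices of \<open>\<epsilon>\<^sub>i\<close> and \<open>\<alpha>\<^sub>i\<close> run from 1 to \<open>n\<close>, whereas matrix entries are numbered
  from 0. Functionals on the diagonal matrices are total functions on matrices; distinct
  simple roots already differ on \<^const>\<open>sp_diag\<close>.\<close>

definition eps :: "nat \<Rightarrow> 'k::field mat \<Rightarrow> 'k" where
  "eps i H = H $$ (i - 1, i - 1)"

definition simple_root :: "nat \<Rightarrow> nat \<Rightarrow> 'k::field mat \<Rightarrow> 'k" where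
  "simple_root n i = (if i < n then (\<lambda>H. eps i H - eps (i + 1) H) else (\<lambda>H. 2 * eps n H))"

definition simple_roots :: "nat \<Rightarrow> ('k::field mat \<Rightarrow> 'k) set" where
  "simple_roots n = simple_root n ` {1..n}"

definition root_space :: "nat \<Rightarrow> ('k::field mat \<Rightarrow> 'k) \<Rightarrow> 'k mat set" where
  "root_space n \<alpha> = {X \<in> sp n. \<forall>H\<in>sp_diag n. commutator H X = \<alpha> H \<cdot>\<^sub>m X}"

section \<open>Seaweed subalgebras\<close>

text \<open>For \<open>\<Psi> \<subseteq> simple_roots n\<close> in characteristic zero there is exactly one subalgebra
  containing the upper (respectively lower) Borel subalgebra and having \<open>\<Psi>\<close> as its set of
  missing opposite simple roots.\<close>

definition parabolic_plus :: "nat \<Rightarrow> ('k::field mat \<Rightarrow> 'k) set \<Rightarrow> 'k mat set" where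
  "parabolic_plus n \<Psi> = (THE P. lie_subalgebra n P \<and>
     {H + U | H U. H \<in> sp_diag n \<and> U \<in> sp_upper n} \<subseteq> P \<and>
     \<Psi> = {\<alpha> \<in> simple_roots n. \<not> root_space n (\<lambda>H. - \<alpha> H) \<subseteq> P})"

definition parabolic_minus :: "nat \<Rightarrow> ('k::field mat \<Rightarrow> 'k) set \<Rightarrow> 'k mat set" where
  "parabolic_minus n \<Psi> = (THE P. lie_subalgebra n P \<and>
     {H + U | H U. H \<in> sp_diag n \<and> U \<in> sp_lower n} \<subseteq> P \<and>
     \<Psi> = {\<alpha> \<in> simple_roots n. \<not> root_space n \<alpha> \<subseteq> P})"

definition seaweed ::
    "nat \<Rightarrow> ('k::field mat \<Rightarrow> 'k) set \<Rightarrow> ('k mat \<Rightarrow> 'k) set \<Rightarrow> 'k mat set" where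
  "seaweed n \<Psi> \<Psi>' = parabolic_plus n \<Psi> \<inter> parabolic_minus n \<Psi>'"

text \<open>Only meaningful for strings of positive integers with sum at most \<open>n\<close>.\<close>

definition phi_C :: "nat \<Rightarrow> nat list \<Rightarrow> ('k::field mat \<Rightarrow> 'k) set" where
  "phi_C n as = {simple_root n (sum_list (take k as)) | k. 1 \<le> k \<and> k \<le> length as}"

definition seaweed_C :: "nat \<Rightarrow> nat list \<Rightarrow> nat list \<Rightarrow> 'k::field mat set" where
  "seaweed_C n as bs = seaweed n (phi_C n as) (phi_C n bs)"

definition index_seaweed_C :: "'k::field itself \<Rightarrow> nat \<Rightarrow> nat list \<Rightarrow> nat list \<Rightarrow> nat" where
  "index_seaweed_C _ n as bs =
     lie_index (module_mat TYPE('k) (2 * n) (2 * n)\<lparr>carrier := seaweed_C n as bs\<rparr>) commutator"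

end

(* A functional on the seaweed restricts to a symmetric form S on the abelian ideal of elements
   supported in the upper right corner, whose size m = n - c is 1 or 2. Generically S is
   nondegenerate, and symplectic reduction by this isotropic ideal replaces the seaweed by the
   stabiliser of S in the upper left block, a block triangular algebra with diagonal blocks of
   sizes a, m and b - m in which the middle block is so(m). Reducing further by isotropic spaces of
   homomorphisms between the blocks performs a Euclidean algorithm on the pair (a + m, b - m). With
   d the gcd, it ends in gl(d - m) + so(m), whose index is d - 1; for m = 2 and d = 1 it ends in a
   Frobenius algebra instead, and so does the case b = 1 < m. All reductions hold only for generic
   functionals; this suffices because the kernel for f + s g is at most as large as the kernel for f
   for all but finitely many s. *)

theory Submission
  imports Defs "Jordan_Normal_Form.Char_Poly"
begin

section \<open>Alternating forms on finite-dimensional subspaces\<close>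

text \<open>Every reduction is run in both directions: a generic functional descends, which bounds
  the index from below, and a functional of minimal kernel on the smaller algebra is lifted, which
  shows that the bound is attained. A Euclidean step needs an invertible square part of the matrix
  \<open>C\<close> that represents the functional on the maps between two blocks. With
  \<open>|W| = b - m\<close> this is available only for \<open>|W| \<le> a\<close> or
  \<open>|W| \<ge> a + m\<close>. For m = 1 these cases exhaust all sizes; for m = 2 the size
  \<open>a + 1\<close> is left, where \<open>C\<close> has a kernel line and the generator of so(2)
  must make up for it. That generator depends on the symmetric form, so for m = 2 the reduced
  algebra varies with the functional. A separate task comes from the seaweed being given by definite
  descriptions: the subalgebras containing a Borel subalgebra have to be classified, which rests on
  their being spanned by root vectors.\<close>

locale matrix_space = vector_space scale
  for scale :: "'a::field \<Rightarrow> 'b::ab_group_add \<Rightarrow> 'b"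
begin

text \<open>The ambient space of finitely supported matrices is infinite-dimensional, and
  \<open>dim\<close> is the cardinality of a basis, hence 0 for an infinite one; comparisons of
  dimensions therefore carry this condition.\<close>

definition fin_dim :: "'b set \<Rightarrow> bool" where
  "fin_dim E \<longleftrightarrow> (\<exists>B. finite B \<and> E \<subseteq> span B)"

text \<open>Linearity on a subset: the induction for \<open>functional_in_span\<close> shrinks the
  domain, and a functional given on a carrier is unconstrained outside it.\<close>

definition linfun_on :: "'b set \<Rightarrow> ('b \<Rightarrow> 'a) \<Rightarrow> bool" where
  "linfun_on S g \<longleftrightarrow> (\<forall>x\<in>S. \<forall>y\<in>S. g (x + y) = g x + g y) \<and> (\<forall>c. \<forall>x\<in>S. g (scale c x) = c * g x)"

lemma linfun_onD:
  assumes "linfun_on S g" "x \<in> S"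
  shows "y \<in> S \<Longrightarrow> g (x + y) = g x + g y" "g (scale c x) = c * g x"
  using assms unfolding linfun_on_def by auto

lemma linfun_on_zero: "linfun_on S g \<Longrightarrow> 0 \<in> S \<Longrightarrow> g 0 = 0"
  unfolding linfun_on_def by (metis mult_zero_left scale_zero_left)

lemma linfun_on_subset: "linfun_on S g \<Longrightarrow> T \<subseteq> S \<Longrightarrow> linfun_on T g"
  unfolding linfun_on_def by blast

lemma linfun_on_sum:
  assumes "linfun_on S g" "subspace S" "\<And>b. b \<in> B \<Longrightarrow> h b \<in> S"
  shows "g (\<Sum>b\<in>B. h b) = (\<Sum>b\<in>B. g (h b))"
  using assms(3)
proof (induction B rule: infinite_finite_induct)
  case (insert b B)
  then have "g (h b + sum h B) = g (h b) + g (sum h B)"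
    using assms(1,2) subspace_sum[OF assms(2), of B h] unfolding linfun_on_def by auto
  then show ?case using insert by simp
qed (use linfun_on_zero[OF assms(1)] subspace_0[OF assms(2)] in auto)

lemma fin_dim_subset: "fin_dim F \<Longrightarrow> E \<subseteq> F \<Longrightarrow> fin_dim E"
  unfolding fin_dim_def by blast

lemma fin_dim_obtain_basis:
  assumes "fin_dim E"
  obtains B where "finite B" "B \<subseteq> E" "independent B" "E \<subseteq> span B" "card B = dim E"
proof -
  obtain B where B: "B \<subseteq> E" "independent B" "E \<subseteq> span B" "card B = dim E"
    using basis_exists by blast
  obtain C where C: "finite C" "E \<subseteq> span C" using assms unfolding fin_dim_def by blast
  have "finite B" using independent_span_bound[OF C(1) B(2)] B(1) C(2) by blast
  then show ?thesis using B that by blast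
qed

lemma fin_dim_independent:
  assumes "fin_dim E" "independent B" "B \<subseteq> E"
  shows "finite B" and "card B \<le> dim E"
proof -
  obtain C where C: "finite C" "E \<subseteq> span C" "card C = dim E"
    using fin_dim_obtain_basis[OF assms(1)] by metis
  show "finite B" "card B \<le> dim E"
    using independent_span_bound[OF C(1) assms(2)] assms(3) C by auto
qed

lemma fin_dim_dim_mono:
  assumes "fin_dim F" "E \<subseteq> F"
  shows "dim E \<le> dim F"
proof -
  obtain B where B: "B \<subseteq> E" "independent B" "card B = dim E"
    using fin_dim_obtain_basis[OF fin_dim_subset[OF assms]] by metis
  then show ?thesis using fin_dim_independent(2)[OF assms(1) B(2)] assms(2) by auto
qed

lemma linear_inj_on_independent_image:
  assumes "Vector_Spaces.linear scale scale \<phi>" "inj_on \<phi> (span B)" "independent B"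
  shows "independent (\<phi> ` B)"
proof -
  interpret vector_space_pair scale scale ..
  show ?thesis using linear_independent_injective_image[OF assms(1,3,2)] .
qed

lemma dim_image_inj_on:
  assumes "Vector_Spaces.linear scale scale \<phi>" "inj_on \<phi> E" "subspace E" "fin_dim E"
  shows "dim (\<phi> ` E) = dim E"
proof -
  interpret vector_space_pair scale scale ..
  obtain B where B: "finite B" "B \<subseteq> E" "independent B" "E \<subseteq> span B" "card B = dim E"
    using fin_dim_obtain_basis[OF assms(4)] by metis
  have s: "span B = E" using B assms(3) span_minimal by blast
  have "independent (\<phi> ` B)"
    using linear_inj_on_independent_image assms(1,2) s B(3) by simp
  moreover have "span (\<phi> ` B) = \<phi> ` E"
    using linear_span_image[OF assms(1)] s by simp
  moreover have "card (\<phi> ` B) = card B"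
    using card_image inj_on_subset[OF assms(2) B(2)] by blast
  ultimately show ?thesis using B(5) dim_span_eq_card_independent by metis
qed

lemma fin_dim_image:
  assumes "Vector_Spaces.linear scale scale \<phi>" "fin_dim E"
  shows "fin_dim (\<phi> ` E)"
proof -
  interpret vector_space_pair scale scale ..
  obtain B where "finite B" "E \<subseteq> span B" using assms(2) unfolding fin_dim_def by blast
  then have "finite (\<phi> ` B)" "\<phi> ` E \<subseteq> span (\<phi> ` B)"
    using linear_span_image[OF assms(1)] by auto
  then show ?thesis unfolding fin_dim_def by blast
qed

lemma dim_le_of_inj_on:
  assumes "Vector_Spaces.linear scale scale \<phi>" "inj_on \<phi> E" "subspace E" "fin_dim E"
    and "\<phi> ` E \<subseteq> F" "fin_dim F"
  shows "dim E \<le> dim F"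
  using dim_image_inj_on[OF assms(1-4)] fin_dim_dim_mono[OF assms(6,5)] by simp

text \<open>If the image missed a vector of \<open>E\<close>, this vector would extend a basis of
  the image to an independent subset of \<open>E\<close> with \<open>dim E + 1\<close>
  elements.\<close>

lemma fin_dim_inj_imp_surj:
  assumes "Vector_Spaces.linear scale scale \<phi>" "inj_on \<phi> E" "subspace E" "fin_dim E" "\<phi> ` E \<subseteq> E"
  shows "\<phi> ` E = E"
proof (rule ccontr)
  interpret vector_space_pair scale scale ..
  assume "\<phi> ` E \<noteq> E"
  then obtain x where x: "x \<in> E" "x \<notin> \<phi> ` E" using assms(5) by blast
  have sub: "subspace (\<phi> ` E)" by (rule linear_subspace_image[OF assms(1,3)])
  obtain B where B: "finite B" "B \<subseteq> \<phi> ` E" "independent B" "\<phi> ` E \<subseteq> span B" "card B = dim (\<phi> ` E)"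
    using fin_dim_obtain_basis[OF fin_dim_subset[OF assms(4,5)]] by metis
  have nx: "x \<notin> span B" using x(2) span_minimal[OF B(2) sub] by blast
  then have "independent (insert x B)" using B(3) independent_insertI by blast
  moreover have "insert x B \<subseteq> E" using x(1) B(2) assms(5) by blast
  ultimately have "card (insert x B) \<le> dim E" using fin_dim_independent[OF assms(4)] by blast
  moreover have "x \<notin> B" using nx span_base by blast
  ultimately have "Suc (dim (\<phi> ` E)) \<le> dim E" using B(1,5) by simp
  then show False using dim_image_inj_on[OF assms(1-4)] by simp
qed

section \<open>Eigenvalues and singular members of a linear pencil\<close>

text \<open>Induction on \<open>S\<close>: applying \<open>L - s\<close> to an expression of
  \<open>x s\<close> through the other eigenvectors gives zero on the left and multiplies the
  coefficient of \<open>x t\<close> by \<open>t - s\<close>, so all coefficients vanish.\<close>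

lemma eigenvectors_independent:
  assumes lin: "Vector_Spaces.linear scale scale L" and fin: "finite S"
    and ev: "\<And>s. s \<in> S \<Longrightarrow> x s \<noteq> 0 \<and> L (x s) = scale s (x s)"
  shows "independent (x ` S) \<and> inj_on x S"
  using fin ev
proof (induction S)
  case empty
  then show ?case by (simp add: independent_empty)
next
  case (insert s S)
  interpret vector_space_pair scale scale ..
  have IH: "independent (x ` S)" "inj_on x S" using insert by auto
  have "x s \<notin> span (x ` S)"
  proof
    assume "x s \<in> span (x ` S)"
    then obtain c where c: "x s = (\<Sum>v\<in>x ` S. scale (c v) v)"
      using span_finite[of "x ` S"] insert.hyps by auto
    have "(\<Sum>v\<in>x ` S. scale (c v) (scale s v)) = scale s (x s)"
      unfolding c scale_sum_right by (simp add: mult.commute)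
    also have "\<dots> = L (x s)" using insert.prems[of s] by simp
    also have "\<dots> = (\<Sum>v\<in>x ` S. scale (c v) (L v))"
      unfolding c linear_sum[OF lin] linear_scale[OF lin] ..
    finally have "(\<Sum>v\<in>x ` S. scale (c v) (L v)) = (\<Sum>v\<in>x ` S. scale (c v) (scale s v))" ..
    then have "(\<Sum>v\<in>x ` S. scale (c v) (L v - scale s v)) = 0"
      by (simp only: scale_right_diff_distrib sum_subtractf) simp
    then have "(\<Sum>t\<in>S. scale (c (x t)) (L (x t) - scale s (x t))) = 0"
      by (simp add: sum.reindex[OF IH(2)])
    moreover have "scale (c (x t)) (L (x t) - scale s (x t)) = scale (c (x t) * (t - s)) (x t)" if "t \<in> S" for t
      using insert.prems[of t] that by (simp add: scale_left_diff_distrib right_diff_distrib scale_right_diff_distrib)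
    ultimately have "(\<Sum>t\<in>S. scale (c (x t) * (t - s)) (x t)) = 0" by simp
    \<comment> \<open>The coefficients are indexed by vectors, not by eigenvalues, so
      \<open>t - s\<close> is expressed through the inverse of \<open>x\<close> on
      \<open>S\<close>.\<close>
    define g where "g v = c v * (inv_into S x v - s)" for v
    have "(\<Sum>v\<in>x ` S. scale (g v) v) = 0"
      using \<open>(\<Sum>t\<in>S. scale (c (x t) * (t - s)) (x t)) = 0\<close>
      by (simp add: sum.reindex[OF IH(2)] g_def inv_into_f_f[OF IH(2)])
    then have "g v = 0" if "v \<in> x ` S" for v
      using independentD[OF IH(1) _ subset_refl, of g v] insert.hyps that by blast
    then have "c (x t) = 0" if "t \<in> S" for t
      using that inv_into_f_f[OF IH(2), of t] insert.hyps(2) unfolding g_def by force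
    then have "(\<Sum>v\<in>x ` S. scale (c v) v) = 0" by (intro sum.neutral) auto
    then have "x s = 0" using c by metis
    then show False using insert.prems by blast
  qed
  then have "independent (x ` insert s S)" "x s \<notin> x ` S"
    using IH(1) independent_insertI span_base by auto
  then show ?case using IH(2) insert.hyps by simp
qed

text \<open>More than \<open>dim E\<close> eigenvalues would give more than \<open>dim E\<close>
  independent vectors of \<open>E\<close>. Only the eigenvectors lie in \<open>E\<close>;
  \<open>L\<close> may map out of it.\<close>

lemma finite_eigenvalues:
  assumes lin: "Vector_Spaces.linear scale scale L" and fd: "fin_dim E"
  shows "finite {s. \<exists>x\<in>E. x \<noteq> 0 \<and> L x = scale s x}" (is "finite ?A")
proof (rule ccontr)
  assume "infinite ?A"
  then obtain S where S: "S \<subseteq> ?A" "finite S" "card S = Suc (dim E)"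
    using infinite_arbitrarily_large[of ?A "Suc (dim E)"] by blast
  define x where "x s = (SOME x. x \<in> E \<and> x \<noteq> 0 \<and> L x = scale s x)" for s
  have x: "x s \<in> E \<and> x s \<noteq> 0 \<and> L (x s) = scale s (x s)" if "s \<in> S" for s
    unfolding x_def by (rule someI_ex) (use S(1) that in blast)
  have "independent (x ` S) \<and> inj_on x S"
    by (rule eigenvectors_independent[OF lin S(2)]) (use x in blast)
  then have "card S \<le> dim E"
    using fin_dim_independent(2)[OF fd, of "x ` S"] x card_image[of x S] by fastforce
  then show False using S(3) by simp
qed

text \<open>A vector \<open>x \<noteq> 0\<close> with \<open>x + s L x = 0\<close> forces
  \<open>s \<noteq> 0\<close> and is an eigenvector of \<open>L\<close> for
  \<open>- 1 / s\<close>.\<close>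

lemma finite_singular_pencil:
  assumes lin: "Vector_Spaces.linear scale scale L" and fd: "fin_dim E"
  shows "finite {s. \<exists>x\<in>E. x \<noteq> 0 \<and> x + scale s (L x) = 0}" (is "finite ?A")
proof -
  have "?A \<subseteq> (\<lambda>s. - inverse s) ` {s. \<exists>x\<in>E. x \<noteq> 0 \<and> L x = scale s x}"
  proof
    fix s assume "s \<in> ?A"
    then obtain x where x: "x \<in> E" "x \<noteq> 0" "x + scale s (L x) = 0" by blast
    then have "s \<noteq> 0" by auto
    have "scale (inverse s) (x + scale s (L x)) = 0" using x(3) by simp
    then have "L x = scale (- inverse s) x"
      using \<open>s \<noteq> 0\<close> by (simp add: scale_right_distrib eq_neg_iff_add_eq_0 add.commute)
    moreover have "s = - inverse (- inverse s)" by simp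
    ultimately show "s \<in> (\<lambda>s. - inverse s) ` {s. \<exists>x\<in>E. x \<noteq> 0 \<and> L x = scale s x}"
      using x by blast
  qed
  then show ?thesis using finite_eigenvalues[OF lin fd] finite_surj by blast
qed

text \<open>Duality in finite form, by induction on \<open>B\<close> with everything restricted to
  the kernel of one \<open>p b\<close>.\<close>

lemma functional_in_span:
  assumes "finite B" "subspace S" "linfun_on S g" "\<And>b. b \<in> B \<Longrightarrow> linfun_on S (p b)"
    and "\<And>y. y \<in> S \<Longrightarrow> (\<And>b. b \<in> B \<Longrightarrow> p b y = 0) \<Longrightarrow> g y = 0"
  shows "\<exists>c. \<forall>y\<in>S. g y = (\<Sum>b\<in>B. c b * p b y)"
  using assms
proof (induction B arbitrary: S)
  case (insert b B)
  let ?S = "{y\<in>S. p b y = 0}"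
  have lb: "linfun_on S (p b)" using insert.prems by blast
  have sub: "subspace ?S"
    using insert.prems(1) lb linfun_on_zero[OF lb] unfolding subspace_def linfun_on_def by auto
  have "\<exists>c. \<forall>y\<in>?S. g y = (\<Sum>b\<in>B. c b * p b y)"
  proof (rule insert.IH[OF sub])
    show "linfun_on ?S g" by (rule linfun_on_subset[OF insert.prems(2)]) blast
    show "linfun_on ?S (p b')" if "b' \<in> B" for b'
      by (rule linfun_on_subset[OF insert.prems(3)[of b']]) (use that in blast)+
    show "g y = 0" if "y \<in> ?S" "\<And>b. b \<in> B \<Longrightarrow> p b y = 0" for y
      using insert.prems(4)[of y] that by blast
  qed
  then obtain c where c: "\<forall>y\<in>?S. g y = (\<Sum>b\<in>B. c b * p b y)" by blast
  show ?case
  proof (cases "\<exists>y\<in>S. p b y \<noteq> 0")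
    case True
    then obtain z where z: "z \<in> S" "p b z \<noteq> 0" by blast
    \<comment> \<open>What remains after subtracting the combination found on the kernel of
      \<open>p b\<close> vanishes on that kernel, so it is a multiple of \<open>p b\<close>, with
      the factor read off at \<open>z\<close>.\<close>
    define h where "h y = g y - (\<Sum>b\<in>B. c b * p b y)" for y
    have hlin: "linfun_on S h"
    proof -
      have "p b' (x + y) = p b' x + p b' y" "p b' (scale r x) = r * p b' x"
        if "b' \<in> B" "x \<in> S" "y \<in> S" for b' x y r
        using insert.prems(3)[of b'] that unfolding linfun_on_def by auto
      then show ?thesis using insert.prems(2) unfolding linfun_on_def h_def
        by (auto simp: sum.distrib algebra_simps sum_distrib_left)
    qed
    define k where "k = h z / p b z"
    have "h y = k * p b y" if y: "y \<in> S" for y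
    proof -
      let ?w = "y + scale (- (p b y / p b z)) z"
      have "?w \<in> S" using y z insert.prems(1) subspace_add subspace_scale by blast
      moreover have "p b ?w = 0"
      proof -
        have "p b ?w = p b y + (- (p b y / p b z)) * p b z"
          using linfun_onD[OF lb] y z subspace_scale[OF insert.prems(1) z(1)] by metis
        then show ?thesis using z(2) by simp
      qed
      ultimately have "h ?w = 0" using c unfolding h_def by auto
      moreover have "h ?w = h y + (- (p b y / p b z)) * h z"
        using linfun_onD[OF hlin] y z subspace_scale[OF insert.prems(1) z(1)] by metis
      ultimately show ?thesis unfolding k_def using z(2) by (simp add: field_simps)
    qed
    then have "\<forall>y\<in>S. g y = (\<Sum>b'\<in>insert b B. (c(b := k)) b' * p b' y)"
      using insert.hyps unfolding h_def
      by (auto simp: algebra_simps intro!: sum.cong)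
    then show ?thesis by blast
  next
    case False
    then have "\<forall>y\<in>S. g y = (\<Sum>b'\<in>insert b B. c b' * p b' y)"
      using c insert.hyps by simp
    then show ?thesis by blast
  qed
qed auto

section \<open>Bilinear forms and their radicals\<close>

definition bilinear_form :: "('b \<Rightarrow> 'b \<Rightarrow> 'a) \<Rightarrow> bool" where
  "bilinear_form \<beta> \<longleftrightarrow> (\<forall>x. linfun_on UNIV (\<beta> x)) \<and> (\<forall>y. linfun_on UNIV (\<lambda>x. \<beta> x y))"

definition radical :: "('b \<Rightarrow> 'b \<Rightarrow> 'a) \<Rightarrow> 'b set \<Rightarrow> 'b set" where
  "radical \<beta> Q = {x\<in>Q. \<forall>y\<in>Q. \<beta> x y = 0}"

lemma bilinear_formD:
  assumes "bilinear_form \<beta>"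
  shows "\<beta> (x + x') y = \<beta> x y + \<beta> x' y" "\<beta> (scale r x) y = r * \<beta> x y"
    "\<beta> x (y + y') = \<beta> x y + \<beta> x y'" "\<beta> x (scale r y) = r * \<beta> x y"
    "\<beta> 0 y = 0" "\<beta> x 0 = 0" "\<beta> (- x) y = - \<beta> x y" "\<beta> x (- y) = - \<beta> x y"
    "\<beta> (x - x') y = \<beta> x y - \<beta> x' y" "\<beta> x (y - y') = \<beta> x y - \<beta> x y'"
proof -
  show 1: "\<beta> (x + x') y = \<beta> x y + \<beta> x' y" "\<beta> (scale r x) y = r * \<beta> x y"
    "\<beta> x (y + y') = \<beta> x y + \<beta> x y'" "\<beta> x (scale r y) = r * \<beta> x y" for x x' y y' r
    using assms unfolding bilinear_form_def linfun_on_def by auto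
  show 2: "\<beta> 0 y = 0" "\<beta> x 0 = 0" using 1(2)[of 0 0 y] 1(4)[of x 0 0] by auto
  show 3: "\<beta> (- x) y = - \<beta> x y" "\<beta> x (- y) = - \<beta> x y" for x y
    using 1(2)[of "- 1" x y] 1(4)[of x "- 1" y] by auto
  show "\<beta> (x - x') y = \<beta> x y - \<beta> x' y" "\<beta> x (y - y') = \<beta> x y - \<beta> x y'"
    using 1(1)[of x "- x'" y] 1(3)[of x y "- y'"] 3 by auto
qed

lemma bilinear_form_linfun_on: "bilinear_form \<beta> \<Longrightarrow> linfun_on S (\<beta> x)"
  unfolding bilinear_form_def by (blast intro: linfun_on_subset)

lemma bilinear_form_sum:
  assumes "bilinear_form \<beta>"
  shows "\<beta> (\<Sum>b\<in>B. h b) y = (\<Sum>b\<in>B. \<beta> (h b) y)" "\<beta> x (\<Sum>b\<in>B. h b) = (\<Sum>b\<in>B. \<beta> x (h b))"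
  using linfun_on_sum[of UNIV "\<lambda>x. \<beta> x y"] linfun_on_sum[of UNIV "\<beta> x"] assms subspace_UNIV
  unfolding bilinear_form_def by auto

lemma subspace_radical:
  assumes "bilinear_form \<beta>" "subspace Q"
  shows "subspace (radical \<beta> Q)"
  using assms(2) unfolding subspace_def radical_def
  by (auto simp: bilinear_formD[OF assms(1)])

lemma radical_subset: "radical \<beta> Q \<subseteq> Q" unfolding radical_def by blast

text \<open>Extend a basis of the radical to one of \<open>Q\<close> and let \<open>B\<close> be the
  added vectors, which are independent modulo the radical. The form separates \<open>B\<close> by
  vectors \<open>y b\<close> of \<open>Q\<close>, and subtracting the components measured by them
  projects \<open>Q\<close> onto the radical along the span of \<open>B\<close>.\<close>

lemma radical_dual_basis:
  assumes bf: "bilinear_form \<beta>" and Q: "subspace Q" "fin_dim Q"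
  obtains B y where "finite B" "B \<subseteq> Q" "\<And>b. b \<in> B \<Longrightarrow> y b \<in> Q"
    "\<And>b b'. b \<in> B \<Longrightarrow> b' \<in> B \<Longrightarrow> \<beta> b (y b') = (if b = b' then 1 else 0)"
    "\<And>x. x \<in> Q \<Longrightarrow> x - (\<Sum>b\<in>B. scale (\<beta> x (y b)) b) \<in> radical \<beta> Q"
proof -
  let ?R = "radical \<beta> Q"
  have subR: "subspace ?R" by (rule subspace_radical[OF bf Q(1)])
  obtain A where A: "finite A" "A \<subseteq> ?R" "independent A" "?R \<subseteq> span A"
    using fin_dim_obtain_basis[OF fin_dim_subset[OF Q(2) radical_subset]] by metis
  obtain D where D: "A \<subseteq> D" "D \<subseteq> Q" "independent D" "Q \<subseteq> span D"
    using maximal_independent_subset_extend[of A Q] A(2,3) radical_subset by (metis subset_trans)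
  have finD: "finite D" using fin_dim_independent(1)[OF Q(2) D(3,2)] .
  define B where "B = D - A"
  have finB: "finite B" "B \<subseteq> Q" using finD D(2) unfolding B_def by auto
  have spanA: "span A = ?R" using A(2,4) subR span_minimal by blast
  have zero: "c b = 0" if "(\<Sum>b\<in>B. scale (c b) b) \<in> ?R" "b \<in> B" for c b
  proof -
    have "(\<Sum>b\<in>B. scale (c b) b) \<in> range (\<lambda>u. \<Sum>v\<in>A. scale (u v) v)"
      using that(1) unfolding spanA[symmetric] span_finite[OF A(1)] .
    then obtain a where a: "(\<Sum>b\<in>B. scale (c b) b) = (\<Sum>v\<in>A. scale (a v) v)" by blast
    define u where "u v = (if v \<in> A then - a v else c v)" for v
    have AD: "A \<inter> B = {}" "A \<union> B = D" using D(1) unfolding B_def by auto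
    have "(\<Sum>v\<in>D. scale (u v) v) = (\<Sum>v\<in>A. scale (u v) v) + (\<Sum>v\<in>B. scale (u v) v)"
      unfolding AD(2)[symmetric] by (rule sum.union_disjoint) (use A(1) finB(1) AD in auto)
    also have "(\<Sum>v\<in>A. scale (u v) v) = - (\<Sum>v\<in>A. scale (a v) v)"
      unfolding u_def by (simp add: sum_negf)
    also have "(\<Sum>v\<in>B. scale (u v) v) = (\<Sum>b\<in>B. scale (c b) b)"
      using AD(1) unfolding u_def by (intro sum.cong) auto
    finally have "(\<Sum>v\<in>D. scale (u v) v) = 0" using a by simp
    then have "u b = 0" using independentD[OF D(3) finD subset_refl] that(2) unfolding B_def by blast
    then show ?thesis using that(2) unfolding u_def B_def by simp
  qed
  have "\<exists>y\<in>Q. \<forall>b'\<in>B. \<beta> b' y = (if b' = b then 1 else 0)" if b: "b \<in> B" for b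
  proof (rule ccontr)
    assume no: "\<not> ?thesis"
    have "\<exists>c. \<forall>y\<in>Q. \<beta> b y = (\<Sum>b'\<in>B - {b}. c b' * \<beta> b' y)"
    proof (rule functional_in_span[OF _ Q(1)])
      show "\<beta> b y = 0" if y: "y \<in> Q" "\<And>b'. b' \<in> B - {b} \<Longrightarrow> \<beta> b' y = 0" for y
      proof (rule ccontr)
        assume nz: "\<beta> b y \<noteq> 0"
        let ?y = "scale (inverse (\<beta> b y)) y"
        have "?y \<in> Q" using y(1) Q(1) subspace_scale by blast
        moreover have "\<forall>b'\<in>B. \<beta> b' ?y = (if b' = b then 1 else 0)"
          using y(2) nz by (auto simp: bilinear_formD[OF bf])
        ultimately show False using no by blast
      qed
    qed (use finB bilinear_form_linfun_on[OF bf] in auto)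
    then obtain c where c: "\<And>y. y \<in> Q \<Longrightarrow> \<beta> b y = (\<Sum>b'\<in>B - {b}. c b' * \<beta> b' y)" by blast
    \<comment> \<open>Without a dual vector, \<open>\<beta> b\<close> is a combination of the other
      functionals on \<open>Q\<close>; moving everything to one side gives a vector of the radical
      with coefficient -1 at \<open>b\<close>.\<close>
    define c' where "c' = (\<lambda>v. if v = b then - 1 else c v)"
    have "(\<Sum>v\<in>B. scale (c' v) v) \<in> ?R"
    proof -
      have "(\<Sum>v\<in>B. scale (c' v) v) \<in> Q" using finB Q(1) by (intro subspace_sum subspace_scale) auto
      moreover have "\<beta> (\<Sum>v\<in>B. scale (c' v) v) y = 0" if "y \<in> Q" for y
      proof -
        have "\<beta> (\<Sum>v\<in>B. scale (c' v) v) y = (\<Sum>v\<in>B. c' v * \<beta> v y)"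
          by (simp add: bilinear_form_sum[OF bf] bilinear_formD[OF bf])
        also have "\<dots> = c' b * \<beta> b y + (\<Sum>v\<in>B - {b}. c' v * \<beta> v y)"
          using b finB(1) by (simp add: sum.remove)
        also have "(\<Sum>v\<in>B - {b}. c' v * \<beta> v y) = (\<Sum>v\<in>B - {b}. c v * \<beta> v y)"
          by (rule sum.cong) (auto simp: c'_def)
        finally show ?thesis using c[OF that] by (simp add: c'_def)
      qed
      ultimately show ?thesis unfolding radical_def by blast
    qed
    then show False using zero[of c' b] b unfolding c'_def by simp
  qed
  then obtain y where y: "\<And>b. b \<in> B \<Longrightarrow> y b \<in> Q"
    "\<And>b b'. b \<in> B \<Longrightarrow> b' \<in> B \<Longrightarrow> \<beta> b' (y b) = (if b' = b then 1 else 0)"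
    by metis
  have "x - (\<Sum>b\<in>B. scale (\<beta> x (y b)) b) \<in> ?R" if x: "x \<in> Q" for x
  proof -
    have "x \<in> range (\<lambda>u. \<Sum>v\<in>D. scale (u v) v)"
      using x D(4) unfolding span_finite[OF finD] by (rule subsetD[rotated])
    then obtain u where u: "x = (\<Sum>v\<in>D. scale (u v) v)" by blast
    define r where "r = (\<Sum>v\<in>A. scale (u v) v)"
    have r: "r \<in> ?R" unfolding r_def using A(2) subR by (intro subspace_sum subspace_scale) auto
    have AD: "A \<inter> B = {}" "A \<union> B = D" using D(1) unfolding B_def by auto
    have xr: "x = r + (\<Sum>v\<in>B. scale (u v) v)"
      unfolding u r_def AD(2)[symmetric] by (rule sum.union_disjoint) (use A(1) finB(1) AD in auto)
    have "\<beta> x (y b) = u b" if b: "b \<in> B" for b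
    proof -
      have "\<beta> x (y b) = \<beta> r (y b) + (\<Sum>v\<in>B. u v * \<beta> v (y b))"
        unfolding xr by (simp add: bilinear_form_sum[OF bf] bilinear_formD[OF bf])
      also have "\<beta> r (y b) = 0" using r y(1)[OF b] unfolding radical_def by blast
      also have "(\<Sum>v\<in>B. u v * \<beta> v (y b)) = (\<Sum>v\<in>B. if v = b then u v else 0)"
        by (rule sum.cong) (use y(2)[OF b] in auto)
      finally show ?thesis using b finB(1) by simp
    qed
    then have "x - (\<Sum>b\<in>B. scale (\<beta> x (y b)) b) = r" unfolding xr by simp
    then show ?thesis using r by simp
  qed
  then show ?thesis using that[of B y] finB y by (metis (no_types, lifting))
qed

text \<open>The projection \<open>\<phi>\<close> onto the radical of \<open>\<beta>\<^sub>0\<close>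
  is injective on the radical of the perturbed form unless \<open>s\<close> is singular: for
  \<open>\<phi> x = 0\<close> the equations against the dual vectors \<open>y b\<close> combine to
  \<open>x + s L x = 0\<close>.\<close>

lemma radical_semicontinuous:
  assumes b0: "bilinear_form \<beta>\<^sub>0" and b1: "bilinear_form \<beta>\<^sub>1" and Q: "subspace Q" "fin_dim Q"
  shows "finite {s. \<not> dim (radical (\<lambda>x y. \<beta>\<^sub>0 x y + s * \<beta>\<^sub>1 x y) Q) \<le> dim (radical \<beta>\<^sub>0 Q)}"
proof -
  obtain B y where B: "finite B" "B \<subseteq> Q" "\<And>b. b \<in> B \<Longrightarrow> y b \<in> Q"
    "\<And>b b'. b \<in> B \<Longrightarrow> b' \<in> B \<Longrightarrow> \<beta>\<^sub>0 b (y b') = (if b = b' then 1 else 0)"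
    "\<And>x. x \<in> Q \<Longrightarrow> x - (\<Sum>b\<in>B. scale (\<beta>\<^sub>0 x (y b)) b) \<in> radical \<beta>\<^sub>0 Q"
    by (rule radical_dual_basis[OF b0 Q]) blast
  define L where "L x = (\<Sum>b\<in>B. scale (\<beta>\<^sub>1 x (y b)) b)" for x
  define \<phi> where "\<phi> x = x - (\<Sum>b\<in>B. scale (\<beta>\<^sub>0 x (y b)) b)" for x
  have vs: "vector_space scale" ..
  have linL: "Vector_Spaces.linear scale scale L"
    unfolding Vector_Spaces.linear_iff L_def using vs
    by (auto simp: bilinear_formD[OF b1] scale_left_distrib sum.distrib scale_sum_right)
  have lin\<phi>: "Vector_Spaces.linear scale scale \<phi>"
    unfolding Vector_Spaces.linear_iff \<phi>_def using vs
    by (auto simp: bilinear_formD[OF b0] scale_left_distrib sum.distrib scale_sum_right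
        algebra_simps scale_right_diff_distrib)
  have "dim (radical (\<lambda>x y. \<beta>\<^sub>0 x y + s * \<beta>\<^sub>1 x y) Q) \<le> dim (radical \<beta>\<^sub>0 Q)"
    if s: "s \<notin> {s. \<exists>x\<in>Q. x \<noteq> 0 \<and> x + scale s (L x) = 0}" for s
  proof (rule dim_le_of_inj_on[OF lin\<phi>])
    let ?R = "radical (\<lambda>x y. \<beta>\<^sub>0 x y + s * \<beta>\<^sub>1 x y) Q"
    have bs: "bilinear_form (\<lambda>x y. \<beta>\<^sub>0 x y + s * \<beta>\<^sub>1 x y)"
      unfolding bilinear_form_def linfun_on_def
      by (auto simp: bilinear_formD[OF b0] bilinear_formD[OF b1] algebra_simps)
    show sub: "subspace ?R" by (rule subspace_radical[OF bs Q(1)])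
    show "fin_dim ?R" "fin_dim (radical \<beta>\<^sub>0 Q)"
      using fin_dim_subset[OF Q(2) radical_subset] by auto
    show "\<phi> ` ?R \<subseteq> radical \<beta>\<^sub>0 Q" using B(5) radical_subset unfolding \<phi>_def by blast
    interpret vector_space_pair scale scale ..
    have "x = 0" if x: "x \<in> ?R" "\<phi> x = 0" for x
    proof -
      have xQ: "x \<in> Q" using x(1) radical_subset by blast
      have "\<beta>\<^sub>0 x (y b) + s * \<beta>\<^sub>1 x (y b) = 0" if "b \<in> B" for b
        using x(1) B(3)[OF that] unfolding radical_def by blast
      then have "(\<Sum>b\<in>B. scale (\<beta>\<^sub>0 x (y b)) b) + scale s (L x) = 0"
        unfolding L_def scale_sum_right sum.distrib[symmetric]
        by (intro sum.neutral) (simp add: scale_left_distrib[symmetric])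
      then have "x + scale s (L x) = 0" using x(2) unfolding \<phi>_def by simp
      then show ?thesis using s xQ by blast
    qed
    then show "inj_on \<phi> ?R" using linear_inj_on_iff_eq_0[OF lin\<phi> sub] by blast
  qed
  then have "{s. \<not> dim (radical (\<lambda>x y. \<beta>\<^sub>0 x y + s * \<beta>\<^sub>1 x y) Q) \<le> dim (radical \<beta>\<^sub>0 Q)}
      \<subseteq> {s. \<exists>x\<in>Q. x \<noteq> 0 \<and> x + scale s (L x) = 0}" by blast
  then show ?thesis using finite_singular_pencil[OF linL Q(2)] finite_subset by blast
qed

text \<open>Symplectic reduction by an isotropic subspace \<open>V\<close>: the radical of an alternating form
  on \<open>S \<oplus> V\<close> projects isomorphically onto the radical of its restriction to \<open>S \<inter> V\<^sup>\<bottom>\<close>.\<close>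

lemma radical_reduction:
  assumes bf: "bilinear_form \<beta>" and alt: "\<And>x y. \<beta> y x = - \<beta> x y"
    and S: "subspace S" and V: "subspace V" "fin_dim V" and fdS: "fin_dim S"
    and Q: "Q = {y + v |y v. y \<in> S \<and> v \<in> V}"
    and iso: "\<And>v w. v \<in> V \<Longrightarrow> w \<in> V \<Longrightarrow> \<beta> v w = 0"
    and nd: "\<And>v. v \<in> V \<Longrightarrow> (\<And>y. y \<in> S \<Longrightarrow> \<beta> v y = 0) \<Longrightarrow> v = 0"
    and lin: "Vector_Spaces.linear scale scale \<pi>" "\<And>y. y \<in> S \<Longrightarrow> \<pi> y = y" "\<And>v. v \<in> V \<Longrightarrow> \<pi> v = 0"
  shows "dim (radical \<beta> Q) = dim (radical \<beta> {y\<in>S. \<forall>v\<in>V. \<beta> y v = 0})"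
proof -
  interpret vector_space_pair scale scale ..
  let ?P = "{y\<in>S. \<forall>v\<in>V. \<beta> y v = 0}"
  note b = bilinear_formD[OF bf]
  have subQ: "subspace Q" unfolding Q by (rule subspace_sums[OF S V(1)])
  have SQ: "S \<subseteq> Q" "V \<subseteq> Q" unfolding Q using subspace_0[OF S] subspace_0[OF V(1)]
    by force+
  have fdQ: "fin_dim Q"
  proof -
    obtain A B where AB: "finite A" "S \<subseteq> span A" "finite B" "V \<subseteq> span B"
      using V(2) fdS unfolding fin_dim_def by blast
    have "Q \<subseteq> span (A \<union> B)" unfolding Q
      using AB span_mono[of A "A \<union> B"] span_mono[of B "A \<union> B"] by (auto intro!: span_add)
    then show ?thesis using AB unfolding fin_dim_def by blast
  qed
  have img: "\<pi> ` radical \<beta> Q = radical \<beta> ?P"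
  proof (intro equalityI subsetI)
    fix z assume "z \<in> \<pi> ` radical \<beta> Q"
    then obtain x where x: "x \<in> radical \<beta> Q" "z = \<pi> x" by blast
    then obtain y v where yv: "x = y + v" "y \<in> S" "v \<in> V" unfolding Q radical_def by blast
    have z: "z = y" using x(2) yv lin linear_add[OF lin(1)] by simp
    have rx: "\<And>q. q \<in> Q \<Longrightarrow> \<beta> (y + v) q = 0" using x(1) yv(1) unfolding radical_def by blast
    have yP: "y \<in> ?P"
    proof -
      have "\<beta> y w = 0" if "w \<in> V" for w
        using rx[of w] SQ(2) iso[OF yv(3) that] that by (auto simp: b)
      then show ?thesis using yv(2) by blast
    qed
    have "\<beta> y q = 0" if q: "q \<in> ?P" for q
    proof -
      have "\<beta> v q = 0" using q yv(3) alt[of v q] by simp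
      then show ?thesis using rx[of q] q SQ(1) by (auto simp: b)
    qed
    then show "z \<in> radical \<beta> ?P" using yP z unfolding radical_def by blast
  next
    fix y assume y: "y \<in> radical \<beta> ?P"
    then have yS: "y \<in> S" "\<And>v. v \<in> V \<Longrightarrow> \<beta> y v = 0" "\<And>q. q \<in> ?P \<Longrightarrow> \<beta> y q = 0"
      unfolding radical_def by blast+
    obtain B where B: "finite B" "B \<subseteq> V" "V \<subseteq> span B"
      using fin_dim_obtain_basis[OF V(2)] by metis
    \<comment> \<open>The functional \<open>\<beta> y\<close> vanishes on \<open>S\<close> wherever
      all functionals from \<open>V\<close> do, so it agrees on \<open>S\<close> with
      \<open>\<beta> v\<close> for some \<open>v\<close> in \<open>V\<close>. Then
      \<open>y - v\<close> lies in the radical and projects to \<open>y\<close>.\<close>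
    have "\<exists>c. \<forall>q\<in>S. \<beta> y q = (\<Sum>w\<in>B. c w * \<beta> w q)"
    proof (rule functional_in_span[OF B(1) S])
      show "\<beta> y q = 0" if q: "q \<in> S" "\<And>w. w \<in> B \<Longrightarrow> \<beta> w q = 0" for q
      proof -
        have "\<beta> q v = 0" if "v \<in> V" for v
        proof -
          have "v \<in> span B" using that B(3) by blast
          then show ?thesis
          proof (induction rule: span_induct_alt)
            case (step c x y)
            then show ?case using q(2)[of x] alt[of q x] by (simp add: b)
          qed (simp add: b)
        qed
        then show ?thesis using yS(3) q(1) by blast
      qed
    qed (rule bilinear_form_linfun_on[OF bf])+
    then obtain c where c: "\<And>q. q \<in> S \<Longrightarrow> \<beta> y q = (\<Sum>w\<in>B. c w * \<beta> w q)" by blast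
    define v where "v = (\<Sum>w\<in>B. scale (c w) w)"
    have vV: "v \<in> V" unfolding v_def using B V(1) by (intro subspace_sum subspace_scale) auto
    have "y - v \<in> radical \<beta> Q"
    proof -
      have "y + (- v) \<in> Q" unfolding Q using yS(1) vV subspace_neg[OF V(1)] by blast
      moreover have "\<beta> (y - v) (q + w) = 0" if "q \<in> S" "w \<in> V" for q w
        using c[OF that(1)] yS(2)[OF that(2)] iso[OF vV that(2)]
        unfolding v_def by (simp add: b bilinear_form_sum[OF bf])
      ultimately show ?thesis unfolding radical_def Q by auto
    qed
    moreover have "\<pi> (y - v) = y"
      using linear_diff[OF lin(1)] lin(2)[OF yS(1)] lin(3)[OF vV] by simp
    ultimately show "y \<in> \<pi> ` radical \<beta> Q" by force
  qed
  have "x = 0" if x: "x \<in> radical \<beta> Q" "\<pi> x = 0" for x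
  proof -
    obtain y v where yv: "x = y + v" "y \<in> S" "v \<in> V" using x(1) unfolding Q radical_def by blast
    then have "y = 0" using x(2) lin linear_add[OF lin(1)] by simp
    then show ?thesis using nd[OF yv(3)] yv x(1) SQ(1) unfolding radical_def by auto
  qed
  then have "inj_on \<pi> (radical \<beta> Q)"
    using linear_inj_on_iff_eq_0[OF lin(1) subspace_radical[OF bf subQ]] by blast
  then show ?thesis
    using dim_image_inj_on[OF lin(1) _ subspace_radical[OF bf subQ]
        fin_dim_subset[OF fdQ radical_subset]] img by simp
qed

end

section \<open>Finitely supported matrices\<close>

text \<open>Infinite matrices with finitely many nonzero entries form one non-unital ring that contains
  the matrix rings of all sizes, so that subalgebras of different sizes can be compared in one type.\<close>

typedef (overloaded) 'a fmat = "{f :: nat \<Rightarrow> nat \<Rightarrow> 'a::zero. \<exists>n. \<forall>i j. n \<le> i \<or> n \<le> j \<longrightarrow> f i j = 0}"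
  morphisms ent Abs_fmat
  by (rule exI[of _ "\<lambda>_ _. 0"]) simp

lemma ent_bound: "\<exists>n. \<forall>i j. n \<le> i \<or> n \<le> j \<longrightarrow> ent X i j = 0"
  using ent[of X] by blast

lemma ent_Abs_fmat:
  assumes "\<And>i j. n \<le> i \<or> n \<le> j \<Longrightarrow> f i j = 0"
  shows "ent (Abs_fmat f) = f"
  by (rule Abs_fmat_inverse) (use assms in blast)

lemma fmat_eqI: "(\<And>i j. ent X i j = ent Y i j) \<Longrightarrow> X = Y"
  by (metis ent_inject ext)

instantiation fmat :: (ring) ring
begin

definition "0 = Abs_fmat (\<lambda>i j. 0)"
definition "X + Y = Abs_fmat (\<lambda>i j. ent X i j + ent Y i j)"
definition "X - Y = Abs_fmat (\<lambda>i j. ent X i j - ent Y i j)"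
definition "- X = Abs_fmat (\<lambda>i j. - ent X i j)"
text \<open>Summing over the indices with a nonzero product keeps the index set finite without
  naming a size.\<close>

definition "X * Y = Abs_fmat (\<lambda>i j. \<Sum>l | ent X i l * ent Y l j \<noteq> 0. ent X i l * ent Y l j)"

lemma ent_zero [simp]: "ent (0 :: 'a fmat) i j = 0"
  unfolding zero_fmat_def by (subst ent_Abs_fmat[of 0]) auto

lemma ent_add [simp]: "ent (X + Y :: 'a fmat) i j = ent X i j + ent Y i j"
proof -
  obtain n m where "\<forall>i j. n \<le> i \<or> n \<le> j \<longrightarrow> ent X i j = 0" "\<forall>i j. m \<le> i \<or> m \<le> j \<longrightarrow> ent Y i j = 0"
    using ent_bound by metis
  then show ?thesis unfolding plus_fmat_def by (subst ent_Abs_fmat[of "max n m"]) auto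
qed

lemma ent_minus [simp]: "ent (X - Y :: 'a fmat) i j = ent X i j - ent Y i j"
proof -
  obtain n m where "\<forall>i j. n \<le> i \<or> n \<le> j \<longrightarrow> ent X i j = 0" "\<forall>i j. m \<le> i \<or> m \<le> j \<longrightarrow> ent Y i j = 0"
    using ent_bound by metis
  then show ?thesis unfolding minus_fmat_def by (subst ent_Abs_fmat[of "max n m"]) auto
qed

lemma ent_uminus [simp]: "ent (- X :: 'a fmat) i j = - ent X i j"
proof -
  obtain n where "\<forall>i j. n \<le> i \<or> n \<le> j \<longrightarrow> ent X i j = 0"
    using ent_bound by metis
  then show ?thesis unfolding uminus_fmat_def by (subst ent_Abs_fmat[of n]) auto
qed

lemma ent_times_raw: "ent (X * Y :: 'a fmat) i j = (\<Sum>l | ent X i l * ent Y l j \<noteq> 0. ent X i l * ent Y l j)"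
proof -
  obtain n m where "\<forall>i j. n \<le> i \<or> n \<le> j \<longrightarrow> ent X i j = 0" "\<forall>i j. m \<le> i \<or> m \<le> j \<longrightarrow> ent Y i j = 0"
    using ent_bound by metis
  then show ?thesis unfolding times_fmat_def by (subst ent_Abs_fmat[of "max n m"]) auto
qed

lemma ent_times:
  assumes "finite L" "\<And>l. ent X i l \<noteq> 0 \<Longrightarrow> ent Y l j \<noteq> 0 \<Longrightarrow> l \<in> L"
  shows "ent (X * Y :: 'a fmat) i j = (\<Sum>l\<in>L. ent X i l * ent Y l j)"
  unfolding ent_times_raw using assms
  by (intro sum.mono_neutral_left) (auto dest: mult_not_zero)

lemma ent_times_bound:
  fixes X Y :: "'a fmat"
  assumes "\<And>i l. n \<le> l \<Longrightarrow> ent X i l = 0"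
  shows "ent (X * Y) i j = (\<Sum>l<n. ent X i l * ent Y l j)"
  by (rule ent_times) (use assms not_le in auto)

instance
proof
  fix X Y Z :: "'a fmat"
  show "X + Y + Z = X + (Y + Z)" "X + Y = Y + X" "0 + X = X" "- X + X = 0" "X - Y = X + - Y"
    by (auto intro!: fmat_eqI simp: algebra_simps)
  obtain n m where n: "\<forall>i j. n \<le> i \<or> n \<le> j \<longrightarrow> ent X i j = 0" and m: "\<forall>i j. m \<le> i \<or> m \<le> j \<longrightarrow> ent Y i j = 0"
    using ent_bound by metis
  have XY: "\<And>i l. m \<le> l \<Longrightarrow> ent (X * Y) i l = 0"
    using n m by (subst ent_times_bound[of n]) auto
  show "X * Y * Z = X * (Y * Z)"
  proof (rule fmat_eqI)
    fix i j
    have "ent (X * Y * Z) i j = (\<Sum>l<m. (\<Sum>k<n. ent X i k * ent Y k l) * ent Z l j)"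
      using XY n by (subst ent_times_bound[of m]) (auto simp: ent_times_bound[of n])
    also have "\<dots> = (\<Sum>k<n. \<Sum>l<m. ent X i k * (ent Y k l * ent Z l j))"
      by (subst sum.swap) (simp add: sum_distrib_right mult.assoc)
    also have "\<dots> = ent (X * (Y * Z)) i j"
      using n m by (subst ent_times_bound[of n]) (auto simp: ent_times_bound[of m] sum_distrib_left)
    finally show "ent (X * Y * Z) i j = ent (X * (Y * Z)) i j" .
  qed
  show "(X + Y) * Z = X * Z + Y * Z"
  proof (rule fmat_eqI)
    fix i j
    have "ent ((X + Y) * Z) i j = (\<Sum>l<max n m. ent (X + Y) i l * ent Z l j)"
      using n m by (intro ent_times_bound) auto
    moreover have "ent (X * Z) i j = (\<Sum>l<max n m. ent X i l * ent Z l j)"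
      "ent (Y * Z) i j = (\<Sum>l<max n m. ent Y i l * ent Z l j)"
      using n m by (intro ent_times_bound; auto)+
    ultimately show "ent ((X + Y) * Z) i j = ent (X * Z + Y * Z) i j"
      by (simp add: distrib_right sum.distrib)
  qed
  show "X * (Y + Z) = X * Y + X * Z"
    using n by (intro fmat_eqI) (simp add: ent_times_bound[of n] distrib_left sum.distrib)
qed

end

definition sc :: "'a::field \<Rightarrow> 'a fmat \<Rightarrow> 'a fmat" where
  "sc c X = Abs_fmat (\<lambda>i j. c * ent X i j)"

lemma ent_sc [simp]: "ent (sc c X) i j = c * ent X i j"
proof -
  obtain n where "\<forall>i j. n \<le> i \<or> n \<le> j \<longrightarrow> ent X i j = 0"
    using ent_bound by metis
  then show ?thesis unfolding sc_def by (subst ent_Abs_fmat[of n]) auto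
qed

interpretation fs: matrix_space "sc :: 'a::field \<Rightarrow> _"
  by unfold_locales (auto intro!: fmat_eqI simp: algebra_simps)

lemma sc_mult_left [simp]: "sc c X * Y = sc c (X * Y)"
proof (rule fmat_eqI)
  fix i j
  obtain n where n: "\<forall>i j. n \<le> i \<or> n \<le> j \<longrightarrow> ent X i j = 0" using ent_bound by metis
  then show "ent (sc c X * Y) i j = ent (sc c (X * Y)) i j"
    by (simp add: ent_times_bound[of n] sum_distrib_left mult.assoc)
qed

lemma sc_mult_right [simp]: "X * sc c Y = sc c (X * Y)"
proof (rule fmat_eqI)
  fix i j
  obtain n where n: "\<forall>i j. n \<le> i \<or> n \<le> j \<longrightarrow> ent X i j = 0" using ent_bound by metis
  then show "ent (X * sc c Y) i j = ent (sc c (X * Y)) i j"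
    by (simp add: ent_times_bound[of n] sum_distrib_left algebra_simps)
qed

lemma ent_sum: "ent (\<Sum>x\<in>A. h x) i j = (\<Sum>x\<in>A. ent (h x) i j)"
  by (induction A rule: infinite_finite_induct) auto

definition munit :: "nat \<Rightarrow> nat \<Rightarrow> 'a::field fmat" where
  "munit p q = Abs_fmat (\<lambda>i j. if i = p \<and> j = q then 1 else 0)"

lemma ent_munit [simp]: "ent (munit p q) i j = (if i = p \<and> j = q then 1 else 0)"
  unfolding munit_def by (subst ent_Abs_fmat[of "Suc (max p q)"]) auto

text \<open>To be read as the maps from the coordinates \<open>J\<close> to the coordinates
  \<open>I\<close>. Positions are absolute, so blocks of algebras of different sizes can be
  multiplied directly.\<close>

definition block :: "nat set \<Rightarrow> nat set \<Rightarrow> 'a::field fmat set" where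
  "block I J = {X. \<forall>i j. ent X i j \<noteq> 0 \<longrightarrow> i \<in> I \<and> j \<in> J}"

text \<open>The ring has no unit; this idempotent acts as the identity on the coordinates in
  \<open>I\<close>, and \<open>bid I * X * bid J\<close> cuts out a block.\<close>

definition bid :: "nat set \<Rightarrow> 'a::field fmat" where
  "bid I = (\<Sum>i\<in>I. munit i i)"

lemma ent_bid: "finite I \<Longrightarrow> ent (bid I) i j = (if i = j \<and> i \<in> I then 1 else 0)"
proof -
  assume "finite I"
  have "ent (bid I) i j = (\<Sum>k\<in>I. if i = k then (if k = j then 1 else 0) else 0)"
    unfolding bid_def ent_sum by (rule sum.cong) auto
  also have "\<dots> = (if i \<in> I then (if i = j then 1 else 0) else 0)"
    using \<open>finite I\<close> by (rule sum.delta')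
  finally show ?thesis by auto
qed

lemma blockI: "(\<And>i j. ent X i j \<noteq> 0 \<Longrightarrow> i \<in> I \<and> j \<in> J) \<Longrightarrow> X \<in> block I J"
  unfolding block_def by blast

lemma block_zero_entry: "X \<in> block I J \<Longrightarrow> i \<notin> I \<or> j \<notin> J \<Longrightarrow> ent X i j = 0"
  unfolding block_def by blast

lemma block_closed [simp, intro]:
  "0 \<in> block I J"
  "X \<in> block I J \<Longrightarrow> Y \<in> block I J \<Longrightarrow> X + Y \<in> block I J"
  "X \<in> block I J \<Longrightarrow> Y \<in> block I J \<Longrightarrow> X - Y \<in> block I J"
  "X \<in> block I J \<Longrightarrow> - X \<in> block I J"
  unfolding block_def mem_Collect_eq ent_zero ent_add ent_minus ent_uminus
  by (simp, metis add_0, metis diff_0_right, simp)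

lemma block_sc [simp, intro]: "X \<in> block I J \<Longrightarrow> sc c X \<in> block I J"
  unfolding block_def by auto

lemma block_mono: "X \<in> block I J \<Longrightarrow> I \<subseteq> I' \<Longrightarrow> J \<subseteq> J' \<Longrightarrow> X \<in> block I' J'"
  unfolding block_def by blast

lemma block_mult: 
  assumes "X \<in> block I J" "Y \<in> block J' K" shows "X * Y \<in> block I K"
proof (rule blockI)
  fix i j assume "ent (X * Y) i j \<noteq> 0"
  then have "\<exists>l. ent X i l * ent Y l j \<noteq> 0"
    unfolding ent_times_raw using sum.neutral by (metis (mono_tags, lifting) mem_Collect_eq)
  then show "i \<in> I \<and> j \<in> K" using assms unfolding block_def by auto
qed

lemma block_mult_zero:
  assumes "X \<in> block I J" "Y \<in> block J' K" "J \<inter> J' = {}" shows "X * Y = 0"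
proof (rule fmat_eqI)
  fix i j
  have "ent X i l * ent Y l j = 0" for l
    using assms block_zero_entry[OF assms(1), of i l] block_zero_entry[OF assms(2), of l j]
    by (cases "l \<in> J") auto
  then show "ent (X * Y) i j = ent 0 i j" unfolding ent_times_raw by simp
qed

lemma block_bid: "finite I \<Longrightarrow> bid I \<in> block I I"
  by (rule blockI) (auto simp: ent_bid split: if_splits)

lemma ent_bid_mult: "finite I \<Longrightarrow> ent (bid I * X) i j = (if i \<in> I then ent X i j else 0)"
  by (subst ent_times[of "{i}"]) (auto simp: ent_bid split: if_splits)

lemma ent_mult_bid: "finite I \<Longrightarrow> ent (X * bid I) i j = (if j \<in> I then ent X i j else 0)"
  by (subst ent_times[of "{j}"]) (auto simp: ent_bid split: if_splits)

lemma bid_mult: "X \<in> block I J \<Longrightarrow> finite K \<Longrightarrow> I \<subseteq> K \<Longrightarrow> bid K * X = X"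
  by (rule fmat_eqI) (auto simp: ent_bid_mult block_def)

lemma mult_bid: "X \<in> block I J \<Longrightarrow> finite K \<Longrightarrow> J \<subseteq> K \<Longrightarrow> X * bid K = X"
  by (rule fmat_eqI) (auto simp: ent_mult_bid block_def)

lemma bid_Un: "finite I \<Longrightarrow> finite J \<Longrightarrow> I \<inter> J = {} \<Longrightarrow> bid (I \<union> J) = bid I + bid J"
  unfolding bid_def by (rule sum.union_disjoint)

lemma munit_block [simp]: "munit p q \<in> block I J \<longleftrightarrow> p \<in> I \<and> q \<in> J"
  unfolding block_def by (auto split: if_splits)

lemma munit_mult: "munit p q * munit r s = (if q = r then munit p s else 0)"
  by (rule fmat_eqI, subst ent_times[of "{q}"]) (auto split: if_splits)

lemma ent_munit_mult: "ent (munit p q * X) i j = (if i = p then ent X q j else 0)"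
  by (subst ent_times[of "{q}"]) (auto split: if_splits)

lemma ent_mult_munit: "ent (X * munit p q) i j = (if j = q then ent X i p else 0)"
  by (subst ent_times[of "{p}"]) (auto split: if_splits)

lemma subspace_block: "fs.subspace (block I J :: 'a::field fmat set)"
  unfolding fs.subspace_def by auto

lemma block_decomp:
  fixes X :: "'a::field fmat"
  assumes "X \<in> block I J" "finite I" "finite J"
  shows "X = (\<Sum>i\<in>I. \<Sum>j\<in>J. sc (ent X i j) (munit i j))"
proof (rule fmat_eqI)
  fix p q
  have "ent (\<Sum>i\<in>I. \<Sum>j\<in>J. sc (ent X i j) (munit i j)) p q
    = (\<Sum>i\<in>I. \<Sum>j\<in>J. if i = p then (if j = q then ent X i j else 0) else 0)"
    unfolding ent_sum by (intro sum.cong) auto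
  also have "\<dots> = (\<Sum>i\<in>I. if i = p then (\<Sum>j\<in>J. if j = q then ent X i j else 0) else 0)"
    by (intro sum.cong) auto
  also have "\<dots> = (if p \<in> I then if q \<in> J then ent X p q else 0 else 0)"
    using assms(2,3) by (simp add: sum.delta')
  finally show "ent X p q = ent (\<Sum>i\<in>I. \<Sum>j\<in>J. sc (ent X i j) (munit i j)) p q"
    using block_zero_entry[OF assms(1)] by auto
qed

lemma fin_dim_block: "finite I \<Longrightarrow> finite J \<Longrightarrow> fs.fin_dim (block I J :: 'a::field fmat set)"
proof -
  assume f: "finite I" "finite J"
  let ?B = "(\<lambda>(i, j). munit i j) ` (I \<times> J) :: 'a fmat set"
  have "X \<in> fs.span ?B" if "X \<in> block I J" for X :: "'a fmat"
    by (subst block_decomp[OF that f])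
      (intro fs.span_sum fs.span_scale fs.span_base, auto)
  then show ?thesis unfolding fs.fin_dim_def using f by (intro exI[of _ ?B]) auto
qed

section \<open>Linear functionals and the trace form\<close>

abbreviation linfun :: "('a::field fmat \<Rightarrow> 'a) \<Rightarrow> bool" where
  "linfun f \<equiv> fs.linfun_on UNIV f"

lemma linfunD:
  assumes "linfun f"
  shows "f (X + Y) = f X + f Y" "f (sc c X) = c * f X" "f (- X) = - f X" "f (X - Y) = f X - f Y" "f 0 = 0"
proof -
  show 1: "f (X + Y) = f X + f Y" "f (sc c X) = c * f X" for X Y c
    using assms unfolding fs.linfun_on_def by auto
  show 2: "f (- X) = - f X" for X using 1(2)[of "- 1" X] by simp
  show "f (X - Y) = f X - f Y" using 1(1)[of X "- Y"] 2 by simp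
  show "f 0 = 0" using 1(2)[of 0 0] by simp
qed

lemma linfunI: "(\<And>X Y. f (X + Y) = f X + f Y) \<Longrightarrow> (\<And>c X. f (sc c X) = c * f X) \<Longrightarrow> linfun f"
  unfolding fs.linfun_on_def by blast

lemma linfun_sum: "linfun f \<Longrightarrow> f (\<Sum>x\<in>A. h x) = (\<Sum>x\<in>A. f (h x))"
  using fs.linfun_on_sum[of UNIV f A h] fs.subspace_UNIV by blast

definition tr :: "'a::field fmat \<Rightarrow> 'a" where
  "tr X = (\<Sum>i | ent X i i \<noteq> 0. ent X i i)"

lemma tr_eq:
  assumes "finite K" "\<And>i. ent X i i \<noteq> 0 \<Longrightarrow> i \<in> K"
  shows "tr X = (\<Sum>i\<in>K. ent X i i)"
  unfolding tr_def using assms by (intro sum.mono_neutral_left) auto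

lemma tr_bound:
  assumes "\<And>i. n \<le> i \<Longrightarrow> ent X i i = 0"
  shows "tr X = (\<Sum>i<n. ent X i i)"
  by (rule tr_eq) (use assms not_le in auto)

lemma linfun_tr: "linfun (tr :: 'a::field fmat \<Rightarrow> 'a)"
proof (rule linfunI)
  fix X Y :: "'a fmat" and c
  obtain n m where n: "\<forall>i j. n \<le> i \<or> n \<le> j \<longrightarrow> ent X i j = 0" and m: "\<forall>i j. m \<le> i \<or> m \<le> j \<longrightarrow> ent Y i j = 0"
    using ent_bound by metis
  show "tr (X + Y) = tr X + tr Y"
    using n m by (simp add: tr_bound[of "max n m"] sum.distrib)
  show "tr (sc c X) = c * tr X"
    using n by (simp add: tr_bound[of n] sum_distrib_left)
qed

lemma tr_commute: "tr (X * Y) = tr (Y * X)"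
proof -
  obtain n m where n: "\<forall>i j. n \<le> i \<or> n \<le> j \<longrightarrow> ent X i j = 0" and m: "\<forall>i j. m \<le> i \<or> m \<le> j \<longrightarrow> ent Y i j = 0"
    using ent_bound by metis
  let ?k = "max n m"
  have b: "\<And>i l. ?k \<le> l \<Longrightarrow> ent X i l = 0" "\<And>i l. ?k \<le> l \<Longrightarrow> ent Y i l = 0"
    "\<And>i l. ?k \<le> i \<Longrightarrow> ent X i l = 0" "\<And>i l. ?k \<le> i \<Longrightarrow> ent Y i l = 0"
    using n m by auto
  have "tr (X * Y) = (\<Sum>i<?k. \<Sum>l<?k. ent X i l * ent Y l i)"
    by (subst tr_bound[of ?k]) (use b in \<open>simp_all only: ent_times_bound[of ?k] mult_zero_left sum.neutral_const\<close>)
  also have "\<dots> = (\<Sum>l<?k. \<Sum>i<?k. ent Y l i * ent X i l)"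
    by (subst sum.swap) (simp add: mult.commute)
  also have "\<dots> = tr (Y * X)"
    by (subst tr_bound[of ?k]) (use b in \<open>simp_all only: ent_times_bound[of ?k] mult_zero_left sum.neutral_const\<close>)
  finally show ?thesis .
qed

lemma linfun_tr_mult: "linfun (\<lambda>X. tr (C * X :: 'a::field fmat))"
  by (rule linfunI) (simp_all add: distrib_left linfunD[OF linfun_tr])

lemma tr_mult_munit: "tr (X * munit i j) = ent X j i"
  by (subst tr_eq[of "{j}"]) (auto simp: ent_mult_munit split: if_splits)

lemma tr_nondegenerate:
  assumes "X \<in> block I J" "\<And>Y. Y \<in> block J I \<Longrightarrow> tr (X * Y) = 0"
  shows "X = 0"
proof (rule fmat_eqI)
  fix i j
  show "ent X i j = ent 0 i j"
  proof (cases "i \<in> I \<and> j \<in> J")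
    case True
    then show ?thesis using assms(2)[of "munit j i"] by (simp add: tr_mult_munit)
  qed (use block_zero_entry[OF assms(1)] in auto)
qed

text \<open>The matrix that represents \<open>f\<close> on \<open>block I J\<close> through the
  trace form; since the trace pairs \<open>munit i j\<close> with \<open>munit j i\<close>, it lies
  in the transposed block.\<close>

definition dualm :: "('a::field fmat \<Rightarrow> 'a) \<Rightarrow> nat set \<Rightarrow> nat set \<Rightarrow> 'a fmat" where
  "dualm f I J = (\<Sum>i\<in>I. \<Sum>j\<in>J. sc (f (munit i j)) (munit j i))"

lemma dualm_block: "finite I \<Longrightarrow> finite J \<Longrightarrow> dualm f I J \<in> block J I"
  unfolding dualm_def by (intro fs.subspace_sum[OF subspace_block]) auto

lemma tr_dualm:
  assumes "linfun f" "X \<in> block I J" "finite I" "finite J"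
  shows "tr (dualm f I J * X) = f X"
proof -
  have "f X = f (\<Sum>i\<in>I. \<Sum>j\<in>J. sc (ent X i j) (munit i j))"
    using block_decomp[OF assms(2-4)] by simp
  also have "\<dots> = (\<Sum>i\<in>I. \<Sum>j\<in>J. f (munit i j) * ent X i j)"
    by (simp add: linfun_sum[OF assms(1)] linfunD[OF assms(1)] mult.commute)
  also have "\<dots> = tr (X * dualm f I J)"
    unfolding dualm_def sum_distrib_left linfun_sum[OF linfun_tr]
    by (simp add: linfunD[OF linfun_tr] tr_mult_munit)
  finally show ?thesis by (simp add: tr_commute)
qed

lemma dualm_tr:
  assumes "C \<in> block J I" "finite I" "finite J"
  shows "dualm (\<lambda>X. tr (C * X)) I J = (C :: 'a::field fmat)"
  unfolding dualm_def tr_mult_munit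
  by (subst sum.swap) (rule block_decomp[OF assms(1,3,2), symmetric])

lemma dualm_add:
  "dualm (\<lambda>X. f X + s * g X) I J = dualm f I J + sc s (dualm g I J)"
  unfolding dualm_def
  by (simp add: fs.scale_left_distrib sum.distrib fs.scale_sum_right)

text \<open>After multiplication by \<open>P'\<close> the pencil reads \<open>C P' + s\<close> or
  \<open>P' C + s\<close>. These are invertible unless \<open>- s\<close> is an eigenvalue of left
  multiplication by \<open>C P'\<close> or of right multiplication by \<open>P' C\<close>, which
  happens only finitely often.\<close>

lemma generic_inverse:
  fixes C P P' :: "'a::field fmat"
  assumes fin: "finite I" "finite J" and C: "C \<in> block J I" and P: "P \<in> block J I" "P' \<in> block I J"
    and inv: "P * P' = bid J" "P' * P = bid I"
  shows "finite {s. \<not> (\<exists>R\<in>block I J. (C + sc s P) * R = bid J \<and> R * (C + sc s P) = bid I)}"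
proof -
  have vs: "vector_space (sc :: 'a \<Rightarrow> _)" ..
  let ?L = "\<lambda>X. - (C * P' * X)" and ?M = "\<lambda>X. - (X * P' * C)"
  have lin: "Vector_Spaces.linear sc sc ?L" "Vector_Spaces.linear sc sc ?M"
    unfolding Vector_Spaces.linear_iff using vs by (auto simp: algebra_simps)
  let ?A = "{s. \<exists>x\<in>block J J. x \<noteq> 0 \<and> ?L x = sc s x}" and ?B = "{s. \<exists>x\<in>block I I. x \<noteq> 0 \<and> ?M x = sc s x}"
  have fin_AB: "finite (?A \<union> ?B)"
    using fs.finite_eigenvalues[OF lin(1) fin_dim_block[OF fin(2,2)]]
      fs.finite_eigenvalues[OF lin(2) fin_dim_block[OF fin(1,1)]] by blast
  have "\<exists>R\<in>block I J. (C + sc s P) * R = bid J \<and> R * (C + sc s P) = bid I" if s: "s \<notin> ?A \<union> ?B" for s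
  proof -
    let ?N = "\<lambda>X. C * P' * X + sc s X" and ?K = "\<lambda>X. X * P' * C + sc s X"
    have linN: "Vector_Spaces.linear sc sc ?N" "Vector_Spaces.linear sc sc ?K"
      unfolding Vector_Spaces.linear_iff using vs
      by (auto simp: algebra_simps fs.scale_right_distrib)
    interpret vector_space_pair "sc :: 'a \<Rightarrow> _" sc ..
    have N: "?N ` block J J = block J J"
    proof (rule fs.fin_dim_inj_imp_surj[OF linN(1) _ subspace_block fin_dim_block[OF fin(2,2)]])
      show "inj_on ?N (block J J)"
        using s by (auto simp: linear_inj_on_iff_eq_0[OF linN(1) subspace_block] add_eq_0_iff)
      show "?N ` block J J \<subseteq> block J J"
        using block_mult[OF block_mult[OF C P(2)]] by auto
    qed
    have K: "?K ` block I I = block I I"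
    proof (rule fs.fin_dim_inj_imp_surj[OF linN(2) _ subspace_block fin_dim_block[OF fin(1,1)]])
      show "inj_on ?K (block I I)"
        using s by (auto simp: linear_inj_on_iff_eq_0[OF linN(2) subspace_block] add_eq_0_iff)
      show "?K ` block I I \<subseteq> block I I"
        using block_mult[OF block_mult[OF _ P(2)] C] by auto
    qed
    obtain X where X: "X \<in> block J J" "?N X = bid J"
    proof -
      have "bid J \<in> ?N ` block J J" using N block_bid[OF fin(2)] by simp
      then show ?thesis using that by (elim imageE) simp
    qed
    obtain Y where Y: "Y \<in> block I I" "?K Y = bid I"
    proof -
      have "bid I \<in> ?K ` block I I" using K block_bid[OF fin(1)] by simp
      then show ?thesis using that by (elim imageE) simp
    qed
    have 1: "(C + sc s P) * (P' * X) = bid J"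
      using X(2) inv(1) bid_mult[OF X(1) fin(2)]
      by (simp add: distrib_right mult.assoc) (metis mult.assoc)
    have 2: "Y * P' * (C + sc s P) = bid I"
      using Y(2) inv(2) mult_bid[OF Y(1) fin(1)]
      by (simp add: distrib_left mult.assoc)
    have PX: "P' * X \<in> block I J" and YP: "Y * P' \<in> block I J"
      using block_mult[OF P(2) X(1)] block_mult[OF Y(1) P(2)] by auto
    \<comment> \<open>A left inverse and a right inverse coincide.\<close>
    have "Y * P' = Y * P' * ((C + sc s P) * (P' * X))" using 1 mult_bid[OF YP fin(2)] by simp
    also have "\<dots> = bid I * (P' * X)" using 2 by (metis mult.assoc)
    also have "\<dots> = P' * X" using bid_mult[OF PX fin(1)] by simp
    finally show ?thesis using 1 2 PX by metis
  qed
  then have "{s. \<not> (\<exists>R\<in>block I J. (C + sc s P) * R = bid J \<and> R * (C + sc s P) = bid I)} \<subseteq> ?A \<union> ?B"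
    by blast
  then show ?thesis using fin_AB by (rule finite_subset)
qed

section \<open>Radicals and index\<close>

definition rad :: "'a::field fmat set \<Rightarrow> ('a fmat \<Rightarrow> 'a) \<Rightarrow> 'a fmat set" where
  "rad Q f = {x\<in>Q. \<forall>y\<in>Q. f (x * y - y * x) = 0}"

text \<open>The attained minimum of the kernel dimension. Functionals are linear on all finitely
  supported matrices, so one functional can be evaluated on algebras of different sizes.\<close>

definition index_is :: "'a::field fmat set \<Rightarrow> nat \<Rightarrow> bool" where
  "index_is Q e \<longleftrightarrow> (\<exists>f. linfun f \<and> fs.dim (rad Q f) = e) \<and> (\<forall>f. linfun f \<longrightarrow> e \<le> fs.dim (rad Q f))"

lemma bilinear_form_bracket: "linfun f \<Longrightarrow> fs.bilinear_form (\<lambda>x y. f (x * y - y * x))"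
  unfolding fs.bilinear_form_def
  by (auto intro!: linfunI simp: linfunD algebra_simps)

lemma rad_eq_radical: "rad Q f = fs.radical (\<lambda>x y. f (x * y - y * x)) Q"
  unfolding rad_def fs.radical_def ..

lemma subspace_rad: "linfun f \<Longrightarrow> fs.subspace Q \<Longrightarrow> fs.subspace (rad Q f)"
  unfolding rad_eq_radical by (rule fs.subspace_radical[OF bilinear_form_bracket])

lemma linfun_combine: "linfun f \<Longrightarrow> linfun g \<Longrightarrow> linfun (\<lambda>x. f x + s * g x)"
  by (rule linfunI) (simp_all add: linfunD algebra_simps)

lemma rad_semicontinuous:
  assumes "linfun f" "linfun g" "fs.subspace Q" "fs.fin_dim Q"
  shows "finite {s. \<not> fs.dim (rad Q (\<lambda>x. f x + s * g x)) \<le> fs.dim (rad Q f)}"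
  using fs.radical_semicontinuous[OF bilinear_form_bracket[OF assms(1)] bilinear_form_bracket[OF assms(2)] assms(3,4)]
  unfolding rad_eq_radical .

lemma index_is_generic:
  fixes Q :: "'a::field_char_0 fmat set"
  assumes Q: "fs.subspace Q" "fs.fin_dim Q"
    and gen: "\<And>f. linfun f \<Longrightarrow> \<exists>g. linfun g \<and> finite {s. \<not> P (\<lambda>x. f x + s * g x)}"
    and lower: "\<And>f. linfun f \<Longrightarrow> P f \<Longrightarrow> e \<le> fs.dim (rad Q f)"
    and ext: "\<exists>f. linfun f \<and> fs.dim (rad Q f) = e"
  shows "index_is Q e"
  unfolding index_is_def
proof (intro conjI allI impI)
  fix f :: "'a fmat \<Rightarrow> 'a" assume f: "linfun f"
  obtain g where g: "linfun g" "finite {s. \<not> P (\<lambda>x. f x + s * g x)}" using gen[OF f] by blast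
  \<comment> \<open>Two finite sets of parameters are avoided: those where \<open>P\<close> fails
    and those where the kernel is larger than for \<open>f\<close>.\<close>
  have "finite ({s. \<not> P (\<lambda>x. f x + s * g x)} \<union> {s. \<not> fs.dim (rad Q (\<lambda>x. f x + s * g x)) \<le> fs.dim (rad Q f)})"
    using g rad_semicontinuous[OF f g(1) Q] by blast
  then obtain s where s: "P (\<lambda>x. f x + s * g x)" "fs.dim (rad Q (\<lambda>x. f x + s * g x)) \<le> fs.dim (rad Q f)"
    using ex_new_if_finite[OF infinite_UNIV_char_0] by blast
  then show "e \<le> fs.dim (rad Q f)" using lower[OF linfun_combine[OF f g(1)]] by (meson le_trans)
qed (rule ext)

text \<open>\<open>red\<close> bounds the generic kernel dimensions on \<open>Q\<close> from below
  by the index of \<open>Q'\<close>, and \<open>ext\<close> lifts a functional of minimal kernel.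
  The form of the statement asks for one and the same \<open>Q'\<close> for all generic
  functionals.\<close>

lemma index_is_transfer:
  fixes Q Q' :: "'a::field_char_0 fmat set"
  assumes Q: "fs.subspace Q" "fs.fin_dim Q"
    and gen: "\<And>f. linfun f \<Longrightarrow> \<exists>g. linfun g \<and> finite {s. \<not> P (\<lambda>x. f x + s * g x)}"
    and red: "\<And>f. linfun f \<Longrightarrow> P f \<Longrightarrow> \<exists>f'. linfun f' \<and> fs.dim (rad Q f) = fs.dim (rad Q' f')"
    and ext: "\<And>f'. linfun f' \<Longrightarrow> \<exists>f. linfun f \<and> fs.dim (rad Q f) = fs.dim (rad Q' f')"
    and ind: "index_is Q' e"
  shows "index_is Q e"
proof (rule index_is_generic[OF Q gen])
  show "e \<le> fs.dim (rad Q f)" if "linfun f" "P f" for f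
    using red[OF that] ind unfolding index_is_def by metis
  show "\<exists>f. linfun f \<and> fs.dim (rad Q f) = e"
    using ind ext unfolding index_is_def by metis
qed

text \<open>\<open>\<phi>\<close> parametrises the orthogonal complement of \<open>V\<close> in
  \<open>S\<close> by the smaller algebra \<open>Q'\<close> and carries one bracket form to the
  other. Elements of \<open>V\<close> multiply to zero, so \<open>V\<close> is isotropic for every
  functional.\<close>

lemma dim_rad_reduction:
  fixes Q :: "'a::field fmat set"
  assumes f: "linfun f" and Q: "Q = {y + v |y v. y \<in> S \<and> v \<in> V}"
    and S: "fs.subspace S" "fs.fin_dim S" and V: "fs.subspace V" "fs.fin_dim V"
    and iso: "\<And>v w. v \<in> V \<Longrightarrow> w \<in> V \<Longrightarrow> v * w = 0"
    and nd: "\<And>v. v \<in> V \<Longrightarrow> (\<And>y. y \<in> S \<Longrightarrow> f (v * y - y * v) = 0) \<Longrightarrow> v = 0"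
    and pr: "Vector_Spaces.linear sc sc \<pi>" "\<And>y. y \<in> S \<Longrightarrow> \<pi> y = y" "\<And>v. v \<in> V \<Longrightarrow> \<pi> v = 0"
    and Q': "fs.subspace Q'" "fs.fin_dim Q'"
    and \<phi>: "Vector_Spaces.linear sc sc \<phi>" "inj_on \<phi> Q'"
      "\<phi> ` Q' = {y\<in>S. \<forall>v\<in>V. f (y * v - v * y) = 0}"
    and hom: "linfun f'" "\<And>x y. x \<in> Q' \<Longrightarrow> y \<in> Q' \<Longrightarrow> f (\<phi> x * \<phi> y - \<phi> y * \<phi> x) = f' (x * y - y * x)"
  shows "fs.dim (rad Q f) = fs.dim (rad Q' f')"
proof -
  let ?\<beta> = "\<lambda>x y. f (x * y - y * x)"
  have "fs.dim (rad Q f) = fs.dim (fs.radical ?\<beta> {y\<in>S. \<forall>v\<in>V. ?\<beta> y v = 0})"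
    unfolding rad_eq_radical
  proof (rule fs.radical_reduction[OF bilinear_form_bracket[OF f] _ S(1) V S(2) Q _ nd pr])
    show "?\<beta> y x = - ?\<beta> x y" for x y by (simp add: linfunD[OF f, symmetric])
    show "?\<beta> v w = 0" if "v \<in> V" "w \<in> V" for v w using iso that by (simp add: linfunD[OF f])
  qed auto
  also have "fs.radical ?\<beta> {y\<in>S. \<forall>v\<in>V. ?\<beta> y v = 0} = \<phi> ` rad Q' f'"
    unfolding \<phi>(3)[symmetric] fs.radical_def rad_def using hom(2) by auto
  also have "fs.dim (\<phi> ` rad Q' f') = fs.dim (rad Q' f')"
    by (rule fs.dim_image_inj_on[OF \<phi>(1) _ subspace_rad[OF hom(1) Q'(1)]])
      (use \<phi>(2) Q'(2) in \<open>auto simp: rad_def intro: inj_on_subset fs.fin_dim_subset\<close>)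
  finally show ?thesis .
qed

lemma linear_scI:
  "(\<And>x y. \<phi> (x + y) = \<phi> x + \<phi> y) \<Longrightarrow> (\<And>c x. \<phi> (sc c x) = sc c (\<phi> x)) \<Longrightarrow> Vector_Spaces.linear sc sc (\<phi> :: 'a::field fmat \<Rightarrow> _)"
  unfolding Vector_Spaces.linear_iff using fs.vector_space_axioms by blast

lemma linear_sc_inj_onI:
  assumes "Vector_Spaces.linear sc sc (\<phi> :: 'a::field fmat \<Rightarrow> _)" "fs.subspace Q" "\<And>x. x \<in> Q \<Longrightarrow> \<phi> x = 0 \<Longrightarrow> x = 0"
  shows "inj_on \<phi> Q"
proof -
  interpret vector_space_pair "sc :: 'a \<Rightarrow> _" sc ..
  show ?thesis using linear_inj_on_iff_eq_0[OF assms(1,2)] assms(3) by blast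
qed

lemma tr_block_disjoint: "X \<in> block I J \<Longrightarrow> I \<inter> J = {} \<Longrightarrow> tr X = 0"
  by (subst tr_eq[of "{}"]) (auto simp: block_def)

text \<open>Supplies the direction in which a functional is perturbed to make its representing block
  invertible.\<close>

lemma permutation_blocks:
  assumes fin: "finite I" "finite J" and card: "card I = card J"
  obtains P P' :: "'a::field fmat" where "P \<in> block J I" "P' \<in> block I J" "P * P' = bid J" "P' * P = bid I"
proof -
  obtain h where h: "bij_betw h I J" using finite_same_card_bij[OF fin card] by blast
  then have inj: "inj_on h I" and im: "h ` I = J" unfolding bij_betw_def by auto
  define P P' :: "'a fmat" where "P = (\<Sum>i\<in>I. munit (h i) i)" and "P' = (\<Sum>i\<in>I. munit i (h i))"
  have "P \<in> block J I" "P' \<in> block I J"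
    unfolding P_def P'_def using im by (intro fs.subspace_sum[OF subspace_block]; auto)+
  moreover have "P * P' = bid J"
  proof -
    have "P * P' = (\<Sum>i\<in>I. \<Sum>j\<in>I. if i = j then munit (h i) (h i) else 0)"
      unfolding P_def P'_def sum_distrib_right sum_distrib_left munit_mult
      by (intro sum.cong) auto
    also have "\<dots> = (\<Sum>i\<in>I. munit (h i) (h i))" using fin(1) by (simp add: sum.delta)
    finally show ?thesis unfolding bid_def im[symmetric] sum.reindex[OF inj] by simp
  qed
  moreover have "P' * P = bid I"
  proof -
    have "P' * P = (\<Sum>i\<in>I. \<Sum>j\<in>I. if i = j then munit i i else 0)"
      unfolding P_def P'_def sum_distrib_right sum_distrib_left munit_mult
      using inj by (intro sum.cong) (auto simp: inj_on_def)
    also have "\<dots> = (\<Sum>i\<in>I. munit i i)" using fin(1) by (simp add: sum.delta)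
    finally show ?thesis unfolding bid_def .
  qed
  ultimately show ?thesis using that by blast
qed

lemma bid_idem [simp]: "finite I \<Longrightarrow> bid I * bid I = bid I"
  using bid_mult[OF block_bid] by blast

lemma block_Un_left:
  assumes "Z \<in> block (I \<union> I') J" "finite I" "finite I'" "I \<inter> I' = {}"
  shows "Z = bid I * Z + bid I' * Z"
  using bid_mult[OF assms(1) finite_UnI[OF assms(2,3)]] bid_Un[OF assms(2-4)]
  by (metis distrib_right subset_refl)

lemma corner_block: "finite I \<Longrightarrow> finite J \<Longrightarrow> bid I * X * bid J \<in> block I J"
proof -
  assume "finite I" "finite J"
  moreover have "X \<in> block UNIV UNIV" unfolding block_def by simp
  ultimately show ?thesis
    using block_mult[OF block_mult[OF block_bid] block_bid] by blast
qed

lemma dualm_cong: "(\<And>X. X \<in> block I J \<Longrightarrow> f X = g X) \<Longrightarrow> dualm f I J = dualm g I J"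
  unfolding dualm_def by (intro sum.cong refl arg_cong2[of _ _ _ _ sc]) simp

section \<open>Block triangular matrix algebras\<close>

text \<open>For \<open>U = {..<a}\<close>, the algebra \<open>galg a T W t\<close> is \<open>\<gg>\<ll>(U) \<oplus> k t \<oplus> Hom(W, U \<oplus> T) \<oplus> \<gg>\<ll>(W)\<close>. It is what remains
  of the seaweed when the symmetric corner has been removed: \<open>T\<close> stands for the indices \<open>c, \<dots>, n - 1\<close>,
  and \<open>t\<close> spans the stabiliser of a generic quadratic form on them.\<close>

definition galg :: "nat \<Rightarrow> nat set \<Rightarrow> nat set \<Rightarrow> 'a::field fmat \<Rightarrow> 'a fmat set" where
  "galg a T W t = {A + sc r t + Z + D | A r Z D.
     A \<in> block {..<a} {..<a} \<and> Z \<in> block ({..<a} \<union> T) W \<and> D \<in> block W W}"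

lemma galgI: "A \<in> block {..<a} {..<a} \<Longrightarrow> Z \<in> block ({..<a} \<union> T) W \<Longrightarrow> D \<in> block W W \<Longrightarrow>
  A + sc r t + Z + D \<in> galg a T W t"
  unfolding galg_def by blast

lemma galgE:
  assumes "x \<in> galg a T W t"
  obtains A r Z D where "x = A + sc r t + Z + D"
    "A \<in> block {..<a} {..<a}" "Z \<in> block ({..<a} \<union> T) W" "D \<in> block W W"
  using assms unfolding galg_def by blast

lemma subspace_galg: "fs.subspace (galg a T W t)"
  unfolding fs.subspace_def
proof (intro conjI ballI allI)
  have "0 = (0 :: 'a fmat) + sc 0 t + 0 + 0" by simp
  then show "0 \<in> galg a T W t" by (metis galgI block_closed(1))
  fix x assume "x \<in> galg a T W t"
  then obtain A r Z D where x: "x = A + sc r t + Z + D"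
    "A \<in> block {..<a} {..<a}" "Z \<in> block ({..<a} \<union> T) W" "D \<in> block W W" by (rule galgE)
  show "sc c x \<in> galg a T W t" for c
    using galgI[OF block_sc[OF x(2)] block_sc[OF x(3)] block_sc[OF x(4)], where r = "c * r" and t = t]
    by (simp add: x(1) fs.scale_right_distrib)
  fix y assume "y \<in> galg a T W t"
  then obtain A' r' Z' D' where y: "y = A' + sc r' t + Z' + D'"
    "A' \<in> block {..<a} {..<a}" "Z' \<in> block ({..<a} \<union> T) W" "D' \<in> block W W" by (rule galgE)
  have "x + y = (A + A') + sc (r + r') t + (Z + Z') + (D + D')"
    unfolding x y by (simp add: fs.scale_left_distrib algebra_simps)
  then show "x + y \<in> galg a T W t" by (metis galgI block_closed(2) x(2-4) y(2-4))
qed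

lemma galg_subset_block:
  assumes "t \<in> block T T"
  shows "galg a T W t \<subseteq> block ({..<a} \<union> T \<union> W) ({..<a} \<union> T \<union> W)"
  using assms by (auto elim!: galgE intro!: block_closed intro: block_mono)

lemma fin_dim_galg: "t \<in> block T T \<Longrightarrow> finite T \<Longrightarrow> finite W \<Longrightarrow> fs.fin_dim (galg a T W t)"
  using fs.fin_dim_subset[OF fin_dim_block galg_subset_block] by blast

text \<open>\<open>galg\<close> is closed under brackets but in general not under products, because
  \<open>t * t\<close> need not be a multiple of \<open>t\<close>. This associative algebra contains
  it, so multiplicative identities can be proved here.\<close>

definition tripat :: "nat \<Rightarrow> nat set \<Rightarrow> nat set \<Rightarrow> 'a::field fmat set" where
  "tripat a T W = {x. \<forall>i j. ent x i j \<noteq> 0 \<longrightarrow>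
     i < a \<and> (j < a \<or> j \<in> W) \<or> i \<in> T \<and> (j \<in> T \<or> j \<in> W) \<or> i \<in> W \<and> j \<in> W}"

lemma ent_mult_nonzeroE:
  fixes X Y :: "'a::field fmat"
  assumes "ent (X * Y) i j \<noteq> 0"
  obtains l where "ent X i l \<noteq> 0" "ent Y l j \<noteq> 0"
proof -
  have "\<exists>l. ent X i l * ent Y l j \<noteq> 0"
    using assms unfolding ent_times_raw using sum.neutral by (metis (mono_tags, lifting) mem_Collect_eq)
  then show ?thesis using that by auto
qed

lemma tripat_mult:
  assumes "{..<a} \<inter> T = {}" "{..<a} \<inter> W = {}" "T \<inter> W = {}" "x \<in> tripat a T W" "y \<in> tripat a T W"
  shows "x * y \<in> tripat a T W"
  unfolding tripat_def
proof (intro CollectI allI impI)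
  fix i j assume "ent (x * y) i j \<noteq> 0"
  then obtain l where l: "ent x i l \<noteq> 0" "ent y l j \<noteq> 0" by (rule ent_mult_nonzeroE)
  show "i < a \<and> (j < a \<or> j \<in> W) \<or> i \<in> T \<and> (j \<in> T \<or> j \<in> W) \<or> i \<in> W \<and> j \<in> W"
    using assms l unfolding tripat_def by blast
qed

lemma galg_subset_tripat: "t \<in> block T T \<Longrightarrow> galg a T W t \<subseteq> tripat a T W"
proof
  fix x assume t: "t \<in> block T T" and "x \<in> galg a T W t"
  then obtain A r Z D where x: "x = A + sc r t + Z + D"
    "A \<in> block {..<a} {..<a}" "Z \<in> block ({..<a} \<union> T) W" "D \<in> block W W" by (blast elim: galgE)
  show "x \<in> tripat a T W" unfolding tripat_def
  proof (intro CollectI allI impI)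
    fix i j assume "ent x i j \<noteq> 0"
    then have "ent A i j \<noteq> 0 \<or> ent t i j \<noteq> 0 \<or> ent Z i j \<noteq> 0 \<or> ent D i j \<noteq> 0" unfolding x by auto
    then show "i < a \<and> (j < a \<or> j \<in> W) \<or> i \<in> T \<and> (j \<in> T \<or> j \<in> W) \<or> i \<in> W \<and> j \<in> W"
      using x(2-4) t unfolding block_def by blast
  qed
qed

lemma tripat_row_invariant:
  assumes "finite I" "x \<in> tripat a T W" "\<And>i j. ent x i j \<noteq> 0 \<Longrightarrow> i \<in> I \<Longrightarrow> j \<in> I"
  shows "bid I * x = bid I * x * bid I"
  by (rule fmat_eqI) (use assms(3) in \<open>auto simp: ent_bid_mult[OF assms(1)] ent_mult_bid[OF assms(1)]\<close>)

text \<open>\<open>L\<close> and \<open>M\<close> transport the algebra with unit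
  \<open>g = M L\<close>, \<open>p\<close> cuts out a second copy, and the mixed products vanish.
  The invariance alternatives allow the idempotent between \<open>x\<close> and \<open>y\<close> to
  be dropped.\<close>

lemma sandwich_mult:
  fixes L M g p x y :: "'a::field fmat"
  assumes "M * L = g" "M * p = 0" "p * L = 0" "p * p = p" "L * g = L" "g * M = M"
    and g: "g * x = g * x * g \<or> y * g = g * y * g" and p: "p * x = p * x * p \<or> y * p = p * y * p"
  shows "(L * x * M + p * x * p) * (L * y * M + p * y * p) = L * (x * y) * M + p * (x * y) * p"
proof -
  have 1: "L * x * M * (L * y * M) = L * (x * y) * M"
  proof -
    have e: "L * x * M * (L * y * M) = L * x * g * y * M" using assms(1) by (simp add: mult.assoc) (metis mult.assoc)
    have "L * (g * x) = L * x" "y * g * M = y * M" using assms(5,6) by (metis mult.assoc)+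
    then show ?thesis using g e by (metis mult.assoc)
  qed
  have 2: "p * x * p * (p * y * p) = p * (x * y) * p"
  proof -
    have "p * x * p * (p * y * p) = p * x * p * y * p" using assms(4) by (metis mult.assoc)
    then show ?thesis using p assms(4) by (metis mult.assoc)
  qed
  have 3: "L * x * M * (p * y * p) = 0" "p * x * p * (L * y * M) = 0"
    using assms(2,3) by (metis mult.assoc mult_zero_left mult_zero_right)+
  show ?thesis by (simp add: distrib_left distrib_right 1 2 3)
qed

text \<open>The isotropic subspace is \<open>Hom(W, U)\<close>. A functional identifies with a matrix \<open>C\<close> whose part on the last
  \<open>d = card W\<close> indices of \<open>U\<close> is generically invertible, with inverse \<open>R\<close>; the map \<open>x \<mapsto> L x M + p x p\<close>
  parametrises the stabiliser of \<open>C\<close>, which is an algebra of the same kind with \<open>a - d\<close> for \<open>a\<close>.\<close>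

locale galg_step1 =
  fixes a d :: nat and T W :: "nat set" and t :: "'a::field_char_0 fmat"
  assumes fin: "finite T" "finite W" and card: "card W = d" and le: "d \<le> a"
    and disj: "{..<a} \<inter> T = {}" "{..<a} \<inter> W = {}" "T \<inter> W = {}" and t: "t \<in> block T T"
begin

abbreviation "U \<equiv> {..<a}"
abbreviation "U1 \<equiv> {..<a - d}"
abbreviation "U2 \<equiv> {a - d..<a}"

lemma U_split: "U = U1 \<union> U2" "U1 \<inter> U2 = {}" using le by auto

text \<open>Of \<open>f'\<close> only agreement on the pattern algebra is asked, so that the lemma
  serves both directions: \<open>f'\<close> may be the pullback of \<open>F\<close>, or
  \<open>F\<close> may be built from a given \<open>f'\<close>.\<close>

lemma reduction:
  assumes F: "linfun F" and R: "R \<in> block U2 W" and inv: "dualm F U2 W * R = bid W" "R * dualm F U2 W = bid U2"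
    and L: "L = bid U1 - R * dualm F U1 W + R" and M: "M = bid U1 + dualm F U1 W + dualm F U2 W"
    and p: "p = bid (T \<union> W)"
    and f': "linfun f'" "\<And>x. x \<in> tripat (a - d) T W \<Longrightarrow> F (L * x * M + p * x * p) = f' x"
  shows "fs.dim (rad (galg a T W t) F) = fs.dim (rad (galg (a - d) T W t) f')"
proof -
  define C1 C2 C where "C1 = dualm F U1 W" and "C2 = dualm F U2 W" and "C = dualm F U W"
  \<comment> \<open>\<open>C\<close> maps \<open>U\<close> onto \<open>W\<close> with right inverse
    \<open>R\<close>, and the columns of \<open>K\<close> span its kernel. Hence
    \<open>L = K + R\<close> and \<open>M = e1 + C\<close> are inverse base changes between
    \<open>U\<close> and \<open>U1 \<union> W\<close>.\<close>
  define K where "K = bid U1 - R * C1"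
  define e1 eW where "e1 = (bid U1 :: 'a fmat)" and "eW = (bid W :: 'a fmat)"
  have finU: "finite U1" "finite U2" "finite U" by auto
  have bl: "C1 \<in> block W U1" "C2 \<in> block W U2" "C \<in> block W U" "R \<in> block U2 W"
    "e1 \<in> block U1 U1" "eW \<in> block W W" "t \<in> block T T" "p \<in> block (T \<union> W) (T \<union> W)"
    unfolding C1_def C2_def C_def e1_def eW_def p using fin R t
    by (auto intro!: dualm_block block_bid)
  have Csum: "C = C1 + C2"
    unfolding C_def C1_def C2_def dualm_def unfolding U_split(1)
    by (rule sum.union_disjoint) (use U_split(2) in auto)
  have C2R: "C2 * R = eW" "R * C2 = bid U2" using inv unfolding C2_def eW_def by auto
  have dj: "U1 \<inter> U2 = {}" "U2 \<inter> U1 = {}" "W \<inter> U1 = {}" "W \<inter> U2 = {}" "W \<inter> U = {}"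
    "U1 \<inter> W = {}" "U1 \<inter> T = {}" using disj U_split by blast+
  have zero: "C1 * R = 0" "e1 * R = 0" "C2 * e1 = 0" "R * e1 = 0" "C1 * bid U2 = 0"
    using block_mult_zero[OF bl(1) bl(4) dj(1)] block_mult_zero[OF bl(5) bl(4) dj(1)]
      block_mult_zero[OF bl(2) bl(5) dj(2)] block_mult_zero[OF bl(4) bl(5) dj(3)]
      block_mult_zero[OF bl(1) block_bid[OF finU(2)] dj(1)] by simp_all
  have unit: "C1 * e1 = C1" "e1 * e1 = e1" "eW * R = 0" "R * eW = R" "eW * C1 = C1" "eW * C2 = C2"
    unfolding e1_def eW_def
    using mult_bid[OF bl(1) finU(1)] mult_bid[OF bl(4) fin(2)] bid_mult[OF bl(1) fin(2)] bid_mult[OF bl(2) fin(2)]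
      block_mult_zero[OF block_bid[OF fin(2)] bl(4) dj(4)] by simp_all
  have LM: "L = K + R" "M = e1 + C" unfolding L M K_def Csum e1_def C1_def C2_def by (auto simp: add.assoc)
  have KU: "K \<in> block U U1"
    unfolding K_def using block_mult[OF bl(4,1)] bl(5) unfolding e1_def
    by (auto intro!: block_closed intro: block_mono)
  have CR: "C * R = eW" unfolding Csum by (simp add: distrib_right zero C2R)
  have CK: "C * K = 0"
  proof -
    have "C * K = C1 + C2 * e1 - (C * R) * C1"
      unfolding K_def Csum e1_def[symmetric] by (simp add: algebra_simps unit)
    then show ?thesis using CR zero unit by simp
  qed
  have e1K: "e1 * K = e1"
    unfolding K_def e1_def[symmetric] by (simp add: algebra_simps unit) (simp add: mult.assoc[symmetric] zero)
  have Lb: "L \<in> block U (U1 \<union> W)" unfolding LM using KU bl(4)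
    by (auto intro!: block_closed intro: block_mono)
  have Mb: "M \<in> block (U1 \<union> W) U" unfolding LM using bl(3,5)
    by (auto intro!: block_closed intro: block_mono)
  have MLg: "M * L = bid (U1 \<union> W)"
  proof -
    have "M * L = e1 + eW" unfolding LM by (simp add: algebra_simps e1K CK CR zero)
    then show ?thesis unfolding e1_def eW_def bid_Un[OF finU(1) fin(2) dj(6)] .
  qed
  have LMid: "L * M = bid U"
  proof -
    have z: "K * C = 0" by (rule block_mult_zero[OF KU bl(3) dj(6)])
    have k: "K * e1 = K" using mult_bid[OF KU finU(1)] unfolding e1_def by simp
    have "L * M = K + R * C" unfolding LM by (simp add: algebra_simps z k zero)
    also have "\<dots> = e1 + bid U2" unfolding K_def e1_def[symmetric] Csum by (simp add: algebra_simps C2R)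
    also have "\<dots> = bid U" unfolding e1_def U_split(1) by (rule bid_Un[symmetric]) (use U_split(2) in auto)
    finally show ?thesis .
  qed
  have pz: "M * p = 0" "p * L = 0" "p * p = p"
    using block_mult_zero[OF Mb bl(8)] block_mult_zero[OF bl(8) Lb] disj p fin by auto
  have CL: "C * L = eW" unfolding LM by (simp add: distrib_left CK CR)
  have disj1: "U1 \<inter> T = {}" "U1 \<inter> W = {}" using dj by blast+
  define \<phi> where "\<phi> x = L * x * M + p * x * p" for x
  have lin\<phi>: "Vector_Spaces.linear sc sc \<phi>"
    unfolding \<phi>_def by (rule linear_scI) (simp_all add: algebra_simps fs.scale_right_distrib)
  \<comment> \<open>\<open>D\<close> acts twice, inside the conjugated block on \<open>U\<close> and
    again on \<open>W\<close>; because of \<open>C L = eW\<close> this duplication solves the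
    intertwining equation \<open>C A = D C\<close>.\<close>
  have \<phi>_comp: "\<phi> (A + sc r t + (X + Y) + D) = L * (A + X + D) * M + (sc r t + Y + D)"
    if "A \<in> block U1 U1" "X \<in> block U1 W" "Y \<in> block T W" "D \<in> block W W" for A r X Y D
  proof -
    have z: "L * t = 0" "L * Y = 0" "p * A = 0" "p * X = 0"
      using block_mult_zero[OF Lb bl(7)] block_mult_zero[OF Lb that(3)] disj disj1
        block_mult_zero[OF bl(8) that(1)] block_mult_zero[OF bl(8) that(2)] by blast+
    have k: "p * t = t" "t * p = t" "p * Y = Y" "Y * p = Y" "p * D = D" "D * p = D"
      unfolding p using bid_mult[OF bl(7)] mult_bid[OF bl(7)] bid_mult[OF that(3)] mult_bid[OF that(3)]
        bid_mult[OF that(4)] mult_bid[OF that(4)] fin by auto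
    show ?thesis unfolding \<phi>_def by (simp add: distrib_left distrib_right z k)
  qed
  let ?Q = "galg a T W t" and ?Q' = "galg (a - d) T W t"
  define S where "S = {x \<in> ?Q. bid U * x * bid W = 0}"
  have Q'E: "\<exists>A r X Y D. x = A + sc r t + (X + Y) + D \<and> A \<in> block U1 U1 \<and> X \<in> block U1 W \<and> Y \<in> block T W \<and> D \<in> block W W"
    if x: "x \<in> galg a' T W t" "U1 = {..<a'}" "{..<a'} \<inter> T = {}" for x a' and U1
  proof -
    obtain A r Z D where e: "x = A + sc r t + Z + D"
      "A \<in> block {..<a'} {..<a'}" "Z \<in> block ({..<a'} \<union> T) W" "D \<in> block W W" using x(1) by (rule galgE)
    have "Z = bid {..<a'} * Z + bid T * Z" using block_Un_left[OF e(3)] fin x(3) by blast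
    moreover have "bid {..<a'} * Z \<in> block {..<a'} W" "bid T * Z \<in> block T W"
      using block_mult[OF block_bid e(3)] fin by auto
    ultimately show ?thesis using e x(2) by metis
  qed
  have SE: "\<exists>A r Y D. y = A + sc r t + Y + D \<and> A \<in> block U U \<and> Y \<in> block T W \<and> D \<in> block W W"
    if y: "y \<in> S" for y
  proof -
    obtain A r X Y D where e: "y = A + sc r t + (X + Y) + D" "A \<in> block U U" "X \<in> block U W" "Y \<in> block T W" "D \<in> block W W"
      using Q'E[of y a U] y disj unfolding S_def by blast
    have z: "A * bid W = 0" "t * bid W = 0" "bid U * Y = 0" "bid U * D = 0"
      using block_mult_zero[OF e(2) block_bid[OF fin(2)]] block_mult_zero[OF bl(7) block_bid[OF fin(2)]]
        block_mult_zero[OF block_bid e(4)] block_mult_zero[OF block_bid e(5)] disj by auto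
    have "bid U * y * bid W = X"
      using bid_mult[OF e(3)] mult_bid[OF e(3) fin(2)] unfolding e(1) by (simp add: distrib_left distrib_right z mult.assoc)
    then have "X = 0" using y unfolding S_def by simp
    then show ?thesis using e by auto
  qed
  have SI: "A + sc r t + Y + D \<in> S" if "A \<in> block U U" "Y \<in> block T W" "D \<in> block W W" for A r Y D
  proof -
    have z: "A * bid W = 0" "t * bid W = 0" "bid U * Y = 0" "bid U * D = 0"
      using block_mult_zero[OF that(1) block_bid[OF fin(2)]] block_mult_zero[OF bl(7) block_bid[OF fin(2)]]
        block_mult_zero[OF block_bid that(2)] block_mult_zero[OF block_bid that(3)] disj by auto
    have "A + sc r t + Y + D \<in> ?Q" using that by (intro galgI) (auto intro: block_mono)
    then show ?thesis unfolding S_def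
      by (simp add: distrib_left distrib_right z(1,2) mult.assoc) (simp add: mult.assoc[symmetric] z(3,4))
  qed
  have VQ: "v \<in> ?Q" if "v \<in> block U W" for v
    using galgI[of 0 a v T W 0 0 t] that block_mono[OF that] by auto
  \<comment> \<open>The trace form turns orthogonality to all of \<open>block U W\<close> into a
    matrix equation.\<close>
  have perp: "(\<forall>v\<in>block U W. F (y * v - v * y) = 0) \<longleftrightarrow> C * A = D * C"
    if y: "y = A + sc r t + Y + D" "A \<in> block U U" "Y \<in> block T W" "D \<in> block W W" for y A r Y D
  proof -
    have e: "F (y * v - v * y) = tr ((C * A - D * C) * v)" if v: "v \<in> block U W" for v
    proof -
      have z: "t * v = 0" "Y * v = 0" "D * v = 0" "v * A = 0" "v * t = 0" "v * Y = 0"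
        using block_mult_zero[OF bl(7) v] block_mult_zero[OF y(3) v] block_mult_zero[OF y(4) v]
          block_mult_zero[OF v y(2)] block_mult_zero[OF v bl(7)] block_mult_zero[OF v y(3)] disj by auto
      have "y * v - v * y = A * v - v * D" unfolding y(1) by (simp add: distrib_left distrib_right z)
      moreover have "A * v - v * D \<in> block U W" using block_mult[OF y(2) v] block_mult[OF v y(4)] by blast
      ultimately have "F (y * v - v * y) = tr (C * (A * v - v * D))"
        unfolding C_def using tr_dualm[OF F _ finU(3) fin(2)] by simp
      also have "\<dots> = tr (C * A * v) - tr (D * C * v)"
        using tr_commute[of "C * v" D] by (simp add: right_diff_distrib linfunD[OF linfun_tr] mult.assoc)
      finally show ?thesis by (simp add: left_diff_distrib linfunD[OF linfun_tr])
    qed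
    have "C * A - D * C \<in> block W U" using block_mult[OF bl(3) y(2)] block_mult[OF y(4) bl(3)] by blast
    then show ?thesis using e tr_nondegenerate[of "C * A - D * C" W U] by (auto simp: linfunD[OF linfun_tr])
  qed
  show ?thesis
  proof (rule dim_rad_reduction[where S = S and V = "block U W" and \<pi> = "\<lambda>x. x - bid U * x * bid W" and \<phi> = \<phi>, OF F])
    show "?Q = {y + v |y v. y \<in> S \<and> v \<in> block U W}"
    proof (intro equalityI subsetI)
      fix x assume x: "x \<in> ?Q"
      have v: "bid U * x * bid W \<in> block U W" by (rule corner_block) (use fin in auto)
      have "x - bid U * x * bid W \<in> S"
        using fs.subspace_diff[OF subspace_galg x VQ[OF v]] fin
        unfolding S_def by (simp add: algebra_simps) (simp add: mult.assoc[symmetric] fin)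
      then show "x \<in> {y + v |y v. y \<in> S \<and> v \<in> block U W}" using v
        by (intro CollectI exI[of _ "x - bid U * x * bid W"] exI[of _ "bid U * x * bid W"]) simp
    next
      fix x assume "x \<in> {y + v |y v. y \<in> S \<and> v \<in> block U W}"
      then show "x \<in> ?Q" unfolding S_def using VQ by (auto intro: fs.subspace_add[OF subspace_galg])
    qed
    show "fs.subspace S"
      using subspace_galg[of a T W t] unfolding S_def fs.subspace_def by (auto simp: distrib_left distrib_right)
    show "fs.fin_dim S" by (rule fs.fin_dim_subset[OF fin_dim_galg[OF t fin]]) (auto simp: S_def)
    show "fs.subspace (block U W :: 'a fmat set)" by (rule subspace_block)
    show "fs.fin_dim (block U W :: 'a fmat set)" using fin_dim_block fin by blast
    show "v * w = 0" if "v \<in> block U W" "w \<in> block U W" for v w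
      using block_mult_zero[OF that] disj by blast
    show "v = 0" if v: "v \<in> block U W" and n: "\<And>y. y \<in> S \<Longrightarrow> F (v * y - y * v) = 0" for v
    proof -
      have "tr (v * C * A) = 0" if A: "A \<in> block U U" for A
      proof -
        have "A + sc 0 t + 0 + 0 \<in> S" using SI[OF A] by blast
        then have "F (v * A - A * v) = 0" using n[of A] by simp
        moreover have "v * A = 0" using block_mult_zero[OF v A] disj by blast
        ultimately have "F (A * v) = 0" by (simp add: linfunD[OF F])
        then have "tr (C * (A * v)) = 0"
          unfolding C_def using tr_dualm[OF F block_mult[OF A v] finU(3) fin(2)] by simp
        then show ?thesis using tr_commute[of "C * A" v] by (simp add: mult.assoc)
      qed
      \<comment> \<open>Pairing with gl(U) gives \<open>v C = 0\<close>, and the right inverse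
        \<open>R\<close> cancels \<open>C\<close>.\<close>
      then have "v * C = 0" using tr_nondegenerate[OF block_mult[OF v bl(3)]] by blast
      then have "v * (C * R) = 0" by (simp add: mult.assoc[symmetric])
      then show "v = 0" using CR mult_bid[OF v fin(2)] unfolding eW_def by simp
    qed
    show "Vector_Spaces.linear sc sc (\<lambda>x. x - bid U * x * bid W :: 'a fmat)"
      by (rule linear_scI) (simp_all add: algebra_simps fs.scale_right_diff_distrib)
    show "y - bid U * y * bid W = y" if "y \<in> S" for y using that unfolding S_def by simp
    show "v - bid U * v * bid W = 0" if "v \<in> block U W" for v
      using bid_mult[OF that finU(3)] mult_bid[OF that fin(2)] by simp
    show "fs.subspace ?Q'" by (rule subspace_galg)
    show "fs.fin_dim ?Q'" by (rule fin_dim_galg[OF t fin])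
    show "Vector_Spaces.linear sc sc \<phi>" by (rule lin\<phi>)
    show "inj_on \<phi> ?Q'"
    proof (rule linear_sc_inj_onI[OF lin\<phi> subspace_galg])
      fix x assume "x \<in> ?Q'" and x0: "\<phi> x = 0"
      then obtain A r X Y D where x: "x = A + sc r t + (X + Y) + D" and b: "A \<in> block U1 U1" "X \<in> block U1 W" "Y \<in> block T W" "D \<in> block W W"
        using Q'E[of x "a - d" U1] disj1 by blast
      let ?N = "A + X + D" and ?R = "sc r t + Y + D"
      have 0: "L * ?N * M + ?R = 0" using x0 \<phi>_comp[OF b] unfolding x by simp
      have Nb: "?N \<in> block (U1 \<union> W) (U1 \<union> W)" using b by (auto intro!: block_closed intro: block_mono)
      have Rb: "?R \<in> block (T \<union> W) (T \<union> W)" using b t by (auto intro!: block_closed block_sc intro: block_mono)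
      have MR: "M * ?R = 0" using block_mult_zero[OF Mb Rb] disj by blast
      have "M * (L * ?N * M) * L = 0" using 0 MR
        by (metis add.right_neutral distrib_left mult_zero_left mult_zero_right)
      then have "bid (U1 \<union> W) * ?N * bid (U1 \<union> W) = 0" unfolding MLg[symmetric] by (simp add: mult.assoc)
      then have N0: "?N = 0" using bid_mult[OF Nb] mult_bid[OF Nb] fin by simp
      then have R0: "?R = 0" using 0 by simp
      \<comment> \<open>\<open>D\<close> is a summand of both \<open>?N\<close> and
        \<open>?R\<close>, so it has to be separated before \<open>x\<close> can be assembled from
        the two.\<close>
      have "eW * A = 0" "eW * X = 0" "eW * D = D"
        using block_mult_zero[OF bl(6) b(1)] block_mult_zero[OF bl(6) b(2)] disj1 bid_mult[OF b(4) fin(2)]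
        unfolding eW_def by auto
      then have "D = eW * ?N" by (simp add: distrib_left)
      then have D0: "D = 0" using N0 by simp
      have "x = ?N + ?R - D" unfolding x by (simp add: algebra_simps)
      then show "x = 0" unfolding N0 R0 unfolding D0 by simp
    qed
    show "\<phi> ` ?Q' = {y \<in> S. \<forall>v\<in>block U W. F (y * v - v * y) = 0}"
    proof (intro equalityI subsetI)
      fix y assume "y \<in> \<phi> ` ?Q'"
      then obtain A r X Y D where y: "y = \<phi> (A + sc r t + (X + Y) + D)"
        and b: "A \<in> block U1 U1" "X \<in> block U1 W" "Y \<in> block T W" "D \<in> block W W"
        using Q'E[of _ "a - d" U1] disj1 by blast
      let ?A = "L * (A + X + D) * M"
      have y': "y = ?A + sc r t + Y + D" using \<phi>_comp[OF b] y by (simp add: add.assoc)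
      have Nb: "A + X + D \<in> block (U1 \<union> W) (U1 \<union> W)" using b by (auto intro!: block_closed intro: block_mono)
      have Ab: "?A \<in> block U U" using block_mult[OF block_mult[OF Lb Nb] Mb] .
      have "eW * A = 0" "eW * X = 0" "eW * D = D" "D * e1 = 0"
        using block_mult_zero[OF bl(6) b(1)] block_mult_zero[OF bl(6) b(2)] disj1 bid_mult[OF b(4) fin(2)]
          block_mult_zero[OF b(4) bl(5)] unfolding eW_def by auto
      then have "C * ?A = D * C"
        unfolding mult.assoc[symmetric] CL by (simp add: distrib_left LM(2))
      then show "y \<in> {y \<in> S. \<forall>v\<in>block U W. F (y * v - v * y) = 0}"
        using perp[OF y' Ab b(3,4)] SI[OF Ab b(3,4)] y' by simp
    next
      fix y assume y: "y \<in> {y \<in> S. \<forall>v\<in>block U W. F (y * v - v * y) = 0}"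
      then obtain A r Y D where e: "y = A + sc r t + Y + D" "A \<in> block U U" "Y \<in> block T W" "D \<in> block W W"
        using SE by blast
      have CA: "C * A = D * C" using perp[OF e] y by blast
      \<comment> \<open>Two of the blocks of \<open>M * A * L\<close>. The remaining ones are
        \<open>C A K = D C K = 0\<close> and \<open>C A R = D\<close>.\<close>
      let ?A = "e1 * A * K" and ?X = "e1 * A * R"
      have b: "?A \<in> block U1 U1" "?X \<in> block U1 W"
        using block_mult[OF block_mult[OF bl(5) e(2)] KU] block_mult[OF block_mult[OF bl(5) e(2)] bl(4)] .
      have "C * A * K = 0" "C * A * R = D"
        unfolding CA mult.assoc CK CR using mult_bid[OF e(4) fin(2)] unfolding eW_def by simp_all
      then have "M * A * L = ?A + ?X + D" unfolding LM by (simp add: distrib_left distrib_right)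
      moreover have "L * (M * A * L) * M = bid U * A * bid U" unfolding LMid[symmetric] by (simp add: mult.assoc)
      moreover have "\<dots> = A" using bid_mult[OF e(2)] mult_bid[OF e(2)] by simp
      ultimately have "\<phi> (?A + sc r t + (?X + Y) + D) = y"
        unfolding \<phi>_comp[OF b e(3,4)] e(1) by (simp add: add.assoc)
      moreover have "?A + sc r t + (?X + Y) + D \<in> ?Q'"
        using b e by (intro galgI) (auto intro!: block_closed intro: block_mono)
      ultimately show "y \<in> \<phi> ` ?Q'" by (metis imageI)
    qed
    show "linfun f'" by (rule f')
    show "F (\<phi> x * \<phi> y - \<phi> y * \<phi> x) = f' (x * y - y * x)" if x: "x \<in> ?Q'" and y: "y \<in> ?Q'" for x y
    proof -
      have pat: "x \<in> tripat (a - d) T W" "y \<in> tripat (a - d) T W" using x y galg_subset_tripat[OF t] by blast+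
      have inv: "bid (U1 \<union> W) * z = bid (U1 \<union> W) * z * bid (U1 \<union> W)" "p * z = p * z * p"
        if "z \<in> tripat (a - d) T W" for z
      proof -
        have d: "\<not> j < a - d" if "j \<in> W" for j using that dj(6) by blast
        show "bid (U1 \<union> W) * z = bid (U1 \<union> W) * z * bid (U1 \<union> W)"
        proof (rule tripat_row_invariant[OF _ that])
          show "j \<in> U1 \<union> W" if "ent z i j \<noteq> 0" "i \<in> U1 \<union> W" for i j
            using that \<open>z \<in> _\<close> dj(6,7) disj(3) d unfolding tripat_def by blast
        qed (use fin in auto)
        show "p * z = p * z * p"
          unfolding p by (rule tripat_row_invariant[OF _ that]) (use that fin disj1 disj(3) d in \<open>auto simp: tripat_def\<close>)
      qed
      have hom: "\<phi> z * \<phi> w = \<phi> (z * w)" if "z \<in> tripat (a - d) T W" for z w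
        unfolding \<phi>_def
        by (rule sandwich_mult[OF MLg pz mult_bid[OF Lb] bid_mult[OF Mb]]) (use inv[OF that] fin in auto)
      have "\<phi> x * \<phi> y - \<phi> y * \<phi> x = \<phi> (x * y) - \<phi> (y * x)" using hom pat by simp
      moreover have "F (\<phi> z) = f' z" if "z \<in> tripat (a - d) T W" for z
        using f'(2)[OF that] unfolding \<phi>_def .
      ultimately show ?thesis
        using tripat_mult[OF disj1 disj(3) pat] tripat_mult[OF disj1 disj(3) pat(2,1)]
        by (metis linfunD(4)[OF F] linfunD(4)[OF f'(1)])
    qed
  qed
qed

lemma index:
  assumes "index_is (galg (a - d) T W t) e"
  shows "index_is (galg a T W t) e"
proof -
  have cU2: "card U2 = card W" "finite U2" using card le by auto
  obtain P P' :: "'a fmat" where P: "P \<in> block W U2" "P' \<in> block U2 W" "P * P' = bid W" "P' * P = bid U2"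
    using permutation_blocks[OF cU2(2) fin(2) cU2(1)] by metis
  let ?G = "\<lambda>F. \<exists>R\<in>block U2 W. dualm F U2 W * R = bid W \<and> R * dualm F U2 W = bid U2"
  show ?thesis
  proof (rule index_is_transfer[OF subspace_galg fin_dim_galg[OF t fin], where P = ?G])
    show "\<exists>g. linfun g \<and> finite {s. \<not> ?G (\<lambda>x. f x + s * g x)}" for f :: "'a fmat \<Rightarrow> 'a"
    proof (intro exI[of _ "\<lambda>x. tr (P * x)"] conjI linfun_tr_mult)
      show "finite {s. \<not> ?G (\<lambda>x. f x + s * tr (P * x))}"
        using generic_inverse[OF cU2(2) fin(2) dualm_block[OF cU2(2) fin(2)] P]
        by (simp add: dualm_add dualm_tr[OF P(1) cU2(2) fin(2)])
    qed
    show "\<exists>f'. linfun f' \<and> fs.dim (rad (galg a T W t) F) = fs.dim (rad (galg (a - d) T W t) f')"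
      if F: "linfun F" and G: "?G F" for F
    proof -
      obtain R where R: "R \<in> block U2 W" "dualm F U2 W * R = bid W" "R * dualm F U2 W = bid U2" using G by blast
      define L M p where "L = bid U1 - R * dualm F U1 W + R" and "M = bid U1 + dualm F U1 W + dualm F U2 W"
        and "p = (bid (T \<union> W) :: 'a fmat)"
      have lin: "linfun (\<lambda>x. F (L * x * M + p * x * p))"
        by (rule linfunI) (simp_all add: algebra_simps linfunD[OF F])
      show ?thesis using reduction[OF F R L_def M_def p_def lin refl] lin by blast
    qed
    show "\<exists>f. linfun f \<and> fs.dim (rad (galg a T W t) f) = fs.dim (rad (galg (a - d) T W t) f')"
      if f': "linfun f'" for f'
    proof -
      define p q L M where "p = (bid (T \<union> W) :: 'a fmat)" and "q = (bid W :: 'a fmat)" and "L = bid U1 + P'" and "M = bid U1 + P"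
      \<comment> \<open>For \<open>y = L x M + p x p\<close> the product \<open>M y L\<close>
        returns the part of \<open>x\<close> on \<open>U1\<close> and \<open>W\<close>, and
        \<open>p y p\<close> the part on \<open>T\<close> and \<open>W\<close>; the term with
        \<open>q\<close> removes the block on \<open>W\<close> that was counted twice. The trace
        term makes the representing block on \<open>U2\<close> equal to \<open>P\<close>.\<close>
      define F where "F y = f' (M * y * L + (p * y * p - q * y * q)) + tr (P * y)" for y
      have F: "linfun F" unfolding F_def
        by (rule linfunI) (simp_all add: algebra_simps linfunD[OF f'] linfunD[OF linfun_tr])
      have dis: "U2 \<inter> U1 = {}" "U1 \<inter> U2 = {}" "U1 \<inter> W = {}" "W \<inter> U1 = {}" "U2 \<inter> W = {}" "W \<inter> U2 = {}"
        "U1 \<inter> (T \<union> W) = {}" "(T \<union> W) \<inter> U2 = {}" "U2 \<inter> (T \<union> W) = {}" "(T \<union> W) \<inter> U1 = {}"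
        "(T \<union> W) \<inter> U = {}" "U \<inter> (T \<union> W) = {}" "W \<inter> U = {}"
        using disj U_split by blast+
      have bl: "bid U1 \<in> block U1 U1" "L \<in> block U (U1 \<union> W)" "M \<in> block (U1 \<union> W) U" "p \<in> block (T \<union> W) (T \<union> W)" "q \<in> block W W"
        unfolding L_def M_def p_def q_def using P(1,2) fin block_bid[of U1] U_split(1)
        by (auto intro!: block_closed block_bid intro: block_mono)
      have FZ: "F Z = tr (P * Z)" if "Z \<in> block U W" for Z
        using block_mult_zero[OF that bl(2) dis(13)] block_mult_zero[OF bl(4) that dis(11)]
          block_mult_zero[OF bl(5) that dis(13)]
        unfolding F_def by (simp add: mult.assoc linfunD[OF f'])
      have D2: "dualm F U2 W = P"
      proof -
        have "dualm F U2 W = dualm (\<lambda>x. tr (P * x)) U2 W"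
          by (rule dualm_cong, rule FZ, erule block_mono) auto
        then show ?thesis using dualm_tr[OF P(1) cU2(2) fin(2)] by simp
      qed
      have D1: "dualm F U1 W = 0"
      proof -
        have "F Z = 0" if "Z \<in> block U1 W" for Z
          using FZ[OF block_mono[OF that]] U_split(1) block_mult_zero[OF P(1) that dis(1)] by (auto simp: linfunD[OF linfun_tr])
        then show ?thesis using dualm_cong[of U1 W F "\<lambda>_. 0"] by (simp add: dualm_def)
      qed
      have z: "bid U1 * P' = 0" "P * bid U1 = 0" "M * p = 0" "p * L = 0" "q * L = 0" "M * q = 0" "P * p = 0"
        using block_mult_zero[OF bl(1) P(2) dis(2)] block_mult_zero[OF P(1) bl(1) dis(1)]
          block_mult_zero[OF bl(3,4) dis(12)] block_mult_zero[OF bl(4,2) dis(11)]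
          block_mult_zero[OF bl(5,2) dis(13)] block_mult_zero[OF bl(3,5)] block_mult_zero[OF P(1) bl(4) dis(9)] disj(2) by simp_all
      have pq: "p * p = p" "q * p = q" "p * q = q"
        using bid_mult[OF bl(5), of "T \<union> W"] mult_bid[OF bl(5), of "T \<union> W"] fin unfolding p_def by auto
      have MLg: "M * L = bid (U1 \<union> W)"
        unfolding bid_Un[OF finite_lessThan fin(2) dis(3)] L_def M_def by (simp add: distrib_left distrib_right z P(3))
      have red: "F (L * x * M + p * x * p) = f' x" if x: "x \<in> tripat (a - d) T W" for x
      proof -
        let ?y = "L * x * M + p * x * p" and ?g = "bid (U1 \<union> W) :: 'a fmat"
        have 1: "M * ?y * L = ?g * x * ?g"
        proof -
          have "M * ?y * L = (M * L) * x * (M * L) + (M * p) * x * (p * L)" by (simp add: algebra_simps)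
          then show ?thesis unfolding MLg z by simp
        qed
        have 2: "p * ?y * p = p * x * p"
        proof -
          have "p * ?y * p = (p * L) * x * (M * p) + (p * p) * x * (p * p)" by (simp add: algebra_simps)
          then show ?thesis unfolding pq z by simp
        qed
        have 3: "q * ?y * q = q * x * q"
        proof -
          have "q * ?y * q = (q * L) * x * (M * q) + (q * p) * x * (p * q)" by (simp add: algebra_simps)
          then show ?thesis unfolding pq z by simp
        qed
        have 4: "tr (P * ?y) = 0"
        proof -
          have "P * ?y = P * (L * x * M) + (P * p) * x * p" by (simp add: algebra_simps)
          moreover have "P * (L * x * M) \<in> block W U"
            using block_mult[OF P(1) block_mult[OF block_mult[OF bl(2), of x UNIV UNIV] bl(3)]] unfolding block_def by auto
          ultimately show ?thesis using tr_block_disjoint[OF _ dis(13)] z by simp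
        qed
        have "?g * x * ?g + (p * x * p - q * x * q) = x"
        proof (rule fmat_eqI)
          fix i j
          have d: "\<forall>k\<in>T. \<not> k < a - d" "\<forall>k\<in>W. \<not> k < a - d" "\<forall>k\<in>T. k \<notin> W" using disj le by force+
          show "ent (?g * x * ?g + (p * x * p - q * x * q)) i j = ent x i j"
          proof (cases "ent x i j = 0")
            case False
            then have "i < a - d \<and> (j < a - d \<or> j \<in> W) \<or> i \<in> T \<and> (j \<in> T \<or> j \<in> W) \<or> i \<in> W \<and> j \<in> W"
              using x unfolding tripat_def by blast
            then show ?thesis using d fin unfolding p_def q_def by (auto simp: ent_bid_mult ent_mult_bid)
          qed (use fin in \<open>auto simp: p_def q_def ent_bid_mult ent_mult_bid\<close>)
        qed
        then show ?thesis unfolding F_def 1 2 3 4 by simp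
      qed
      show ?thesis
        by (intro exI[of _ F] conjI F reduction[OF F P(2) _ _ _ _ p_def f' red])
          (simp_all add: D1 D2 P(3,4) L_def M_def)
    qed
    show "index_is (galg (a - d) T W t) e" by fact
  qed
qed

end

lemma col_invariant:
  assumes "finite I" "\<And>i j. ent x i j \<noteq> 0 \<Longrightarrow> j \<in> I \<Longrightarrow> i \<in> I"
  shows "x * bid I = bid I * x * bid I"
  by (rule fmat_eqI) (use assms(2) in \<open>auto simp: ent_bid_mult[OF assms(1)] ent_mult_bid[OF assms(1)]\<close>)

section \<open>Reduction by all maps from W to the sum of U and T\<close>

locale galg_vertical =
  fixes a :: nat and T W :: "nat set" and t :: "'a::field_char_0 fmat"
  assumes fin: "finite T" "finite W" and disj: "{..<a} \<inter> T = {}" "({..<a} \<union> T) \<inter> W = {}"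
    and t: "t \<in> block T T"
begin

abbreviation "U \<equiv> {..<a} \<union> T"

lemma finU: "finite U" using fin by auto

lemma top_block: "A \<in> block {..<a} {..<a} \<Longrightarrow> A + sc r t \<in> block U U"
  using t by (auto intro!: block_closed block_sc intro: block_mono)

text \<open>\<open>nd\<close> collects what pairing with the complement yields: testing
  \<open>v\<close> against gl(W) gives \<open>C v = 0\<close>, testing against the upper part gives
  the trace conditions. It is left open because it is automatic for an injective \<open>C\<close>
  but delicate when \<open>C\<close> has a kernel.\<close>

lemma reduction:
  assumes F: "linfun F" and C: "C = dualm F U W"
    and nd: "\<And>v. v \<in> block U W \<Longrightarrow> C * v = 0 \<Longrightarrow>
      (\<And>A r. A \<in> block {..<a} {..<a} \<Longrightarrow> tr (C * (A + sc r t) * v) = 0) \<Longrightarrow> v = 0"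
    and Q': "fs.subspace Q'" "fs.fin_dim Q'"
    and \<phi>: "Vector_Spaces.linear sc sc \<phi>" "inj_on \<phi> Q'"
      "\<phi> ` Q' = {A + sc r t + D | A r D. A \<in> block {..<a} {..<a} \<and> D \<in> block W W \<and> C * (A + sc r t) = D * C}"
    and hom: "linfun f'" "\<And>x y. x \<in> Q' \<Longrightarrow> y \<in> Q' \<Longrightarrow> F (\<phi> x * \<phi> y - \<phi> y * \<phi> x) = f' (x * y - y * x)"
  shows "fs.dim (rad (galg a T W t) F) = fs.dim (rad Q' f')"
proof -
  define p where "p = (bid U :: 'a fmat)"
  have bl: "C \<in> block W U" "p \<in> block U U"
    unfolding C p_def using fin by (auto intro!: dualm_block block_bid)
  have pp: "p * p = p" unfolding p_def using finU by simp
  have disj': "W \<inter> U = {}" "U \<inter> W = {}" using disj by blast+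
  let ?Q = "galg a T W t"
  define S where "S = {x \<in> ?Q. p * x * bid W = 0}"
  have SE: "\<exists>A r D. y = A + sc r t + D \<and> A \<in> block {..<a} {..<a} \<and> D \<in> block W W"
    if y: "y \<in> S" for y
  proof -
    obtain A r Z D where e: "y = A + sc r t + Z + D" "A \<in> block {..<a} {..<a}" "Z \<in> block U W" "D \<in> block W W"
      using y unfolding S_def by (blast elim: galgE)
    have z: "(A + sc r t) * bid W = 0" "p * D = 0"
      using block_mult_zero[OF top_block[OF e(2)] block_bid[OF fin(2)] disj'(2)] block_mult_zero[OF bl(2) e(4) disj'(2)] .
    have "p * y * bid W = p * ((A + sc r t) * bid W) + p * (Z * bid W) + p * D * bid W"
      unfolding e(1) by (simp only: distrib_left distrib_right mult.assoc)
    also have "\<dots> = Z" unfolding z using bid_mult[OF e(3) finU] mult_bid[OF e(3) fin(2)] unfolding p_def by simp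
    finally have "Z = 0" using y unfolding S_def by simp
    then show ?thesis using e by auto
  qed
  have SI: "A + sc r t + D \<in> S" if "A \<in> block {..<a} {..<a}" "D \<in> block W W" for A r D
  proof -
    have z: "(A + sc r t) * bid W = 0" "p * D = 0"
      using block_mult_zero[OF top_block[OF that(1)] block_bid[OF fin(2)] disj'(2)] block_mult_zero[OF bl(2) that(2) disj'(2)] .
    have "p * (A + sc r t + D) * bid W = p * ((A + sc r t) * bid W) + p * D * bid W"
      by (simp only: distrib_left distrib_right mult.assoc)
    moreover have "A + sc r t + 0 + D \<in> ?Q" using that by (intro galgI) auto
    ultimately show ?thesis unfolding S_def by (simp add: z)
  qed
  have VQ: "v \<in> ?Q" if "v \<in> block U W" for v
    using galgI[of 0 a v T W 0 0 t] that by auto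
  have perp: "(\<forall>v\<in>block U W. F (y * v - v * y) = 0) \<longleftrightarrow> C * A = D * C"
    if y: "y = A + D" "A \<in> block U U" "D \<in> block W W" for y A D
  proof -
    have e: "F (y * v - v * y) = tr ((C * A - D * C) * v)" if v: "v \<in> block U W" for v
    proof -
      have z: "D * v = 0" "v * A = 0"
        using block_mult_zero[OF y(3) v disj'(1)] block_mult_zero[OF v y(2) disj'(1)] .
      have "y * v - v * y = A * v - v * D" unfolding y(1) by (simp add: distrib_left distrib_right z)
      moreover have "A * v - v * D \<in> block U W" using block_mult[OF y(2) v] block_mult[OF v y(3)] by blast
      ultimately have "F (y * v - v * y) = tr (C * (A * v - v * D))"
        unfolding C using tr_dualm[OF F _ finU fin(2)] by simp
      also have "\<dots> = tr (C * A * v) - tr (D * C * v)"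
        using tr_commute[of "C * v" D] by (simp add: right_diff_distrib linfunD[OF linfun_tr] mult.assoc)
      finally show ?thesis by (simp add: left_diff_distrib linfunD[OF linfun_tr])
    qed
    have "C * A - D * C \<in> block W U" using block_mult[OF bl(1) y(2)] block_mult[OF y(3) bl(1)] by blast
    then show ?thesis using e tr_nondegenerate[of "C * A - D * C" W U] by (auto simp: linfunD[OF linfun_tr])
  qed
  show ?thesis
  proof (rule dim_rad_reduction[where S = S and V = "block U W" and \<pi> = "\<lambda>x. x - p * x * bid W" and \<phi> = \<phi>, OF F])
    show "?Q = {y + v |y v. y \<in> S \<and> v \<in> block U W}"
    proof (intro equalityI subsetI)
      fix x assume x: "x \<in> ?Q"
      have v: "p * x * bid W \<in> block U W" unfolding p_def by (rule corner_block[OF finU fin(2)])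
      have "p * (x - p * x * bid W) * bid W = p * x * bid W - (p * p) * x * (bid W * bid W)"
        by (simp add: algebra_simps)
      then have "x - p * x * bid W \<in> S"
        using fs.subspace_diff[OF subspace_galg x VQ[OF v]] fin(2) pp unfolding S_def by simp
      then show "x \<in> {y + v |y v. y \<in> S \<and> v \<in> block U W}" using v
        by (intro CollectI exI[of _ "x - p * x * bid W"] exI[of _ "p * x * bid W"]) simp
    next
      fix x assume "x \<in> {y + v |y v. y \<in> S \<and> v \<in> block U W}"
      then show "x \<in> ?Q" unfolding S_def using VQ by (auto intro: fs.subspace_add[OF subspace_galg])
    qed
    show "fs.subspace S"
      using subspace_galg[of a T W t] unfolding S_def fs.subspace_def by (auto simp: distrib_left distrib_right)
    show "fs.fin_dim S" by (rule fs.fin_dim_subset[OF fin_dim_galg[OF t fin]]) (auto simp: S_def)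
    show "fs.subspace (block U W :: 'a fmat set)" by (rule subspace_block)
    show "fs.fin_dim (block U W :: 'a fmat set)" by (rule fin_dim_block[OF finU fin(2)])
    show "v * w = 0" if "v \<in> block U W" "w \<in> block U W" for v w
      using block_mult_zero[OF that disj'(1)] .
    show "v = 0" if v: "v \<in> block U W" and n: "\<And>y. y \<in> S \<Longrightarrow> F (v * y - y * v) = 0" for v
    proof (rule nd[OF v])
      have "tr (C * v * D) = 0" if D: "D \<in> block W W" for D
      proof -
        have "0 + sc 0 t + D \<in> S" using SI[OF _ D, of 0 0] by blast
        then have "F (v * D - D * v) = 0" using n[of D] by simp
        moreover have "D * v = 0" using block_mult_zero[OF D v disj'(1)] .
        ultimately have "F (v * D) = 0" by simp
        then show ?thesis
          unfolding C mult.assoc using tr_dualm[OF F block_mult[OF v D] finU fin(2)] by simp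
      qed
      then show "C * v = 0" using tr_nondegenerate[OF block_mult[OF bl(1) v]] by blast
      show "tr (C * (A + sc r t) * v) = 0" if A: "A \<in> block {..<a} {..<a}" for A r
      proof -
        let ?A = "A + sc r t"
        have "?A + 0 \<in> S" using SI[OF A, of 0 r] by blast
        then have "F (v * ?A - ?A * v) = 0" using n[of ?A] by simp
        moreover have "v * ?A = 0" using block_mult_zero[OF v top_block[OF A] disj'(1)] .
        ultimately have "F (?A * v) = 0" by (simp add: linfunD[OF F])
        then show ?thesis
          unfolding C mult.assoc using tr_dualm[OF F block_mult[OF top_block[OF A] v] finU fin(2)] by simp
      qed
    qed
    show "Vector_Spaces.linear sc sc (\<lambda>x. x - p * x * bid W :: 'a fmat)"
      by (rule linear_scI) (simp_all add: algebra_simps fs.scale_right_diff_distrib)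
    show "y - p * y * bid W = y" if "y \<in> S" for y using that unfolding S_def by simp
    show "v - p * v * bid W = 0" if "v \<in> block U W" for v
      unfolding p_def using bid_mult[OF that finU] mult_bid[OF that fin(2)] by simp
    show "\<phi> ` Q' = {y \<in> S. \<forall>v\<in>block U W. F (y * v - v * y) = 0}"
    proof (intro equalityI subsetI)
      fix y assume "y \<in> \<phi> ` Q'"
      then obtain A r D where e: "y = A + sc r t + D" "A \<in> block {..<a} {..<a}" "D \<in> block W W" "C * (A + sc r t) = D * C"
        unfolding \<phi>(3) by blast
      then show "y \<in> {y \<in> S. \<forall>v\<in>block U W. F (y * v - v * y) = 0}"
        using perp[OF e(1) top_block[OF e(2)] e(3)] SI[OF e(2,3)] by simp
    next
      fix y assume y: "y \<in> {y \<in> S. \<forall>v\<in>block U W. F (y * v - v * y) = 0}"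
      then obtain A r D where e: "y = A + sc r t + D" "A \<in> block {..<a} {..<a}" "D \<in> block W W"
        using SE by blast
      then show "y \<in> \<phi> ` Q'"
        unfolding \<phi>(3) using perp[OF e(1) top_block[OF e(2)] e(3)] y by blast
    qed
  qed (use Q' \<phi> hom in auto)
qed

end

text \<open>For \<open>card W \<ge> a + card T\<close> the roles are exchanged: \<open>C\<close> has an invertible part on a subset \<open>W\<^sub>1\<close> of \<open>W\<close> with
  \<open>a + card T\<close> elements, and the stabiliser replaces \<open>W\<close> by \<open>W - W\<^sub>1\<close>.\<close>

locale galg_step2 =
  fixes a :: nat and T W1 W2 :: "nat set" and t :: "'a::field_char_0 fmat"
  assumes fin: "finite T" "finite W1" "finite W2" and card: "card W1 = a + card T"
    and disj: "{..<a} \<inter> T = {}" "({..<a} \<union> T) \<inter> W1 = {}" "({..<a} \<union> T) \<inter> W2 = {}" "W1 \<inter> W2 = {}"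
    and t: "t \<in> block T T"
begin

abbreviation "U \<equiv> {..<a} \<union> T"
abbreviation "W \<equiv> W1 \<union> W2"

lemma disj': "W1 \<inter> U = {}" "W2 \<inter> U = {}" "W2 \<inter> W1 = {}" "W \<inter> U = {}" "U \<inter> W = {}"
  using disj by blast+

lemma finU: "finite U" "finite W" using fin by auto

text \<open>\<open>C\<close> is injective on \<open>U\<close> with left inverse \<open>R\<close>, so
  \<open>L = C + b2\<close> identifies \<open>U \<union> W2\<close> with \<open>W\<close>, with
  inverse \<open>M\<close>. The upper part of \<open>x\<close> acts on \<open>U\<close> and,
  transported by \<open>L\<close>, on \<open>W\<close>, which solves
  \<open>C A = D C\<close>.\<close>

lemma reduction:
  assumes F: "linfun F" and R: "R \<in> block U W1" and inv: "dualm F U W1 * R = bid W1" "R * dualm F U W1 = bid U"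
    and L: "L = dualm F U W1 + dualm F U W2 + bid W2" and M: "M = R + (bid W2 - dualm F U W2 * R)"
    and p: "p = bid U"
    and f': "linfun f'" "\<And>x. x \<in> tripat a T W2 \<Longrightarrow> F (L * x * M + p * x * p) = f' x"
  shows "fs.dim (rad (galg a T W t) F) = fs.dim (rad (galg a T W2 t) f')"
proof -
  define C1 C2 C where "C1 = dualm F U W1" and "C2 = dualm F U W2" and "C = dualm F U W"
  define b2 where "b2 = (bid W2 :: 'a fmat)"
  \<comment> \<open>The projection of \<open>W\<close> to \<open>W2\<close> along the image of
    \<open>C\<close>.\<close>
  define K where "K = b2 - C2 * R"
  have bl: "C1 \<in> block W1 U" "C2 \<in> block W2 U" "C \<in> block W U" "R \<in> block U W1"
    "b2 \<in> block W2 W2" "p \<in> block U U"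
    unfolding C1_def C2_def C_def b2_def p using fin R
    by (auto intro!: dualm_block block_bid)
  have Csum: "C = C1 + C2"
    unfolding C_def C1_def C2_def dualm_def sum.distrib[symmetric]
    by (intro sum.cong refl sum.union_disjoint fin disj)
  have CR: "C1 * R = bid W1" "R * C1 = p" using inv unfolding C1_def p by auto
  have zero: "R * C2 = 0" "R * b2 = 0" "C * b2 = 0" "b2 * R = 0" "b2 * C1 = 0"
    using block_mult_zero[OF bl(4) bl(2) disj(4)] block_mult_zero[OF bl(4) bl(5) disj(4)]
      block_mult_zero[OF bl(3) bl(5) disj(3)] block_mult_zero[OF bl(5) bl(4) disj'(2)]
      block_mult_zero[OF bl(5) bl(1) disj'(3)] by simp_all
  have unit: "b2 * b2 = b2" "b2 * C2 = C2" "C2 * p = C2" "p * p = p"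
    unfolding b2_def p using bid_mult[OF bl(2) fin(3)] mult_bid[OF bl(2) finU(1)] fin by auto
  have LM: "L = C + b2" "M = R + K" unfolding L M K_def Csum b2_def C1_def C2_def by auto
  have Kb: "K \<in> block W2 W"
    unfolding K_def using block_mult[OF bl(2,4)] bl(5) by (auto intro!: block_closed intro: block_mono)
  have RC: "R * C = p" unfolding Csum by (simp add: distrib_left zero CR)
  have KC: "K * C = 0"
    unfolding K_def left_diff_distrib mult.assoc RC unit unfolding Csum by (simp add: distrib_left zero unit)
  have K2: "K * b2 = b2" "b2 * K = K"
    unfolding K_def by (simp_all add: algebra_simps zero unit) (simp add: mult.assoc[symmetric] unit)
  have CK: "C * K = 0" by (rule block_mult_zero[OF bl(3) Kb disj(3)])
  have Lb: "L \<in> block W (U \<union> W2)" unfolding LM using bl(3,5)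
    by (auto intro!: block_closed intro: block_mono)
  have Mb: "M \<in> block (U \<union> W2) W" unfolding LM using Kb bl(4)
    by (auto intro!: block_closed intro: block_mono)
  have MLg: "M * L = bid (U \<union> W2)"
  proof -
    have "M * L = p + b2" unfolding LM by (simp add: algebra_simps RC zero KC K2)
    then show ?thesis unfolding p b2_def bid_Un[OF finU(1) fin(3) disj(3)] .
  qed
  have LMid: "L * M = bid W"
  proof -
    have "L * M = bid W1 + b2" unfolding LM unfolding distrib_left distrib_right CK K2 zero
      unfolding Csum K_def by (simp add: algebra_simps CR)
    then show ?thesis unfolding b2_def bid_Un[OF fin(2,3) disj(4)] .
  qed
  have MC: "M * C = p" unfolding LM by (simp add: distrib_right RC KC)
  have pz: "M * p = 0" "p * L = 0"
    using block_mult_zero[OF Mb bl(6) disj'(4)] block_mult_zero[OF bl(6) Lb disj'(5)] by simp_all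
  define \<phi> where "\<phi> x = L * x * M + p * x * p" for x
  have lin\<phi>: "Vector_Spaces.linear sc sc \<phi>"
    unfolding \<phi>_def by (rule linear_scI) (simp_all add: algebra_simps fs.scale_right_distrib)
  let ?Q = "galg a T W t" and ?Q' = "galg a T W2 t"
  have Ab: "A + sc r t \<in> block U U" if "A \<in> block {..<a} {..<a}" for A r
    using that t by (auto intro!: block_closed block_sc intro: block_mono)
  have pxp: "p * (A + Z + D) * p = A" if "A \<in> block U U" "Z \<in> block U X" "D \<in> block X X" "X \<inter> U = {}" for A Z D X
  proof -
    have "Z * p = 0" "D * p = 0" using block_mult_zero[OF that(2) bl(6) that(4)] block_mult_zero[OF that(3) bl(6) that(4)] by simp_all
    moreover have "p * A = A" "A * p = A" unfolding p using bid_mult[OF that(1) finU(1)] mult_bid[OF that(1) finU(1)] by simp_all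
    ultimately show ?thesis by (simp add: distrib_left distrib_right mult.assoc)
  qed
  have \<phi>_comp: "\<phi> (A + Z + D) = L * (A + Z + D) * M + A"
    if "A \<in> block U U" "Z \<in> block U W2" "D \<in> block W2 W2" for A Z D
    unfolding \<phi>_def pxp[OF that disj'(2)] ..
  interpret v: galg_vertical a T W t
    by unfold_locales (use fin disj t in auto)
  show ?thesis
  proof (rule v.reduction[OF F C_def])
    show "v = 0" if v: "v \<in> block U W" and "C * v = 0" for v
    proof -
      have "(R * C) * v = 0" using that by (simp add: mult.assoc)
      then show "v = 0" unfolding RC p using bid_mult[OF v finU(1)] by simp
    qed
    show "fs.subspace ?Q'" by (rule subspace_galg)
    show "fs.fin_dim ?Q'" by (rule fin_dim_galg[OF t fin(1,3)])
    show "Vector_Spaces.linear sc sc \<phi>" by (rule lin\<phi>)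
    show "inj_on \<phi> ?Q'"
    proof (rule linear_sc_inj_onI[OF lin\<phi> subspace_galg])
      fix x assume x: "x \<in> ?Q'" and x0: "\<phi> x = 0"
      have xb: "x \<in> block (U \<union> W2) (U \<union> W2)" using galg_subset_block[OF t] x by blast
      have "M * (L * x * M + p * x * p) * L = (M * L) * x * (M * L) + (M * p) * x * (p * L)"
        by (simp add: algebra_simps)
      then have "(M * L) * x * (M * L) = 0" using x0 unfolding \<phi>_def pz by simp
      then show "x = 0" unfolding MLg using bid_mult[OF xb] mult_bid[OF xb] fin by simp
    qed
    show "\<phi> ` ?Q' = {A + sc r t + D | A r D. A \<in> block {..<a} {..<a} \<and> D \<in> block W W \<and> C * (A + sc r t) = D * C}"
    proof (intro equalityI subsetI)
      fix y assume "y \<in> \<phi> ` ?Q'"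
      then obtain A r Z D where y: "y = \<phi> (A + sc r t + Z + D)"
        and b: "A \<in> block {..<a} {..<a}" "Z \<in> block U W2" "D \<in> block W2 W2"
        by (auto elim!: galgE)
      let ?A = "A + sc r t" and ?x = "A + sc r t + Z + D"
      let ?D = "L * ?x * M"
      have y': "y = ?A + ?D" using \<phi>_comp[OF Ab[OF b(1)] b(2,3)] y by (simp add: add.commute)
      have xb: "?x \<in> block (U \<union> W2) (U \<union> W2)" using galg_subset_block[OF t] galgI[OF b] by blast
      have Db: "?D \<in> block W W" using block_mult[OF block_mult[OF Lb xb] Mb] .
      have z: "Z * p = 0" "D * p = 0" "?A * p = ?A" "b2 * ?A = 0"
        using block_mult_zero[OF b(2) bl(6) disj'(2)] block_mult_zero[OF b(3) bl(6) disj'(2)]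
          mult_bid[OF Ab[OF b(1)] finU(1)] block_mult_zero[OF bl(5) Ab[OF b(1)] disj'(2)] unfolding p by simp_all
      have "?D * C = L * (?x * p)" by (simp only: mult.assoc MC)
      also have "?x * p = ?A" by (simp only: distrib_right[of _ _ p] z) (simp only: distrib_right[symmetric] z add_0_right)
      also have "L * ?A = C * ?A" unfolding LM by (simp only: distrib_right z add_0_right)
      finally show "y \<in> {A + sc r t + D | A r D. A \<in> block {..<a} {..<a} \<and> D \<in> block W W \<and> C * (A + sc r t) = D * C}"
        using y' b(1) Db by (metis (mono_tags, lifting) mem_Collect_eq)
    next
      fix y assume "y \<in> {A + sc r t + D | A r D. A \<in> block {..<a} {..<a} \<and> D \<in> block W W \<and> C * (A + sc r t) = D * C}"
      then obtain A r D where e: "y = A + sc r t + D" "A \<in> block {..<a} {..<a}" "D \<in> block W W"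
        and CA: "C * (A + sc r t) = D * C"
        by blast
      let ?A = "A + sc r t" and ?Z = "R * D * b2" and ?E = "K * D * b2"
      have b: "?Z \<in> block U W2" "?E \<in> block W2 W2"
        using block_mult[OF block_mult[OF bl(4) e(3)] bl(5)] block_mult[OF block_mult[OF Kb e(3)] bl(5)] .
      have "R * D * C = ?A" "K * D * C = 0"
      proof -
        have "R * D * C = (R * C) * ?A" by (simp only: mult.assoc CA)
        then show "R * D * C = ?A" unfolding RC p using bid_mult[OF Ab[OF e(2)] finU(1)] by simp
        have "K * D * C = (K * C) * ?A" by (simp only: mult.assoc CA)
        then show "K * D * C = 0" unfolding KC by simp
      qed
      then have x: "M * D * L = ?A + ?Z + ?E" unfolding LM(1,2)
        by (simp only: distrib_left[of _ C b2] distrib_right[of R K] distrib_right[of "R * D"] add_0_left add_0_right add.assoc)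
      have "\<phi> (?A + ?Z + ?E) = L * (M * D * L) * M + ?A"
        unfolding \<phi>_comp[OF Ab[OF e(2)] b] x ..
      also have "L * (M * D * L) * M = (L * M) * D * (L * M)" by (simp only: mult.assoc)
      also have "\<dots> = D" unfolding LMid using bid_mult[OF e(3) finU(2)] mult_bid[OF e(3) finU(2)] by simp
      finally have "\<phi> (?A + ?Z + ?E) = y" unfolding e(1) by (simp add: add.commute)
      moreover have "?A + ?Z + ?E \<in> ?Q'" using galgI[OF e(2) b] .
      ultimately show "y \<in> \<phi> ` ?Q'" by (metis imageI)
    qed
    show "linfun f'" by (rule f')
    show "F (\<phi> x * \<phi> y - \<phi> y * \<phi> x) = f' (x * y - y * x)" if x: "x \<in> ?Q'" and y: "y \<in> ?Q'" for x y
    proof -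
      have dis: "{..<a} \<inter> T = {}" "{..<a} \<inter> W2 = {}" "T \<inter> W2 = {}" using disj by blast+
      have pat: "x \<in> tripat a T W2" "y \<in> tripat a T W2" using x y galg_subset_tripat[OF t] by blast+
      have inv: "bid (U \<union> W2) * z = bid (U \<union> W2) * z * bid (U \<union> W2)" "z * p = p * z * p"
        if "z \<in> tripat a T W2" for z
      proof -
        show "bid (U \<union> W2) * z = bid (U \<union> W2) * z * bid (U \<union> W2)"
          by (rule tripat_row_invariant[OF _ that]) (use that fin in \<open>auto simp: tripat_def\<close>)
        show "z * p = p * z * p" unfolding p
        proof (rule col_invariant[OF finU(1)])
          show "i \<in> U" if "ent z i j \<noteq> 0" "j \<in> U" for i j
            using that \<open>z \<in> _\<close> disj'(2) unfolding tripat_def by blast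
        qed
      qed
      have hom: "\<phi> z * \<phi> w = \<phi> (z * w)" if "z \<in> tripat a T W2" "w \<in> tripat a T W2" for z w
        unfolding \<phi>_def
        by (rule sandwich_mult[OF MLg pz unit(4) mult_bid[OF Lb] bid_mult[OF Mb]])
          (use inv[OF that(1)] inv[OF that(2)] fin in auto)
      have "\<phi> x * \<phi> y - \<phi> y * \<phi> x = \<phi> (x * y) - \<phi> (y * x)" using hom pat by simp
      moreover have "F (\<phi> z) = f' z" if "z \<in> tripat a T W2" for z
        using f'(2)[OF that] unfolding \<phi>_def .
      ultimately show ?thesis
        using tripat_mult[OF dis pat] tripat_mult[OF dis pat(2,1)]
        by (metis linfunD(4)[OF F] linfunD(4)[OF f'(1)])
    qed
  qed
qed

lemma index:
  assumes "index_is (galg a T W2 t) e"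
  shows "index_is (galg a T W t) e"
proof -
  have cU: "card U = card W1" unfolding card using card_Un_disjoint[OF _ fin(1) disj(1)] by simp
  obtain P P' :: "'a fmat" where P: "P \<in> block W1 U" "P' \<in> block U W1" "P * P' = bid W1" "P' * P = bid U"
    using permutation_blocks[OF finU(1) fin(2) cU] by metis
  let ?G = "\<lambda>F. \<exists>R\<in>block U W1. dualm F U W1 * R = bid W1 \<and> R * dualm F U W1 = bid U"
  show ?thesis
  proof (rule index_is_transfer[OF subspace_galg fin_dim_galg[OF t fin(1) finU(2)], where P = ?G])
    show "\<exists>g. linfun g \<and> finite {s. \<not> ?G (\<lambda>x. f x + s * g x)}" for f :: "'a fmat \<Rightarrow> 'a"
    proof (intro exI[of _ "\<lambda>x. tr (P * x)"] conjI linfun_tr_mult)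
      show "finite {s. \<not> ?G (\<lambda>x. f x + s * tr (P * x))}"
        using generic_inverse[OF finU(1) fin(2) dualm_block[OF finU(1) fin(2)] P]
        by (simp add: dualm_add dualm_tr[OF P(1) finU(1) fin(2)])
    qed
    show "\<exists>f'. linfun f' \<and> fs.dim (rad (galg a T W t) F) = fs.dim (rad (galg a T W2 t) f')"
      if F: "linfun F" and G: "?G F" for F
    proof -
      obtain R where R: "R \<in> block U W1" "dualm F U W1 * R = bid W1" "R * dualm F U W1 = bid U" using G by blast
      define L M p where "L = dualm F U W1 + dualm F U W2 + bid W2" and "M = R + (bid W2 - dualm F U W2 * R)"
        and "p = (bid U :: 'a fmat)"
      have lin: "linfun (\<lambda>x. F (L * x * M + p * x * p))"
        by (rule linfunI) (simp_all add: algebra_simps linfunD[OF F])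
      show ?thesis using reduction[OF F R L_def M_def p_def lin refl] lin by blast
    qed
    show "\<exists>f. linfun f \<and> fs.dim (rad (galg a T W t) f) = fs.dim (rad (galg a T W2 t) f')"
      if f': "linfun f'" for f'
    proof -
      define p L M where "p = (bid U :: 'a fmat)" and "L = P + bid W2" and "M = P' + bid W2"
      \<comment> \<open>Here \<open>M y L\<close> alone recovers \<open>x\<close> from
        \<open>y = L x M + p x p\<close>, since the second summand is killed by
        \<open>M p = 0\<close> and \<open>p L = 0\<close>.\<close>
      define F where "F y = f' (M * y * L) + tr (P * y)" for y
      have F: "linfun F" unfolding F_def
        by (rule linfunI) (simp_all add: algebra_simps linfunD[OF f'] linfunD[OF linfun_tr])
      have bl: "bid W2 \<in> block W2 W2" "L \<in> block W (U \<union> W2)" "M \<in> block (U \<union> W2) W" "p \<in> block U U"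
        unfolding L_def M_def p_def using P(1,2) fin block_bid[OF fin(3)]
        by (auto intro!: block_closed block_bid intro: block_mono)
      have FZ: "F Z = tr (P * Z)" if "Z \<in> block U W" for Z
        using block_mult_zero[OF bl(3) that disj'(4)] unfolding F_def by (simp add: linfunD[OF f'])
      have D1: "dualm F U W1 = P"
      proof -
        have "dualm F U W1 = dualm (\<lambda>x. tr (P * x)) U W1"
          by (rule dualm_cong, rule FZ, erule block_mono) auto
        then show ?thesis using dualm_tr[OF P(1) finU(1) fin(2)] by simp
      qed
      have D2: "dualm F U W2 = 0"
      proof -
        have "F Z = 0" if "Z \<in> block U W2" for Z
          using FZ[OF block_mono[OF that]] tr_block_disjoint[OF block_mult[OF P(1) that] disj(4)] by auto
        then show ?thesis using dualm_cong[of U W2 F "\<lambda>_. 0"] by (simp add: dualm_def)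
      qed
      have z: "bid W2 * P = 0" "P' * bid W2 = 0" "M * p = 0" "P * L = 0" "P * bid W2 = 0" "bid W2 * P' = 0"
        using block_mult_zero[OF bl(1) P(1) disj'(3)] block_mult_zero[OF P(2) bl(1) disj(4)]
          block_mult_zero[OF bl(3,4) disj'(4)] block_mult_zero[OF P(1) bl(2) disj'(5)]
          block_mult_zero[OF P(1) bl(1) disj(3)] block_mult_zero[OF bl(1) P(2) disj'(2)] by simp_all
      have MLg: "M * L = bid (U \<union> W2)"
        unfolding bid_Un[OF finU(1) fin(3) disj(3)] L_def M_def by (simp add: distrib_left distrib_right z P(4) fin)
      have red: "F (L * x * M + p * x * p) = f' x" if x: "x \<in> tripat a T W2" for x
      proof -
        let ?y = "L * x * M + p * x * p" and ?g = "bid (U \<union> W2) :: 'a fmat"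
        have "M * ?y * L = (M * L) * x * (M * L) + (M * p) * x * (p * L)" by (simp add: algebra_simps)
        moreover have xb: "x \<in> block (U \<union> W2) (U \<union> W2)" using x unfolding tripat_def block_def by blast
        ultimately have 1: "M * ?y * L = x"
          unfolding MLg z using bid_mult[OF xb] mult_bid[OF xb] fin by simp
        have 4: "tr (P * ?y) = 0"
        proof -
          have "P * ?y = (P * L) * x * M + P * (p * x * p)" by (simp add: algebra_simps)
          moreover have "P * (p * x * p) \<in> block W1 U"
            using block_mult[OF P(1) corner_block[OF finU(1) finU(1)]] unfolding p_def .
          ultimately show ?thesis using tr_block_disjoint[OF _ disj'(1)] z by simp
        qed
        then show ?thesis unfolding F_def 1 4 by simp
      qed
      show ?thesis
        by (intro exI[of _ F] conjI F reduction[OF F P(2) _ _ _ _ p_def f' red])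
          (simp_all add: D1 D2 P(3,4) L_def M_def)
    qed
    show "index_is (galg a T W2 t) e" by fact
  qed
qed

end

section \<open>Base case: the general linear algebra with a central line\<close>

text \<open>Independence is assumed for the indexed family rather than for its set of values, so
  injectivity of \<open>h\<close> has to be extracted; the difference of two unit coefficient
  vectors rules out a repetition.\<close>

lemma card_le_dim_of_family:
  fixes h :: "nat \<Rightarrow> 'a::field fmat"
  assumes fin: "finite I" and E: "fs.fin_dim E" "\<And>i. i \<in> I \<Longrightarrow> h i \<in> E"
    and ind: "\<And>c i. (\<Sum>i\<in>I. sc (c i) (h i)) = 0 \<Longrightarrow> i \<in> I \<Longrightarrow> c i = 0"
  shows "card I \<le> fs.dim E"
proof -
  have inj: "inj_on h I"
  proof (rule inj_onI, rule ccontr)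
    fix i j assume ij: "i \<in> I" "j \<in> I" "h i = h j" "i \<noteq> j"
    define c :: "nat \<Rightarrow> 'a" where "c k = (if k = i then 1 else 0) - (if k = j then 1 else 0)" for k
    have "(\<Sum>k\<in>I. sc (c k) (h k)) = (\<Sum>k\<in>I. if k = i then h k else 0) - (\<Sum>k\<in>I. if k = j then h k else 0)"
      unfolding sum_subtractf[symmetric] by (rule sum.cong) (auto simp: c_def fs.scale_left_diff_distrib)
    then have "(\<Sum>k\<in>I. sc (c k) (h k)) = 0" using ij fin by simp
    then have "c i = 0" using ind ij by blast
    then show False using ij(4) unfolding c_def by simp
  qed
  have "fs.independent (h ` I)"
  proof (rule fs.independent_if_scalars_zero)
    show "finite (h ` I)" using fin by simp
    fix g x assume s: "(\<Sum>x\<in>h ` I. sc (g x) x) = 0" "x \<in> h ` I"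
    then obtain i where i: "x = h i" "i \<in> I" by blast
    have "(\<Sum>i\<in>I. sc (g (h i)) (h i)) = 0" using s(1)[unfolded sum.reindex[OF inj] o_def] .
    then show "g x = 0" using ind[of "g \<circ> h" i] i by simp
  qed
  then have "card (h ` I) \<le> fs.dim E" using fs.fin_dim_independent(2)[OF E(1)] E(2) by blast
  then show ?thesis using card_image[OF inj] by simp
qed

text \<open>For a generic parameter the vector \<open>e\<^sub>0\<close> is cyclic for \<open>N + \<tau> G\<close>, because this holds at
  \<open>\<tau> = 0\<close> and the Krylov determinant is polynomial in \<open>\<tau>\<close>.\<close>

lemma finite_dependent_powers:
  fixes G N :: "'a::field fmat"
  assumes G: "G \<in> block {..<a} {..<a}" and N: "N = (\<Sum>i<a - 1. munit (Suc i) i)"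
  shows "finite {\<tau>. \<not> (\<forall>c. (\<Sum>i<a. sc (c i) (((*) (N + sc \<tau> G) ^^ i) (bid {..<a}))) = 0 \<longrightarrow> (\<forall>i<a. c i = 0))}"
proof (cases "a = 0")
  case False
  \<comment> \<open>\<open>k i j\<close> is the \<open>j\<close>-th coordinate of the
    \<open>i\<close>-th power of \<open>N + \<tau> G\<close> applied to the first basis vector, as a
    polynomial in \<tau>; the linear factor is the matrix entry of
    \<open>N + \<tau> G\<close>.\<close>
  define k :: "nat \<Rightarrow> nat \<Rightarrow> 'a poly" where
    "k = rec_nat (\<lambda>j. if j = 0 then 1 else 0) (\<lambda>i v j. \<Sum>l<a. [:ent N j l, ent G j l:] * v l)"
  have k0: "k 0 j = (if j = 0 then 1 else 0)" and kS: "k (Suc i) j = (\<Sum>l<a. [:ent N j l, ent G j l:] * k i l)" for i j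
    unfolding k_def by simp_all
  have Nb: "N \<in> block {..<a} {..<a}"
    unfolding N by (intro fs.subspace_sum[OF subspace_block]) auto
  have X: "((*) (N + sc \<tau> G) ^^ i) (bid {..<a}) \<in> block {..<a} {..<a}" for \<tau> i
  proof (induction i)
    case (Suc i)
    then show ?case using block_mult[of "N + sc \<tau> G" "{..<a}" "{..<a}"] Nb G by simp
  qed (simp add: block_bid)
  have ent_k: "ent (((*) (N + sc \<tau> G) ^^ i) (bid {..<a})) j 0 = poly (k i j) \<tau>" if "j < a" for \<tau> i j
    using that
  proof (induction i arbitrary: j)
    case 0
    then show ?case using False by (auto simp: ent_bid k0)
  next
    case (Suc i)
    have "ent (((*) (N + sc \<tau> G) ^^ Suc i) (bid {..<a})) j 0
      = (\<Sum>l<a. ent (N + sc \<tau> G) j l * ent (((*) (N + sc \<tau> G) ^^ i) (bid {..<a})) l 0)"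
      unfolding funpow.simps o_apply
    proof (rule ent_times)
      show "l \<in> {..<a}" if "ent (((*) (N + sc \<tau> G) ^^ i) (bid {..<a})) l 0 \<noteq> 0" for l
        using block_zero_entry[OF X] that by blast
    qed simp
    also have "\<dots> = poly (k (Suc i) j) \<tau>"
      unfolding kS poly_sum by (rule sum.cong) (simp_all add: Suc.IH, simp add: algebra_simps)
    finally show ?case .
  qed
  have entN: "ent N j l = (if j = Suc l \<and> j < a then 1 else 0)" for j l
  proof -
    have "ent N j l = (\<Sum>i<a - 1. if i = l then (if j = Suc i then 1 else 0) else 0)"
      unfolding N ent_sum by (rule sum.cong) auto
    then show ?thesis by auto
  qed
  \<comment> \<open>At parameter 0 the shift \<open>N\<close> takes the first basis vector to the
    \<open>i\<close>-th one, so the Krylov matrix is the identity and its determinant is not the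
    zero polynomial.\<close>
  have k_at_0: "poly (k i j) 0 = (if i = j then 1 else 0)" if "i < a" "j < a" for i j
    using that
  proof (induction i arbitrary: j)
    case (Suc i)
    have "poly (k (Suc i) j) 0 = (\<Sum>l<a. ent N j l * (if i = l then 1 else 0))"
      unfolding kS poly_sum by (rule sum.cong) (use Suc in auto)
    also have "\<dots> = ent N j i" using Suc.prems by (simp add: if_distrib cong: if_cong)
    finally show ?case using Suc.prems unfolding entN by simp
  qed (simp add: k0)
  define K where "K = mat a a (\<lambda>(j, i). k i j)"
  have K: "K \<in> carrier_mat a a" unfolding K_def by simp
  have evK: "poly (det K) \<tau> = det (mat a a (\<lambda>(j, i). poly (k i j) \<tau>))" for \<tau>
    by (rule poly_det_cong[of _ a]) (auto simp: K_def)
  have "mat a a (\<lambda>(j, i). poly (k i j) 0) = 1\<^sub>m a"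
    by (rule eq_matI) (auto simp: k_at_0)
  then have "poly (det K) 0 = 1" unfolding evK by simp
  then have "det K \<noteq> 0" by auto
  have "\<forall>i<a. c i = 0"
    if nz: "poly (det K) \<tau> \<noteq> 0" and s: "(\<Sum>i<a. sc (c i) (((*) (N + sc \<tau> G) ^^ i) (bid {..<a}))) = 0" for \<tau> c
  proof -
    let ?A = "mat a a (\<lambda>(j, i). poly (k i j) \<tau>)" and ?v = "vec a c"
    have "?A *\<^sub>v ?v = 0\<^sub>v a"
    proof (rule eq_vecI)
      fix j assume j: "j < dim_vec (0\<^sub>v a :: 'a vec)"
      have "(?A *\<^sub>v ?v) $ j = (\<Sum>i<a. poly (k i j) \<tau> * c i)"
        using j by (simp add: scalar_prod_def lessThan_atLeast0)
      also have "\<dots> = ent (\<Sum>i<a. sc (c i) (((*) (N + sc \<tau> G) ^^ i) (bid {..<a}))) j 0"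
        unfolding ent_sum by (rule sum.cong) (use j ent_k in auto)
      finally show "(?A *\<^sub>v ?v) $ j = 0\<^sub>v a $ j" unfolding s using j by simp
    qed simp
    moreover have "det ?A \<noteq> 0" using nz unfolding evK .
    ultimately have "?v = 0\<^sub>v a"
      using det_0_iff_vec_prod_zero_field[of ?A a] by (metis mat_carrier vec_carrier)
    then show ?thesis by (metis index_vec index_zero_vec(1))
  qed
  then have "{\<tau>. \<not> (\<forall>c. (\<Sum>i<a. sc (c i) (((*) (N + sc \<tau> G) ^^ i) (bid {..<a}))) = 0 \<longrightarrow> (\<forall>i<a. c i = 0))}
    \<subseteq> {\<tau>. poly (det K) \<tau> = 0}" by blast
  then show ?thesis using poly_roots_finite[OF \<open>det K \<noteq> 0\<close>] finite_subset by blast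
qed simp

locale galg_base =
  fixes a :: nat and T :: "nat set" and t :: "'a::field_char_0 fmat"
  assumes fin: "finite T" and disj: "{..<a} \<inter> T = {}" and t: "t \<in> block T T"
begin

abbreviation "U \<equiv> {..<a}"

lemma galg_base_eq: "galg a T {} t = {A + sc r t | A r. A \<in> block U U}"
proof (intro equalityI subsetI)
  have z: "X = 0" if "X \<in> block I {}" for X :: "'a fmat" and I
    using that by (intro fmat_eqI) (auto simp: block_def)
  fix x assume "x \<in> galg a T {} t"
  then obtain A r Z D where x: "x = A + sc r t + Z + D" "A \<in> block U U" "Z \<in> block (U \<union> T) {}" "D \<in> block {} {}"
    by (rule galgE)
  then have "x = A + sc r t" using z[OF x(3)] z[OF x(4)] by simp
  then show "x \<in> {A + sc r t | A r. A \<in> block U U}" using x(2) by blast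
next
  fix x assume "x \<in> {A + sc r t | A r. A \<in> block U U}"
  then obtain A r where x: "x = A + sc r t" "A \<in> block U U" by blast
  have "A + sc r t + 0 + 0 \<in> galg a T {} t" using x(2) by (intro galgI) auto
  then show "x \<in> galg a T {} t" using x(1) by simp
qed

lemma bracket_eq:
  assumes "A \<in> block U U" "B \<in> block U U"
  shows "(A + sc r t) * (B + sc s t) - (B + sc s t) * (A + sc r t) = A * B - B * A"
proof -
  have "A * t = 0" "B * t = 0" "t * A = 0" "t * B = 0"
    using block_mult_zero[OF assms(1) t disj] block_mult_zero[OF assms(2) t disj]
      block_mult_zero[OF t assms(1)] block_mult_zero[OF t assms(2)] disj by (simp_all add: Int_commute)
  then have "(A + sc r t) * (B + sc s t) = A * B + sc r (sc s (t * t))"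
    "(B + sc s t) * (A + sc r t) = B * A + sc r (sc s (t * t))"
    by (simp_all add: distrib_left distrib_right mult.commute)
  then show ?thesis by simp
qed

text \<open>\<open>t\<close> is central, and invariance of the trace form turns the kernel condition
  on \<open>A\<close> into commuting with the representing matrix.\<close>

lemma rad_iff:
  assumes f: "linfun f" and A: "A \<in> block U U"
  shows "A + sc r t \<in> rad (galg a T {} t) f \<longleftrightarrow> dualm f U U * A = A * dualm f U U"
proof -
  let ?F = "dualm f U U"
  have F: "?F \<in> block U U" by (rule dualm_block) auto
  have e: "f (A * B - B * A) = tr ((?F * A - A * ?F) * B)" if B: "B \<in> block U U" for B
  proof -
    have "f (A * B - B * A) = tr (?F * (A * B - B * A))"
      by (rule tr_dualm[OF f, symmetric]) (use block_mult[OF A B] block_mult[OF B A] in auto)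
    also have "\<dots> = tr (?F * A * B) - tr (A * ?F * B)"
      using tr_commute[of "?F * B" A] by (simp add: right_diff_distrib linfunD[OF linfun_tr] mult.assoc)
    finally show ?thesis by (simp add: left_diff_distrib linfunD[OF linfun_tr])
  qed
  have "A + sc r t \<in> rad (galg a T {} t) f \<longleftrightarrow> (\<forall>B\<in>block U U. tr ((?F * A - A * ?F) * B) = 0)"
  proof -
    have mem: "B + sc s t \<in> galg a T {} t" if "B \<in> block U U" for B s
      unfolding galg_base_eq using that by blast
    have "(\<forall>y\<in>galg a T {} t. f ((A + sc r t) * y - y * (A + sc r t)) = 0) \<longleftrightarrow>
      (\<forall>B\<in>block U U. f (A * B - B * A) = 0)"
    proof
      assume "\<forall>y\<in>galg a T {} t. f ((A + sc r t) * y - y * (A + sc r t)) = 0"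
      then show "\<forall>B\<in>block U U. f (A * B - B * A) = 0"
        using mem bracket_eq[OF A] by metis
    next
      assume 0: "\<forall>B\<in>block U U. f (A * B - B * A) = 0"
      show "\<forall>y\<in>galg a T {} t. f ((A + sc r t) * y - y * (A + sc r t)) = 0"
      proof
        fix y assume "y \<in> galg a T {} t"
        then obtain B s where y: "y = B + sc s t" "B \<in> block U U" unfolding galg_base_eq by blast
        show "f ((A + sc r t) * y - y * (A + sc r t)) = 0"
          unfolding y(1) bracket_eq[OF A y(2)] using 0 y(2) by blast
      qed
    qed
    moreover have "(\<forall>B\<in>block U U. f (A * B - B * A) = 0) \<longleftrightarrow> (\<forall>B\<in>block U U. tr ((?F * A - A * ?F) * B) = 0)"
      using e by (intro ball_cong) simp_all
    ultimately show ?thesis unfolding rad_def mem_Collect_eq using mem[OF A, of r] by blast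
  qed
  also have "\<dots> \<longleftrightarrow> ?F * A - A * ?F = 0"
    using tr_nondegenerate[of "?F * A - A * ?F" U U] block_mult[OF F A] block_mult[OF A F]
    by (auto simp: linfunD[OF linfun_tr])
  finally show ?thesis by simp
qed

text \<open>The minimum is attained at a diagonal matrix with distinct entries, whose centraliser is
  diagonal. For the lower bound any matrix is perturbed to one with a cyclic vector, whose powers
  give \<open>a\<close> independent commuting matrices; \<open>t\<close> adds one more if it is
  nonzero.\<close>

lemma index: "index_is (galg a T {} t) (a + (if t = 0 then 0 else 1))" (is "index_is ?Q ?e")
proof -
  define E where "E = (\<Sum>i<a. sc (of_nat i) (munit i i :: 'a fmat))"
  let ?g = "\<lambda>x. tr (E * x)"
  have D: "E \<in> block U U" unfolding E_def by (intro fs.subspace_sum[OF subspace_block]) auto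
  have entD: "ent E i j = (if i = j \<and> i < a then of_nat i else 0)" for i j
  proof -
    have "ent E i j = (\<Sum>l<a. if l = i then (if i = j then of_nat l else 0) else 0)"
      unfolding E_def ent_sum by (rule sum.cong) auto
    then show ?thesis by auto
  qed
  have fd: "fs.fin_dim ?Q" by (rule fin_dim_galg[OF t fin]) simp
  have upper: "fs.dim (rad ?Q ?g) \<le> ?e"
  proof -
    let ?B = "(\<lambda>i. munit i i) ` {..<a} \<union> (if t = 0 then {} else {t})"
    have "rad ?Q ?g \<subseteq> fs.span ?B"
    proof
      fix x assume x: "x \<in> rad ?Q ?g"
      then obtain A r where A: "x = A + sc r t" "A \<in> block U U" unfolding rad_def galg_base_eq by blast
      have DA: "E * A = A * E"
        using rad_iff[OF linfun_tr_mult[of E] A(2), of r] x A(1) dualm_tr[OF D] by simp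
      have off: "ent A i j = 0" if "i \<noteq> j" for i j
      proof (cases "i < a \<and> j < a")
        case True
        have "ent (E * A) i j = of_nat i * ent A i j"
          using True by (subst ent_times[of "{i}"]) (auto simp: entD split: if_splits)
        moreover have "ent (A * E) i j = of_nat j * ent A i j"
          using True by (subst ent_times[of "{j}"]) (auto simp: entD split: if_splits)
        ultimately have "(of_nat i - of_nat j) * ent A i j = (0::'a)" using DA by (metis left_diff_distrib right_minus_eq)
        then show ?thesis using that by simp
      qed (use block_zero_entry[OF A(2)] in auto)
      have "A = (\<Sum>i<a. sc (ent A i i) (munit i i))"
      proof (rule fmat_eqI)
        fix i j
        have "ent (\<Sum>i<a. sc (ent A i i) (munit i i)) i j = (\<Sum>l<a. if l = i then (if i = j then ent A l l else 0) else 0)"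
          unfolding ent_sum by (rule sum.cong) auto
        then show "ent A i j = ent (\<Sum>i<a. sc (ent A i i) (munit i i)) i j"
          using off block_zero_entry[OF A(2)] by auto
      qed
      moreover have "(\<Sum>i<a. sc (ent A i i) (munit i i)) \<in> fs.span ?B"
        by (intro fs.span_sum fs.span_scale fs.span_base) auto
      moreover have "sc r t \<in> fs.span ?B"
        by (cases "t = 0") (auto intro: fs.span_scale fs.span_base fs.span_zero)
      ultimately show "x \<in> fs.span ?B" unfolding A(1) using fs.span_add by metis
    qed
    then have "fs.dim (rad ?Q ?g) \<le> card ?B" by (rule fs.dim_le_card) auto
    also have "\<dots> \<le> card ((\<lambda>i. munit i i :: 'a fmat) ` {..<a}) + card (if t = 0 then {} else {t})" by (rule card_Un_le)
    also have "\<dots> \<le> ?e" using card_image_le[of "{..<a}" "\<lambda>i. munit i i :: 'a fmat"] by auto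
    finally show ?thesis .
  qed
  have lower: "?e \<le> fs.dim (rad ?Q f)" if f: "linfun f" for f
  proof -
    define N where "N = (\<Sum>i<a - 1. munit (Suc i) i :: 'a fmat)"
    define G where "G = dualm f U U"
    have N: "N \<in> block U U" unfolding N_def by (intro fs.subspace_sum[OF subspace_block]) auto
    have G: "G \<in> block U U" unfolding G_def by (rule dualm_block) auto
    define bad where "bad = {\<tau>. \<not> (\<forall>c. (\<Sum>i<a. sc (c i) (((*) (N + sc \<tau> G) ^^ i) (bid U))) = 0 \<longrightarrow> (\<forall>i<a. c i = 0))}"
    have "finite bad" unfolding bad_def by (rule finite_dependent_powers[OF G N_def])
    then have fin_bad: "finite (insert 0 (inverse ` bad) \<union> {s. \<not> fs.dim (rad ?Q (\<lambda>x. f x + s * tr (N * x))) \<le> fs.dim (rad ?Q f)})"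
      using rad_semicontinuous[OF f linfun_tr_mult[of N] subspace_galg fd] by simp
    obtain s where "s \<notin> insert 0 (inverse ` bad) \<union> {s. \<not> fs.dim (rad ?Q (\<lambda>x. f x + s * tr (N * x))) \<le> fs.dim (rad ?Q f)}"
      using ex_new_if_finite[OF infinite_UNIV_char_0 fin_bad] by blast
    then have s: "s \<noteq> 0" "s \<notin> inverse ` bad" "fs.dim (rad ?Q (\<lambda>x. f x + s * tr (N * x))) \<le> fs.dim (rad ?Q f)"
      by auto
    have "inverse s \<notin> bad" using s(2) image_eqI[of s inverse "inverse s"] by fastforce
    note s = s(1) this s(3)
    \<comment> \<open>The perturbed matrix is \<open>s\<close> times \<open>N + G / s\<close>, so
      the parameter of the pencil is the inverse of \<open>s\<close>; this is why 0 was excluded as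
      well.\<close>
    let ?f = "\<lambda>x. f x + s * tr (N * x)" and ?X = "N + sc (inverse s) G"
    let ?P = "\<lambda>i. ((*) ?X ^^ i) (bid U)"
    have dual: "dualm ?f U U = sc s ?X"
      unfolding dualm_add dualm_tr[OF N finite_lessThan finite_lessThan] G_def[symmetric]
      using s(1) by (simp add: fs.scale_right_distrib add.commute)
    have X: "?X \<in> block U U" using N G by blast
    have P: "?P i \<in> block U U" for i
      by (induction i) (use block_bid block_mult[OF X] in auto)
    have com: "?X * ?P i = ?P i * ?X" for i
    proof (induction i)
      case 0 then show ?case using bid_mult[OF X] mult_bid[OF X] by simp
    next
      case (Suc i)
      then show ?case unfolding funpow.simps o_apply by (metis mult.assoc)
    qed
    \<comment> \<open>The index \<open>a\<close> is reserved for \<open>t\<close>.\<close>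
    define h where "h i = (if i < a then ?P i else t)" for i
    define I where "I = (if t = 0 then {..<a} else {..a})"
    have "card I \<le> fs.dim (rad ?Q ?f)"
    proof (rule card_le_dim_of_family)
      show "finite I" unfolding I_def by simp
      show "fs.fin_dim (rad ?Q ?f)" by (rule fs.fin_dim_subset[OF fd]) (auto simp: rad_def)
      have lf: "linfun ?f" by (rule linfun_combine[OF f linfun_tr_mult])
      show "h i \<in> rad ?Q ?f" for i
        using rad_iff[OF lf P, of i 0] rad_iff[OF lf block_closed(1), of 1] com[of i]
        unfolding dual h_def by auto
      fix c i assume c: "(\<Sum>i\<in>I. sc (c i) (h i)) = 0" and i: "i \<in> I"
      define q where "q = (if t = 0 then 0 else c a)"
      have sum: "(\<Sum>i\<in>I. sc (c i) (h i)) = (\<Sum>i<a. sc (c i) (?P i)) + sc q t"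
      proof -
        have "(\<Sum>i<a. sc (c i) (h i)) = (\<Sum>i<a. sc (c i) (?P i))" by (rule sum.cong) (auto simp: h_def)
        then show ?thesis unfolding I_def q_def lessThan_Suc_atMost[symmetric] by (auto simp: h_def)
      qed
      have b: "(\<Sum>i<a. sc (c i) (?P i)) \<in> block U U"
        using P by (intro fs.subspace_sum[OF subspace_block]) auto
      have "bid T * (\<Sum>i<a. sc (c i) (?P i)) = 0" using block_mult_zero[OF block_bid[OF fin] b] disj by blast
      moreover have "bid T * sc q t = sc q t" using bid_mult[OF t fin] by simp
      moreover have "bid T * ((\<Sum>i<a. sc (c i) (?P i)) + sc q t) = 0" using c unfolding sum by simp
      ultimately have qt: "sc q t = 0" by (auto simp: distrib_left)
      then have "(\<Sum>i<a. sc (c i) (?P i)) = 0" using c unfolding sum qt by simp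
      then have "\<forall>i<a. c i = 0" using s(2) unfolding bad_def by blast
      moreover have "c a = 0" if "t \<noteq> 0" using qt that unfolding q_def by simp
      ultimately show "c i = 0" using i unfolding I_def by (cases "i < a") (auto split: if_splits simp: le_less)
    qed
    moreover have "card I = ?e" unfolding I_def by simp
    ultimately show ?thesis using s(3) by simp
  qed
  show ?thesis unfolding index_is_def
    using lower le_antisym[OF upper lower[OF linfun_tr_mult]] linfun_tr_mult[of E] by blast
qed

end

section \<open>The Euclidean algorithm\<close>

text \<open>One step replaces \<open>a\<close> by \<open>a - |W|\<close> when
  \<open>|W| \<le> a\<close>, the other \<open>|W|\<close> by \<open>|W| - (a + |T|)\<close> when
  \<open>|W| \<ge> a + |T|\<close>; both preserve the gcd of \<open>a + |T|\<close> and
  \<open>|W|\<close>. The sizes strictly in between are left to \<open>middle\<close>.\<close>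

lemma index_galg_general:
  fixes t :: "'a::field_char_0 fmat"
  assumes T: "finite T" "t \<in> block T T" "T \<noteq> {}"
    and base: "\<And>a. {..<a} \<inter> T = {} \<Longrightarrow> index_is (galg a T {} t) (a + card T - 1)"
    and middle: "\<And>a W. finite W \<Longrightarrow> {..<a} \<inter> T = {} \<Longrightarrow> ({..<a} \<union> T) \<inter> W = {} \<Longrightarrow>
      a < card W \<Longrightarrow> card W < a + card T \<Longrightarrow> index_is (galg a T W t) (gcd (a + card T) (card W) - 1)"
  shows "finite W \<Longrightarrow> {..<a} \<inter> T = {} \<Longrightarrow> ({..<a} \<union> T) \<inter> W = {} \<Longrightarrow>
    index_is (galg a T W t) (gcd (a + card T) (card W) - 1)"
proof (induction "a + card W" arbitrary: a W rule: less_induct)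
  case less
  let ?d = "card W" and ?m = "card T"
  have m: "?m > 0" using T by (simp add: card_gt_0_iff)
  consider "?d = 0" | "0 < ?d" "?d \<le> a" | "a < ?d" "?d < a + ?m" | "0 < ?d" "a + ?m \<le> ?d" by linarith
  then show ?case
  proof cases
    case 1
    then have "W = {}" using less.prems by simp
    then show ?thesis using base[OF less.prems(2)] by simp
  next
    case 2
    interpret galg_step1 a ?d T W t
      by unfold_locales (use less.prems T 2 in auto)
    have "index_is (galg (a - ?d) T W t) (gcd (a - ?d + ?m) ?d - 1)"
      using less.prems 2 U_split by (intro less.hyps) auto
    moreover have "gcd (a - ?d + ?m) ?d = gcd (a + ?m) ?d"
      using gcd_add2[of ?d "a - ?d + ?m"] 2 by (simp add: gcd.commute)
    ultimately show ?thesis using index by simp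
  next
    case 3
    then show ?thesis using middle less.prems by blast
  next
    case 4
    obtain W1 where W1: "W1 \<subseteq> W" "card W1 = a + ?m" using obtain_subset_with_card_n[OF 4(2)] by metis
    have split: "W = W1 \<union> (W - W1)" using W1 by blast
    have fin1: "finite W1" using W1 less.prems finite_subset by blast
    have c: "card (W - W1) = ?d - (a + ?m)" using card_Diff_subset[OF fin1 W1(1)] W1(2) by simp
    interpret galg_step2 a T W1 "W - W1" t
      by unfold_locales (use less.prems T W1 fin1 in auto)
    have "index_is (galg a T (W - W1) t) (gcd (a + ?m) (card (W - W1)) - 1)"
      using less.prems 4 c m by (intro less.hyps) auto
    moreover have "gcd (a + ?m) (card (W - W1)) = gcd (a + ?m) ?d"
      unfolding c using gcd_add2[of "a + ?m" "?d - (a + ?m)"] 4 by simp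
    ultimately show ?thesis using index split by metis
  qed
qed

text \<open>The orthogonal algebra of a line is zero, so \<open>t = 0\<close>. No integer lies
  strictly between \<open>a\<close> and \<open>a + 1\<close>, so the middle case is void.\<close>

lemma index_galg_singleton:
  assumes "finite W" "\<tau> \<notin> {..<a}" "({..<a} \<union> {\<tau>}) \<inter> W = {}"
  shows "index_is (galg a {\<tau>} W (0 :: 'a::field_char_0 fmat)) (gcd (a + 1) (card W) - 1)"
proof -
  have "index_is (galg a {\<tau>} W (0 :: 'a fmat)) (gcd (a + card {\<tau>}) (card W) - 1)"
  proof (rule index_galg_general)
    show "index_is (galg a {\<tau>} {} (0 :: 'a fmat)) (a + card {\<tau>} - 1)" if "{..<a} \<inter> {\<tau>} = {}" for a
    proof -
      interpret galg_base a "{\<tau>}" "0 :: 'a fmat" by unfold_locales (use that in auto)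
      show ?thesis using index by simp
    qed
  qed (use assms in auto)
  then show ?thesis by simp
qed

text \<open>With \<open>U\<close> empty and \<open>T\<close> consisting of the last row this is a
  \<open>galg\<close>, and the gcd is \<open>gcd 1 (a - 1) = 1\<close>. It is the Frobenius algebra
  in which the exceptional cases end.\<close>

lemma index_zero_last_column: "index_is (block {..<a} {..<a - 1} :: 'a::field_char_0 fmat set) 0"
proof (cases "a = 0")
  case True
  have "x = 0" if "x \<in> block {..<a} {..<a - 1}" for x :: "'a fmat"
    using that True by (intro fmat_eqI) (auto simp: block_def)
  then have r: "rad (block {..<a} {..<a - 1}) f = {0 :: 'a fmat}" if "linfun f" for f
    unfolding rad_def using linfunD[OF that] by auto
  have "fs.dim {0 :: 'a fmat} = 0" using fs.dim_le_card[of "{0}" "{}"] by simp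
  then show ?thesis unfolding index_is_def using r linfun_tr by auto
next
  case False
  have "galg 0 {a - 1} {..<a - 1} (0 :: 'a fmat) = block {..<a} {..<a - 1}" (is "?L = ?R")
  proof (intro equalityI subsetI)
    fix x assume "x \<in> ?L"
    then obtain A r Z D where x: "x = A + sc r 0 + Z + D" "A \<in> block {..<0} {..<0}"
      "Z \<in> block ({..<0} \<union> {a - 1}) {..<a - 1}" "D \<in> block {..<a - 1} {..<a - 1}" by (rule galgE)
    have "A = 0" using x(2) by (intro fmat_eqI) (auto simp: block_def)
    then show "x \<in> ?R" unfolding x(1) using x(3,4) False
      by (auto intro!: block_closed intro: block_mono)
  next
    fix x :: "'a fmat" assume x: "x \<in> ?R"
    have un: "{a - 1} \<union> {..<a - 1} = {..<a}" using False by auto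
    have s: "x = bid {a - 1} * x + bid {..<a - 1} * x"
      by (rule block_Un_left) (use x un in auto)
    have "0 + sc 0 0 + bid {a - 1} * x + bid {..<a - 1} * x \<in> ?L"
      using block_mult[OF block_bid x] by (intro galgI) auto
    then show "x \<in> ?L" using s by simp
  qed
  then show ?thesis
    using index_galg_singleton[of "{..<a - 1}" "a - 1" 0, where ?'a = 'a] by simp
qed

section \<open>The size left over by the Euclidean steps\<close>

text \<open>\<open>C\<close> maps \<open>a + 2\<close> coordinates to \<open>a + 1\<close>, so it
  has a kernel and \<open>C v = 0\<close> does not force \<open>v = 0\<close>. The trace conditions,
  in particular the one with \<open>t\<close>, have to exclude the remaining
  \<open>v\<close>.\<close>

locale galg_middle =
  fixes a \<tau>\<^sub>1 \<tau>\<^sub>2 :: nat and W :: "nat set" and t :: "'a::field_char_0 fmat"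
  assumes fin: "finite W" and disj: "{..<a} \<inter> {\<tau>\<^sub>1, \<tau>\<^sub>2} = {}" "({..<a} \<union> {\<tau>\<^sub>1, \<tau>\<^sub>2}) \<inter> W = {}" "\<tau>\<^sub>1 \<noteq> \<tau>\<^sub>2"
    and card: "card W = Suc a" and t: "t \<in> block {\<tau>\<^sub>1, \<tau>\<^sub>2} {\<tau>\<^sub>1, \<tau>\<^sub>2}" "ent t \<tau>\<^sub>2 \<tau>\<^sub>1 \<noteq> 0"
begin

abbreviation "T \<equiv> {\<tau>\<^sub>1, \<tau>\<^sub>2}"
abbreviation "U \<equiv> {..<a}"

text \<open>The form is chosen such that the kernel of \<open>C\<close> is spanned by \<open>e\<^bsub>\<tau>\<^sub>1\<^esub> - e\<^bsub>a-1\<^esub>\<close>, whose component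
  in \<open>T\<close> is not an eigenvector of \<open>t\<close>.\<close>

lemma index: "index_is (galg a T W t) 0"
proof -
  obtain w where w: "w \<in> W" using card by fastforce
  define W' where "W' = W - {w}"
  have cW': "finite W'" "card U = card W'" using fin card w unfolding W'_def by auto
  obtain P P' :: "'a fmat" where P: "P \<in> block W' U" "P' \<in> block U W'" "P * P' = bid W'" "P' * P = bid U"
    using permutation_blocks[OF _ cW'] by (metis finite_lessThan)
  \<comment> \<open>\<open>n\<close> sends the basis vector at \<open>\<tau>\<^sub>1\<close> to the
    last one of \<open>U\<close>, so that \<open>C\<close> takes the same value on both. For
    \<open>a = 0\<close> there is no such vector, and \<open>C\<close> vanishes at
    \<open>\<tau>\<^sub>1\<close>.\<close>
  define n where "n = (if a = 0 then 0 else munit (a - 1) \<tau>\<^sub>1 :: 'a fmat)"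
  define C where "C = P + P * n + munit w \<tau>\<^sub>2"
  define R where "R = P' + munit \<tau>\<^sub>2 w"
  have nb: "n \<in> block U {\<tau>\<^sub>1}" unfolding n_def by auto
  have dj: "W' \<inter> U = {}" "U \<inter> W' = {}" "W' \<inter> T = {}" "T \<inter> U = {}" "T \<inter> W' = {}" "{\<tau>\<^sub>1} \<inter> U = {}" "{\<tau>\<^sub>2} \<inter> U = {}"
    "U \<inter> {\<tau>\<^sub>2} = {}" "W \<inter> U = {}" "U \<inter> W = {}" "{\<tau>\<^sub>1} \<inter> W = {}" "W' \<inter> {w} = {}" "{w} \<inter> U = {}"
    "U \<inter> {w} = {}" "{\<tau>\<^sub>1} \<inter> {\<tau>\<^sub>2} = {}" "{\<tau>\<^sub>2} \<inter> {\<tau>\<^sub>1} = {}" "{\<tau>\<^sub>1} \<inter> {w} = {}" "{\<tau>\<^sub>2} \<inter> {w} = {}" "{\<tau>\<^sub>2} \<inter> W' = {}"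
    "U \<inter> T = {}" "{w} \<inter> W' = {}" "{w} \<inter> T = {}" "W \<inter> T = {}"
    using disj w unfolding W'_def by auto
  have wW: "W' \<subseteq> W" "W = W' \<union> {w}" using w unfolding W'_def by auto
  have mb: "munit w \<tau>\<^sub>2 \<in> block {w} {\<tau>\<^sub>2}" "munit \<tau>\<^sub>2 w \<in> block {\<tau>\<^sub>2} {w}" "munit \<tau>\<^sub>1 \<tau>\<^sub>1 \<in> block {\<tau>\<^sub>1} {\<tau>\<^sub>1}" by auto
  have Pn: "P * n \<in> block W' {\<tau>\<^sub>1}" by (rule block_mult[OF P(1) nb])
  have Cb: "C \<in> block W (U \<union> T)" unfolding C_def using P(1) Pn wW w
    by (auto intro!: block_closed intro: block_mono)
  have z: "n * P' = 0" "P * munit \<tau>\<^sub>2 w = 0" "n * munit \<tau>\<^sub>2 w = 0" "munit w \<tau>\<^sub>2 * P' = 0" "P' * munit w \<tau>\<^sub>2 = 0"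
    "n * n = 0" "munit w \<tau>\<^sub>2 * n = 0" "P * munit \<tau>\<^sub>1 \<tau>\<^sub>1 = 0"
    using block_mult_zero[OF nb P(2) dj(6)] block_mult_zero[OF P(1) mb(2) dj(8)]
      block_mult_zero[OF nb mb(2) dj(15)] block_mult_zero[OF mb(1) P(2) dj(7)] block_mult_zero[OF P(2) mb(1) dj(12)]
      block_mult_zero[OF nb nb dj(6)] block_mult_zero[OF mb(1) nb dj(7)] block_mult_zero[OF P(1) mb(3)] disj by auto
  have CR: "C * R = bid W"
  proof -
    have "C * R = P * P' + munit w w"
      unfolding C_def R_def by (simp add: distrib_left distrib_right z mult.assoc munit_mult)
    then show ?thesis unfolding P(3) wW(2) bid_Un[OF cW'(1) finite.insertI[OF finite.emptyI] dj(12)] by (simp add: bid_def)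
  qed
  obtain f' :: "'a fmat \<Rightarrow> 'a" where f': "linfun f'" "fs.dim (rad (block U {..<a - 1}) f') = 0"
    using index_zero_last_column[of a, where ?'a = 'a] unfolding index_is_def by blast
  \<comment> \<open>The trace term prescribes \<open>C\<close> as representing matrix;
    \<open>f'\<close>, which has trivial kernel on the expected stabiliser, enters through the block
    on \<open>U\<close>.\<close>
  define F where "F x = f' (bid U * x * bid U) + tr (C * x)" for x
  have F: "linfun F" unfolding F_def
    by (rule linfunI) (simp_all add: algebra_simps linfunD[OF f'(1)] linfunD[OF linfun_tr])
  interpret vert: galg_vertical a T W t
    by unfold_locales (use fin disj t in auto)
  have FC: "C = dualm F (U \<union> T) W"
  proof -
    have "F Z = tr (C * Z)" if Z: "Z \<in> block (U \<union> T) W" for Z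
      using block_mult_zero[OF Z block_bid dj(9)] unfolding F_def by (simp add: mult.assoc linfunD[OF f'(1)])
    then have "dualm F (U \<union> T) W = dualm (\<lambda>x. tr (C * x)) (U \<union> T) W" by (rule dualm_cong)
    then show ?thesis using dualm_tr[OF Cb _ fin] by simp
  qed
  let ?Q' = "block U {..<a - 1} :: 'a fmat set"
  define \<phi> where "\<phi> A = A + P * A * P'" for A
  have lin\<phi>: "Vector_Spaces.linear sc sc \<phi>"
    unfolding \<phi>_def by (rule linear_scI) (simp_all add: algebra_simps fs.scale_right_distrib)
  have Q'U: "A \<in> block U U" if "A \<in> ?Q'" for A using that by (rule block_mono) auto
  have An: "A * n = 0" if A: "A \<in> ?Q'" for A
    using block_mult_zero[OF A, of n "{a - 1}" "{\<tau>\<^sub>1}"] by (auto simp: n_def)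
  have "fs.dim (rad (galg a T W t) F) = fs.dim (rad ?Q' f')"
  proof (rule vert.reduction[OF F FC])
    show "fs.subspace ?Q'" by (rule subspace_block)
    show "fs.fin_dim ?Q'" by (rule fin_dim_block) auto
    show "Vector_Spaces.linear sc sc \<phi>" by (rule lin\<phi>)
    show "linfun f'" by (rule f')
    show "inj_on \<phi> ?Q'"
    proof (rule linear_sc_inj_onI[OF lin\<phi> subspace_block])
      fix A assume A: "A \<in> ?Q'" and 0: "\<phi> A = 0"
      have "bid U * P = 0" using block_mult_zero[OF block_bid P(1) dj(2)] by simp
      then have "bid U * \<phi> A = A" unfolding \<phi>_def using bid_mult[OF A]
        by (simp add: distrib_left) (simp add: mult.assoc[symmetric])
      then show "A = 0" using 0 by simp
    qed
    show "F (\<phi> A * \<phi> B - \<phi> B * \<phi> A) = f' (A * B - B * A)" if AB: "A \<in> ?Q'" "B \<in> ?Q'" for A B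
    proof -
      have m: "\<phi> A * \<phi> B = \<phi> (A * B)" if A: "A \<in> block U U" and B: "B \<in> block U U" for A B
      proof -
        have "A * P = 0" "P' * B = 0" using block_mult_zero[OF A P(1) dj(2)] block_mult_zero[OF P(2) B dj(1)] by simp_all
        moreover have "P * A * P' * (P * B * P') = P * (A * (P' * P) * B) * P'" by (simp only: mult.assoc)
        moreover have "A * (P' * P) * B = A * B" unfolding P(4) using mult_bid[OF A] by simp
        moreover have "A * (P * B * P') = (A * P) * B * P'" "P * A * P' * B = P * A * (P' * B)" by (simp_all only: mult.assoc)
        ultimately show ?thesis unfolding \<phi>_def by (simp add: distrib_left distrib_right)
      qed
      have F\<phi>: "F (\<phi> Z) = f' Z" if Z: "Z \<in> block U U" for Z
      proof -
        have "bid U * P = 0" "C * P = 0" using block_mult_zero[OF block_bid P(1) dj(2)] block_mult_zero[OF Cb P(1)] dj by auto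
        then have "bid U * (P * Z * P') = 0" "C * (P * Z * P') = 0" by (metis mult.assoc mult_zero_left)+
        moreover have "tr (C * Z) = 0" by (rule tr_block_disjoint[OF block_mult[OF Cb Z] dj(9)])
        ultimately show ?thesis unfolding F_def \<phi>_def
          using bid_mult[OF Z] mult_bid[OF Z] by (simp add: distrib_left distrib_right)
      qed
      have "\<phi> A * \<phi> B - \<phi> B * \<phi> A = \<phi> (A * B) - \<phi> (B * A)" using m[OF Q'U Q'U] AB by simp
      then show ?thesis
        using F\<phi>[OF block_mult[OF Q'U Q'U]] AB by (simp add: linfunD[OF F] linfunD[OF f'(1)])
    qed
    show "\<phi> ` ?Q' = {A + sc r t + D | A r D. A \<in> block U U \<and> D \<in> block W W \<and> C * (A + sc r t) = D * C}"
    proof (intro equalityI subsetI)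
      fix y assume "y \<in> \<phi> ` ?Q'"
      then obtain A where A: "A \<in> ?Q'" "y = \<phi> A" by blast
      let ?D = "P * A * P'"
      have D: "?D \<in> block W W" using block_mult[OF block_mult[OF P(1) A(1)] P(2)] wW by (auto intro: block_mono)
      have z2: "n * A = 0" "munit w \<tau>\<^sub>2 * A = 0"
        using block_mult_zero[OF nb A(1) dj(6)] block_mult_zero[OF mb(1) A(1) dj(7)] by simp_all
      have "C * A = P * A" unfolding C_def by (simp add: distrib_right z2 mult.assoc)
      moreover have "?D * C = P * A"
      proof -
        have "?D * C = P * (A * (P' * P)) + P * (A * (P' * P) * n) + P * A * (P' * munit w \<tau>\<^sub>2)"
          unfolding C_def by (simp add: distrib_left mult.assoc)
        moreover have "A * (P' * P) = A" unfolding P(4) using mult_bid[OF Q'U[OF A(1)]] by simp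
        ultimately show ?thesis using An[OF A(1)] z(5) by simp
      qed
      ultimately have "C * (A + sc 0 t) = ?D * C" by simp
      moreover have "y = A + sc 0 t + ?D" using A(2) unfolding \<phi>_def by simp
      ultimately show "y \<in> {A + sc r t + D | A r D. A \<in> block U U \<and> D \<in> block W W \<and> C * (A + sc r t) = D * C}"
        using Q'U[OF A(1)] D by blast
    next
      fix y assume "y \<in> {A + sc r t + D | A r D. A \<in> block U U \<and> D \<in> block W W \<and> C * (A + sc r t) = D * C}"
      then obtain A r D where y: "y = A + sc r t + D" and A: "A \<in> block U U" and D: "D \<in> block W W"
        and CA: "C * (A + sc r t) = D * C" by blast
      have "C * (munit \<tau>\<^sub>1 \<tau>\<^sub>1 - n) = 0"
      proof -
        have "n * munit \<tau>\<^sub>1 \<tau>\<^sub>1 = n" unfolding n_def by (simp add: munit_mult)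
        then show ?thesis using disj(3) unfolding C_def by (simp add: distrib_right right_diff_distrib z munit_mult mult.assoc)
      qed
      then have 0: "C * (A + sc r t) * (munit \<tau>\<^sub>1 \<tau>\<^sub>1 - n) = 0" unfolding CA by (simp add: mult.assoc)
      have tn: "t * n = 0" "A * munit \<tau>\<^sub>1 \<tau>\<^sub>1 = 0"
        using block_mult_zero[OF t(1) nb dj(4)] block_mult_zero[OF A mb(3)] disj by auto
      have key: "C * (sc r (t * munit \<tau>\<^sub>1 \<tau>\<^sub>1) - A * n) = 0"
        using 0 by (simp add: distrib_left distrib_right right_diff_distrib mult.assoc tn)
      \<comment> \<open>Row \<open>w\<close> of \<open>C\<close> reads off the coordinate
        \<open>\<tau>\<^sub>2\<close>. Applied to the kernel vector of \<open>C\<close>, the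
        relation \<open>C (A + r t) = D C\<close> leaves there \<open>r\<close> times the nonzero
        entry of \<open>t\<close>.\<close>
      have "r = 0"
      proof -
        have "ent (munit \<tau>\<^sub>2 w * (C * (sc r (t * munit \<tau>\<^sub>1 \<tau>\<^sub>1) - A * n))) \<tau>\<^sub>2 \<tau>\<^sub>1 = 0" unfolding key by simp
        moreover have "munit \<tau>\<^sub>2 w * C = munit \<tau>\<^sub>2 \<tau>\<^sub>2"
          using block_mult_zero[OF mb(2) P(1) dj(21)] block_mult_zero[OF mb(2) Pn dj(21)]
          unfolding C_def by (simp add: distrib_left munit_mult)
        moreover have "munit \<tau>\<^sub>2 \<tau>\<^sub>2 * (A * n) = 0"
          using block_mult_zero[of "munit \<tau>\<^sub>2 \<tau>\<^sub>2" "{\<tau>\<^sub>2}" "{\<tau>\<^sub>2}", OF _ block_mult[OF A nb] dj(7)] by simp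
        ultimately have "ent (munit \<tau>\<^sub>2 \<tau>\<^sub>2 * sc r (t * munit \<tau>\<^sub>1 \<tau>\<^sub>1)) \<tau>\<^sub>2 \<tau>\<^sub>1 = 0"
          by (simp add: mult.assoc[symmetric] right_diff_distrib)
        then show "r = 0" using t(2) by (simp add: ent_munit_mult ent_mult_munit)
      qed
      have CA': "C * X = P * X" if X: "X \<in> block U I" for X I
        using block_mult_zero[OF nb X dj(6)] block_mult_zero[OF mb(1) X dj(7)]
        unfolding C_def by (simp add: distrib_right mult.assoc)
      have "P * (A * n) = 0" using key CA'[OF block_mult[OF A nb]] \<open>r = 0\<close> by (simp add: right_diff_distrib)
      then have "P' * P * (A * n) = 0" by (simp add: mult.assoc)
      then have An0: "A * n = 0" unfolding P(4) using bid_mult[OF block_mult[OF A nb]] by simp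
      \<comment> \<open>\<open>A * n = 0\<close> says that the last column of \<open>A\<close>
        vanishes.\<close>
      have AQ: "A \<in> ?Q'"
      proof (rule blockI)
        fix i j assume nz: "ent A i j \<noteq> 0"
        then have ij: "i < a" "j < a" using A unfolding block_def by auto
        have "ent (A * n) i \<tau>\<^sub>1 = ent A i (a - 1)" using ij unfolding n_def by (simp add: ent_mult_munit)
        then have "j \<noteq> a - 1" using An0 nz by auto
        then show "i \<in> U \<and> j \<in> {..<a - 1}" using ij by auto
      qed
      have "D = D * (C * R)" unfolding CR using mult_bid[OF D fin] by simp
      also have "\<dots> = P * A * R" using CA CA'[OF A] \<open>r = 0\<close> by (simp add: mult.assoc[symmetric])
      also have "\<dots> = P * A * P'" using block_mult_zero[OF A mb(2) dj(8)] unfolding R_def by (simp add: distrib_left mult.assoc)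
      finally have "y = \<phi> A" unfolding y \<phi>_def \<open>r = 0\<close> by simp
      then show "y \<in> \<phi> ` ?Q'" using AQ by blast
    qed
    show "v = 0" if v: "v \<in> block (U \<union> T) W" and Cv: "C * v = 0"
      and tr0: "\<And>A r. A \<in> block U U \<Longrightarrow> tr (C * (A + sc r t) * v) = 0" for v
    proof -
      have mbw: "munit \<tau>\<^sub>2 w * C = munit \<tau>\<^sub>2 \<tau>\<^sub>2" "P' * C = bid U + n"
        using block_mult_zero[OF mb(2) P(1) dj(21)] block_mult_zero[OF mb(2) Pn dj(21)]
        unfolding C_def by (simp_all add: distrib_left munit_mult z)
          (simp add: mult.assoc[symmetric] P(4) bid_mult[OF nb])
      \<comment> \<open>\<open>C v = 0\<close> makes the columns of \<open>v\<close> multiples of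
        the kernel vector, so \<open>v\<close> is determined by its row at
        \<open>\<tau>\<^sub>1\<close>.\<close>
      define x where "x = munit \<tau>\<^sub>1 \<tau>\<^sub>1 * v"
      have xb: "x \<in> block {\<tau>\<^sub>1} W" unfolding x_def by (rule block_mult[OF mb(3) v])
      have "munit \<tau>\<^sub>2 \<tau>\<^sub>2 * v = 0" "bid U * v + n * v = 0"
        using Cv mbw by (metis mult.assoc mult_zero_right, metis distrib_right mult.assoc mult_zero_right)
      moreover have "n * v = n * x" unfolding x_def n_def by (simp add: mult.assoc[symmetric] munit_mult)
      moreover have "v = bid U * v + (munit \<tau>\<^sub>1 \<tau>\<^sub>1 * v + munit \<tau>\<^sub>2 \<tau>\<^sub>2 * v)"
      proof -
        have "bid (U \<union> T) = bid U + (munit \<tau>\<^sub>1 \<tau>\<^sub>1 + munit \<tau>\<^sub>2 \<tau>\<^sub>2 :: 'a fmat)"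
          using bid_Un[OF _ _ dj(20)] disj(3) by (simp add: bid_def)
        then have "bid (U \<union> T) * v = bid U * v + (munit \<tau>\<^sub>1 \<tau>\<^sub>1 * v + munit \<tau>\<^sub>2 \<tau>\<^sub>2 * v)"
          by (simp only: distrib_right)
        then show ?thesis using bid_mult[OF v, of "U \<union> T"] by simp
      qed
      ultimately have vx: "v = x - n * x" unfolding x_def by (simp add: add_eq_0_iff2)
      have vC: "ent (v * C) \<tau>\<^sub>1 j = ent (x * C) \<tau>\<^sub>1 j" "ent (v * C) \<tau>\<^sub>2 j = 0"
        "a > 0 \<Longrightarrow> ent (v * C) (a - 1) j = - ent (x * C) \<tau>\<^sub>1 j" for j
      proof -
        have xC: "x * C \<in> block {\<tau>\<^sub>1} (U \<union> T)" by (rule block_mult[OF xb Cb])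
        have nxC: "n * x * C \<in> block U (U \<union> T)" using block_mult[OF nb xC] by (simp add: mult.assoc)
        have e: "v * C = x * C - n * x * C" unfolding vx by (simp add: left_diff_distrib)
        show "ent (v * C) \<tau>\<^sub>1 j = ent (x * C) \<tau>\<^sub>1 j" "ent (v * C) \<tau>\<^sub>2 j = 0"
          unfolding e using block_zero_entry[OF nxC] block_zero_entry[OF xC] disj by auto
        show "ent (v * C) (a - 1) j = - ent (x * C) \<tau>\<^sub>1 j" if "a > 0"
        proof -
          have "a - 1 \<noteq> \<tau>\<^sub>1" using that disj(1) by auto
          then have "ent (x * C) (a - 1) j = 0" using block_zero_entry[OF xC, of "a - 1"] by simp
          then show ?thesis using that unfolding e n_def by (simp add: mult.assoc ent_munit_mult)
        qed
      qed
      have trv: "tr (v * C * (A + sc r t)) = 0" if "A \<in> block U U" for A r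
        using tr0[OF that, of r] tr_commute[of "C * (A + sc r t)" v] by (simp add: mult.assoc)
      have xCU: "ent (x * C) \<tau>\<^sub>1 k = 0" if k: "k < a" for k
      proof -
        have "tr (v * C * munit k (a - 1)) = 0" using trv[of "munit k (a - 1)" 0] k by simp
        then show ?thesis using vC(3)[of k] k by (simp add: tr_mult_munit)
      qed
      have C\<tau>: "C * munit \<tau>\<^sub>1 \<tau>\<^sub>1 = C * n"
      proof -
        have "n * munit \<tau>\<^sub>1 \<tau>\<^sub>1 = n" unfolding n_def by (simp add: munit_mult)
        then show ?thesis using disj(3) unfolding C_def by (simp add: distrib_right z munit_mult mult.assoc)
      qed
      have xC1: "ent (x * C) \<tau>\<^sub>1 \<tau>\<^sub>1 = 0"
      proof -
        have "ent (x * C) \<tau>\<^sub>1 \<tau>\<^sub>1 = ent (x * (C * munit \<tau>\<^sub>1 \<tau>\<^sub>1)) \<tau>\<^sub>1 \<tau>\<^sub>1"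
          by (simp add: mult.assoc[symmetric] ent_mult_munit)
        also have "\<dots> = (if a = 0 then 0 else ent (x * C) \<tau>\<^sub>1 (a - 1))"
          unfolding C\<tau> n_def by (simp add: mult.assoc[symmetric] ent_mult_munit)
        finally show ?thesis using xCU by auto
      qed
      \<comment> \<open>The coordinate at \<open>\<tau>\<^sub>2\<close> is out of reach for tests
        with gl(U); only the test with \<open>t\<close> detects it.\<close>
      have xC2: "ent (x * C) \<tau>\<^sub>1 \<tau>\<^sub>2 = 0"
      proof -
        have "0 = tr (v * C * t)" using trv[of 0 1] by simp
        also have "\<dots> = (\<Sum>i\<in>T. ent (v * C * t) i i)"
          by (rule tr_eq) (use block_mult[OF block_mult[OF v Cb] t(1)] in \<open>auto simp: block_def\<close>)
        also have "\<dots> = (\<Sum>i\<in>T. \<Sum>k\<in>T. ent (v * C) i k * ent t k i)"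
          by (intro sum.cong refl ent_times) (use t(1) in \<open>auto simp: block_def\<close>)
        also have "\<dots> = ent (x * C) \<tau>\<^sub>1 \<tau>\<^sub>2 * ent t \<tau>\<^sub>2 \<tau>\<^sub>1"
          using disj(3) by (simp add: vC(1,2) xC1)
        finally show ?thesis using t(2) by simp
      qed
      have "x * C = 0"
      proof (rule fmat_eqI)
        fix i j
        show "ent (x * C) i j = ent 0 i j"
          using block_zero_entry[OF block_mult[OF xb Cb], of i j] xCU[of j] xC1 xC2
          by (cases "i = \<tau>\<^sub>1"; cases "j \<in> U \<union> T") auto
      qed
      then have "x * (C * R) = 0" by (simp add: mult.assoc[symmetric])
      then have "x = 0" unfolding CR using mult_bid[OF xb fin] by simp
      then show "v = 0" unfolding vx by simp
    qed
  qed
  then show ?thesis unfolding index_is_def using F f'(2) by auto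
qed

end

text \<open>Strictly between \<open>a\<close> and \<open>a + 2\<close> lies only
  \<open>a + 1\<close>, which is coprime to \<open>a + 2\<close>, so the gcd formula gives 0 in the
  middle case as well.\<close>

lemma index_galg_pair:
  fixes t :: "'a::field_char_0 fmat"
  assumes "finite W" "{..<a} \<inter> {\<tau>\<^sub>1, \<tau>\<^sub>2} = {}" "({..<a} \<union> {\<tau>\<^sub>1, \<tau>\<^sub>2}) \<inter> W = {}"
    and \<tau>: "\<tau>\<^sub>1 \<noteq> \<tau>\<^sub>2" and tT: "t \<in> block {\<tau>\<^sub>1, \<tau>\<^sub>2} {\<tau>\<^sub>1, \<tau>\<^sub>2}" "ent t \<tau>\<^sub>2 \<tau>\<^sub>1 \<noteq> 0"
  shows "index_is (galg a {\<tau>\<^sub>1, \<tau>\<^sub>2} W t) (gcd (a + 2) (card W) - 1)"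
proof -
  have c: "card {\<tau>\<^sub>1, \<tau>\<^sub>2} = 2" using \<tau> by simp
  have "index_is (galg a {\<tau>\<^sub>1, \<tau>\<^sub>2} W t) (gcd (a + card {\<tau>\<^sub>1, \<tau>\<^sub>2}) (card W) - 1)"
  proof (rule index_galg_general)
    show "index_is (galg a {\<tau>\<^sub>1, \<tau>\<^sub>2} {} t) (a + card {\<tau>\<^sub>1, \<tau>\<^sub>2} - 1)" if "{..<a} \<inter> {\<tau>\<^sub>1, \<tau>\<^sub>2} = {}" for a
    proof -
      interpret galg_base a "{\<tau>\<^sub>1, \<tau>\<^sub>2}" t
        by unfold_locales (use that tT(1) in simp_all)
      have "t \<noteq> 0" using tT(2) by auto
      then show ?thesis using index unfolding c by simp
    qed
    show "index_is (galg a {\<tau>\<^sub>1, \<tau>\<^sub>2} W t) (gcd (a + card {\<tau>\<^sub>1, \<tau>\<^sub>2}) (card W) - 1)"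
      if h: "finite W" "{..<a} \<inter> {\<tau>\<^sub>1, \<tau>\<^sub>2} = {}" "({..<a} \<union> {\<tau>\<^sub>1, \<tau>\<^sub>2}) \<inter> W = {}"
        "a < card W" "card W < a + card {\<tau>\<^sub>1, \<tau>\<^sub>2}" for a W
    proof -
      have cW: "card W = Suc a" using h(4,5) c by simp
      interpret galg_middle a \<tau>\<^sub>1 \<tau>\<^sub>2 W t
        by unfold_locales (fact h \<tau> tT cW)+
      have "gcd (a + 2) (Suc a) = 1"
        using coprime_Suc_left_nat[of "Suc a"] by (simp add: coprime_iff_gcd_eq_1)
      then show ?thesis using index cW unfolding c by simp
    qed
  qed (use assms(1-3) tT(1) in auto)
  then show ?thesis unfolding c .
qed

section \<open>Symplectic seaweeds\<close>

text \<open>The signs of the symplectic form that pairs each index with its mirror image.\<close>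

definition sgn_sp :: "nat \<Rightarrow> nat \<Rightarrow> 'a::field" where
  "sgn_sp n i = (if i < n then 1 else - 1)"

lemma sgn_sp_sq [simp]: "sgn_sp n i * sgn_sp n i = 1" "sgn_sp n i * (sgn_sp n i * x) = x"
  unfolding sgn_sp_def by auto

lemma sgn_sp_neq_0 [simp]: "sgn_sp n i \<noteq> 0" unfolding sgn_sp_def by simp

lemma sgn_sp_mirror: "i < 2 * n \<Longrightarrow> sgn_sp n (2 * n - Suc i) = - sgn_sp n i"
  unfolding sgn_sp_def by auto

text \<open>The adjoint with respect to the symplectic form.\<close>

definition spt :: "nat \<Rightarrow> 'a::field fmat \<Rightarrow> 'a fmat" where
  "spt n X = Abs_fmat (\<lambda>i j. if i < 2 * n \<and> j < 2 * n
     then sgn_sp n i * sgn_sp n j * ent X (2 * n - 1 - j) (2 * n - 1 - i) else 0)"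

lemma ent_spt: "ent (spt n X) i j = (if i < 2 * n \<and> j < 2 * n
     then sgn_sp n i * sgn_sp n j * ent X (2 * n - 1 - j) (2 * n - 1 - i) else 0)"
  unfolding spt_def by (subst ent_Abs_fmat[of "2 * n"]) auto

lemma spt_linear: "spt n (X + Y) = spt n X + spt n Y" "spt n (sc c X) = sc c (spt n X)" "spt n 0 = 0"
  "spt n (X - Y) = spt n X - spt n Y" "spt n (- X) = - spt n X"
  by (rule fmat_eqI; auto simp: ent_spt algebra_simps)+

text \<open>The adjoint reverses products. The columns of \<open>X\<close> are bounded because
  \<open>spt\<close> cuts off the indices from \<open>2 * n\<close> on, and the inner sum of the
  product must not lose terms.\<close>

lemma spt_mult:
  assumes "X \<in> block I {..<2 * n}" 
  shows "spt n (X * Y) = spt n Y * spt n X"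
proof (rule fmat_eqI)
  fix i j
  show "ent (spt n (X * Y)) i j = ent (spt n Y * spt n X) i j"
  proof (cases "i < 2 * n \<and> j < 2 * n")
    case True
    have "ent (spt n Y * spt n X) i j = (\<Sum>l<2 * n. ent (spt n Y) i l * ent (spt n X) l j)"
      by (rule ent_times) (auto simp: ent_spt split: if_splits)
    also have "\<dots> = (\<Sum>l<2 * n. sgn_sp n i * sgn_sp n j * (ent X (2 * n - 1 - j) (2 * n - 1 - l) * ent Y (2 * n - 1 - l) (2 * n - 1 - i)))"
      using True by (intro sum.cong) (auto simp: ent_spt algebra_simps)
    also have "\<dots> = (\<Sum>l<2 * n. sgn_sp n i * sgn_sp n j * (ent X (2 * n - 1 - j) l * ent Y l (2 * n - 1 - i)))"
      using sum.nat_diff_reindex[of "\<lambda>l. sgn_sp n i * sgn_sp n j * (ent X (2 * n - 1 - j) l * ent Y l (2 * n - 1 - i))" "2 * n"]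
      by (simp add: algebra_simps)
    also have "\<dots> = sgn_sp n i * sgn_sp n j * ent (X * Y) (2 * n - 1 - j) (2 * n - 1 - i)"
      unfolding sum_distrib_left[symmetric]
      by (subst ent_times[of "{..<2 * n}"]) (use assms in \<open>auto simp: block_def\<close>)
    finally show ?thesis using True by (simp add: ent_spt)
  next
    case False
    have "spt n Y * spt n X \<in> block {..<2 * n} {..<2 * n}"
      by (rule block_mult[of _ _ "{..<2 * n}"]) (auto simp: block_def ent_spt split: if_splits)
    then show ?thesis using False by (auto simp: ent_spt block_def)
  qed
qed

lemma spt_spt: "X \<in> block {..<2 * n} {..<2 * n} \<Longrightarrow> spt n (spt n X) = X"
  by (rule fmat_eqI) (auto simp: ent_spt block_def sgn_sp_mirror mult.left_commute)

lemma spt_munit: "i < 2 * n \<Longrightarrow> j < 2 * n \<Longrightarrow>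
  spt n (munit i j) = sc (sgn_sp n i * sgn_sp n j) (munit (2 * n - 1 - j) (2 * n - 1 - i))"
proof (rule fmat_eqI)
  fix x y assume ij: "i < 2 * n" "j < 2 * n"
  show "ent (spt n (munit i j)) x y = ent (sc (sgn_sp n i * sgn_sp n j) (munit (2 * n - 1 - j) (2 * n - 1 - i)) :: 'a fmat) x y"
  proof (cases "x < 2 * n \<and> y < 2 * n \<and> i = 2 * n - Suc y \<and> j = 2 * n - Suc x")
    case True
    then have "sgn_sp n i = (- sgn_sp n y :: 'a)" "sgn_sp n j = (- sgn_sp n x :: 'a)"
      "2 * n - Suc i = y" "2 * n - Suc j = x"
      using sgn_sp_mirror[of y n] sgn_sp_mirror[of x n] by auto
    then show ?thesis using True by (simp add: ent_spt)
  next
    case False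
    have "\<not> (x < 2 * n \<and> y < 2 * n \<and> 2 * n - 1 - y = i \<and> 2 * n - 1 - x = j)"
      using False by auto
    moreover have "\<not> (x = 2 * n - 1 - j \<and> y = 2 * n - 1 - i)"
    proof
      assume "x = 2 * n - 1 - j \<and> y = 2 * n - 1 - i"
      then have "x < 2 * n" "y < 2 * n" "i = 2 * n - Suc y" "j = 2 * n - Suc x" using ij by arith+
      then show False using False by blast
    qed
    ultimately have *: "\<not> (x < 2 * n \<and> y < 2 * n \<and> 2 * n - 1 - y = i \<and> 2 * n - 1 - x = j)"
      "\<not> (x = 2 * n - 1 - j \<and> y = 2 * n - 1 - i)" .
    then show ?thesis unfolding ent_spt ent_sc ent_munit by auto
  qed
qed

definition spf :: "nat \<Rightarrow> 'a::field fmat set" where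
  "spf n = {X \<in> block {..<2 * n} {..<2 * n}. spt n X = - X}"

text \<open>An entry in row \<open>i\<close> and column \<open>j\<close> with this property moves a
  vector out of the span of the first \<open>r\<close> coordinates, where indices are counted from
  0.\<close>

definition crosses :: "nat set \<Rightarrow> nat \<Rightarrow> nat \<Rightarrow> bool" where
  "crosses R i j \<longleftrightarrow> (\<exists>r\<in>R. j < r \<and> r \<le> i)"

text \<open>The seaweed consists of the elements of \<open>\<ss>\<pp>(2n)\<close> preserving the flags with breaks
  \<open>a, n, 2n - a\<close> (from above) and \<open>c, 2n - c\<close> (from below).\<close>

definition swf :: "nat \<Rightarrow> nat \<Rightarrow> nat \<Rightarrow> 'a::field fmat set" where
  "swf n a c = {X \<in> spf n. \<forall>i j. ent X i j \<noteq> 0 \<longrightarrow>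
     \<not> crosses {a, n, 2 * n - a} i j \<and> \<not> crosses {c, 2 * n - c} j i}"

text \<open>The seaweed of gl(n) formed by the upper left blocks, with the break \<open>a\<close>
  acting below and the break \<open>c\<close> above the diagonal.\<close>

definition gtop :: "nat \<Rightarrow> nat \<Rightarrow> nat \<Rightarrow> 'a::field fmat set" where
  "gtop n a c = {A \<in> block {..<n} {..<n}. \<forall>i j. ent A i j \<noteq> 0 \<longrightarrow> \<not> (j < a \<and> a \<le> i) \<and> \<not> (i < c \<and> c \<le> j)}"

definition vsym :: "nat \<Rightarrow> nat \<Rightarrow> 'a::field fmat set" where
  "vsym n c = {S \<in> block {c..<n} {n..<2 * n - c}. spt n S = - S}"

text \<open>On the upper left block this is the embedding of gl(n) into sp(2n), on the upper right
  block a symmetrisation; \<open>dbl n (A * S)\<close> thus describes the action of \<open>A\<close>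
  on the symmetric corner.\<close>

definition dbl :: "nat \<Rightarrow> 'a::field fmat \<Rightarrow> 'a fmat" where
  "dbl n A = A - spt n A"

lemma linear_dbl: "Vector_Spaces.linear sc sc (dbl n)"
  unfolding dbl_def by (rule linear_scI) (simp_all add: spt_linear algebra_simps fs.scale_right_diff_distrib)

lemma dbl_linear: "dbl n (X + Y) = dbl n X + dbl n Y" "dbl n (sc c X) = sc c (dbl n X)" "dbl n 0 = 0"
  "dbl n (X - Y) = dbl n X - dbl n Y"
  unfolding dbl_def by (simp_all add: spt_linear algebra_simps fs.scale_right_diff_distrib)

lemma spt_top_block: "A \<in> block {..<n} {..<n} \<Longrightarrow> spt n A \<in> block {n..<2 * n} {n..<2 * n}"
proof (rule blockI)
  fix i j assume "A \<in> block {..<n} {..<n}" "ent (spt n A) i j \<noteq> 0"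
  then have "i < 2 * n" "j < 2 * n" "2 * n - 1 - j < n" "2 * n - 1 - i < n"
    by (auto simp: ent_spt block_def split: if_splits)
  then show "i \<in> {n..<2 * n} \<and> j \<in> {n..<2 * n}" by auto
qed

lemma subspace_spf: "fs.subspace (spf n)"
  unfolding spf_def fs.subspace_def by (auto simp: spt_linear)

lemma subspace_pattern: "fs.subspace {X. \<forall>i j. ent X i j \<noteq> 0 \<longrightarrow> B i j}"
proof -
  have e: "{X. \<forall>i j. ent X i j \<noteq> 0 \<longrightarrow> B i j} = {X. \<forall>i j. \<not> B i j \<longrightarrow> ent X i j = 0}" by blast
  show ?thesis unfolding e fs.subspace_def by simp
qed

lemma subspace_swf: "fs.subspace (swf n a c)"
proof -
  have e: "swf n a c = spf n \<inter> {X. \<forall>i j. ent X i j \<noteq> 0 \<longrightarrow> \<not> crosses {a, n, 2 * n - a} i j \<and> \<not> crosses {c, 2 * n - c} j i}"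
    unfolding swf_def by blast
  show ?thesis unfolding e by (intro fs.subspace_inter subspace_spf subspace_pattern)
qed

lemma fin_dim_swf: "fs.fin_dim (swf n a c)"
  by (rule fs.fin_dim_subset[OF fin_dim_block[of "{..<2 * n}" "{..<2 * n}"]]) (auto simp: swf_def spf_def)

locale sp_seaweed =
  fixes n a c :: nat
  assumes a: "a < n" and c: "c \<le> n"
begin

definition p :: "'a::field fmat" where "p = bid {..<n}"
definition p' :: "'a::field fmat" where "p' = bid {n..<2 * n}"

text \<open>The break at \<open>n\<close> removes the lower left block, and the adjoint condition
  determines the lower right one from the upper left one, so only the upper two blocks are
  free.\<close>

lemma decomposition:
  fixes X :: "'a::field fmat"
  assumes X: "X \<in> swf n a c"
  shows "p * X * p \<in> gtop n a c" "p * X * p' \<in> vsym n c" "X = dbl n (p * X * p) + p * X * p'"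
proof -
  have Xb: "X \<in> block {..<2 * n} {..<2 * n}" and Xs: "spt n X = - X" using X unfolding swf_def spf_def by auto
  have cr: "\<not> crosses {a, n, 2 * n - a} i j" "\<not> crosses {c, 2 * n - c} j i" if "ent X i j \<noteq> 0" for i j
    using X that unfolding swf_def by blast+
  have e1: "ent (p * X * p) i j = (if i < n \<and> j < n then ent X i j else 0)" for i j
    unfolding p_def by (simp add: ent_bid_mult ent_mult_bid)
  have e2: "ent (p * X * p') i j = (if i < n \<and> n \<le> j \<and> j < 2 * n then ent X i j else 0)" for i j
    unfolding p_def p'_def by (simp add: ent_bid_mult ent_mult_bid)
  have sym: "sgn_sp n i * sgn_sp n j * ent X (2 * n - 1 - j) (2 * n - 1 - i) = - ent X i j" if "i < 2 * n" "j < 2 * n" for i j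
    using Xs that ent_spt[of n X i j] by simp
  show "p * X * p \<in> gtop n a c"
    unfolding gtop_def using cr by (auto simp: e1 block_def crosses_def split: if_splits)
  show "p * X * p' \<in> vsym n c"
    unfolding vsym_def
  proof (intro CollectI conjI)
    show "p * X * p' \<in> block {c..<n} {n..<2 * n - c}"
    proof (rule blockI)
      fix i j assume "ent (p * X * p') i j \<noteq> 0"
      then have *: "i < n" "n \<le> j" "j < 2 * n" "ent X i j \<noteq> 0" by (auto simp: e2 split: if_splits)
      show "i \<in> {c..<n} \<and> j \<in> {n..<2 * n - c}"
        using cr(2)[OF *(4)] * c unfolding crosses_def by auto
    qed
    show "spt n (p * X * p') = - (p * X * p')"
      by (rule fmat_eqI) (use sym in \<open>auto simp: ent_spt e2\<close>)
  qed
  show "X = dbl n (p * X * p) + p * X * p'"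
  proof (rule fmat_eqI)
    fix i j
    consider "i \<ge> 2 * n \<or> j \<ge> 2 * n" | "i < 2 * n" "j < 2 * n" "j < n" "n \<le> i" | "i < n" "j < 2 * n" | "i < 2 * n" "j < 2 * n" "n \<le> i" "n \<le> j" by linarith
    then show "ent X i j = ent (dbl n (p * X * p) + p * X * p') i j"
    proof cases
      case 1
      then show ?thesis using block_zero_entry[OF Xb] by (auto simp: dbl_def ent_spt e1 e2)
    next
      case 2
      then have "ent X i j = 0" using cr(1)[of i j] unfolding crosses_def by auto
      then show ?thesis using 2 by (auto simp: dbl_def ent_spt e1 e2)
    next
      case 3
      then show ?thesis by (auto simp: dbl_def ent_spt e1 e2)
    next
      case 4
      then show ?thesis using sym[of i j] by (auto simp: dbl_def ent_spt e1 e2)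
    qed
  qed
qed

lemma dbl_in_swf: "A \<in> gtop n a c \<Longrightarrow> dbl n A \<in> swf n a c"
proof -
  assume A: "A \<in> gtop n a c"
  then have Ab: "A \<in> block {..<n} {..<n}" unfolding gtop_def by blast
  have Ab2: "A \<in> block {..<2 * n} {..<2 * n}" by (rule block_mono[OF Ab]) auto
  have sb: "spt n A \<in> block {..<2 * n} {..<2 * n}" by (rule block_mono[OF spt_top_block[OF Ab]]) auto
  show ?thesis unfolding swf_def spf_def
  proof (intro CollectI conjI allI impI)
    show "dbl n A \<in> block {..<2 * n} {..<2 * n}" unfolding dbl_def using Ab2 sb by blast
    show "spt n (dbl n A) = - dbl n A" unfolding dbl_def by (simp add: spt_linear spt_spt[OF Ab2])
    fix i j assume "ent (dbl n A) i j \<noteq> 0"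
    then have "ent A i j \<noteq> 0 \<or> i < 2 * n \<and> j < 2 * n \<and> ent A (2 * n - 1 - j) (2 * n - 1 - i) \<noteq> 0"
      unfolding dbl_def by (auto simp: ent_spt split: if_splits)
    then show "\<not> crosses {a, n, 2 * n - a} i j" "\<not> crosses {c, 2 * n - c} j i"
    proof (atomize (full), elim disjE)
      assume nz: "ent A i j \<noteq> 0"
      then have "i < n" "j < n" "\<not> (j < a \<and> a \<le> i)" "\<not> (i < c \<and> c \<le> j)"
        using A unfolding gtop_def block_def by auto
      then show "\<not> crosses {a, n, 2 * n - a} i j \<and> \<not> crosses {c, 2 * n - c} j i"
        using a c unfolding crosses_def by auto
    next
      assume nz: "i < 2 * n \<and> j < 2 * n \<and> ent A (2 * n - 1 - j) (2 * n - 1 - i) \<noteq> 0"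
      let ?i = "2 * n - 1 - j" and ?j = "2 * n - 1 - i"
      have "?i < n" "?j < n" "\<not> (?j < a \<and> a \<le> ?i)" "\<not> (?i < c \<and> c \<le> ?j)"
        using A nz unfolding gtop_def block_def by auto
      then show "\<not> crosses {a, n, 2 * n - a} i j \<and> \<not> crosses {c, 2 * n - c} j i"
        using nz a c unfolding crosses_def by auto
    qed
  qed
qed

lemma vsym_in_swf: "S \<in> vsym n c \<Longrightarrow> S \<in> swf n a c"
proof -
  assume S: "S \<in> vsym n c"
  then have Sb: "S \<in> block {c..<n} {n..<2 * n - c}" unfolding vsym_def by blast
  show ?thesis unfolding swf_def spf_def
  proof (intro CollectI conjI allI impI)
    show "S \<in> block {..<2 * n} {..<2 * n}" by (rule block_mono[OF Sb]) auto
    show "spt n S = - S" using S unfolding vsym_def by blast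
    fix i j assume "ent S i j \<noteq> 0"
    then have "c \<le> i" "i < n" "n \<le> j" "j < 2 * n - c" using Sb unfolding block_def by auto
    then show "\<not> crosses {a, n, 2 * n - a} i j" "\<not> crosses {c, 2 * n - c} j i"
      using a c unfolding crosses_def by auto
  qed
qed

lemma subspace_vsym: "fs.subspace (vsym n c)"
  unfolding vsym_def using subspace_block unfolding fs.subspace_def by (auto simp: spt_linear)

lemma subspace_gtop: "fs.subspace (gtop n a c)"
proof -
  have e: "gtop n a c = block {..<n} {..<n} \<inter> {X. \<forall>i j. ent X i j \<noteq> 0 \<longrightarrow> \<not> (j < a \<and> a \<le> i) \<and> \<not> (i < c \<and> c \<le> j)}"
    unfolding gtop_def by blast
  show ?thesis unfolding e by (intro fs.subspace_inter subspace_block subspace_pattern)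
qed

lemma gtop_block: "A \<in> gtop n a c \<Longrightarrow> A \<in> block {..<n} {..<n}"
  unfolding gtop_def by blast

lemma corner_dbl:
  assumes A: "A \<in> block {..<n} {..<n}"
  shows "p * dbl n A * p = A" "p * dbl n A * p' = 0"
proof -
  have z: "p * spt n A = 0" "A * p' = 0" "p * A = A" "A * p = A"
  proof -
    have d: "{..<n} \<inter> {n..<2 * n} = {}" by auto
    show "p * spt n A = 0" "A * p' = 0" "p * A = A" "A * p = A"
      unfolding p_def p'_def
      using block_mult_zero[OF block_bid spt_top_block[OF A] d] block_mult_zero[OF A block_bid d]
        bid_mult[OF A, of "{..<n}"] mult_bid[OF A, of "{..<n}"] by simp_all
  qed
  show "p * dbl n A * p = A" "p * dbl n A * p' = 0"
    unfolding dbl_def by (simp_all add: right_diff_distrib mult.assoc z)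
qed

lemma dbl_mult:
  assumes A: "A \<in> block {..<n} {..<n}" and B: "B \<in> block {..<n} {..<n}"
  shows "dbl n A * dbl n B - dbl n B * dbl n A = dbl n (A * B - B * A)"
proof -
  have z: "A * spt n B = 0" "spt n A * B = 0" "B * spt n A = 0" "spt n B * A = 0"
  proof -
    have d: "{..<n} \<inter> {n..<2 * n} = {}" "{n..<2 * n} \<inter> {..<n} = {}" by auto
    show "A * spt n B = 0" "spt n A * B = 0" "B * spt n A = 0" "spt n B * A = 0"
      using block_mult_zero[OF A spt_top_block[OF B] d(1)] block_mult_zero[OF spt_top_block[OF A] B d(2)]
        block_mult_zero[OF B spt_top_block[OF A] d(1)] block_mult_zero[OF spt_top_block[OF B] A d(2)] by simp_all
  qed
  have "spt n (A * B) = spt n B * spt n A" "spt n (B * A) = spt n A * spt n B"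
    using spt_mult[OF block_mono[OF A subset_refl]] spt_mult[OF block_mono[OF B subset_refl]] by auto
  then show ?thesis unfolding dbl_def by (simp add: left_diff_distrib right_diff_distrib z spt_linear)
qed

text \<open>Only \<open>A * S\<close> and \<open>S * spt n A\<close> survive, and the second is
  minus the adjoint of the first because \<open>spt n S = - S\<close>.\<close>

lemma dbl_bracket_vsym:
  assumes A: "A \<in> gtop n a c" and S: "S \<in> vsym n c"
  shows "dbl n A * S - S * dbl n A = dbl n (A * S)"
proof -
  have Ab: "A \<in> block {..<n} {..<n}" and Sb: "S \<in> block {c..<n} {n..<2 * n - c}" and Ss: "spt n S = - S"
    using A S unfolding gtop_def vsym_def by auto
  have z: "spt n A * S = 0" "S * A = 0"
  proof -
    have d: "{n..<2 * n} \<inter> {c..<n} = {}" "{n..<2 * n - c} \<inter> {..<n} = {}" by auto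
    show "spt n A * S = 0" "S * A = 0"
      using block_mult_zero[OF spt_top_block[OF Ab] Sb d(1)] block_mult_zero[OF Sb Ab d(2)] by simp_all
  qed
  have "spt n (A * S) = spt n S * spt n A"
    using spt_mult[OF block_mono[OF Ab subset_refl]] by auto
  then show ?thesis unfolding dbl_def by (simp add: left_diff_distrib right_diff_distrib z Ss)
qed

text \<open>The complement of the abelian corner is a copy of \<open>gtop n a c\<close>, so the
  stabiliser can be described by \<open>n\<close> by \<open>n\<close> matrices through their action
  on the corner.\<close>

lemma reduction:
  fixes F f' :: "'a::field fmat \<Rightarrow> 'a"
  assumes F: "linfun F" and Q': "fs.subspace Q'" "Q' \<subseteq> gtop n a c"
    and nd: "\<And>v. v \<in> vsym n c \<Longrightarrow> (\<And>A. A \<in> gtop n a c \<Longrightarrow> F (dbl n (A * v)) = 0) \<Longrightarrow> v = 0"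
    and img: "\<And>A. A \<in> gtop n a c \<Longrightarrow> A \<in> Q' \<longleftrightarrow> (\<forall>v\<in>vsym n c. F (dbl n (A * v)) = 0)"
    and f': "linfun f'" "\<And>A. A \<in> block {..<n} {..<n} \<Longrightarrow> F (dbl n A) = f' A"
  shows "fs.dim (rad (swf n a c) F) = fs.dim (rad Q' f')"
proof (rule dim_rad_reduction[where S = "dbl n ` gtop n a c" and V = "vsym n c" and \<pi> = "\<lambda>x. x - p * x * p'" and \<phi> = "dbl n", OF F])
  interpret vector_space_pair "sc :: 'a \<Rightarrow> _" sc ..
  have fdg: "fs.fin_dim (gtop n a c :: 'a fmat set)"
    by (rule fs.fin_dim_subset[OF fin_dim_block[of "{..<n}" "{..<n}"]]) (auto simp: gtop_def)
  show "(swf n a c :: 'a fmat set) = {y + v |y v. y \<in> dbl n ` gtop n a c \<and> v \<in> vsym n c}"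
  proof (intro equalityI subsetI)
    fix x :: "'a fmat" assume "x \<in> swf n a c"
    then show "x \<in> {y + v |y v. y \<in> dbl n ` gtop n a c \<and> v \<in> vsym n c}" using decomposition by blast
  next
    fix x :: "'a fmat" assume "x \<in> {y + v |y v. y \<in> dbl n ` gtop n a c \<and> v \<in> vsym n c}"
    then show "x \<in> swf n a c" using dbl_in_swf vsym_in_swf by (auto intro: fs.subspace_add[OF subspace_swf])
  qed
  show "fs.subspace (dbl n ` gtop n a c :: 'a fmat set)" by (rule linear_subspace_image[OF linear_dbl subspace_gtop])
  show "fs.fin_dim (dbl n ` gtop n a c :: 'a fmat set)" by (rule fs.fin_dim_image[OF linear_dbl fdg])
  show "fs.subspace (vsym n c :: 'a fmat set)" by (rule subspace_vsym)
  show "fs.fin_dim (vsym n c :: 'a fmat set)"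
    by (rule fs.fin_dim_subset[OF fin_dim_swf[of n a c]]) (use vsym_in_swf in blast)
  show "v * w = 0" if "v \<in> vsym n c" "w \<in> vsym n c" for v w :: "'a fmat"
  proof -
    have "v \<in> block {c..<n} {n..<2 * n - c}" "w \<in> block {c..<n} {n..<2 * n - c}" using that unfolding vsym_def by auto
    then show ?thesis by (rule block_mult_zero) auto
  qed
  show "v = 0" if v: "v \<in> vsym n c" and n0: "\<And>y. y \<in> dbl n ` gtop n a c \<Longrightarrow> F (v * y - y * v) = 0" for v
  proof (rule nd[OF v])
    fix A :: "'a fmat" assume A: "A \<in> gtop n a c"
    have "F (v * dbl n A - dbl n A * v) = 0" using n0 A by blast
    then show "F (dbl n (A * v)) = 0"
      unfolding dbl_bracket_vsym[OF A v, symmetric] by (simp add: linfunD[OF F])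
  qed
  show "Vector_Spaces.linear sc sc (\<lambda>x. x - p * x * p' :: 'a fmat)"
    by (rule linear_scI) (simp_all add: algebra_simps fs.scale_right_diff_distrib)
  show "y - p * y * p' = y" if "y \<in> dbl n ` gtop n a c" for y :: "'a fmat" using that corner_dbl(2)[OF gtop_block] by auto
  show "v - p * v * p' = 0" if "v \<in> vsym n c" for v :: "'a fmat"
  proof -
    have v: "v \<in> block {c..<n} {n..<2 * n - c}" using that unfolding vsym_def by blast
    have s: "{c..<n} \<subseteq> {..<n}" by auto
    have "p * v = v" "v * p' = v" unfolding p_def p'_def
      using bid_mult[OF v _ s] mult_bid[OF v, of "{n..<2 * n}"] by auto
    then show ?thesis by simp
  qed
  show "fs.subspace Q'" by (rule Q')
  show "fs.fin_dim Q'" by (rule fs.fin_dim_subset[OF fdg Q'(2)])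
  show "Vector_Spaces.linear sc sc (dbl n :: 'a fmat \<Rightarrow> _)" by (rule linear_dbl)
  show "inj_on (dbl n) Q'" using Q'(2) corner_dbl(1)[OF gtop_block] by (metis inj_onI subsetD)
  show "dbl n ` Q' = {y \<in> dbl n ` gtop n a c. \<forall>v\<in>vsym n c. F (y * v - v * y) = 0}"
  proof (intro equalityI subsetI)
    fix y assume "y \<in> dbl n ` Q'"
    then obtain A where A: "A \<in> Q'" "y = dbl n A" by blast
    then have Ag: "A \<in> gtop n a c" using Q'(2) by blast
    show "y \<in> {y \<in> dbl n ` gtop n a c. \<forall>v\<in>vsym n c. F (y * v - v * y) = 0}"
      using img[OF Ag] A dbl_bracket_vsym[OF Ag] Ag by auto
  next
    fix y assume "y \<in> {y \<in> dbl n ` gtop n a c. \<forall>v\<in>vsym n c. F (y * v - v * y) = 0}"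
    then obtain A where A: "A \<in> gtop n a c" "y = dbl n A" "\<forall>v\<in>vsym n c. F (y * v - v * y) = 0" by blast
    then show "y \<in> dbl n ` Q'" using img[OF A(1)] dbl_bracket_vsym[OF A(1)] by auto
  qed
  show "linfun f'" by (rule f')
  show "F (dbl n x * dbl n y - dbl n y * dbl n x) = f' (x * y - y * x)" if "x \<in> Q'" "y \<in> Q'" for x y
  proof -
    have b: "x \<in> block {..<n} {..<n}" "y \<in> block {..<n} {..<n}" using that Q'(2) unfolding gtop_def by auto
    show ?thesis
      unfolding dbl_mult[OF b] by (rule f'(2)) (use block_mult[OF b] block_mult[OF b(2,1)] in blast)
  qed
qed

end

text \<open>For \<open>a \<le> c\<close> the two breaks cut the \<open>n\<close> indices into
  \<open>U\<close>, \<open>W\<close> and \<open>T\<close>. The allowed blocks are those of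
  \<open>galg\<close>, except that \<open>gtop\<close> leaves the square block on \<open>T\<close>
  free, which the second condition reduces to the line through \<open>t\<close>.\<close>

lemma galg_iff_gtop:
  fixes t :: "'a::field fmat"
  assumes ac: "a \<le> c" "c \<le> n" and t: "t \<in> block {c..<n} {c..<n}"
  shows "X \<in> galg a {c..<n} {a..<c} t \<longleftrightarrow>
    X \<in> gtop n a c \<and> (\<exists>r. bid {c..<n} * X * bid {c..<n} = sc r t)"
proof
  let ?T = "{c..<n}" and ?W = "{a..<c}" and ?U = "{..<a}"
  assume X: "X \<in> galg a ?T ?W t"
  then obtain A r Z D where x: "X = A + sc r t + Z + D" and b: "A \<in> block ?U ?U" "Z \<in> block (?U \<union> ?T) ?W" "D \<in> block ?W ?W"
    by (rule galgE)
  have "X \<in> tripat a ?T ?W" using galg_subset_tripat[OF t] X by blast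
  then have "X \<in> gtop n a c" using ac unfolding tripat_def gtop_def block_def by fastforce
  moreover have "bid ?T * X * bid ?T = sc r t"
  proof -
    have d: "?T \<inter> ?U = {}" "?W \<inter> ?T = {}" "?T \<inter> ?W = {}" using ac by auto
    have "bid ?T * A = 0" "Z * bid ?T = 0" "bid ?T * D = 0" "bid ?T * t = t" "t * bid ?T = t"
      using block_mult_zero[OF block_bid b(1) d(1)] block_mult_zero[OF b(2) block_bid d(2)]
        block_mult_zero[OF block_bid b(3) d(3)] bid_mult[OF t, of ?T] mult_bid[OF t, of ?T] by simp_all
    then show ?thesis unfolding x by (simp add: distrib_left distrib_right mult.assoc)
  qed
  ultimately show "X \<in> gtop n a c \<and> (\<exists>r. bid ?T * X * bid ?T = sc r t)" by blast
next
  let ?T = "{c..<n}" and ?W = "{a..<c}" and ?U = "{..<a}"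
  assume X: "X \<in> gtop n a c \<and> (\<exists>r. bid ?T * X * bid ?T = sc r t)"
  then obtain r where r: "bid ?T * X * bid ?T = sc r t" by blast
  have "X = bid ?U * X * bid ?U + bid ?T * X * bid ?T + bid (?U \<union> ?T) * X * bid ?W + bid ?W * X * bid ?W"
  proof (rule fmat_eqI)
    fix i j
    show "ent X i j = ent (bid ?U * X * bid ?U + bid ?T * X * bid ?T + bid (?U \<union> ?T) * X * bid ?W + bid ?W * X * bid ?W) i j"
    proof (cases "ent X i j = 0")
      case False
      then have "i < n" "j < n" "\<not> (j < a \<and> a \<le> i)" "\<not> (i < c \<and> c \<le> j)"
        using X unfolding gtop_def block_def by auto
      then show ?thesis using ac by (auto simp: ent_bid_mult ent_mult_bid)
    qed (simp add: ent_bid_mult ent_mult_bid)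
  qed
  also have "\<dots> \<in> galg a ?T ?W t"
    unfolding r by (intro galgI corner_block) auto
  finally show "X \<in> galg a ?T ?W t" .
qed

lemma munit_gtop: "p < n \<Longrightarrow> q < n \<Longrightarrow> \<not> (q < a \<and> a \<le> p) \<Longrightarrow> \<not> (p < c \<and> c \<le> q) \<Longrightarrow> munit p q \<in> gtop n a c"
  unfolding gtop_def by (auto split: if_splits)

lemma ent_linfun: "linfun (\<lambda>X. ent X i j)"
  by (rule linfunI) auto

lemma linfun_dbl: "linfun F \<Longrightarrow> linfun (\<lambda>x. F (dbl n x))"
  by (rule linfunI) (simp_all add: dbl_linear linfunD)

context sp_seaweed
begin

text \<open>Extends a functional on \<open>\<gg>\<ll>(n)\<close> to one on \<open>\<ss>\<pp>(2n)\<close>, with prescribed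
  restriction \<open>g\<close> to the upper right block.\<close>

lemma extend_functional:
  fixes f' g :: "'a::field fmat \<Rightarrow> 'a"
  assumes f': "linfun f'" and g: "linfun g"
  defines "F \<equiv> \<lambda>X. f' (p * X * p) + g (p * X * p')"
  shows "linfun F" "A \<in> block {..<n} {..<n} \<Longrightarrow> F (dbl n A) = f' A"
    "S \<in> block {..<n} {n..<2 * n} \<Longrightarrow> F S = g S"
proof -
  show "linfun F" unfolding F_def
    by (rule linfunI) (simp_all add: algebra_simps linfunD[OF f'] linfunD[OF g])
  show "F (dbl n A) = f' A" if "A \<in> block {..<n} {..<n}"
    unfolding F_def using corner_dbl[OF that] by (simp add: linfunD[OF g])
  show "F S = g S" if S: "S \<in> block {..<n} {n..<2 * n}"
  proof -
    have d: "{n..<2 * n} \<inter> {..<n} = {}" by auto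
    have "S * p = 0" "p * S = S" "S * p' = S"
      unfolding p_def p'_def using block_mult_zero[OF S block_bid d] bid_mult[OF S, of "{..<n}"] mult_bid[OF S, of "{n..<2 * n}"]
      by simp_all
    then show ?thesis unfolding F_def by (simp add: mult.assoc linfunD[OF f'])
  qed
qed

end

section \<open>The seaweed with a corner of size one\<close>

text \<open>The corner is the line through \<open>e\<close>, on which \<open>A\<close> acts by twice
  its last diagonal entry. For \<open>F e \<noteq> 0\<close> the stabiliser therefore consists of
  the matrices in which this entry vanishes, the case \<open>t = 0\<close> of
  \<open>galg\<close>.\<close>

lemma index_swf_minus_one:
  fixes n a :: nat
  assumes a: "a < n"
  shows "index_is (swf n a (n - 1) :: 'a::field_char_0 fmat set) (gcd (a + 1) (n - 1 - a) - 1)"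
proof -
  interpret sp_seaweed n a "n - 1" by unfold_locales (use a in auto)
  let ?c = "n - 1" and ?Q = "swf n a (n - 1) :: 'a fmat set" and ?Q' = "galg a {n - 1..<n} {a..<n - 1} (0 :: 'a fmat)"
  define e :: "'a fmat" where "e = munit (n - 1) n"
  have T: "{n - 1..<n} = {n - 1}" using a by auto
  have se: "spt n e = - e"
    unfolding e_def using a by (subst spt_munit) (auto simp: sgn_sp_def intro!: fmat_eqI)
  have V: "v \<in> vsym n ?c \<Longrightarrow> v = sc (ent v (n - 1) n) e" for v :: "'a fmat"
  proof (rule fmat_eqI)
    fix i j assume v: "v \<in> vsym n ?c"
    then have "v \<in> block {n - 1..<n} {n..<2 * n - ?c}" unfolding vsym_def by blast
    then show "ent v i j = ent (sc (ent v (n - 1) n) e) i j"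
      using a unfolding e_def block_def by (cases "ent v i j = 0") force+
  qed
  have eV: "e \<in> vsym n ?c" unfolding vsym_def using se a by (auto simp: e_def)
  have Ae: "dbl n (A * e) = sc (2 * ent A (n - 1) (n - 1)) e" if A: "A \<in> gtop n a ?c" for A
  proof -
    have "A * e = sc (ent A (n - 1) (n - 1)) e"
    proof (rule fmat_eqI)
      fix i j
      \<comment> \<open>The break \<open>c = n - 1\<close> leaves only the diagonal entry in the
        last column.\<close>
      have "ent A i (n - 1) = 0" if "i \<noteq> n - 1"
        using A that a unfolding gtop_def block_def by (cases "ent A i (n - 1) = 0") force+
      then show "ent (A * e) i j = ent (sc (ent A (n - 1) (n - 1)) e) i j"
        unfolding e_def by (simp add: ent_mult_munit)
    qed
    then show ?thesis by (simp add: dbl_def spt_linear se fs.scale_left_distrib[symmetric])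
  qed
  have FA: "F (dbl n (A * v)) = 2 * ent A (n - 1) (n - 1) * ent v (n - 1) n * F e"
    if "linfun F" "A \<in> gtop n a ?c" "v \<in> vsym n ?c" for F A v
  proof -
    have "dbl n (A * v) = sc (ent v (n - 1) n) (dbl n (A * e))"
      by (subst V[OF that(3)]) (simp add: dbl_linear)
    then show ?thesis unfolding Ae[OF that(2)] by (simp add: linfunD[OF that(1)])
  qed
  have unit: "munit (n - 1) (n - 1) \<in> (gtop n a ?c :: 'a fmat set)" using a by (intro munit_gtop) auto
  have Q': "A \<in> ?Q' \<longleftrightarrow> A \<in> gtop n a ?c \<and> ent A (n - 1) (n - 1) = 0" for A
  proof -
    have "bid {n - 1..<n} * A * bid {n - 1..<n} = 0 \<longleftrightarrow> ent A (n - 1) (n - 1) = 0"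
    proof
      assume "bid {n - 1..<n} * A * bid {n - 1..<n} = 0"
      then have "ent (bid {n - 1..<n} * A * bid {n - 1..<n}) (n - 1) (n - 1) = 0" by simp
      then show "ent A (n - 1) (n - 1) = 0" unfolding T by (simp add: ent_bid_mult ent_mult_bid)
    next
      assume "ent A (n - 1) (n - 1) = 0"
      then show "bid {n - 1..<n} * A * bid {n - 1..<n} = 0"
        unfolding T by (intro fmat_eqI) (simp add: ent_bid_mult ent_mult_bid)
    qed
    then show ?thesis using galg_iff_gtop[of a ?c n "0 :: 'a fmat" A] a by auto
  qed
  have red: "fs.dim (rad ?Q F) = fs.dim (rad ?Q' f')"
    if F: "linfun F" "F e \<noteq> 0" and f': "linfun f'" "\<And>A. A \<in> block {..<n} {..<n} \<Longrightarrow> F (dbl n A) = f' A" for F f'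
  proof (rule reduction[OF F(1) subspace_galg _ _ _ f'])
    show "?Q' \<subseteq> gtop n a ?c" using Q' by blast
    show "v = 0" if v: "v \<in> vsym n ?c" and z: "\<And>A. A \<in> gtop n a ?c \<Longrightarrow> F (dbl n (A * v)) = 0" for v
    proof -
      have "ent v (n - 1) n = 0" using z[OF unit] FA[OF F(1) unit v] F(2) by simp
      then show ?thesis using V[OF v] by simp
    qed
    show "A \<in> ?Q' \<longleftrightarrow> (\<forall>v\<in>vsym n ?c. F (dbl n (A * v)) = 0)" if A: "A \<in> gtop n a ?c" for A
    proof
      assume "A \<in> ?Q'"
      then have "ent A (n - 1) (n - 1) = 0" using Q' by blast
      then show "\<forall>v\<in>vsym n ?c. F (dbl n (A * v)) = 0" using FA[OF F(1) A] by simp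
    next
      assume "\<forall>v\<in>vsym n ?c. F (dbl n (A * v)) = 0"
      then have "F (dbl n (A * e)) = 0" using eV by blast
      moreover have "ent e (n - 1) n = 1" by (simp add: e_def)
      ultimately have "ent A (n - 1) (n - 1) = 0" using FA[OF F(1) A eV] F(2) by simp
      then show "A \<in> ?Q'" using Q' A by blast
    qed
  qed
  show ?thesis
  proof (rule index_is_transfer[OF subspace_swf fin_dim_swf, where P = "\<lambda>F. F e \<noteq> 0"])
    show "\<exists>g. linfun g \<and> finite {s. \<not> f e + s * g e \<noteq> 0}" for f :: "'a fmat \<Rightarrow> 'a"
    proof (intro exI[of _ "\<lambda>X. ent X (n - 1) n"] conjI ent_linfun)
      have "{s. \<not> f e + s * ent e (n - 1) n \<noteq> 0} \<subseteq> {- f e}" by (auto simp: e_def add_eq_0_iff)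
      then show "finite {s. \<not> f e + s * ent e (n - 1) n \<noteq> 0}" using finite_subset by blast
    qed
    show "\<exists>f'. linfun f' \<and> fs.dim (rad ?Q F) = fs.dim (rad ?Q' f')" if "linfun F" "F e \<noteq> 0" for F
      using red[OF that linfun_dbl[OF that(1)] refl] linfun_dbl[OF that(1)] by blast
    show "\<exists>F. linfun F \<and> fs.dim (rad ?Q F) = fs.dim (rad ?Q' f')" if f': "linfun f'" for f'
    proof -
      have "e \<in> block {..<n} {n..<2 * n}" using a by (simp add: e_def)
      note X = extend_functional[OF f' ent_linfun[of "n - 1" n]]
      have "(\<lambda>X. f' (p * X * p) + ent (p * X * p') (n - 1) n) e \<noteq> 0"
        unfolding X(3)[OF \<open>e \<in> block {..<n} {n..<2 * n}\<close>] by (simp add: e_def)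
      then show ?thesis using red[OF X(1) _ f' X(2)] X(1) by blast
    qed
    have "index_is (galg a {n - 1} {a..<n - 1} (0 :: 'a fmat)) (gcd (a + 1) (card {a..<n - 1}) - 1)"
      by (rule index_galg_singleton) (use a in auto)
    then show "index_is ?Q' (gcd (a + 1) (n - 1 - a) - 1)" unfolding T by simp
  qed
qed

section \<open>The seaweed with a corner of size two\<close>

locale sp_seaweed_two = sp_seaweed n a "n - 2" for n a +
  assumes n: "2 \<le> n"
begin

abbreviation "x \<equiv> n - 2"
abbreviation "y \<equiv> n - 1"
abbreviation "c \<equiv> n - 2"

text \<open>Together with \<open>S2\<close> and \<open>S3\<close> a basis of the corner. The mirror
  images of \<open>x\<close> and \<open>y\<close> are \<open>n + 1\<close> and \<open>n\<close>, so
  \<open>S1\<close> and \<open>S2\<close> sit on the antidiagonal, while \<open>S3\<close> joins the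
  two positions exchanged by the adjoint.\<close>

definition S1 :: "'a::field_char_0 fmat" where "S1 = munit x (n + 1)"
definition S2 :: "'a::field_char_0 fmat" where "S2 = munit y n"
definition S3 :: "'a::field_char_0 fmat" where "S3 = munit x n + munit y (n + 1)"

lemma arith: "x < n" "y < n" "x < 2 * n" "y < 2 * n" "n < 2 * n" "n + 1 < 2 * n" "x \<noteq> y"
  "2 * n - 1 - x = n + 1" "2 * n - 1 - y = n" "2 * n - 1 - n = y" "2 * n - 1 - (n + 1) = x" "\<not> n + 1 < n"
  using n by auto

lemma spt_units: "spt n (munit x (n + 1)) = - (munit x (n + 1) :: 'b::field fmat)" "spt n (munit y n) = - (munit y n :: 'b fmat)"
  "spt n (munit x n) = - (munit y (n + 1) :: 'b fmat)" "spt n (munit y (n + 1)) = - (munit x n :: 'b fmat)"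
proof -
  have s: "sgn_sp n x = (1 :: 'b::field)" "sgn_sp n y = (1 :: 'b)" "sgn_sp n n = (- 1 :: 'b)" "sgn_sp n (n + 1) = (- 1 :: 'b)"
    unfolding sgn_sp_def using arith(1,2) by simp_all
  show "spt n (munit x (n + 1)) = - (munit x (n + 1) :: 'b fmat)" "spt n (munit y n) = - (munit y n :: 'b fmat)"
    "spt n (munit x n) = - (munit y (n + 1) :: 'b fmat)" "spt n (munit y (n + 1)) = - (munit x n :: 'b fmat)"
    unfolding spt_munit[OF arith(3,6)] spt_munit[OF arith(4,5)] spt_munit[OF arith(3,5)] spt_munit[OF arith(4,6)]
    unfolding arith s by (auto intro!: fmat_eqI)
qed

lemma vsym_elements: "S1 \<in> vsym n c" "S2 \<in> vsym n c" "S3 \<in> vsym n c"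
proof -
  have "2 * n - c = n + 2" using n by simp
  then show "S1 \<in> vsym n c" "S2 \<in> vsym n c" "S3 \<in> vsym n c"
    unfolding vsym_def S1_def S2_def S3_def
    using n by (auto simp: spt_linear spt_units[simplified] spt_units intro!: block_closed)
qed

lemma vsym_expand:
  assumes S: "S \<in> vsym n c"
  shows "S = sc (ent S x (n + 1)) S1 + sc (ent S y n) S2 + sc (ent S x n) S3"
proof (rule fmat_eqI)
  fix i j
  have b: "S \<in> block {c..<n} {n..<2 * n - c}" and s: "spt n S = - S" using S unfolding vsym_def by auto
  have e: "ent S y (n + 1) = ent S x n"
  proof -
    have "- ent S x n = ent (spt n S) x n" unfolding s by simp
    also have "\<dots> = - ent S y (n + 1)"
      unfolding ent_spt arith using arith(1-6) by (simp add: sgn_sp_def)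
    finally show ?thesis by simp
  qed
  show "ent S i j = ent (sc (ent S x (n + 1)) S1 + sc (ent S y n) S2 + sc (ent S x n) S3) i j"
  proof (cases "(i = x \<or> i = y) \<and> (j = n \<or> j = n + 1)")
    case True
    then show ?thesis using arith(7) e by (auto simp: S1_def S2_def S3_def)
  next
    case False
    then have "\<not> (i \<in> {c..<n} \<and> j \<in> {n..<2 * n - c})" using n by auto
    then have "ent S i j = 0" using block_zero_entry[OF b] by blast
    then show ?thesis using False by (auto simp: S1_def S2_def S3_def)
  qed
qed

lemma dbl_units: "dbl n (munit x (n + 1)) = sc 2 S1" "dbl n (munit y n) = sc 2 S2"
  "dbl n (munit x n) = S3" "dbl n (munit y (n + 1)) = S3"
  unfolding dbl_def spt_units S1_def S2_def S3_def by (auto intro!: fmat_eqI)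

lemma top_column:
  assumes A: "A \<in> gtop n a c"
  shows "A * munit x j = sc (ent A x x) (munit x j) + sc (ent A y x) (munit y j)"
    "A * munit y j = sc (ent A x y) (munit x j) + sc (ent A y y) (munit y j)"
proof -
  have z: "ent A i k = 0" if "i \<noteq> x" "i \<noteq> y" "c \<le> k" for i k
    using A that n unfolding gtop_def block_def by (cases "ent A i k = 0") force+
  show "A * munit x j = sc (ent A x x) (munit x j) + sc (ent A y x) (munit y j)"
    "A * munit y j = sc (ent A x y) (munit x j) + sc (ent A y y) (munit y j)"
    by (rule fmat_eqI; use z arith(7) n in \<open>force simp: ent_mult_munit\<close>)+
qed

text \<open>With \<open>F S1\<close>, \<open>F S2\<close>, \<open>F S3\<close> as the coefficients
  of a binary quadratic form, this is the infinitesimal action of the last 2 by 2 block of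
  \<open>A\<close> on it. No other entries occur, since the break \<open>c\<close> clears the last
  two columns above that block.\<close>

lemma functional_value:
  assumes F: "linfun F" and A: "A \<in> gtop n a c" and S: "S \<in> vsym n c"
  shows "F (dbl n (A * S)) =
      ent S x (n + 1) * (2 * ent A x x * F S1 + ent A y x * F S3)
    + ent S y n * (2 * ent A y y * F S2 + ent A x y * F S3)
    + ent S x n * ((ent A x x + ent A y y) * F S3 + 2 * ent A y x * F S2 + 2 * ent A x y * F S1)"
proof -
  have "A * S1 = sc (ent A x x) (munit x (n + 1)) + sc (ent A y x) (munit y (n + 1))"
    "A * S2 = sc (ent A x y) (munit x n) + sc (ent A y y) (munit y n)"
    "A * S3 = sc (ent A x x) (munit x n) + sc (ent A y x) (munit y n)
      + (sc (ent A x y) (munit x (n + 1)) + sc (ent A y y) (munit y (n + 1)))"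
    unfolding S1_def S2_def S3_def by (simp_all only: distrib_left top_column[OF A])
  then have "F (dbl n (A * S1)) = 2 * ent A x x * F S1 + ent A y x * F S3"
    "F (dbl n (A * S2)) = 2 * ent A y y * F S2 + ent A x y * F S3"
    "F (dbl n (A * S3)) = (ent A x x + ent A y y) * F S3 + 2 * ent A y x * F S2 + 2 * ent A x y * F S1"
    by (simp_all only: dbl_linear dbl_units linfunD[OF F]) (simp_all add: algebra_simps)
  moreover have "A * S = sc (ent S x (n + 1)) (A * S1) + sc (ent S y n) (A * S2) + sc (ent S x n) (A * S3)"
    by (subst vsym_expand[OF S]) (simp only: distrib_left sc_mult_right)
  ultimately show ?thesis by (simp only: dbl_linear linfunD[OF F])
qed

text \<open>Testing on the basis of the corner gives one equation for each element; together they
  say that the 2 by 2 block annihilates the form.\<close>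

lemma values_vanish_iff:
  assumes F: "linfun F" and A: "A \<in> gtop n a c"
  shows "(\<forall>v\<in>vsym n c. F (dbl n (A * v)) = 0) \<longleftrightarrow>
    2 * ent A x x * F S1 + ent A y x * F S3 = 0 \<and> 2 * ent A y y * F S2 + ent A x y * F S3 = 0 \<and>
    (ent A x x + ent A y y) * F S3 + 2 * ent A y x * F S2 + 2 * ent A x y * F S1 = 0"
proof
  assume *: "\<forall>v\<in>vsym n c. F (dbl n (A * v)) = 0"
  have e: "ent S1 x (n + 1) = 1" "ent S1 y n = 0" "ent S1 x n = 0" "ent S2 x (n + 1) = 0" "ent S2 y n = 1" "ent S2 x n = 0"
    "ent S3 x (n + 1) = 0" "ent S3 y n = 0" "ent S3 x n = 1"
    unfolding S1_def S2_def S3_def using arith(7) by auto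
  then show "2 * ent A x x * F S1 + ent A y x * F S3 = 0 \<and> 2 * ent A y y * F S2 + ent A x y * F S3 = 0 \<and>
    (ent A x x + ent A y y) * F S3 + 2 * ent A y x * F S2 + 2 * ent A x y * F S1 = 0"
    using functional_value[OF F A vsym_elements(1)] functional_value[OF F A vsym_elements(2)]
      functional_value[OF F A vsym_elements(3)] *[rule_format, OF vsym_elements(1)]
      *[rule_format, OF vsym_elements(2)] *[rule_format, OF vsym_elements(3)]
    unfolding e by simp
qed (use functional_value[OF F A] in simp)

text \<open>The form chosen on the corner is a sum of two squares. It serves both as the direction
  of perturbation and as the form at which the minimum is attained.\<close>

lemma functionals:
  fixes f' :: "'a::field_char_0 fmat \<Rightarrow> 'a"
  assumes "linfun f'"
  obtains F where "linfun F" "\<And>A. A \<in> block {..<n} {..<n} \<Longrightarrow> F (dbl n A) = f' A" "F S1 = 1" "F S2 = 1" "F S3 = 0"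
proof -
  have g: "linfun (\<lambda>X. ent X x (n + 1) + ent X y n :: 'a)" by (rule linfunI) (auto simp: algebra_simps)
  note X = extend_functional[OF assms g]
  have "S1 \<in> block {..<n} {n..<2 * n}" "S2 \<in> block {..<n} {n..<2 * n}" "S3 \<in> block {..<n} {n..<2 * n}"
    unfolding S1_def S2_def S3_def using n by (auto intro!: block_closed)
  then show ?thesis using that[OF X(1,2)] X(3) arith(7) by (simp add: S1_def S2_def S3_def)
qed

end

text \<open>A nondegenerate form on the corner has a one-dimensional stabiliser, spanned by
  \<open>t F\<close>. This line depends on \<open>F\<close>, so there is no fixed reduced algebra to
  transfer from; the lower bound and its attainment are derived separately from the common index of
  all \<open>?Q' F\<close>.\<close>

lemma index_swf_minus_two:
  fixes n a :: nat
  assumes an: "a + 2 \<le> n"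
  shows "index_is (swf n a (n - 2) :: 'a::field_char_0 fmat set) (gcd (a + 2) (n - 2 - a) - 1)"
proof -
  interpret sp_seaweed_two n a by unfold_locales (use an in auto)
  let ?Q = "swf n a c :: 'a fmat set"
  have T: "{n - 2..<n} = {x, y}" using an by auto
  \<comment> \<open>The Gram matrix with diagonal \<open>2 * F S1\<close>, \<open>2 * F S2\<close>
    and off-diagonal entry \<open>F S3\<close>, multiplied from the left by a quarter turn: the
    infinitesimal rotation for the form.\<close>
  define t :: "('a fmat \<Rightarrow> 'a) \<Rightarrow> 'a fmat" where "t F = sc (F S3) (munit x x) + sc (2 * F S2) (munit x y)
    - sc (2 * F S1) (munit y x) - sc (F S3) (munit y y)" for F
  have ent_t: "ent (t F) x x = F S3" "ent (t F) x y = 2 * F S2" "ent (t F) y x = - (2 * F S1)" "ent (t F) y y = - F S3" for F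
    unfolding t_def using arith(7) by auto
  have tb: "t F \<in> block {x, y} {x, y}" for F
    unfolding t_def by (intro block_closed block_sc) auto
  \<comment> \<open>The second condition is that the Gram determinant does not vanish. The first
    makes the entry of \<open>t F\<close> at \<open>(y, x)\<close> nonzero, as
    \<open>index_galg_pair\<close> requires.\<close>
  let ?P = "\<lambda>F. F S1 \<noteq> 0 \<and> 4 * F S1 * F S2 - F S3 ^ 2 \<noteq> 0"
  let ?Q' = "\<lambda>F. galg a {x, y} {a..<c} (t F)"
  have units: "munit i j \<in> (gtop n a c :: 'a fmat set)" if "i \<in> {x, y}" "j \<in> {x, y}" for i j
    using that an by (intro munit_gtop) auto
  have Q': "A \<in> ?Q' F \<longleftrightarrow> A \<in> gtop n a c \<and> (\<exists>r. ent A x x = r * F S3 \<and> ent A x y = r * (2 * F S2) \<and>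
      ent A y x = r * - (2 * F S1) \<and> ent A y y = r * - F S3)" for A F
  proof -
    have "bid {x, y} * A * bid {x, y} = sc r (t F) \<longleftrightarrow> ent A x x = r * F S3 \<and> ent A x y = r * (2 * F S2) \<and>
      ent A y x = r * - (2 * F S1) \<and> ent A y y = r * - F S3" for r
    proof
      assume "bid {x, y} * A * bid {x, y} = sc r (t F)"
      then have "ent (bid {x, y} * A * bid {x, y}) i j = r * ent (t F) i j" for i j by simp
      from this[of x x] this[of x y] this[of y x] this[of y y]
      show "ent A x x = r * F S3 \<and> ent A x y = r * (2 * F S2) \<and> ent A y x = r * - (2 * F S1) \<and> ent A y y = r * - F S3"
        unfolding ent_t by (simp add: ent_bid_mult ent_mult_bid)
    next
      assume *: "ent A x x = r * F S3 \<and> ent A x y = r * (2 * F S2) \<and> ent A y x = r * - (2 * F S1) \<and> ent A y y = r * - F S3"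
      show "bid {x, y} * A * bid {x, y} = sc r (t F)"
      proof (rule fmat_eqI)
        fix i j
        show "ent (bid {x, y} * A * bid {x, y}) i j = ent (sc r (t F)) i j"
        proof (cases "i \<in> {x, y} \<and> j \<in> {x, y}")
          case True
          then show ?thesis using * ent_t[of F] by (auto simp: ent_bid_mult ent_mult_bid)
        next
          case False
          then show ?thesis using block_zero_entry[OF tb[of F]] by (auto simp: ent_bid_mult ent_mult_bid)
        qed
      qed
    qed
    then show ?thesis using galg_iff_gtop[of a c n "t F" A] an tb[of F] unfolding T by auto
  qed
  have red: "fs.dim (rad ?Q F) = fs.dim (rad (?Q' F) f')"
    if F: "linfun F" "?P F" and f': "linfun f'" "\<And>A. A \<in> block {..<n} {..<n} \<Longrightarrow> F (dbl n A) = f' A" for F f'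
  proof (rule reduction[OF F(1) subspace_galg _ _ _ f'])
    let ?b1 = "F S1" and ?b2 = "F S2" and ?b3 = "F S3"
    have b1: "?b1 \<noteq> 0" and D: "4 * ?b1 * ?b2 - ?b3 ^ 2 \<noteq> 0" using F(2) by auto
    show "?Q' F \<subseteq> gtop n a c" using Q' by blast
    show "v = 0" if v: "v \<in> vsym n c" and z: "\<And>A. A \<in> gtop n a c \<Longrightarrow> F (dbl n (A * v)) = 0" for v
    proof -
      let ?x1 = "ent v x (n + 1)" and ?x2 = "ent v y n" and ?x3 = "ent v x n"
      have p: "2 * ?x1 * ?b1 + ?x3 * ?b3 = 0" and q: "?x2 * ?b3 + 2 * ?x3 * ?b1 = 0"
        and r: "?x1 * ?b3 + 2 * ?x3 * ?b2 = 0" and s: "2 * ?x2 * ?b2 + ?x3 * ?b3 = 0"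
      proof -
        have u: "munit x x \<in> (gtop n a c :: 'a fmat set)" "munit x y \<in> (gtop n a c :: 'a fmat set)"
          "munit y x \<in> (gtop n a c :: 'a fmat set)" "munit y y \<in> (gtop n a c :: 'a fmat set)"
          by (rule units; simp)+
        note ne = arith(7)[unfolded One_nat_def] arith(7)[unfolded One_nat_def, symmetric]
        show "2 * ?x1 * ?b1 + ?x3 * ?b3 = 0"
          using z[OF u(1)] unfolding functional_value[OF F(1) u(1) v] by (simp add: ne algebra_simps)
        show "?x2 * ?b3 + 2 * ?x3 * ?b1 = 0"
          using z[OF u(2)] unfolding functional_value[OF F(1) u(2) v] by (simp add: ne algebra_simps)
        show "?x1 * ?b3 + 2 * ?x3 * ?b2 = 0"
          using z[OF u(3)] unfolding functional_value[OF F(1) u(3) v] by (simp add: ne algebra_simps)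
        show "2 * ?x2 * ?b2 + ?x3 * ?b3 = 0"
          using z[OF u(4)] unfolding functional_value[OF F(1) u(4) v] by (simp add: ne algebra_simps)
      qed
      \<comment> \<open>Eliminating \<open>?x1\<close> from \<open>p\<close> and \<open>r\<close>
        leaves the Gram determinant as factor of \<open>?x3\<close>.\<close>
      have "?x3 * (4 * ?b1 * ?b2 - ?b3 ^ 2) = 2 * ?b1 * (?x1 * ?b3 + 2 * ?x3 * ?b2) - ?b3 * (2 * ?x1 * ?b1 + ?x3 * ?b3)"
        by (simp add: algebra_simps power2_eq_square)
      then have x3: "?x3 = 0" unfolding p r using D by simp
      have x1: "?x1 = 0" using p x3 b1 by simp
      have "?x2 = 0"
      proof (rule ccontr)
        assume "?x2 \<noteq> 0"
        then have "?b3 = 0" "?b2 = 0" using q s x3 by auto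
        then show False using D by simp
      qed
      then show "v = 0" using vsym_expand[OF v] x1 x3 by simp
    qed
    show "A \<in> ?Q' F \<longleftrightarrow> (\<forall>v\<in>vsym n c. F (dbl n (A * v)) = 0)" if A: "A \<in> gtop n a c" for A
      unfolding values_vanish_iff[OF F(1) A] Q'
    proof (intro iffI)
      assume "A \<in> gtop n a c \<and> (\<exists>r. ent A x x = r * ?b3 \<and> ent A x y = r * (2 * ?b2) \<and> ent A y x = r * - (2 * ?b1) \<and> ent A y y = r * - ?b3)"
      then obtain r where r: "ent A x x = r * ?b3" "ent A x y = r * (2 * ?b2)" "ent A y x = r * - (2 * ?b1)" "ent A y y = r * - ?b3" by blast
      show "2 * ent A x x * ?b1 + ent A y x * ?b3 = 0 \<and> 2 * ent A y y * ?b2 + ent A x y * ?b3 = 0 \<and>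
        (ent A x x + ent A y y) * ?b3 + 2 * ent A y x * ?b2 + 2 * ent A x y * ?b1 = 0"
        unfolding r by (simp add: algebra_simps)
    next
      let ?p = "ent A x x" and ?q = "ent A x y" and ?r = "ent A y x" and ?s = "ent A y y"
      assume "2 * ?p * ?b1 + ?r * ?b3 = 0 \<and> 2 * ?s * ?b2 + ?q * ?b3 = 0 \<and> (?p + ?s) * ?b3 + 2 * ?r * ?b2 + 2 * ?q * ?b1 = 0"
      then have e: "2 * ?p * ?b1 + ?r * ?b3 = 0" "2 * ?s * ?b2 + ?q * ?b3 = 0" "(?p + ?s) * ?b3 + 2 * ?r * ?b2 + 2 * ?q * ?b1 = 0" by auto
      \<comment> \<open>The multiple of \<open>t F\<close> is read off at the entry
        \<open>(y, x)\<close>; the deviations \<open>?u\<close> and \<open>?w\<close> of the other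
        entries then solve a homogeneous system with the Gram determinant.\<close>
      define \<rho> where "\<rho> = - ?r / (2 * ?b1)"
      have r: "?r = \<rho> * - (2 * ?b1)" unfolding \<rho>_def using b1 by simp
      have "2 * ?b1 * (?p - \<rho> * ?b3) = 0" using e(1) unfolding r by (simp add: algebra_simps)
      then have p: "?p = \<rho> * ?b3" using b1 by simp
      let ?u = "?q - \<rho> * (2 * ?b2)" and ?w = "?s - \<rho> * - ?b3"
      have u: "2 * ?u * ?b1 + ?w * ?b3 = 0" using e(3) unfolding r p by (simp add: algebra_simps)
      have w: "?u * ?b3 + 2 * ?w * ?b2 = 0" using e(2) by (simp add: algebra_simps)
      have "?u * (4 * ?b1 * ?b2 - ?b3 ^ 2) = 2 * ?b2 * (2 * ?u * ?b1 + ?w * ?b3) - ?b3 * (?u * ?b3 + 2 * ?w * ?b2)"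
        by (simp add: algebra_simps power2_eq_square)
      then have u0: "?u = 0" unfolding u w using D by simp
 have "?w = 0"
      proof (rule ccontr)
        assume "?w \<noteq> 0"
        then have "?b3 = 0" "?b2 = 0" using u w unfolding u0 by auto
        then show False using D by simp
      qed
      then show "A \<in> gtop n a c \<and> (\<exists>r. ?p = r * ?b3 \<and> ?q = r * (2 * ?b2) \<and> ?r = r * - (2 * ?b1) \<and> ?s = r * - ?b3)"
        using A p r u0 by (intro conjI exI[of _ \<rho>]) (simp_all add: eq_neg_iff_add_eq_0)
    qed
  qed
  have ind: "index_is (?Q' F) (gcd (a + 2) (n - 2 - a) - 1)" if "F S1 \<noteq> 0" for F
  proof -
    have "index_is (?Q' F) (gcd (a + 2) (card {a..<c}) - 1)"
      by (rule index_galg_pair[OF _ _ _ arith(7) tb]) (use an that ent_t in auto)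
    then show ?thesis by simp
  qed
  show ?thesis
  proof (rule index_is_generic[OF subspace_swf fin_dim_swf, where P = ?P])
    show "\<exists>g. linfun g \<and> finite {s. \<not> (f S1 + s * g S1 \<noteq> 0 \<and> 4 * (f S1 + s * g S1) * (f S2 + s * g S2) - (f S3 + s * g S3) ^ 2 \<noteq> 0)}"
      for f :: "'a fmat \<Rightarrow> 'a"
    proof -
      obtain g :: "'a fmat \<Rightarrow> 'a" where g: "linfun g" "g S1 = 1" "g S2 = 1" "g S3 = 0"
        by (rule functionals[OF linfun_tr]) blast
      \<comment> \<open>The Gram determinant along the line through \<open>f\<close> in direction
        \<open>g\<close>, a polynomial in \<open>s\<close> with leading coefficient 4.\<close>
      let ?q = "[:4 * f S1 * f S2 - f S3 ^ 2, 4 * (f S1 + f S2), 4:]"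
      have "poly ?q s = 4 * (f S1 + s * g S1) * (f S2 + s * g S2) - (f S3 + s * g S3) ^ 2" for s
        unfolding g by (simp add: algebra_simps power2_eq_square)
      moreover have "finite {s. poly ?q s = 0}" by (rule poly_roots_finite) simp
      ultimately have "finite ({s. 4 * (f S1 + s * g S1) * (f S2 + s * g S2) - (f S3 + s * g S3) ^ 2 = 0} \<union> {- f S1})" by simp
      moreover have "{s. \<not> (f S1 + s * g S1 \<noteq> 0 \<and> 4 * (f S1 + s * g S1) * (f S2 + s * g S2) - (f S3 + s * g S3) ^ 2 \<noteq> 0)}
        \<subseteq> {s. 4 * (f S1 + s * g S1) * (f S2 + s * g S2) - (f S3 + s * g S3) ^ 2 = 0} \<union> {- f S1}"
        unfolding g by (auto simp: add_eq_0_iff)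
      ultimately show ?thesis using g(1) finite_subset by blast
    qed
    show "gcd (a + 2) (n - 2 - a) - 1 \<le> fs.dim (rad ?Q F)" if "linfun F" "?P F" for F
    proof -
      have l: "linfun (\<lambda>x. F (dbl n x))" by (rule linfun_dbl[OF that(1)])
      have "gcd (a + 2) (n - 2 - a) - 1 \<le> fs.dim (rad (?Q' F) (\<lambda>x. F (dbl n x)))"
        using ind[of F] that(2) l unfolding index_is_def by blast
      then show ?thesis unfolding red[OF that l refl] .
    qed
    \<comment> \<open>\<open>t\<close> sees only the values on the basis of the corner. The
      coordinate functional therefore fixes the reduced algebra, and with it \<open>f'\<close>,
      before the functional \<open>F\<close> built from \<open>f'\<close> is available.\<close>
    have "index_is (galg a {x, y} {a..<c} (t (\<lambda>X. ent X x (n + 1) + ent X y n))) (gcd (a + 2) (n - 2 - a) - 1)"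
      by (rule ind) (use arith(7) in \<open>simp add: S1_def\<close>)
    moreover have t0: "t (\<lambda>X. ent X x (n + 1) + ent X y n) = t F" if "F S1 = 1" "F S2 = 1" "F S3 = 0" for F
      unfolding t_def that using arith(7) by (simp add: S1_def S2_def S3_def)
    ultimately obtain f' where f': "linfun f'"
      "fs.dim (rad (galg a {x, y} {a..<c} (t (\<lambda>X. ent X x (n + 1) + ent X y n))) f') = gcd (a + 2) (n - 2 - a) - 1"
      unfolding index_is_def by blast
    obtain F where F: "linfun F" "\<And>A. A \<in> block {..<n} {..<n} \<Longrightarrow> F (dbl n A) = f' A" "F S1 = 1" "F S2 = 1" "F S3 = 0"
      by (rule functionals[OF f'(1)]) blast
    have "fs.dim (rad ?Q F) = fs.dim (rad (?Q' F) f')"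
      by (rule red[OF F(1) _ f'(1) F(2)]) (use F in auto)
    then show "\<exists>F. linfun F \<and> fs.dim (rad ?Q F) = gcd (a + 2) (n - 2 - a) - 1"
      using f'(2) F(1) unfolding t0[OF F(3-5)] by auto
  qed
qed

text \<open>With \<open>a = n - 1\<close> the break \<open>a\<close> separates \<open>x\<close> from
  \<open>y\<close> and clears the entry at \<open>(y, x)\<close>, so no rotation of the form is
  left. The other three entries vanish, and with them the last row and the last two columns; what
  remains is the algebra of \<open>index_zero_last_column\<close> for \<open>n - 1\<close>.\<close>

lemma index_swf_minus_two_narrow:
  fixes n a :: nat
  assumes n2: "2 \<le> n" and an: "a = n - 1"
  shows "index_is (swf n a (n - 2) :: 'a::field_char_0 fmat set) 0"
proof -
  interpret sp_seaweed_two n a by unfold_locales (use n2 an in auto)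
  let ?Q = "swf n a c :: 'a fmat set" and ?Q' = "block {..<n - 1} {..<n - 2} :: 'a fmat set"
  have yx: "ent A y x = 0" if "A \<in> gtop n a c" for A :: "'a fmat"
  proof -
    have "x < a" "a \<le> y" using n2 an by auto
    then show ?thesis using that unfolding gtop_def by blast
  qed
  have units: "munit x x \<in> (gtop n a c :: 'a fmat set)" "munit x y \<in> (gtop n a c :: 'a fmat set)" "munit y y \<in> (gtop n a c :: 'a fmat set)"
    using n2 an by (auto intro!: munit_gtop)
  have "index_is (block {..<n - 1} {..<n - 1 - 1} :: 'a fmat set) 0" by (rule index_zero_last_column)
  moreover have "n - 1 - 1 = n - 2" by simp
  ultimately obtain f' where f': "linfun f'" "fs.dim (rad ?Q' f') = 0"
    unfolding index_is_def by auto
  obtain F where F: "linfun F" "\<And>A. A \<in> block {..<n} {..<n} \<Longrightarrow> F (dbl n A) = f' A" "F S1 = 1" "F S2 = 1" "F S3 = 0"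
    by (rule functionals[OF f'(1)]) blast
  have "fs.dim (rad ?Q F) = fs.dim (rad ?Q' f')"
  proof (rule reduction[OF F(1) subspace_block _ _ _ f'(1) F(2)])
    show sub: "?Q' \<subseteq> gtop n a c" using n2 an unfolding gtop_def block_def by fastforce
    show "v = 0" if v: "v \<in> vsym n c" and z: "\<And>A. A \<in> gtop n a c \<Longrightarrow> F (dbl n (A * v)) = 0" for v
    proof -
      have "ent v x (n + 1) = 0" "ent v x n = 0" "ent v y n = 0"
        using z[OF units(1)] z[OF units(2)] z[OF units(3)] functional_value[OF F(1) units(1) v]
          functional_value[OF F(1) units(2) v] functional_value[OF F(1) units(3) v] arith(7)
        unfolding F by simp_all
      then show "v = 0" using vsym_expand[OF v] by simp
    qed
    show "A \<in> ?Q' \<longleftrightarrow> (\<forall>v\<in>vsym n c. F (dbl n (A * v)) = 0)" if A: "A \<in> gtop n a c" for A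
    proof -
      have "(\<forall>v\<in>vsym n c. F (dbl n (A * v)) = 0) \<longleftrightarrow> ent A x x = 0 \<and> ent A y y = 0 \<and> ent A x y = 0"
        unfolding values_vanish_iff[OF F(1) A] F yx[OF A] by auto
      moreover have "A \<in> ?Q' \<longleftrightarrow> ent A x x = 0 \<and> ent A y y = 0 \<and> ent A x y = 0"
      proof
        assume "A \<in> ?Q'"
        then show "ent A x x = 0 \<and> ent A y y = 0 \<and> ent A x y = 0" using block_zero_entry[of A] n by simp
      next
        assume z: "ent A x x = 0 \<and> ent A y y = 0 \<and> ent A x y = 0"
        show "A \<in> ?Q'"
        proof (rule blockI)
          fix i j assume nz: "ent A i j \<noteq> 0"
          then have ij: "i < n" "j < n" "\<not> (j < a \<and> a \<le> i)" "\<not> (i < c \<and> c \<le> j)"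
            using A unfolding gtop_def block_def by auto
          have no: "\<not> (i = x \<and> j = x)" "\<not> (i = y \<and> j = y)" "\<not> (i = x \<and> j = y)" "\<not> (i = y \<and> j = x)"
            using nz z yx[OF A] by auto
          consider "i < x" | "i = x" | "i = y" using ij(1) n2 by linarith
          then have "i < y \<and> j < x"
          proof cases
            case 1
            then show ?thesis using ij(4) by simp
          next
            case 2
            then have "j \<noteq> x" "j \<noteq> y" using no by auto
            then show ?thesis using 2 ij(2) n2 by linarith
          next
            case 3
            then have "j \<noteq> y" using no by auto
            then show ?thesis using 3 ij(2,3) an n2 by linarith
          qed
          then show "i \<in> {..<n - 1} \<and> j \<in> {..<n - 2}" by simp
        qed
      qed
      ultimately show ?thesis by simp
    qed
  qed
  then show ?thesis unfolding index_is_def using f'(2) F(1) by auto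
qed

section \<open>Parabolic subalgebras\<close>

text \<open>A root vector for \<open>p \<noteq> q\<close> and a Cartan element for
  \<open>p = q\<close>. For a long root \<open>q\<close> is the mirror image of \<open>p\<close>,
  the two summands coincide and the vector is twice a matrix unit.\<close>

definition root_vec :: "nat \<Rightarrow> nat \<Rightarrow> nat \<Rightarrow> 'a::field fmat" where
  "root_vec n p q = dbl n (munit p q)"

abbreviation mir :: "nat \<Rightarrow> nat \<Rightarrow> nat" where "mir n i \<equiv> 2 * n - 1 - i"

lemma mir_mir: "i < 2 * n \<Longrightarrow> mir n (mir n i) = i" by auto

lemma mir_less: "i < 2 * n \<Longrightarrow> mir n i < 2 * n" by auto

lemma sgn_mir: "i < 2 * n \<Longrightarrow> sgn_sp n (mir n i) = - sgn_sp n i"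
  using sgn_sp_mirror[of i n] by simp

lemma root_vec_eq: "p < 2 * n \<Longrightarrow> q < 2 * n \<Longrightarrow>
  root_vec n p q = munit p q - sc (sgn_sp n p * sgn_sp n q) (munit (mir n q) (mir n p))"
  unfolding root_vec_def dbl_def by (simp add: spt_munit)

lemma root_vec_mirror:
  assumes "p < 2 * n" "q < 2 * n"
  shows "root_vec n (mir n q) (mir n p) = sc (- (sgn_sp n p * sgn_sp n q)) (root_vec n p q)"
  unfolding root_vec_eq[OF assms] root_vec_eq[OF mir_less[OF assms(2)] mir_less[OF assms(1)]]
  unfolding mir_mir[OF assms(1)] mir_mir[OF assms(2)] sgn_mir[OF assms(1)] sgn_mir[OF assms(2)]
  by (rule fmat_eqI) (auto simp: algebra_simps)

lemma spf_D:
  assumes "X \<in> spf n"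
  shows "X \<in> block {..<2 * n} {..<2 * n}" "spt n X = - X"
    "i < 2 * n \<Longrightarrow> j < 2 * n \<Longrightarrow> ent X (mir n j) (mir n i) = - (sgn_sp n i * sgn_sp n j * ent X i j)"
proof -
  show b: "X \<in> block {..<2 * n} {..<2 * n}" and s: "spt n X = - X" using assms unfolding spf_def by auto
  show "ent X (mir n j) (mir n i) = - (sgn_sp n i * sgn_sp n j * ent X i j)" if "i < 2 * n" "j < 2 * n"
  proof -
    have "- ent X i j = sgn_sp n i * sgn_sp n j * ent X (mir n j) (mir n i)"
      using ent_spt[of n X i j] that unfolding s by simp
    then have "ent X i j = - (sgn_sp n i * sgn_sp n j * ent X (mir n j) (mir n i))"
      by (metis minus_minus)
    then show ?thesis by (simp add: mult.assoc mult.left_commute[of "sgn_sp n j"])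
  qed
qed

lemma dbl_spf: "X \<in> spf n \<Longrightarrow> dbl n X = sc 2 X"
  unfolding dbl_def using spf_D(2)[of X n] by (auto intro!: fmat_eqI)

lemma root_vec_spf: assumes "p < 2 * n" "q < 2 * n" shows "root_vec n p q \<in> spf n"
proof -
  have b: "munit p q \<in> block {..<2 * n} {..<2 * n}" using assms by simp
  have "spt n (munit p q) \<in> block {..<2 * n} {..<2 * n}"
    by (rule blockI) (auto simp: ent_spt split: if_splits)
  then show ?thesis unfolding root_vec_def dbl_def spf_def using b by (auto simp: spt_linear spt_spt[OF b])
qed

lemma bracket_dbl:
  assumes A: "A \<in> block {..<2 * n} {..<2 * n}" and Y: "Y \<in> spf n"
  shows "dbl n A * Y - Y * dbl n A = dbl n (A * Y - Y * A)"
proof -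
  have "spt n (A * Y) = spt n Y * spt n A" "spt n (Y * A) = spt n A * spt n Y"
    using spt_mult[OF A] spt_mult[OF spf_D(1)[OF Y]] by auto
  then show ?thesis unfolding dbl_def by (simp add: spt_linear spf_D(2)[OF Y] algebra_simps)
qed

text \<open>The mirror coincidences \<open>j = mir n k\<close> and \<open>mir n j = i\<close> only
  add further copies of the same vector with the same sign, so the structure constant is a positive
  integer.\<close>

lemma bracket_root_vec:
  assumes ijk: "i < 2 * n" "j < 2 * n" "k < 2 * n" "i \<noteq> k"
  obtains c :: "'a::field_char_0" where "c \<noteq> 0"
    "root_vec n i j * root_vec n j k - root_vec n j k * root_vec n i j = sc c (root_vec n i k)"
proof -
  let ?s = "sgn_sp n j * sgn_sp n k :: 'a"
  have b: "munit i j \<in> block {..<2 * n} {..<2 * n}" using ijk by simp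
  have "root_vec n i j * root_vec n j k - root_vec n j k * root_vec n i j
    = dbl n (munit i j * root_vec n j k - root_vec n j k * (munit i j :: 'a fmat))"
    unfolding root_vec_def[of n i j] by (rule bracket_dbl[OF b root_vec_spf[OF ijk(2,3)]])
  also have "munit i j * root_vec n j k - root_vec n j k * (munit i j :: 'a fmat) =
    munit i k - (if j = mir n k then sc ?s (munit i (mir n j)) else 0) + (if mir n j = i then sc ?s (munit (mir n k) j) else 0)"
  proof -
    have "munit i j * root_vec n j k = munit i k - (if j = mir n k then sc ?s (munit i (mir n j)) else 0)"
      unfolding root_vec_eq[OF ijk(2,3)] right_diff_distrib sc_mult_right munit_mult by simp
    moreover have "root_vec n j k * munit i j = - (if mir n j = i then sc ?s (munit (mir n k) j) else 0 :: 'a fmat)"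
      unfolding root_vec_eq[OF ijk(2,3)] left_diff_distrib sc_mult_left munit_mult using ijk(4) by simp
    ultimately show ?thesis by simp
  qed
  also have "dbl n \<dots> = sc (1 + (if j = mir n k then 1 else 0) + (if mir n j = i then 1 else 0)) (root_vec n i k)"
  proof -
    have 1: "sc ?s (root_vec n i (mir n j)) = - root_vec n i k" if "j = mir n k"
    proof -
      have "mir n j = k" "?s = - 1" using that mir_mir[OF ijk(3)] sgn_mir[OF ijk(3), where ?'a = 'a] by auto
      then show ?thesis by (auto intro!: fmat_eqI)
    qed
    have 2: "sc ?s (root_vec n (mir n k) j) = root_vec n i k" if "mir n j = i"
    proof -
      have j: "j = mir n i" using that mir_mir[OF ijk(2)] by auto
      have s: "sgn_sp n j = (- sgn_sp n i :: 'a)" unfolding j by (rule sgn_mir[OF ijk(1)])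
      show ?thesis unfolding j[symmetric] s unfolding j root_vec_mirror[OF ijk(1,3)]
        by (simp add: algebra_simps)
    qed
    show ?thesis unfolding dbl_linear
      using 1 2 by (auto simp: root_vec_def[symmetric] dbl_linear fs.scale_left_distrib)
  qed
  finally show ?thesis
    by (rule that[rotated]) auto
qed

lemma subspace_sc_iff:
  assumes "fs.subspace L" "c \<noteq> 0"
  shows "sc c X \<in> L \<longleftrightarrow> X \<in> L"
proof
  assume "sc c X \<in> L"
  then have "sc (inverse c) (sc c X) \<in> L" by (rule fs.subspace_scale[OF assms(1)])
  then show "X \<in> L" using assms(2) by simp
qed (rule fs.subspace_scale[OF assms(1)])

section \<open>Root components and subalgebras containing a Borel subalgebra\<close>

definition sub_lie :: "nat \<Rightarrow> 'a::field fmat set \<Rightarrow> bool" where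
  "sub_lie n L \<longleftrightarrow> fs.subspace L \<and> L \<subseteq> spf n \<and> (\<forall>x\<in>L. \<forall>y\<in>L. x * y - y * x \<in> L)"

text \<open>The coefficient of the \<open>k\<close>-th coordinate functional, counted from 0, in the
  weight of the \<open>i\<close>-th basis vector.\<close>

definition weight :: "nat \<Rightarrow> nat \<Rightarrow> nat \<Rightarrow> int" where
  "weight n k i = (if i = k then 1 else 0) - (if i = mir n k then 1 else 0)"

lemma weight_eq:
  assumes "i < 2 * n" "k < n"
  shows "weight n k i = (if min i (mir n i) = k then (if i < n then 1 else - 1) else 0)"
  unfolding weight_def min_def using assms by auto

text \<open>A root of type C is a difference of two signed coordinate functionals and fixes the pair
  up to the mirror map; this is why root spaces are lines.\<close>

lemma weights_determine_entry:
  assumes l: "i < 2 * n" "j < 2 * n" "p < 2 * n" "q < 2 * n" and pq: "p \<noteq> q"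
    and w: "\<And>k. k < n \<Longrightarrow> weight n k i - weight n k j = weight n k p - weight n k q"
  shows "i = p \<and> j = q \<or> i = mir n q \<and> j = mir n p"
proof -
  \<comment> \<open>\<open>u\<close> is the absolute coordinate of an index and \<open>s\<close>
    below its sign; together they determine the index.\<close>
  define u :: "nat \<Rightarrow> nat" where "u i = min i (mir n i)" for i
  define s :: "nat \<Rightarrow> int" where "s i = (if i < n then 1 else - 1)" for i
  have u: "u i < n" if "i < 2 * n" for i using that unfolding u_def min_def by auto
  have inj: "i = i'" if "i < 2 * n" "i' < 2 * n" "u i = u i'" "s i = s i'" for i i'
    using that unfolding u_def s_def min_def by (auto split: if_splits)
  have opp: "i = mir n i'" if "i < 2 * n" "i' < 2 * n" "u i = u i'" "s i \<noteq> s i'" for i i'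
    using that unfolding u_def s_def min_def by (auto split: if_splits)
  have s: "s i = 1 \<or> s i = - 1" for i unfolding s_def by auto
  have W: "(if u i = k then s i else 0) - (if u j = k then s j else 0) = (if u p = k then s p else 0) - (if u q = k then s q else 0)"
    if "k < n" for k
    using w[OF that] unfolding weight_eq[OF l(1) that] weight_eq[OF l(2) that] weight_eq[OF l(3) that] weight_eq[OF l(4) that]
      u_def s_def .
  show ?thesis
  proof (cases "u p = u q")
    case True
    \<comment> \<open>Distinct indices with the same coordinate are mirror images: the case of a
      long root.\<close>
    have sq: "s q = - s p" using inj[OF l(3,4) True] pq s[of p] s[of q] by auto
    have "(if u i = u p then s i else 0) - (if u j = u p then s j else 0) = 2 * s p"
      using W[OF u[OF l(3)]] True sq by simp
    then have "u i = u p \<and> s i = s p \<and> u j = u p \<and> s j = - s p"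
      using s[of i] s[of j] s[of p] by (auto split: if_splits)
    then show ?thesis using inj[OF l(1,3)] inj[OF l(2,4)] True sq by auto
  next
    case False
    have 1: "(if u i = u p then s i else 0) - (if u j = u p then s j else 0) = s p"
      using W[OF u[OF l(3)]] False by simp
    have 2: "(if u i = u q then s i else 0) - (if u j = u q then s j else 0) = - s q"
      using W[OF u[OF l(4)]] False by simp
    have a: "u i = u p \<and> s i = s p \<or> u j = u p \<and> s j = - s p"
      using 1 s[of i] s[of j] s[of p] by (auto split: if_splits)
    have b: "u j = u q \<and> s j = s q \<or> u i = u q \<and> s i = - s q"
      using 2 s[of i] s[of j] s[of q] by (auto split: if_splits)
    have ne: "- s p \<noteq> s p" "- s q \<noteq> s q" using s[of p] s[of q] by auto
    from a show ?thesis
    proof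
      assume i: "u i = u p \<and> s i = s p"
      then have "u j = u q \<and> s j = s q" using b False by metis
      then show ?thesis using i inj[OF l(1,3)] inj[OF l(2,4)] by blast
    next
      assume j: "u j = u p \<and> s j = - s p"
      then have i: "u i = u q \<and> s i = - s q" using b False by metis
      have "j = mir n p" by (rule opp[OF l(2,3)]) (use j ne in simp_all)
      moreover have "i = mir n q" by (rule opp[OF l(1,4)]) (use i ne in simp_all)
      ultimately show ?thesis by blast
    qed
  qed
qed

lemma bracket_cartan:
  assumes "X \<in> spf n" "k < n"
  shows "ent (root_vec n k k * X - X * root_vec n k k) i j = of_int (weight n k i - weight n k j) * ent X i j"
proof -
  have k: "k < 2 * n" using assms by simp
  have e: "root_vec n k k = munit k k - munit (mir n k) (mir n k)"
    unfolding root_vec_eq[OF k k] by (auto intro!: fmat_eqI)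
  show ?thesis
    unfolding e by (simp add: left_diff_distrib right_diff_distrib ent_munit_mult ent_mult_munit weight_def)
qed

lemma spf_two_entries:
  fixes X :: "'a::field_char_0 fmat"
  assumes X: "X \<in> spf n" and pq: "p < 2 * n" "q < 2 * n"
    and z: "\<And>i j. ent X i j \<noteq> 0 \<Longrightarrow> i = p \<and> j = q \<or> i = mir n q \<and> j = mir n p"
  shows "\<exists>c. X = sc c (root_vec n p q) \<and> (ent X p q \<noteq> 0 \<longrightarrow> c \<noteq> 0)"
proof -
  let ?s = "sgn_sp n p * sgn_sp n q :: 'a"
  have m: "ent X (mir n q) (mir n p) = - (?s * ent X p q)" by (rule spf_D(3)[OF X pq])
  have s: "?s = 1 \<or> ?s = - 1" unfolding sgn_sp_def by auto
  \<comment> \<open>On the antidiagonal the two positions coincide and \<open>root_vec\<close> has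
    the entry 2 there.\<close>
  define c where "c = (if p = mir n q \<and> q = mir n p then ent X p q / 2 else ent X p q)"
  have "X = sc c (root_vec n p q)"
  proof (rule fmat_eqI)
    fix i j
    show "ent X i j = ent (sc c (root_vec n p q)) i j"
    proof (cases "p = mir n q \<and> q = mir n p")
      case True
      have "sgn_sp n p = (- sgn_sp n q :: 'a)" using True sgn_mir[OF pq(2), where ?'a = 'a] by metis
      then have "?s = - 1" by simp
      moreover have mm: "mir n q = p" "mir n p = q"
        by (rule True[THEN conjunct1, symmetric], rule True[THEN conjunct2, symmetric])
      ultimately have "ent (root_vec n p q :: 'a fmat) i j = (if i = p \<and> j = q then 2 else 0)"
        unfolding root_vec_eq[OF pq] mm by simp
      moreover have "ent X i j = 0" if "\<not> (i = p \<and> j = q)" using z[of i j] that unfolding mm by blast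
      moreover have "c = ent X p q / 2" unfolding c_def by (rule if_P[OF True])
      ultimately show ?thesis by simp
    next
      case False
      show ?thesis
      proof (cases "i = p \<and> j = q \<or> i = mir n q \<and> j = mir n p")
        case True
        have c: "c = ent X p q" unfolding c_def using False by (rule if_not_P)
        show ?thesis
        proof (cases "i = p \<and> j = q")
          case True
          then have "\<not> (i = mir n q \<and> j = mir n p)"
            using \<open>\<not> (p = mir n q \<and> q = mir n p)\<close> by (elim conjE) (rule notI, elim conjE, metis)
          then have "ent (root_vec n p q :: 'a fmat) i j = 1"
            unfolding root_vec_eq[OF pq] ent_minus ent_sc ent_munit if_P[OF True] by (simp only: if_False) simp
          then show ?thesis using True c by simp
        next
          case False
          then have ij: "i = mir n q \<and> j = mir n p" using True by blast
          have "ent (root_vec n p q :: 'a fmat) i j = - ?s"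
            unfolding root_vec_eq[OF pq] ent_minus ent_sc ent_munit if_not_P[OF False] if_P[OF ij] by simp
          then show ?thesis using m c unfolding ij[THEN conjunct1] ij[THEN conjunct2] by simp
        qed
      next
        case False
        then have "ent X i j = 0" using z by blast
        moreover have n1: "\<not> (i = p \<and> j = q)" and n2: "\<not> (i = mir n q \<and> j = mir n p)" using False by blast+
        have "ent (root_vec n p q :: 'a fmat) i j = 0"
          unfolding root_vec_eq[OF pq] ent_minus ent_sc ent_munit if_not_P[OF n1] if_not_P[OF n2] by simp
        ultimately show ?thesis by simp
      qed
    qed
  qed
  moreover have "c = ent X p q \<or> c = ent X p q / 2"
  proof -
    have "(if P then x else y) = y \<or> (if P then x else y) = x" for P and x y :: 'a by simp
    then show ?thesis unfolding c_def by this
  qed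
  then have "ent X p q \<noteq> 0 \<longrightarrow> c \<noteq> 0" by auto
  ultimately show ?thesis by blast
qed

text \<open>Lagrange interpolation in the commuting operators \<open>ad H\<^sub>k\<close> isolates root components.\<close>

lemma sub_lie_root_vec:
  fixes X :: "'a::field_char_0 fmat"
  assumes L: "sub_lie n L" and H: "\<And>k. k < n \<Longrightarrow> root_vec n k k \<in> L"
    and X: "X \<in> L" "ent X p q \<noteq> 0" and pq: "p \<noteq> q"
  shows "root_vec n p q \<in> L"
proof -
  have sub: "fs.subspace L" and LS: "L \<subseteq> spf n" and cl: "\<And>x y. x \<in> L \<Longrightarrow> y \<in> L \<Longrightarrow> x * y - y * x \<in> L"
    using L unfolding sub_lie_def by auto
  have l: "p < 2 * n" "q < 2 * n" using X LS spf_D(1)[of X n] unfolding block_def by auto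
  \<comment> \<open>Pairs of a coordinate and a value that the wanted root does not take there.
    Coordinates of differences of weights lie between -2 and 2, so the product over \<open>S\<close>
    is nonzero at the entry \<open>(p, q)\<close> and zero at every entry of a different
    weight.\<close>
  define S where "S = (SIGMA k:{..<n}. {- 2, - 1, 0, 1, 2} - {weight n k p - weight n k q})"
  have finS: "finite S" unfolding S_def by auto
  let ?g = "\<lambda>i j (k, s). of_int (weight n k i - weight n k j - s) :: 'a"
  have "\<exists>Y\<in>L. \<forall>i j. ent Y i j = prod (?g i j) R * ent X i j" if "finite R" "R \<subseteq> S" for R
    using that
  proof (induction R)
    case empty
    then show ?case using X(1) by (intro bexI[of _ X]) auto
  next
    case (insert ks R)
    obtain k s where ks: "ks = (k, s)" by (cases ks)
    then have k: "k < n" using insert.prems unfolding S_def by auto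
    obtain Y where Y: "Y \<in> L" "\<And>i j. ent Y i j = prod (?g i j) R * ent X i j" using insert by auto
    let ?Y = "root_vec n k k * Y - Y * root_vec n k k - sc (of_int s) Y"
    have "?Y \<in> L" by (rule fs.subspace_diff[OF sub cl[OF H[OF k] Y(1)] fs.subspace_scale[OF sub Y(1)]])
    moreover have "ent ?Y i j = prod (?g i j) (insert ks R) * ent X i j" for i j
      using bracket_cartan[of Y n k i j] Y LS k insert.hyps unfolding ks by (simp add: algebra_simps subset_iff)
    ultimately show ?case by blast
  qed
  then obtain Y where Y: "Y \<in> L" "\<And>i j. ent Y i j = prod (?g i j) S * ent X i j"
    using finS by blast
  have nz: "ent Y p q \<noteq> 0"
  proof -
    have "?g p q ks \<noteq> 0" if "ks \<in> S" for ks
      using that unfolding S_def by (auto simp del: of_int_diff)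
    then show ?thesis unfolding Y(2) using X(2) finS by (simp add: prod_zero_iff)
  qed
  have "i = p \<and> j = q \<or> i = mir n q \<and> j = mir n p" if e: "ent Y i j \<noteq> 0" for i j
  proof (rule weights_determine_entry[OF _ _ l pq])
    show ij: "i < 2 * n" "j < 2 * n" using e Y(1) LS spf_D(1)[of Y n] unfolding block_def by auto
    fix k assume k: "k < n"
    show "weight n k i - weight n k j = weight n k p - weight n k q"
    proof (rule ccontr)
      assume ne: "weight n k i - weight n k j \<noteq> weight n k p - weight n k q"
      have "weight n k i - weight n k j \<in> {- 2, - 1, 0, 1, 2}" unfolding weight_def by auto
      then have "(k, weight n k i - weight n k j) \<in> S" using ne k unfolding S_def by auto
      then have "prod (?g i j) S = 0" using finS by (force simp: prod_zero_iff)
      then show False using e unfolding Y(2) by simp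
    qed
  qed
  then obtain c where c: "Y = sc c (root_vec n p q)" "c \<noteq> 0"
    using spf_two_entries[of Y n p q] Y(1) LS l nz by blast
  then have "root_vec n p q = sc (inverse c) Y" by simp
  then show ?thesis using Y(1) sub fs.subspace_scale by simp
qed

text \<open>Preserves the flag with breaks \<open>R\<close> and their mirror images;
  \<open>R\<close> lists the simple roots whose negatives are missing.\<close>

definition parf :: "nat \<Rightarrow> nat set \<Rightarrow> 'a::field fmat set" where
  "parf n R = {X \<in> spf n. \<forall>i j. ent X i j \<noteq> 0 \<longrightarrow> \<not> crosses (R \<union> (\<lambda>r. 2 * n - r) ` R) i j}"

text \<open>\<open>L\<close> contains the Cartan subalgebra, so it contains the root vector of every
  entry that occurs in it. A lower root vector whose interval contains no break arises from simple
  ones by brackets; from one whose interval contains a break \<open>r\<close>, brackets with upper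
  root vectors would produce the simple one at \<open>r\<close>.\<close>

lemma parf_unique:
  fixes L :: "'a::field_char_0 fmat set"
  assumes L: "sub_lie n L" and R: "R \<subseteq> {1..n}"
    and B: "\<And>p q. p \<le> q \<Longrightarrow> q < 2 * n \<Longrightarrow> root_vec n p q \<in> L"
    and lo: "\<And>r. r \<in> {1..n} \<Longrightarrow> root_vec n r (r - 1) \<in> L \<longleftrightarrow> r \<notin> R"
  shows "L = parf n R"
proof -
  let ?R = "R \<union> (\<lambda>r. 2 * n - r) ` R"
  have sub: "fs.subspace L" and LS: "L \<subseteq> spf n" and cl: "\<And>x y. x \<in> L \<Longrightarrow> y \<in> L \<Longrightarrow> x * y - y * x \<in> L"
    using L unfolding sub_lie_def by auto
  have trans: "root_vec n i k \<in> L" if h: "root_vec n i j \<in> L" "root_vec n j k \<in> L" "i < 2 * n" "j < 2 * n" "k < 2 * n" "i \<noteq> k" for i j k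
  proof -
    obtain c :: 'a where "c \<noteq> 0" "root_vec n i j * root_vec n j k - root_vec n j k * root_vec n i j = sc c (root_vec n i k)"
      using bracket_root_vec[OF h(3-6)] by blast
    then show ?thesis using cl[OF h(1,2)] subspace_sc_iff[OF sub, of c] by simp
  qed
  \<comment> \<open>The simple lower root vectors beyond the middle are mirror images of those up to
    \<open>n\<close>.\<close>
  have lo2: "root_vec n r (r - 1) \<in> L \<longleftrightarrow> r \<notin> ?R" if r: "1 \<le> r" "r < 2 * n" for r
  proof (cases "r \<le> n")
    case True
    have "r \<in> ?R \<longleftrightarrow> r \<in> R"
    proof
      assume "r \<in> ?R"
      then consider "r \<in> R" | s where "s \<in> R" "r = 2 * n - s" by auto
      then show "r \<in> R"
      proof cases
        case 2
        then have "s \<le> n" using R by auto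
        then have "s = r" using 2 True r by linarith
        then show ?thesis using 2 by simp
      qed
    qed simp
    then show ?thesis using lo[of r] True r by auto
  next
    case False
    let ?r = "2 * n - r"
    have m: "mir n r = ?r - 1" "mir n (r - 1) = ?r" using r False by auto
    have "root_vec n ?r (?r - 1) = sc (- (sgn_sp n r * sgn_sp n (r - 1))) (root_vec n r (r - 1) :: 'a fmat)"
      using root_vec_mirror[of r n "r - 1", where ?'a = 'a] r unfolding m by simp
    moreover have nz: "- (sgn_sp n r * sgn_sp n (r - 1)) \<noteq> (0 :: 'a)" by simp
    ultimately have "root_vec n ?r (?r - 1) \<in> L \<longleftrightarrow> root_vec n r (r - 1) \<in> L"
      using subspace_sc_iff[OF sub nz] by simp
    moreover have "?r \<in> {1..n}" using False r by auto
    moreover have "r \<in> ?R \<longleftrightarrow> ?r \<in> R"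
    proof
      assume "r \<in> ?R"
      moreover have "r \<notin> R" using False R by auto
      ultimately obtain s where "s \<in> R" "r = 2 * n - s" by blast
      moreover from this have "s \<le> n" using R by auto
      ultimately show "?r \<in> R" by simp
    next
      assume "?r \<in> R"
      moreover have "r = 2 * n - ?r" using r by simp
      ultimately show "r \<in> ?R" by blast
    qed
    ultimately show ?thesis using lo[of ?r] by blast
  qed
  have low: "root_vec n p q \<in> L" if "q < p" "p < 2 * n" "\<not> crosses ?R p q" for p q
    using that
  proof (induction "p - q" arbitrary: p rule: less_induct)
    case less
    have p: "root_vec n p (p - 1) \<in> L"
      using lo2[of p] less.prems unfolding crosses_def by auto
    show ?case
    proof (cases "q = p - 1")
      case False
      then have q: "q < p - 1" using less.prems by auto
      have "\<not> crosses ?R (p - 1) q" using less.prems(3) unfolding crosses_def by auto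
      then have "root_vec n (p - 1) q \<in> L" using less.hyps[of "p - 1"] less.prems q by auto
      then show ?thesis using trans[OF p] less.prems by auto
    qed (use p in simp)
  qed
  show ?thesis
  proof (intro equalityI subsetI)
    fix X assume X: "X \<in> L"
    have "\<not> crosses ?R p q" if nz: "ent X p q \<noteq> 0" for p q
    proof
      assume "crosses ?R p q"
      then obtain r where r: "r \<in> ?R" "q < r" "r \<le> p" unfolding crosses_def by blast
      have l: "p < 2 * n" "q < 2 * n" using X LS nz spf_D(1)[of X n] unfolding block_def by auto
      have pq: "root_vec n p q \<in> L"
        by (rule sub_lie_root_vec[OF L _ X nz]) (use B r in auto)
      have "root_vec n r q \<in> L"
        using trans[OF B[of r p] pq] r l by (cases "r = p") (auto simp: pq)
      then have "root_vec n r (r - 1) \<in> L"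
        using trans[OF _ B[of q "r - 1"], of r] r l by (cases "q = r - 1") auto
      then show False using lo2[of r] r l by auto
    qed
    then show "X \<in> parf n R" using X LS unfolding parf_def by blast
  next
    fix X :: "'a fmat" assume X: "X \<in> parf n R"
    then have Xs: "X \<in> spf n" and cr: "\<And>i j. ent X i j \<noteq> 0 \<Longrightarrow> \<not> crosses ?R i j" unfolding parf_def by auto
    \<comment> \<open>An element of sp(2n) is half its image under \<open>dbl\<close>, and expanding
      the image splits it into root vectors.\<close>
    have "sc 2 X = dbl n (\<Sum>i<2 * n. \<Sum>j<2 * n. sc (ent X i j) (munit i j))"
      using block_decomp[OF spf_D(1)[OF Xs]] dbl_spf[OF Xs] by simp
    also have "\<dots> = (\<Sum>i<2 * n. \<Sum>j<2 * n. sc (ent X i j) (root_vec n i j))"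
    proof -
      interpret vector_space_pair "sc :: 'a \<Rightarrow> _" sc ..
      show ?thesis unfolding root_vec_def
        by (simp add: linear_sum[OF linear_dbl] dbl_linear)
    qed
    also have "\<dots> \<in> L"
    proof (intro fs.subspace_sum[OF sub])
      fix i j assume ij: "i \<in> {..<2 * n}" "j \<in> {..<2 * n}"
      show "sc (ent X i j) (root_vec n i j) \<in> L"
      proof (cases "ent X i j = 0")
        case False
        then have "root_vec n i j \<in> L"
          using cr[OF False] low[of j i] B[of i j] ij by (cases "i \<le> j") auto
        then show ?thesis by (rule fs.subspace_scale[OF sub])
      qed (simp add: fs.subspace_0[OF sub])
    qed
    finally have "sc (inverse 2) (sc 2 X) \<in> L" by (rule fs.subspace_scale[OF sub])
    then show "X \<in> L" by simp
  qed
qed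

lemma sub_lie_parf: "sub_lie n (parf n R :: 'a::field fmat set)"
  unfolding sub_lie_def
proof (intro conjI ballI)
  let ?R = "R \<union> (\<lambda>r. 2 * n - r) ` R"
  have e: "parf n R = spf n \<inter> {X :: 'a fmat. \<forall>i j. ent X i j \<noteq> 0 \<longrightarrow> \<not> crosses ?R i j}"
    unfolding parf_def by blast
  show sub: "fs.subspace (parf n R :: 'a fmat set)" unfolding e by (intro fs.subspace_inter subspace_spf subspace_pattern)
  show "parf n R \<subseteq> (spf n :: 'a fmat set)" unfolding parf_def by blast
  fix x y :: "'a fmat" assume x: "x \<in> parf n R" and y: "y \<in> parf n R"
  have m: "\<not> crosses ?R i j" if "x \<in> parf n R" "y \<in> parf n R" "ent (x * y) i j \<noteq> 0" for x y :: "'a fmat" and i j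
  proof -
    obtain l where l: "ent x i l \<noteq> 0" "ent y l j \<noteq> 0"
      by (rule ent_mult_nonzeroE[OF \<open>ent (x * y) i j \<noteq> 0\<close>])
    then have "\<not> crosses ?R i l" "\<not> crosses ?R l j" using that unfolding parf_def by auto
    \<comment> \<open>A break between \<open>j\<close> and \<open>i\<close> also lies between
      \<open>j\<close> and \<open>l\<close> or between \<open>l\<close> and
      \<open>i\<close>.\<close>
    then show ?thesis unfolding crosses_def by (meson not_le_imp_less)
  qed
  have xs: "x \<in> spf n" "y \<in> spf n" using x y unfolding parf_def by auto
  have "x * y - y * x \<in> spf n" unfolding spf_def
  proof (intro CollectI conjI)
    show "x * y - y * x \<in> block {..<2 * n} {..<2 * n}"
      using block_mult[OF spf_D(1)[OF xs(1)] spf_D(1)[OF xs(2)]] block_mult[OF spf_D(1)[OF xs(2)] spf_D(1)[OF xs(1)]] by blast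
    show "spt n (x * y - y * x) = - (x * y - y * x)"
      by (simp add: spt_linear spt_mult[OF spf_D(1)[OF xs(1)]] spt_mult[OF spf_D(1)[OF xs(2)]] spf_D(2)[OF xs(1)] spf_D(2)[OF xs(2)])
  qed
  moreover have "\<not> crosses ?R i j" if "ent (x * y - y * x) i j \<noteq> 0" for i j
  proof -
    have "ent (x * y) i j \<noteq> 0 \<or> ent (y * x) i j \<noteq> 0" using that by auto
    then show ?thesis using m[OF x y, of i j] m[OF y x, of i j] by blast
  qed
  ultimately show "x * y - y * x \<in> parf n R" unfolding parf_def by blast
qed

text \<open>The simple lower root vector occupies \<open>(r, r - 1)\<close> and its mirror position.
  These are crossed only by the breaks \<open>r\<close> and \<open>2 * n - r\<close>, and either of
  them is present exactly when \<open>r \<in> R\<close>.\<close>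

lemma root_vec_parf:
  assumes "r \<in> {1..n}" "R \<subseteq> {1..n}"
  shows "(root_vec n r (r - 1) :: 'a::field_char_0 fmat) \<in> parf n R \<longleftrightarrow> r \<notin> R"
proof -
  let ?R = "R \<union> (\<lambda>r. 2 * n - r) ` R"
  have l: "r < 2 * n" "r - 1 < 2 * n" using assms by auto
  have m: "mir n (r - 1) = 2 * n - r" "mir n r = 2 * n - r - 1" using assms by auto
  have s: "sgn_sp n r * sgn_sp n (r - 1) = (if r = n then - 1 else 1 :: 'a)" using assms unfolding sgn_sp_def by auto
  have nz: "ent (root_vec n r (r - 1) :: 'a fmat) r (r - 1) \<noteq> 0"
    unfolding root_vec_eq[OF l] m s using assms by auto
  have e: "i = r \<and> j = r - 1 \<or> i = 2 * n - r \<and> j = 2 * n - r - 1" if "ent (root_vec n r (r - 1) :: 'a fmat) i j \<noteq> 0" for i j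
    using that unfolding root_vec_eq[OF l] m by (auto split: if_splits)
  have mem: "r \<in> ?R \<longleftrightarrow> r \<in> R" "2 * n - r \<in> ?R \<longleftrightarrow> r \<in> R"
  proof -
    have *: "s = r" if "s \<in> R" "r = 2 * n - s" for s
    proof -
      have "s \<le> n" "r \<le> n" using that assms by auto
      then show ?thesis using that by linarith
    qed
    have **: "s = r" if "s \<in> R" "2 * n - r = 2 * n - s" for s
    proof -
      have "s \<le> n" "r \<le> n" using that assms by auto
      then show ?thesis using that by linarith
    qed
    have ***: "s = r" if "s \<in> R" "2 * n - r = s" for s
    proof -
      have "s \<le> n" "r \<le> n" using that assms by auto
      then show ?thesis using that by linarith
    qed
    show "r \<in> ?R \<longleftrightarrow> r \<in> R"
    proof
      assume "r \<in> ?R"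
      then consider "r \<in> R" | s where "s \<in> R" "r = 2 * n - s" by (elim UnE imageE)
      then show "r \<in> R" by cases (use * in metis)+
    qed simp
    show "2 * n - r \<in> ?R \<longleftrightarrow> r \<in> R"
    proof
      assume "2 * n - r \<in> ?R"
      then consider "2 * n - r \<in> R" | s where "s \<in> R" "2 * n - r = 2 * n - s" by (elim UnE imageE)
      then show "r \<in> R" by cases (use ** *** in metis)+
    qed simp
  qed
  have c: "crosses ?R i (i - 1) \<longleftrightarrow> i \<in> ?R" if "1 \<le> i" for i
  proof -
    have "i - 1 < k \<and> k \<le> i \<longleftrightarrow> k = i" for k using that by auto
    then show ?thesis unfolding crosses_def by simp
  qed
  show ?thesis
  proof
    assume "(root_vec n r (r - 1) :: 'a fmat) \<in> parf n R"
    then have "\<not> crosses ?R r (r - 1)" using nz unfolding parf_def by blast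
    then show "r \<notin> R" using c[of r] mem assms by auto
  next
    assume "r \<notin> R"
    moreover have "1 \<le> r" "1 \<le> 2 * n - r" using assms(1) l(1) unfolding atLeastAtMost_iff by linarith+
    ultimately have "\<not> crosses ?R r (r - 1)" "\<not> crosses ?R (2 * n - r) (2 * n - r - 1)"
      using c[of r] c[of "2 * n - r"] mem by blast+
    then show "(root_vec n r (r - 1) :: 'a fmat) \<in> parf n R"
      unfolding parf_def using root_vec_spf[OF l] e by blast
  qed
qed

section \<open>Matrices with carriers\<close>

definition conv :: "'a::field mat \<Rightarrow> 'a fmat" where
  "conv X = Abs_fmat (\<lambda>i j. if i < dim_row X \<and> j < dim_col X then X $$ (i, j) else 0)"

lemma ent_conv: "ent (conv X) i j = (if i < dim_row X \<and> j < dim_col X then X $$ (i, j) else 0)"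
  unfolding conv_def by (subst ent_Abs_fmat[of "max (dim_row X) (dim_col X)"]) auto

definition unconv :: "nat \<Rightarrow> 'a::field fmat \<Rightarrow> 'a mat" where
  "unconv m Z = mat m m (\<lambda>(i, j). ent Z i j)"

lemma unconv_carrier [simp]: "unconv m Z \<in> carrier_mat m m"
  unfolding unconv_def by simp

lemma conv_block: "X \<in> carrier_mat m m \<Longrightarrow> conv X \<in> block {..<m} {..<m}"
  by (rule blockI) (auto simp: ent_conv split: if_splits)

lemma unconv_conv: "X \<in> carrier_mat m m \<Longrightarrow> unconv m (conv X) = X"
  unfolding unconv_def by (rule eq_matI) (auto simp: ent_conv)

lemma conv_unconv: "Z \<in> block {..<m} {..<m} \<Longrightarrow> conv (unconv m Z) = Z"
  unfolding unconv_def by (rule fmat_eqI) (auto simp: ent_conv block_def)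

lemma conv_inj: "inj_on conv (carrier_mat m m)"
  by (rule inj_on_inverseI[of _ "unconv m"]) (rule unconv_conv)

lemma conv_arith:
  assumes "X \<in> carrier_mat m m" "Y \<in> carrier_mat m m"
  shows "conv (X + Y) = conv X + conv Y" "conv (X - Y) = conv X - conv Y" "conv (c \<cdot>\<^sub>m X) = sc c (conv X)"
    "conv (X * Y) = conv X * conv Y" "conv (commutator X Y) = conv X * conv Y - conv Y * conv X"
proof -
  have m: "conv (X * Y) = conv X * conv Y" if "X \<in> carrier_mat m m" "Y \<in> carrier_mat m m" for X Y :: "'a mat"
  proof (rule fmat_eqI)
    fix i j
    have "ent (conv X * conv Y) i j = (\<Sum>l<m. ent (conv X) i l * ent (conv Y) l j)"
      by (rule ent_times) (use that in \<open>auto simp: ent_conv split: if_splits\<close>)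
    then show "ent (conv (X * Y)) i j = ent (conv X * conv Y) i j"
      using that by (auto simp: ent_conv scalar_prod_def lessThan_atLeast0)
  qed
  show "conv (X + Y) = conv X + conv Y" "conv (c \<cdot>\<^sub>m X) = sc c (conv X)"
    using assms by (auto intro!: fmat_eqI simp: ent_conv)
  have s: "conv (X - Y) = conv X - conv Y" if "X \<in> carrier_mat m m" "Y \<in> carrier_mat m m" for X Y :: "'a mat"
    using that by (auto intro!: fmat_eqI simp: ent_conv)
  show "conv (X - Y) = conv X - conv Y" "conv (X * Y) = conv X * conv Y" using m s assms by auto
  show "conv (commutator X Y) = conv X * conv Y - conv Y * conv X"
    unfolding commutator_def using m[OF assms] m[OF assms(2,1)] s[of "X * Y" "Y * X"] assms by simp
qed

lemma conv_zero: "conv (0\<^sub>m m m) = 0"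
  by (rule fmat_eqI) (simp add: ent_conv)

lemma sp_carrier: "X \<in> sp n \<Longrightarrow> X \<in> carrier_mat (2 * n) (2 * n)"
  unfolding sp_def by (auto simp: antitranspose_def mult_2)

text \<open>The mirror map exchanges the two halves of the indices, and the product of signs is -1
  exactly in the off-diagonal quadrants. Quadrant by quadrant \<open>spt n X = - X\<close> therefore
  becomes the symmetry of \<open>B\<close> and \<open>C\<close> under the antitranspose and the
  prescribed form of the lower right block.\<close>

lemma sp_iff:
  fixes X :: "'a::field mat"
  assumes X: "X \<in> carrier_mat (2 * n) (2 * n)"
  shows "X \<in> sp n \<longleftrightarrow> conv X \<in> spf n"
proof
  assume "X \<in> sp n"
  then obtain A B C where X': "X = four_block_mat A B C (- antitranspose A)"
    and c: "A \<in> carrier_mat n n" "B \<in> carrier_mat n n" "C \<in> carrier_mat n n"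
    and BC: "B = antitranspose B" "C = antitranspose C" unfolding sp_def by blast
  have D: "- antitranspose A \<in> carrier_mat n n" using c unfolding antitranspose_def by auto
  have b: "B $$ (i, j) = B $$ (n - 1 - j, n - 1 - i)" "C $$ (i, j) = C $$ (n - 1 - j, n - 1 - i)" if "i < n" "j < n" for i j
  proof -
    have "antitranspose B $$ (i, j) = B $$ (n - 1 - j, n - 1 - i)" "antitranspose C $$ (i, j) = C $$ (n - 1 - j, n - 1 - i)"
      unfolding antitranspose_def using c that by auto
    then show "B $$ (i, j) = B $$ (n - 1 - j, n - 1 - i)" "C $$ (i, j) = C $$ (n - 1 - j, n - 1 - i)" using BC by simp_all
  qed
  have d: "dim_row X = 2 * n" "dim_col X = 2 * n" "dim_row A = n" "dim_col A = n" using X c by auto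
  have e: "ent (conv X) i j = A $$ (i, j)" if "i < n" "j < n" for i j
    unfolding ent_conv using that d c by (simp add: X')
  have eB: "ent (conv X) i (j + n) = B $$ (i, j)" if "i < n" "j < n" for i j
    unfolding ent_conv using that d c by (simp add: X')
  have eC: "ent (conv X) (i + n) j = C $$ (i, j)" if "i < n" "j < n" for i j
    unfolding ent_conv using that d c by (simp add: X')
  have eD: "ent (conv X) (i + n) (j + n) = - A $$ (n - 1 - j, n - 1 - i)" if "i < n" "j < n" for i j
    unfolding ent_conv using that d c by (simp add: X' antitranspose_def)
  have "ent (spt n (conv X)) i j = ent (- conv X) i j" if ij: "i < 2 * n" "j < 2 * n" for i j
  proof -
    have sp: "ent (spt n (conv X)) i j = sgn_sp n i * sgn_sp n j * ent (conv X) (mir n j) (mir n i)"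
      using ent_spt[of n "conv X" i j] ij by simp
    have small: "mir n k = (n - 1 - k) + n" "n - 1 - k < n" "sgn_sp n k = (1 :: 'a)" if "k < n" for k
      using that unfolding sgn_sp_def by auto
    have large: "mir n (k + n) = n - 1 - k" "n - 1 - k < n" "sgn_sp n (k + n) = (- 1 :: 'a)" "n - 1 - (n - 1 - k) = k" if "k < n" for k
      using that unfolding sgn_sp_def by auto
    have shift: "i < n \<or> (\<exists>k. i = k + n \<and> k < n)" if "i < 2 * n" for i
      using that by (cases "i < n") (auto intro!: exI[of _ "i - n"])
    from shift[OF ij(1)] show ?thesis
    proof
      assume i: "i < n"
      from shift[OF ij(2)] show ?thesis
      proof
        assume j: "j < n"
        show ?thesis unfolding sp small(1)[OF i] small(1)[OF j] small(3)[OF i] small(3)[OF j] eD[OF small(2)[OF j] small(2)[OF i]] ent_uminus e[OF i j]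
          using large(4)[OF i] large(4)[OF j] by simp
      next
        assume "\<exists>k. j = k + n \<and> k < n"
        then obtain k where j: "j = k + n" and k: "k < n" by blast
        show ?thesis unfolding j sp[unfolded j] small(1)[OF i] large(1)[OF k] small(3)[OF i] large(3)[OF k] ent_uminus
          eB[OF large(2)[OF k] small(2)[OF i]] eB[OF i k] using b(1)[OF i k] by simp
      qed
    next
      assume "\<exists>k. i = k + n \<and> k < n"
      then obtain l where i: "i = l + n" and l: "l < n" by blast
      from shift[OF ij(2)] show ?thesis
      proof
        assume j: "j < n"
        show ?thesis unfolding i sp[unfolded i] small(1)[OF j] large(1)[OF l] small(3)[OF j] large(3)[OF l] ent_uminus
          eC[OF small(2)[OF j] large(2)[OF l]] eC[OF l j] using b(2)[OF l j] by simp
      next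
        assume "\<exists>k. j = k + n \<and> k < n"
        then obtain k where j: "j = k + n" and k: "k < n" by blast
        show ?thesis unfolding i j sp[unfolded i j] large(1)[OF k] large(1)[OF l] large(3)[OF k] large(3)[OF l] ent_uminus
          eD[OF l k] e[OF large(2)[OF k] large(2)[OF l]] by simp
      qed
    qed
  qed
  moreover have "ent (spt n (conv X)) i j = ent (- conv X) i j" if "\<not> (i < 2 * n \<and> j < 2 * n)" for i j
    unfolding ent_spt ent_uminus ent_conv d if_not_P[OF that] by simp
  ultimately have ee: "ent (spt n (conv X)) i j = ent (- conv X) i j" for i j by (cases "i < 2 * n \<and> j < 2 * n") simp_all
  have "spt n (conv X) = - conv X" by (rule fmat_eqI) (rule ee)
  then show "conv X \<in> spf n" unfolding spf_def using conv_block[OF X] by blast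
next
  assume "conv X \<in> spf n"
  then have s: "X $$ (2 * n - 1 - j, 2 * n - 1 - i) = - (sgn_sp n i * sgn_sp n j * X $$ (i, j))" if "i < 2 * n" "j < 2 * n" for i j
    using spf_D(3)[of "conv X" n i j] that X by (simp add: ent_conv)
  define A B C where "A = mat n n (\<lambda>(i, j). X $$ (i, j))" and "B = mat n n (\<lambda>(i, j). X $$ (i, j + n))"
    and "C = mat n n (\<lambda>(i, j). X $$ (i + n, j))"
  have "B = antitranspose B"
  proof (rule eq_matI)
    fix i j assume "i < dim_row (antitranspose B)" "j < dim_col (antitranspose B)"
    then have ij: "i < n" "j < n" unfolding antitranspose_def B_def by auto
    have m: "2 * n - 1 - (j + n) = n - 1 - j" "2 * n - 1 - i = n - 1 - i + n" using ij by auto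
    have "X $$ (n - 1 - j, n - 1 - i + n) = X $$ (i, j + n)"
      using s[of i "j + n"] ij unfolding m by (simp add: sgn_sp_def)
    then show "B $$ (i, j) = antitranspose B $$ (i, j)"
      unfolding antitranspose_def B_def using ij by simp
  qed (auto simp: antitranspose_def B_def)
  moreover have "C = antitranspose C"
  proof (rule eq_matI)
    fix i j assume "i < dim_row (antitranspose C)" "j < dim_col (antitranspose C)"
    then have ij: "i < n" "j < n" unfolding antitranspose_def C_def by auto
    have m: "2 * n - 1 - j = n - 1 - j + n" "2 * n - 1 - (i + n) = n - 1 - i" using ij by auto
    have "X $$ (n - 1 - j + n, n - 1 - i) = X $$ (i + n, j)"
      using s[of "i + n" j] ij unfolding m by (simp add: sgn_sp_def)
    then show "C $$ (i, j) = antitranspose C $$ (i, j)"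
      unfolding antitranspose_def C_def using ij by simp
  qed (auto simp: antitranspose_def C_def)
  moreover have "X = four_block_mat A B C (- antitranspose A)"
  proof (rule eq_matI)
    fix i j assume "i < dim_row (four_block_mat A B C (- antitranspose A))" "j < dim_col (four_block_mat A B C (- antitranspose A))"
    then have ij: "i < 2 * n" "j < 2 * n" unfolding A_def antitranspose_def by auto
    show "X $$ (i, j) = four_block_mat A B C (- antitranspose A) $$ (i, j)"
    proof (cases "n \<le> i \<and> n \<le> j")
      case True
      have m: "n - Suc (j - n) = 2 * n - 1 - j" "n - Suc (i - n) = 2 * n - 1 - i" using True ij by auto
      have "X $$ (2 * n - 1 - j, 2 * n - 1 - i) = - X $$ (i, j)"
        using s[OF ij] True by (simp add: sgn_sp_def)
      then show ?thesis using True ij m unfolding A_def B_def C_def antitranspose_def by simp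
    next
      case False
      then show ?thesis using ij unfolding A_def B_def C_def antitranspose_def by auto
    qed
  qed (use X in \<open>auto simp: A_def antitranspose_def\<close>)
  moreover have "A \<in> carrier_mat n n" "B \<in> carrier_mat n n" "C \<in> carrier_mat n n"
    unfolding A_def B_def C_def by auto
  ultimately show "X \<in> sp n" unfolding sp_def by blast
qed

section \<open>Transfer of dimension and index\<close>

lemma submodule_iff:
  fixes K :: "'a::field mat set"
  assumes K: "K \<subseteq> carrier_mat m m"
  shows "submodule class_ring K (module_mat TYPE('a) m m) \<longleftrightarrow> fs.subspace (conv ` K)"
proof
  assume "submodule class_ring K (module_mat TYPE('a) m m)"
  then interpret S: submodule class_ring K "module_mat TYPE('a) m m" .
  have c: "x + y \<in> K" "c \<cdot>\<^sub>m x \<in> K" "0\<^sub>m m m \<in> K" if "x \<in> K" "y \<in> K" for x y c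
    using S.m_closed[OF that] S.smult_closed[of c x] S.zero_closed that by (simp_all add: module_mat_simps class_ring_simps)
  have z: "0\<^sub>m m m \<in> K" using S.zero_closed by (simp add: module_mat_simps)
  show "fs.subspace (conv ` K)" unfolding fs.subspace_def
  proof (intro conjI ballI allI)
    show "0 \<in> conv ` K" using z conv_zero[of m] by (metis image_eqI)
    fix X assume "X \<in> conv ` K"
    then obtain x where x: "x \<in> K" "X = conv x" by blast
    show "sc c X \<in> conv ` K" for c
      using c(2)[OF x(1) x(1), of c] conv_arith(3)[of x m x c] x K by (metis image_eqI subsetD)
    fix Y assume "Y \<in> conv ` K"
    then obtain y where y: "y \<in> K" "Y = conv y" by blast
    show "X + Y \<in> conv ` K"
      using c(1)[OF x(1) y(1)] conv_arith(1)[of x m y] x y K by (metis image_eqI subsetD)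
  qed
next
  assume sub: "fs.subspace (conv ` K)"
  have inj: "x \<in> K" if "x \<in> carrier_mat m m" "conv x \<in> conv ` K" for x
    using that K inj_onD[OF conv_inj[of m]] by (metis imageE subsetD)
  have vs: "vectorspace class_ring (module_mat TYPE('a) m m)" by (rule matrix_vs)
  show "submodule class_ring K (module_mat TYPE('a) m m)"
  proof (rule submodule.intro)
    show "Module.module class_ring (module_mat TYPE('a) m m)" using vs unfolding vectorspace_def by blast
    show "K \<subseteq> carrier (module_mat TYPE('a) m m)" using K by (simp add: module_mat_simps)
    show "v \<oplus>\<^bsub>module_mat TYPE('a) m m\<^esub> w \<in> K" if "v \<in> K" "w \<in> K" for v w
    proof -
      have vw: "v \<in> carrier_mat m m" "w \<in> carrier_mat m m" using that K by auto
      have "conv (v + w) \<in> conv ` K" unfolding conv_arith(1)[OF vw] using that fs.subspace_add[OF sub] by blast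
      then show ?thesis using inj[of "v + w"] vw by (simp add: module_mat_simps)
    qed
    show "\<zero>\<^bsub>module_mat TYPE('a) m m\<^esub> \<in> K"
      using inj[of "0\<^sub>m m m"] fs.subspace_0[OF sub] unfolding conv_zero by (simp add: module_mat_simps)
    show "c \<odot>\<^bsub>module_mat TYPE('a) m m\<^esub> v \<in> K" if "c \<in> carrier class_ring" "v \<in> K" for c v
    proof -
      have v: "v \<in> carrier_mat m m" using that K by auto
      have "conv (c \<cdot>\<^sub>m v) \<in> conv ` K" unfolding conv_arith(3)[OF v v] using that fs.subspace_scale[OF sub] by blast
      then show ?thesis using inj[of "c \<cdot>\<^sub>m v"] v by (simp add: module_mat_simps)
    qed
  qed
qed

lemma subspace_iff:
  fixes K :: "'a::field mat set"
  shows "VectorSpace.subspace class_ring K (module_mat TYPE('a) m m) \<longleftrightarrow> K \<subseteq> carrier_mat m m \<and> fs.subspace (conv ` K)"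
  unfolding VectorSpace.subspace_def
  using submodule_iff[of K m] matrix_vs submodule.subset[of class_ring K "module_mat TYPE('a) m m"]
  by (auto simp: module_mat_simps)

text \<open>The carrier-based dimension is the least size of a finite generating set, the other one
  the size of a basis. \<open>conv\<close> takes linear combinations to sums, so generating sets
  correspond.\<close>

lemma dim_conv:
  fixes K :: "'a::field mat set"
  assumes K: "K \<subseteq> carrier_mat m m" and sub: "fs.subspace (conv ` K)"
  shows "vectorspace.dim class_ring (module_mat TYPE('a) m m\<lparr>carrier := K\<rparr>) = fs.dim (conv ` K)"
proof -
  let ?V = "module_mat TYPE('a) m m\<lparr>carrier := K\<rparr>"
  interpret M: vectorspace class_ring "module_mat TYPE('a) m m" by (rule matrix_vs)
  interpret V: vectorspace class_ring ?V
    by (rule M.subspace_is_vs) (use subspace_iff K sub in blast)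
  have lin: "V.lincomb c A \<in> K \<and> conv (V.lincomb c A) = (\<Sum>v\<in>A. sc (c v) (conv v))"
    if A: "finite A" "A \<subseteq> K" for A c
    using A
  proof (induction A)
    case empty
    then show ?case using V.M.zero_closed by (simp add: V.lincomb_def module_mat_simps conv_zero)
  next
    case (insert a A)
    have fa: "(\<lambda>v. c v \<odot>\<^bsub>?V\<^esub> v) \<in> A \<rightarrow> carrier ?V" "c a \<odot>\<^bsub>?V\<^esub> a \<in> carrier ?V"
      using insert.prems V.smult_closed by auto
    have e: "V.lincomb c (insert a A) = c a \<cdot>\<^sub>m a + V.lincomb c A"
      unfolding V.lincomb_def using V.M.finsum_insert[OF insert.hyps fa] by (simp add: module_mat_simps)
    have m: "c a \<cdot>\<^sub>m a \<in> K" using fa(2) by (simp add: module_mat_simps)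
    have IH: "V.lincomb c A \<in> K" "conv (V.lincomb c A) = (\<Sum>v\<in>A. sc (c v) (conv v))" using insert by auto
    have "c a \<cdot>\<^sub>m a + V.lincomb c A \<in> K"
      using V.M.a_closed[of "c a \<cdot>\<^sub>m a" "V.lincomb c A"] m IH(1) by (simp add: module_mat_simps)
    moreover have "conv (c a \<cdot>\<^sub>m a + V.lincomb c A) = sc (c a) (conv a) + (\<Sum>v\<in>A. sc (c v) (conv v))"
      using conv_arith(1)[of "c a \<cdot>\<^sub>m a" m "V.lincomb c A"] conv_arith(3)[of a m a "c a"] m IH insert.prems K
      by (auto simp: subset_iff)
    ultimately show ?case unfolding e using insert.hyps by simp
  qed
  have span: "conv ` V.span A = fs.span (conv ` A)" if A: "finite A" "A \<subseteq> K" for A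
  proof -
    have inj: "inj_on conv A" using conv_inj[of m] A K inj_on_subset by blast
    have S: "V.span A = range (\<lambda>c. V.lincomb c A)"
      using V.finite_span[of A] A by (auto simp: class_ring_simps)
    have "conv ` V.span A = range (\<lambda>c. \<Sum>v\<in>A. sc (c v) (conv v))"
      unfolding S using lin[OF A] by (auto simp: image_iff)
    also have "\<dots> = range (\<lambda>u. \<Sum>v\<in>conv ` A. sc (u v) v)"
    proof (intro equalityI subsetI)
      fix z assume "z \<in> range (\<lambda>c. \<Sum>v\<in>A. sc (c v) (conv v))"
      then obtain c where "z = (\<Sum>v\<in>A. sc (c v) (conv v))" by blast
      then have "z = (\<Sum>v\<in>conv ` A. sc (c (the_inv_into A conv v)) v)"
        by (simp add: sum.reindex[OF inj] the_inv_into_f_f[OF inj])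
      then show "z \<in> range (\<lambda>u. \<Sum>v\<in>conv ` A. sc (u v) v)" by (rule range_eqI[of _ "\<lambda>u. \<Sum>v\<in>conv ` A. sc (u v) v" "\<lambda>v. c (the_inv_into A conv v)"])
    next
      fix z assume "z \<in> range (\<lambda>u. \<Sum>v\<in>conv ` A. sc (u v) v)"
      then obtain u where "z = (\<Sum>v\<in>conv ` A. sc (u v) v)" by blast
      then have "z = (\<Sum>v\<in>A. sc (u (conv v)) (conv v))" by (simp add: sum.reindex[OF inj])
      then show "z \<in> range (\<lambda>c. \<Sum>v\<in>A. sc (c v) (conv v))"
        by (rule range_eqI[of _ "\<lambda>c. \<Sum>v\<in>A. sc (c v) (conv v)" "\<lambda>v. u (conv v)"])
    qed
    also have "\<dots> = fs.span (conv ` A)" using fs.span_finite[of "conv ` A"] A by simp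
    finally show ?thesis .
  qed
  have gen: "V.span A = K \<longleftrightarrow> fs.span (conv ` A) = conv ` K" if A: "finite A" "A \<subseteq> K" for A
  proof -
    have "V.span A \<subseteq> K" using V.span_is_subset2[of A] A by simp
    then show ?thesis
      unfolding span[OF A, symmetric] using inj_on_image_eq_iff[OF conv_inj[of m], of "V.span A" K] K by auto
  qed
  have fd: "fs.fin_dim (conv ` K)"
    by (rule fs.fin_dim_subset[OF fin_dim_block[of "{..<m}" "{..<m}"]]) (use K conv_block in auto)
  show ?thesis unfolding V.dim_def
  proof (rule Least_equality)
    obtain B where B: "finite B" "B \<subseteq> conv ` K" "fs.independent B" "conv ` K \<subseteq> fs.span B" "card B = fs.dim (conv ` K)"
      using fs.fin_dim_obtain_basis[OF fd] by metis
    obtain A where A: "A \<subseteq> K" "B = conv ` A" "inj_on conv A" using B(2) by (metis subset_image_inj)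
    have "finite A" using B(1) A by (simp add: finite_image_iff)
    moreover have "card A = fs.dim (conv ` K)" using B(5) A card_image by metis
    moreover have "V.span A = carrier ?V"
      using gen[OF \<open>finite A\<close> A(1)] B(2,4) A(2) fs.span_minimal[OF B(2) sub] by auto
    ultimately show "\<exists>A. finite A \<and> card A = fs.dim (conv ` K) \<and> A \<subseteq> carrier ?V \<and> V.span A = carrier ?V"
      using A(1) by auto
  next
    fix k assume "\<exists>A. finite A \<and> card A = k \<and> A \<subseteq> carrier ?V \<and> V.span A = carrier ?V"
    then obtain A where A: "finite A" "card A = k" "A \<subseteq> K" "V.span A = K" by auto
    have "fs.dim (conv ` K) \<le> card (conv ` A)"
      by (rule fs.dim_le_card) (use gen[OF A(1,3)] A in auto)
    then show "fs.dim (conv ` K) \<le> k" using card_image_le[OF A(1), of conv] A(2) by simp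
  qed
qed

lemma linfun_extend:
  fixes g :: "'a::field fmat \<Rightarrow> 'a"
  assumes g: "fs.linfun_on Q g" and Q: "fs.subspace Q"
  obtains g' where "linfun g'" "\<And>x. x \<in> Q \<Longrightarrow> g' x = g x"
proof -
  interpret k: vector_space "(*) :: 'a \<Rightarrow> 'a \<Rightarrow> 'a" by unfold_locales (auto simp: algebra_simps)
  interpret vp: vector_space_pair "sc :: 'a \<Rightarrow> _" "(*) :: 'a \<Rightarrow> 'a \<Rightarrow> 'a" ..
  obtain B where B: "B \<subseteq> Q" "fs.independent B" "Q \<subseteq> fs.span B" "card B = fs.dim Q"
    by (rule fs.basis_exists[of Q])
  obtain g' where g': "Vector_Spaces.linear sc (*) g'" "\<forall>x\<in>B. g' x = g x"
    using vp.linear_independent_extend[OF B(2), of g] by blast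
  have lg': "linfun g'"
    using g'(1) unfolding Vector_Spaces.linear_iff by (auto intro!: linfunI)
  have "fs.subspace {x \<in> Q. g' x = g x}"
    using Q unfolding fs.subspace_def
    by (auto simp: linfunD[OF lg'] fs.linfun_onD[OF g] fs.linfun_on_zero[OF g])
  then have "fs.span B \<subseteq> {x \<in> Q. g' x = g x}" using B(1) g'(2) by (intro fs.span_minimal) auto
  then show ?thesis using that[OF lg'] B(3) by blast
qed

text \<open>A member of \<open>linear_functionals\<close> is constrained on the carrier only, so it
  is extended to all finitely supported matrices. As \<open>Q\<close> is closed under commutators,
  the kernel does not depend on the extension.\<close>

lemma lie_index_conv:
  fixes Q :: "'a::field mat set"
  assumes Q: "Q \<subseteq> carrier_mat m m" "fs.subspace (conv ` Q)"
    and cl: "\<And>x y. x \<in> Q \<Longrightarrow> y \<in> Q \<Longrightarrow> commutator x y \<in> Q" and ind: "index_is (conv ` Q) e"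
  shows "lie_index (module_mat TYPE('a) m m\<lparr>carrier := Q\<rparr>) commutator = e"
proof -
  let ?V = "module_mat TYPE('a) m m\<lparr>carrier := Q\<rparr>"
  have key: "vectorspace.dim class_ring (?V\<lparr>carrier := form_kernel ?V commutator f\<rparr>) = fs.dim (rad (conv ` Q) g)"
    if g: "linfun g" and fg: "\<And>x. x \<in> Q \<Longrightarrow> f x = g (conv x)" for f g
  proof -
    have K: "form_kernel ?V commutator f \<subseteq> carrier_mat m m" unfolding form_kernel_def using Q(1) by auto
    have e: "f (commutator x y) = g (conv x * conv y - conv y * conv x)" if "x \<in> Q" "y \<in> Q" for x y
      using fg[OF cl[OF that]] conv_arith(5)[OF subsetD[OF Q(1) that(1)] subsetD[OF Q(1) that(2)]] by simp
    have im: "conv ` form_kernel ?V commutator f = rad (conv ` Q) g"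
      unfolding form_kernel_def rad_def using e by auto
    have "fs.subspace (conv ` form_kernel ?V commutator f)" unfolding im by (rule subspace_rad[OF g Q(2)])
    then show ?thesis using dim_conv[OF K] unfolding im by simp
  qed
  have toF: "\<exists>g. linfun g \<and> (\<forall>x\<in>Q. f x = g (conv x))" if f: "f \<in> linear_functionals ?V" for f
  proof -
    have fl: "f (x + y) = f x + f y" "f (c \<cdot>\<^sub>m x) = c * f x" if "x \<in> Q" "y \<in> Q" for x y c
      using f that unfolding linear_functionals_def by (auto simp: module_mat_simps)
    have uc: "unconv m (conv x) = x" if "x \<in> Q" for x using unconv_conv that Q(1) by blast
    have "fs.linfun_on (conv ` Q) (f \<circ> unconv m)"
      unfolding fs.linfun_on_def
    proof (intro conjI ballI allI)
      fix X assume "X \<in> conv ` Q"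
      then obtain x where x: "x \<in> Q" "X = conv x" by blast
      have xc: "x \<in> carrier_mat m m" using x Q(1) by blast
      show "(f \<circ> unconv m) (sc c X) = c * (f \<circ> unconv m) X" for c
        using fl(2)[OF x(1) x(1), of c] uc[OF x(1)] conv_arith(3)[OF xc xc, of c] unconv_conv[of "c \<cdot>\<^sub>m x" m] xc
        unfolding x(2) by simp
      fix Y assume "Y \<in> conv ` Q"
      then obtain y where y: "y \<in> Q" "Y = conv y" by blast
      have yc: "y \<in> carrier_mat m m" using y Q(1) by blast
      show "(f \<circ> unconv m) (X + Y) = (f \<circ> unconv m) X + (f \<circ> unconv m) Y"
        using fl(1)[OF x(1) y(1)] uc[OF x(1)] uc[OF y(1)] conv_arith(1)[OF xc yc] unconv_conv[of "x + y" m] xc yc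
        unfolding x(2) y(2) by simp
    qed
    then obtain g where "linfun g" "\<And>x. x \<in> conv ` Q \<Longrightarrow> g x = (f \<circ> unconv m) x"
      using linfun_extend[OF _ Q(2)] by blast
    then show ?thesis using uc by (intro exI[of _ g]) auto
  qed
  show ?thesis unfolding lie_index_def
  proof (rule Least_equality)
    obtain g where g: "linfun g" "fs.dim (rad (conv ` Q) g) = e" using ind unfolding index_is_def by blast
    have "g (conv (x + y)) = g (conv x) + g (conv y)" "g (conv (c \<cdot>\<^sub>m x)) = c * g (conv x)" if "x \<in> Q" "y \<in> Q" for x y c
      using conv_arith(1,3)[OF subsetD[OF Q(1) that(1)] subsetD[OF Q(1) that(2)]] by (simp_all add: linfunD[OF g(1)])
    then have "(\<lambda>x. g (conv x)) \<in> linear_functionals ?V"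
      unfolding linear_functionals_def by (auto simp: module_mat_simps)
    then show "\<exists>f\<in>linear_functionals ?V. e = vectorspace.dim class_ring (?V\<lparr>carrier := form_kernel ?V commutator f\<rparr>)"
      using key[OF g(1), of "\<lambda>x. g (conv x)"] g(2) by (intro bexI[of _ "\<lambda>x. g (conv x)"]) auto
  next
    fix d assume "\<exists>f\<in>linear_functionals ?V. d = vectorspace.dim class_ring (?V\<lparr>carrier := form_kernel ?V commutator f\<rparr>)"
    then obtain f where f: "f \<in> linear_functionals ?V" "d = vectorspace.dim class_ring (?V\<lparr>carrier := form_kernel ?V commutator f\<rparr>)" by blast
    obtain g where "linfun g" "\<forall>x\<in>Q. f x = g (conv x)" using toF[OF f(1)] by blast
    then show "e \<le> d" using key[of g f] ind f(2) unfolding index_is_def by auto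
  qed
qed

section \<open>Transposition and the identification of the parabolic subalgebras\<close>

text \<open>Transposition preserves sp(2n) and exchanges the two Borel subalgebras, so the lower
  parabolic subalgebras are obtained from the upper ones.\<close>

definition tp :: "'a::field fmat \<Rightarrow> 'a fmat" where
  "tp X = Abs_fmat (\<lambda>i j. ent X j i)"

lemma ent_tp [simp]: "ent (tp X) i j = ent X j i"
proof -
  obtain n where "\<forall>i j. n \<le> i \<or> n \<le> j \<longrightarrow> ent X i j = 0" using ent_bound by metis
  then show ?thesis unfolding tp_def by (subst ent_Abs_fmat[of n]) auto
qed

lemma tp_tp [simp]: "tp (tp X) = X"
  by (rule fmat_eqI) simp

lemma tp_mult: "tp (X * Y) = tp Y * tp X"
  by (rule fmat_eqI) (simp add: ent_times_raw mult.commute)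

lemma tp_linear: "tp (X - Y) = tp X - tp Y" "tp (X + Y) = tp X + tp Y" "tp (sc c X) = sc c (tp X)" "tp 0 = 0"
  by (rule fmat_eqI, simp)+

lemma tp_spf: assumes "X \<in> spf n" shows "tp X \<in> spf n"
proof -
  have b: "X \<in> block {..<2 * n} {..<2 * n}" and s: "spt n X = - X" using assms unfolding spf_def by auto
  have "spt n (tp X) = tp (spt n X)"
    by (rule fmat_eqI) (simp add: ent_spt mult.commute)
  also have "\<dots> = - tp X" unfolding s by (rule fmat_eqI) simp
  finally show ?thesis using b unfolding spf_def block_def by simp
qed

lemma tp_root_vec: assumes "p < 2 * n" "q < 2 * n" shows "tp (root_vec n p q) = root_vec n q p"
proof (rule fmat_eqI)
  fix i j
  have a: "(j = p \<and> i = q) = (i = q \<and> j = p)" "(j = mir n q \<and> i = mir n p) = (i = mir n p \<and> j = mir n q)" by blast+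
  show "ent (tp (root_vec n p q)) i j = ent (root_vec n q p) i j"
    unfolding root_vec_eq[OF assms] root_vec_eq[OF assms(2,1)] ent_tp ent_minus ent_sc ent_munit a
    by (simp only: mult.commute[of "sgn_sp n p"])
qed

lemma tp_image_iff: "X \<in> tp ` L \<longleftrightarrow> tp X \<in> L"
  by (metis image_iff tp_tp)

lemma sub_lie_tp:
  assumes "sub_lie n L"
  shows "sub_lie n (tp ` L)"
proof -
  have sub: "fs.subspace L" and LS: "L \<subseteq> spf n" and cl: "\<And>x y. x \<in> L \<Longrightarrow> y \<in> L \<Longrightarrow> x * y - y * x \<in> L"
    using assms unfolding sub_lie_def by auto
  have "fs.subspace (tp ` L)" unfolding fs.subspace_def tp_image_iff tp_linear
    using sub unfolding fs.subspace_def by simp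
  \<comment> \<open>Transposition reverses products, so closure is used with the two factors
    exchanged.\<close>
  moreover have "x * y - y * x \<in> tp ` L" if "x \<in> tp ` L" "y \<in> tp ` L" for x y
    using cl[of "tp y" "tp x"] that unfolding tp_image_iff tp_linear tp_mult by simp
  moreover have "tp ` L \<subseteq> spf n" using LS tp_spf by blast
  ultimately show ?thesis unfolding sub_lie_def by blast
qed

lemma parf_tp_unique:
  fixes L :: "'a::field_char_0 fmat set"
  assumes L: "sub_lie n L" and R: "R \<subseteq> {1..n}"
    and B: "\<And>p q. q \<le> p \<Longrightarrow> p < 2 * n \<Longrightarrow> root_vec n p q \<in> L"
    and lo: "\<And>r. r \<in> {1..n} \<Longrightarrow> root_vec n (r - 1) r \<in> L \<longleftrightarrow> r \<notin> R"
  shows "L = tp ` parf n R"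
proof -
  have "tp ` L = parf n R"
  proof (rule parf_unique[OF sub_lie_tp[OF L] R])
    fix p q assume pq: "p \<le> q" "q < 2 * n"
    show "root_vec n p q \<in> tp ` L"
      unfolding tp_image_iff using tp_root_vec[of p n q, where ?'a = 'a] B[OF pq] pq by simp
  next
    fix r assume r: "r \<in> {1..n}"
    have "tp (root_vec n r (r - 1)) = (root_vec n (r - 1) r :: 'a fmat)"
      by (rule tp_root_vec) (use r in auto)
    then show "(root_vec n r (r - 1) \<in> tp ` L) = (r \<notin> R)" unfolding tp_image_iff using lo[OF r] by simp
  qed
  moreover have "tp ` tp ` L = L" unfolding image_image by simp
  ultimately show ?thesis by metis
qed

text \<open>The size is part of this inverse image because \<open>conv\<close> is injective only on
  matrices of one fixed size.\<close>

definition unc :: "nat \<Rightarrow> 'a::field fmat set \<Rightarrow> 'a mat set" where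
  "unc m L = {X \<in> carrier_mat m m. conv X \<in> L}"

lemma conv_unc: assumes "L \<subseteq> block {..<m} {..<m}" shows "conv ` unc m L = L"
proof (intro equalityI subsetI)
  fix Z assume Z: "Z \<in> L"
  have c: "conv (unconv m Z) = Z" by (rule conv_unconv) (use Z assms in blast)
  then have "unconv m Z \<in> unc m L" unfolding unc_def using Z by simp
  then show "Z \<in> conv ` unc m L" using c by (metis image_eqI)
qed (auto simp: unc_def)

lemma conv_image_iff:
  assumes "P \<subseteq> carrier_mat m m" "X \<in> carrier_mat m m"
  shows "conv X \<in> conv ` P \<longleftrightarrow> X \<in> P"
  using inj_on_image_mem_iff[OF conv_inj assms(2,1)] .

lemma unc_conv: "P \<subseteq> carrier_mat m m \<Longrightarrow> unc m (conv ` P) = P"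
  unfolding unc_def using conv_image_iff[of P m] by blast

lemma lie_subalgebra_iff:
  fixes P :: "'a::field mat set"
  shows "lie_subalgebra n P \<longleftrightarrow> P \<subseteq> carrier_mat (2 * n) (2 * n) \<and> sub_lie n (conv ` P)"
proof (cases "P \<subseteq> carrier_mat (2 * n) (2 * n)")
  case True
  have 1: "P \<subseteq> sp n \<longleftrightarrow> conv ` P \<subseteq> spf n"
    using sp_iff True by (auto simp: subset_iff)
  have "commutator X Y \<in> P \<longleftrightarrow> conv X * conv Y - conv Y * conv X \<in> conv ` P" if "X \<in> P" "Y \<in> P" for X Y
  proof -
    have XY: "X \<in> carrier_mat (2 * n) (2 * n)" "Y \<in> carrier_mat (2 * n) (2 * n)" using that True by auto
    then have "commutator X Y \<in> carrier_mat (2 * n) (2 * n)" unfolding commutator_def by auto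
    from conv_image_iff[OF True this] show ?thesis unfolding conv_arith(5)[OF XY] by simp
  qed
  then have 2: "(\<forall>X\<in>P. \<forall>Y\<in>P. commutator X Y \<in> P) \<longleftrightarrow> (\<forall>X\<in>P. \<forall>Y\<in>P. conv X * conv Y - conv Y * conv X \<in> conv ` P)"
    by blast
  show ?thesis unfolding lie_subalgebra_def subspace_iff sub_lie_def ball_simps(9) 1 2 using True by blast
next
  case False
  then show ?thesis unfolding lie_subalgebra_def subspace_iff by blast
qed

lemma sub_lie_unc:
  assumes "sub_lie n L"
  shows "lie_subalgebra n (unc (2 * n) L)" "conv ` unc (2 * n) L = L"
proof -
  have "L \<subseteq> block {..<2 * n} {..<2 * n}" using assms spf_D(1) unfolding sub_lie_def by blast
  then show "conv ` unc (2 * n) L = L" by (rule conv_unc)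
  then show "lie_subalgebra n (unc (2 * n) L)" unfolding lie_subalgebra_iff using assms by (auto simp: unc_def)
qed

lemma sp_diag_D:
  fixes H :: "'a::field mat"
  assumes "H \<in> sp_diag n"
  shows "H \<in> carrier_mat (2 * n) (2 * n)" "conv H \<in> spf n" "i \<noteq> j \<Longrightarrow> ent (conv H) i j = 0"
    "i < 2 * n \<Longrightarrow> ent (conv H) i i = H $$ (i, i)" "i < 2 * n \<Longrightarrow> H $$ (mir n i, mir n i) = - H $$ (i, i)"
proof -
  have s: "H \<in> sp n" "diagonal_mat H" using assms unfolding sp_diag_def by auto
  show c: "H \<in> carrier_mat (2 * n) (2 * n)" by (rule sp_carrier[OF s(1)])
  show f: "conv H \<in> spf n" using sp_iff[OF c] s by blast
  show e: "ent (conv H) i i = H $$ (i, i)" if "i < 2 * n" for i using c that by (simp add: ent_conv)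
  show "ent (conv H) i j = 0" if "i \<noteq> j" for i j using s(2) that c unfolding diagonal_mat_def by (auto simp: ent_conv)
  show "H $$ (mir n i, mir n i) = - H $$ (i, i)" if "i < 2 * n"
    using spf_D(3)[OF f that that] e[OF that] e[OF mir_less[OF that]] by simp
qed

lemma ent_diag_mult:
  assumes "\<And>i j. i \<noteq> j \<Longrightarrow> ent D i j = 0"
  shows "ent (D * Z) i j = ent D i i * ent Z i j" "ent (Z * D) i j = ent Z i j * ent D j j"
  using ent_times[of "{i}" D i Z j] ent_times[of "{j}" Z i D j] assms by (metis (no_types, lifting) finite.emptyI finite.insertI singletonI sum.insert sum.empty empty_iff add_0_right)+

lemma cartan_mem:
  fixes n k :: nat
  assumes "k < n"
  defines "H \<equiv> unconv (2 * n) (root_vec n k k :: 'a::field fmat)"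
  shows "H \<in> sp_diag n" "conv H = root_vec n k k" "p < 2 * n \<Longrightarrow> H $$ (p, p) = of_int (weight n k p)"
proof -
  have k: "k < 2 * n" using assms by simp
  have sp: "(root_vec n k k :: 'a fmat) \<in> spf n" by (rule root_vec_spf[OF k k])
  show c: "conv H = root_vec n k k" unfolding H_def by (rule conv_unconv[OF spf_D(1)[OF sp]])
  have e: "root_vec n k k = (munit k k - munit (mir n k) (mir n k) :: 'a fmat)"
    unfolding root_vec_eq[OF k k] by (auto intro!: fmat_eqI)
  have H: "H \<in> sp n" using sp_iff[of H n] c sp unfolding H_def by simp
  moreover have "diagonal_mat H" unfolding diagonal_mat_def H_def unconv_def e by auto
  ultimately show "H \<in> sp_diag n" unfolding sp_diag_def by blast
  show "H $$ (p, p) = of_int (weight n k p)" if "p < 2 * n"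
    using that unfolding H_def unconv_def e weight_def by simp
qed

text \<open>Testing with the Cartan elements \<open>root_vec n k k\<close> shows that all nonzero
  entries of a root vector have the same weight, and the weight determines the entry up to the
  mirror map.\<close>

lemma conv_root_space:
  fixes \<alpha> :: "'a::field_char_0 mat \<Rightarrow> 'a"
  assumes pq: "p < 2 * n" "q < 2 * n" "p \<noteq> q"
    and al: "\<And>H. H \<in> sp_diag n \<Longrightarrow> \<alpha> H = H $$ (p, p) - H $$ (q, q)"
  shows "conv ` root_space n \<alpha> = range (\<lambda>c. sc c (root_vec n p q))"
proof (intro equalityI subsetI)
  fix Z assume "Z \<in> conv ` root_space n \<alpha>"
  then obtain X where X: "X \<in> sp n" "\<And>H. H \<in> sp_diag n \<Longrightarrow> commutator H X = \<alpha> H \<cdot>\<^sub>m X" and Z: "Z = conv X"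
    unfolding root_space_def by blast
  have c: "X \<in> carrier_mat (2 * n) (2 * n)" by (rule sp_carrier[OF X(1)])
  have Zs: "Z \<in> spf n" unfolding Z using sp_iff[OF c] X(1) by blast
  have w: "weight n k i - weight n k j = weight n k p - weight n k q" if k: "k < n" and nz: "ent Z i j \<noteq> 0" for k i j
  proof -
    note H = cartan_mem[OF k, where ?'a = 'a]
    let ?H = "unconv (2 * n) (root_vec n k k :: 'a fmat)"
    have "conv (commutator ?H X) = conv (\<alpha> ?H \<cdot>\<^sub>m X)" unfolding X(2)[OF H(1)] ..
    then have "root_vec n k k * Z - Z * root_vec n k k = sc (\<alpha> ?H) Z"
      unfolding conv_arith(5)[OF sp_diag_D(1)[OF H(1)] c] conv_arith(3)[OF c c] H(2) Z .
    moreover have "\<alpha> ?H = of_int (weight n k p - weight n k q)" unfolding al[OF H(1)] H(3)[OF pq(1)] H(3)[OF pq(2)] by simp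
    ultimately have "of_int (weight n k i - weight n k j) * ent Z i j = of_int (weight n k p - weight n k q) * ent Z i j"
      unfolding bracket_cartan[OF Zs k, of i j, symmetric] by simp
    then show ?thesis using nz by (simp only: mult_cancel_right of_int_eq_iff) blast
  qed
  have "i = p \<and> j = q \<or> i = mir n q \<and> j = mir n p" if nz: "ent Z i j \<noteq> 0" for i j
  proof (rule weights_determine_entry[OF _ _ pq])
    show "i < 2 * n" "j < 2 * n" using nz spf_D(1)[OF Zs] unfolding block_def by auto
  qed (rule w[OF _ nz])
  then obtain d where "Z = sc d (root_vec n p q)" using spf_two_entries[OF Zs pq(1,2)] by blast
  then show "Z \<in> range (\<lambda>c. sc c (root_vec n p q))" by blast
next
  fix Z :: "'a fmat" assume "Z \<in> range (\<lambda>c. sc c (root_vec n p q))"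
  then obtain d where d: "Z = sc d (root_vec n p q)" by blast
  have Zs: "Z \<in> spf n" unfolding d by (rule fs.subspace_scale[OF subspace_spf root_vec_spf[OF pq(1,2)]])
  have c: "conv (unconv (2 * n) Z) = Z" by (rule conv_unconv[OF spf_D(1)[OF Zs]])
  have "commutator H (unconv (2 * n) Z) = \<alpha> H \<cdot>\<^sub>m unconv (2 * n) Z" if H: "H \<in> sp_diag n" for H
  proof (rule inj_onD[OF conv_inj[of "2 * n"]])
    note D = sp_diag_D[OF H]
    have "conv H * Z - Z * conv H = sc (\<alpha> H) Z"
    proof (rule fmat_eqI)
      fix i j
      have e: "ent (conv H * Z - Z * conv H) i j = (ent (conv H) i i - ent (conv H) j j) * ent Z i j"
        using ent_diag_mult[of "conv H" Z i j] D(3) by (simp add: algebra_simps)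
      show "ent (conv H * Z - Z * conv H) i j = ent (sc (\<alpha> H) Z) i j"
      proof (cases "ent Z i j = 0")
        case False
        then have "i = p \<and> j = q \<or> i = mir n q \<and> j = mir n p"
          unfolding d root_vec_eq[OF pq(1,2)] by (auto split: if_splits)
        then have "ent (conv H) i i - ent (conv H) j j = \<alpha> H"
        proof
          assume ij: "i = p \<and> j = q"
          show ?thesis unfolding ij[THEN conjunct1] ij[THEN conjunct2] al[OF H] D(4)[OF pq(1)] D(4)[OF pq(2)] ..
        next
          assume ij: "i = mir n q \<and> j = mir n p"
          show ?thesis unfolding ij[THEN conjunct1] ij[THEN conjunct2] al[OF H] D(4)[OF mir_less[OF pq(1)]] D(4)[OF mir_less[OF pq(2)]]
            D(5)[OF pq(1)] D(5)[OF pq(2)] by simp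
        qed
        then show ?thesis unfolding e by simp
      qed (simp add: e del: ent_minus)
    qed
    then show "conv (commutator H (unconv (2 * n) Z)) = conv (\<alpha> H \<cdot>\<^sub>m unconv (2 * n) Z)"
      unfolding conv_arith(5)[OF D(1) unconv_carrier] conv_arith(3)[OF unconv_carrier unconv_carrier] c .
    show "commutator H (unconv (2 * n) Z) \<in> carrier_mat (2 * n) (2 * n)"
      unfolding commutator_def
      by (rule minus_carrier_mat) (rule mult_carrier_mat[OF unconv_carrier D(1)])
    show "\<alpha> H \<cdot>\<^sub>m unconv (2 * n) Z \<in> carrier_mat (2 * n) (2 * n)" by simp
  qed
  moreover have "unconv (2 * n) Z \<in> sp n" using sp_iff[of "unconv (2 * n) Z" n] c Zs by simp
  ultimately have "unconv (2 * n) Z \<in> root_space n \<alpha>" unfolding root_space_def by blast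
  then show "Z \<in> conv ` root_space n \<alpha>" using c by (metis image_eqI)
qed

lemma root_space_subset_iff:
  fixes \<alpha> :: "'a::field_char_0 mat \<Rightarrow> 'a"
  assumes P: "lie_subalgebra n P" and pq: "p < 2 * n" "q < 2 * n" "p \<noteq> q"
    and al: "\<And>H. H \<in> sp_diag n \<Longrightarrow> \<alpha> H = H $$ (p, p) - H $$ (q, q)"
  shows "root_space n \<alpha> \<subseteq> P \<longleftrightarrow> root_vec n p q \<in> conv ` P"
proof -
  have P': "P \<subseteq> carrier_mat (2 * n) (2 * n)" "fs.subspace (conv ` P)"
    using P unfolding lie_subalgebra_iff sub_lie_def by auto
  have cr: "conv ` root_space n \<alpha> = range (\<lambda>c. sc c (root_vec n p q))"
    by (rule conv_root_space[OF pq]) (rule al)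
  have "root_space n \<alpha> \<subseteq> carrier_mat (2 * n) (2 * n)" unfolding root_space_def using sp_carrier by blast
  then have "root_space n \<alpha> \<subseteq> P \<longleftrightarrow> conv ` root_space n \<alpha> \<subseteq> conv ` P"
    using conv_image_iff[OF P'(1)] by (metis (no_types, opaque_lifting) image_mono image_subset_iff subset_iff)
  also have "\<dots> \<longleftrightarrow> root_vec n p q \<in> conv ` P"
    unfolding cr
  proof
    assume "range (\<lambda>c. sc c (root_vec n p q)) \<subseteq> conv ` P"
    then have "sc 1 (root_vec n p q) \<in> conv ` P" by blast
    then show "root_vec n p q \<in> conv ` P" by simp
  next
    assume "root_vec n p q \<in> conv ` P"
    then show "range (\<lambda>c. sc c (root_vec n p q)) \<subseteq> conv ` P" using fs.subspace_scale[OF P'(2)] by blast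
  qed
  finally show ?thesis .
qed

text \<open>On the diagonal of sp(2n) mirror entries are opposite, so the long root
  \<open>2 \<epsilon>\<^sub>n\<close> is also a difference of two neighbouring diagonal entries. All
  simple roots thus belong to positions \<open>(r - 1, r)\<close>.\<close>

lemma simple_root_diag:
  fixes H :: "'a::field mat"
  assumes H: "H \<in> sp_diag n" and r: "r \<in> {1..n}"
  shows "simple_root n r H = H $$ (r - 1, r - 1) - H $$ (r, r)"
proof (cases "r < n")
  case False
  then have rn: "r = n" using r by simp
  have "n - 1 < 2 * n" "mir n (n - 1) = n" using r by auto
  then have "H $$ (n, n) = - H $$ (n - 1, n - 1)" using sp_diag_D(5)[OF H, of "n - 1"] by metis
  then show ?thesis unfolding simple_root_def rn eps_def by simp
qed (simp add: simple_root_def eps_def)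

lemma inj_on_simple_root: "inj_on (simple_root n :: nat \<Rightarrow> 'a::field_char_0 mat \<Rightarrow> 'a) {1..n}"
proof (rule linorder_inj_onI)
  fix s r assume sr: "s < r" "s \<in> {1..n}" "r \<in> {1..n}"
  \<comment> \<open>The identity cut off after the first \<open>r\<close> coordinates: earlier
    simple roots vanish on it, the \<open>r\<close>-th does not. Roots are total functions, so they
    may be evaluated outside sp(2n).\<close>
  define H :: "'a mat" where "H = mat (2 * n) (2 * n) (\<lambda>(i, j). if i = j \<and> i < r then 1 else 0)"
  have "simple_root n s H = 0" using sr unfolding simple_root_def eps_def H_def by auto
  moreover have "simple_root n r H \<noteq> 0" using sr unfolding simple_root_def eps_def H_def by auto
  ultimately show "simple_root n s \<noteq> (simple_root n r :: 'a mat \<Rightarrow> 'a)" by metis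
qed auto

lemma simple_root_image_iff:
  fixes Q :: "('a::field_char_0 mat \<Rightarrow> 'a) \<Rightarrow> bool"
  assumes R: "R \<subseteq> {1..n}"
  shows "simple_root n ` R = {\<alpha> \<in> simple_roots n. \<not> Q \<alpha>} \<longleftrightarrow> (\<forall>r\<in>{1..n}. Q (simple_root n r) \<longleftrightarrow> r \<notin> R)"
proof -
  let ?s = "simple_root n :: nat \<Rightarrow> 'a mat \<Rightarrow> 'a"
  have "{\<alpha> \<in> simple_roots n. \<not> Q \<alpha>} = ?s ` {r \<in> {1..n}. \<not> Q (?s r)}" unfolding simple_roots_def by blast
  moreover have "{r \<in> {1..n}. \<not> Q (?s r)} \<subseteq> {1..n}" by blast
  ultimately have "?s ` R = {\<alpha> \<in> simple_roots n. \<not> Q \<alpha>} \<longleftrightarrow> R = {r \<in> {1..n}. \<not> Q (?s r)}"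
    using inj_on_image_eq_iff[OF inj_on_simple_root[of n, where ?'a = 'a] R] by simp
  also have "\<dots> \<longleftrightarrow> (\<forall>r\<in>{1..n}. Q (?s r) \<longleftrightarrow> r \<notin> R)" using R by blast
  finally show ?thesis .
qed

lemma zero_sp: "0\<^sub>m (2 * n) (2 * n) \<in> (sp n :: 'a::field mat set)"
  using sp_iff[of "0\<^sub>m (2 * n) (2 * n) :: 'a mat" n] fs.subspace_0[OF subspace_spf, of n] unfolding conv_zero by simp

lemma zero_sp_diag: "0\<^sub>m (2 * n) (2 * n) \<in> sp_diag n"
  unfolding sp_diag_def diagonal_mat_def using zero_sp by simp

lemma zero_sp_triangular: "0\<^sub>m (2 * n) (2 * n) \<in> sp_upper n" "0\<^sub>m (2 * n) (2 * n) \<in> sp_lower n"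
  unfolding sp_upper_def sp_lower_def using zero_sp by auto

lemma unconv_root_vec:
  fixes n p q :: nat
  assumes pq: "p < 2 * n" "q < 2 * n"
  defines "X \<equiv> unconv (2 * n) (root_vec n p q :: 'a::field fmat)"
  shows "X \<in> sp n" "conv X = root_vec n p q"
    "p = q \<Longrightarrow> X \<in> sp_diag n" "p < q \<Longrightarrow> X \<in> sp_upper n" "q < p \<Longrightarrow> X \<in> sp_lower n"
proof -
  have s: "(root_vec n p q :: 'a fmat) \<in> spf n" by (rule root_vec_spf[OF pq])
  show c: "conv X = root_vec n p q" unfolding X_def by (rule conv_unconv[OF spf_D(1)[OF s]])
  show X: "X \<in> sp n" using sp_iff[of X n] c s unfolding X_def by simp
  have e: "X $$ (i, j) = (if i = p \<and> j = q then 1 else 0) - sgn_sp n p * sgn_sp n q * (if i = mir n q \<and> j = mir n p then 1 else 0)"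
    if "i < 2 * n" "j < 2 * n" for i j
    using that unfolding X_def unconv_def root_vec_eq[OF pq] by simp
  have m: "mir n p < mir n q \<longleftrightarrow> q < p" "mir n q < mir n p \<longleftrightarrow> p < q" "mir n p = mir n q \<longleftrightarrow> p = q" using pq by auto
  have z: "X $$ (i, j) = 0" if "i < 2 * n" "j < 2 * n" "i \<noteq> p \<or> j \<noteq> q" "i \<noteq> mir n q \<or> j \<noteq> mir n p" for i j
  proof -
    have n: "\<not> (i = p \<and> j = q)" "\<not> (i = mir n q \<and> j = mir n p)" using that(3,4) by blast+
    show ?thesis unfolding e[OF that(1,2)] if_not_P[OF n(1)] if_not_P[OF n(2)] by simp
  qed
  have cX: "X \<in> carrier_mat (2 * n) (2 * n)" unfolding X_def by simp
  show "X \<in> sp_diag n" if "p = q"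
  proof -
    have "X $$ (i, j) = 0" if "i < 2 * n" "j < 2 * n" "i \<noteq> j" for i j using z[OF that(1,2)] that(3) \<open>p = q\<close> by blast
    then show ?thesis unfolding sp_diag_def diagonal_mat_def using X cX by auto
  qed
  show "X \<in> sp_upper n" if "p < q"
  proof -
    have "X $$ (i, j) = 0" if "i < 2 * n" "j < 2 * n" "j \<le> i" for i j
      by (rule z[OF that(1,2)]) (use m(2) \<open>p < q\<close> that(3) not_le in blast)+
    then show ?thesis unfolding sp_upper_def using X by blast
  qed
  show "X \<in> sp_lower n" if "q < p"
  proof -
    have "X $$ (i, j) = 0" if "i < 2 * n" "j < 2 * n" "i \<le> j" for i j
      by (rule z[OF that(1,2)]) (use m(1) \<open>q < p\<close> that(3) not_le in blast)+
    then show ?thesis unfolding sp_lower_def using X by blast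
  qed
qed

lemma root_vec_in_borel:
  fixes P :: "'a::field mat set"
  assumes B: "{H + U | H U. H \<in> sp_diag n \<and> U \<in> T} \<subseteq> P" and T: "0\<^sub>m (2 * n) (2 * n) \<in> T"
    and pq: "p < 2 * n" "q < 2 * n" and X: "p = q \<or> unconv (2 * n) (root_vec n p q) \<in> T"
  shows "root_vec n p q \<in> conv ` P"
proof -
  let ?X = "unconv (2 * n) (root_vec n p q :: 'a fmat)"
  have "?X + 0\<^sub>m (2 * n) (2 * n) = ?X" "0\<^sub>m (2 * n) (2 * n) + ?X = ?X" by auto
  then have "?X \<in> {H + U | H U. H \<in> sp_diag n \<and> U \<in> T}"
    using X T unconv_root_vec(3)[OF pq] zero_sp_diag[of n, where ?'a = 'a] by (metis (mono_tags, lifting) mem_Collect_eq)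
  then have "?X \<in> P" using B by blast
  then show ?thesis using unconv_root_vec(2)[OF pq, where ?'a = 'a] by (metis image_eqI)
qed

lemma diag_plus_entry:
  fixes H U :: "'a::field mat"
  assumes "H \<in> sp_diag n" "U \<in> sp n"
  shows "H + U \<in> carrier_mat (2 * n) (2 * n)" "conv (H + U) \<in> spf n"
    "i \<noteq> j \<Longrightarrow> ent (conv (H + U)) i j = ent (conv U) i j"
proof -
  have c: "H \<in> carrier_mat (2 * n) (2 * n)" "U \<in> carrier_mat (2 * n) (2 * n)"
    using sp_diag_D(1)[OF assms(1)] sp_carrier[OF assms(2)] by auto
  then show "H + U \<in> carrier_mat (2 * n) (2 * n)" by simp
  have "conv U \<in> spf n" using sp_iff[OF c(2)] assms(2) by blast
  then show "conv (H + U) \<in> spf n" unfolding conv_arith(1)[OF c]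
    by (rule fs.subspace_add[OF subspace_spf sp_diag_D(2)[OF assms(1)]])
  show "ent (conv (H + U)) i j = ent (conv U) i j" if "i \<noteq> j"
    unfolding conv_arith(1)[OF c] using sp_diag_D(3)[OF assms(1) that] by simp
qed

lemma not_crosses: "i \<le> j \<Longrightarrow> \<not> crosses R i j"
  unfolding crosses_def by auto

text \<open>This evaluates the definite description. The condition on missing roots translates into
  membership of the simple lower root vectors; the flag stabiliser then satisfies all three
  conditions, and \<open>parf_unique\<close> excludes any other subalgebra.\<close>

lemma parabolic_plus_eq:
  assumes R: "R \<subseteq> {1..n}"
  shows "parabolic_plus n (simple_root n ` R) = (unc (2 * n) (parf n R) :: 'a::field_char_0 mat set)"
proof -
  have root: "(simple_root n ` R = {\<alpha> \<in> simple_roots n. \<not> root_space n (\<lambda>H. - \<alpha> H) \<subseteq> P})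
    \<longleftrightarrow> (\<forall>r\<in>{1..n}. root_vec n r (r - 1) \<in> conv ` P \<longleftrightarrow> r \<notin> R)"
    if P: "lie_subalgebra n P" for P :: "'a mat set"
  proof -
    have "root_space n (\<lambda>H. - simple_root n r H) \<subseteq> P \<longleftrightarrow> root_vec n r (r - 1) \<in> conv ` P" if r: "r \<in> {1..n}" for r
      by (rule root_space_subset_iff[OF P]) (use r in \<open>auto simp: simple_root_diag[OF _ r]\<close>)
    then show ?thesis unfolding simple_root_image_iff[OF R, of "\<lambda>\<alpha>. root_space n (\<lambda>H. - \<alpha> H) \<subseteq> P"] by simp
  qed
  note sl = sub_lie_unc[OF sub_lie_parf[of n R, where ?'a = 'a]]
  show ?thesis unfolding parabolic_plus_def
  proof (rule the_equality, intro conjI)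
    show "lie_subalgebra n (unc (2 * n) (parf n R) :: 'a mat set)" by (rule sl)
    show "simple_root n ` R = {\<alpha> \<in> simple_roots n. \<not> root_space n (\<lambda>H. - \<alpha> H) \<subseteq> (unc (2 * n) (parf n R) :: 'a mat set)}"
      unfolding root[OF sl(1)] sl(2) using root_vec_parf[OF _ R] by blast
    show "{H + U | H U. H \<in> sp_diag n \<and> U \<in> sp_upper n} \<subseteq> (unc (2 * n) (parf n R) :: 'a mat set)"
    proof clarify
      fix H U :: "'a mat" assume H: "H \<in> sp_diag n" and U: "U \<in> sp_upper n"
      have Us: "U \<in> sp n" and Uz: "\<And>i j. i < 2 * n \<Longrightarrow> j < 2 * n \<Longrightarrow> j \<le> i \<Longrightarrow> U $$ (i, j) = 0"
        using U unfolding sp_upper_def by auto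
      note D = diag_plus_entry[OF H Us]
      have "\<not> crosses (R \<union> (\<lambda>r. 2 * n - r) ` R) i j" if "ent (conv (H + U)) i j \<noteq> 0" for i j
      proof (rule not_crosses, rule ccontr)
        assume ij: "\<not> i \<le> j"
        then have "ent (conv U) i j \<noteq> 0" using D(3)[of i j] that by auto
        then show False using Uz[of i j] ij sp_carrier[OF Us] by (auto simp: ent_conv split: if_splits)
      qed
      then show "H + U \<in> unc (2 * n) (parf n R)" unfolding unc_def parf_def using D(1,2) by blast
    qed
  next
    fix P :: "'a mat set"
    assume P: "lie_subalgebra n P \<and> {H + U | H U. H \<in> sp_diag n \<and> U \<in> sp_upper n} \<subseteq> P \<and>
      simple_root n ` R = {\<alpha> \<in> simple_roots n. \<not> root_space n (\<lambda>H. - \<alpha> H) \<subseteq> P}"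
    then have L: "P \<subseteq> carrier_mat (2 * n) (2 * n)" "sub_lie n (conv ` P)" unfolding lie_subalgebra_iff by auto
    have "conv ` P = parf n R"
    proof (rule parf_unique[OF L(2) R])
      fix p q assume pq: "p \<le> q" "q < 2 * n"
      show "root_vec n p q \<in> conv ` P"
      proof (rule root_vec_in_borel[of n "sp_upper n"])
        show "p = q \<or> unconv (2 * n) (root_vec n p q :: 'a fmat) \<in> sp_upper n"
          using unconv_root_vec(4)[of p n q, where ?'a = 'a] pq by (cases "p = q") auto
      qed (use P pq zero_sp_triangular in auto)
    next
      fix r assume "r \<in> {1..n}"
      then show "(root_vec n r (r - 1) \<in> conv ` P) = (r \<notin> R)"
        by (rule bspec[OF iffD1[OF root[OF conjunct1[OF P]] conjunct2[OF conjunct2[OF P]]]])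
    qed
    then show "P = unc (2 * n) (parf n R)" using unc_conv[OF L(1)] by simp
  qed
qed

lemma parabolic_minus_eq:
  assumes R: "R \<subseteq> {1..n}"
  shows "parabolic_minus n (simple_root n ` R) = (unc (2 * n) (tp ` parf n R) :: 'a::field_char_0 mat set)"
proof -
  have root: "(simple_root n ` R = {\<alpha> \<in> simple_roots n. \<not> root_space n \<alpha> \<subseteq> P})
    \<longleftrightarrow> (\<forall>r\<in>{1..n}. root_vec n (r - 1) r \<in> conv ` P \<longleftrightarrow> r \<notin> R)"
    if P: "lie_subalgebra n P" for P :: "'a mat set"
  proof -
    have "root_space n (simple_root n r) \<subseteq> P \<longleftrightarrow> root_vec n (r - 1) r \<in> conv ` P" if r: "r \<in> {1..n}" for r
      by (rule root_space_subset_iff[OF P]) (use r in \<open>auto simp: simple_root_diag[OF _ r]\<close>)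
    then show ?thesis unfolding simple_root_image_iff[OF R, of "\<lambda>\<alpha>. root_space n \<alpha> \<subseteq> P"] by simp
  qed
  note sl = sub_lie_unc[OF sub_lie_tp[OF sub_lie_parf[of n R, where ?'a = 'a]]]
  show ?thesis unfolding parabolic_minus_def
  proof (rule the_equality, intro conjI)
    show "lie_subalgebra n (unc (2 * n) (tp ` parf n R) :: 'a mat set)" by (rule sl)
    have "(root_vec n (r - 1) r :: 'a fmat) \<in> tp ` parf n R \<longleftrightarrow> r \<notin> R" if r: "r \<in> {1..n}" for r
    proof -
      have "tp (root_vec n (r - 1) r) = (root_vec n r (r - 1) :: 'a fmat)" by (rule tp_root_vec) (use r in auto)
      then show ?thesis unfolding tp_image_iff using root_vec_parf[OF r R, where ?'a = 'a] by simp
    qed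
    then show "simple_root n ` R = {\<alpha> \<in> simple_roots n. \<not> root_space n \<alpha> \<subseteq> (unc (2 * n) (tp ` parf n R) :: 'a mat set)}"
      unfolding root[OF sl(1)] sl(2) by blast
    show "{H + U | H U. H \<in> sp_diag n \<and> U \<in> sp_lower n} \<subseteq> (unc (2 * n) (tp ` parf n R) :: 'a mat set)"
    proof clarify
      fix H U :: "'a mat" assume H: "H \<in> sp_diag n" and U: "U \<in> sp_lower n"
      have Us: "U \<in> sp n" and Uz: "\<And>i j. i < 2 * n \<Longrightarrow> j < 2 * n \<Longrightarrow> i \<le> j \<Longrightarrow> U $$ (i, j) = 0"
        using U unfolding sp_lower_def by auto
      note D = diag_plus_entry[OF H Us]
      have "\<not> crosses (R \<union> (\<lambda>r. 2 * n - r) ` R) i j" if "ent (conv (H + U)) j i \<noteq> 0" for i j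
      proof (rule not_crosses, rule ccontr)
        assume ij: "\<not> i \<le> j"
        then have "ent (conv U) j i \<noteq> 0" using D(3)[of j i] that by auto
        then show False using Uz[of j i] ij sp_carrier[OF Us] by (auto simp: ent_conv split: if_splits)
      qed
      then show "H + U \<in> unc (2 * n) (tp ` parf n R)"
        unfolding unc_def parf_def tp_image_iff using D(1) tp_spf[OF D(2)] by simp
    qed
  next
    fix P :: "'a mat set"
    assume P: "lie_subalgebra n P \<and> {H + U | H U. H \<in> sp_diag n \<and> U \<in> sp_lower n} \<subseteq> P \<and>
      simple_root n ` R = {\<alpha> \<in> simple_roots n. \<not> root_space n \<alpha> \<subseteq> P}"
    then have L: "P \<subseteq> carrier_mat (2 * n) (2 * n)" "sub_lie n (conv ` P)" unfolding lie_subalgebra_iff by auto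
    have "conv ` P = tp ` parf n R"
    proof (rule parf_tp_unique[OF L(2) R])
      fix p q assume pq: "q \<le> p" "p < 2 * n"
      show "root_vec n p q \<in> conv ` P"
      proof (rule root_vec_in_borel[of n "sp_lower n"])
        show "p = q \<or> unconv (2 * n) (root_vec n p q :: 'a fmat) \<in> sp_lower n"
          using unconv_root_vec(5)[of p n q, where ?'a = 'a] pq by (cases "p = q") auto
      qed (use P pq zero_sp_triangular in auto)
    next
      fix r assume "r \<in> {1..n}"
      then show "(root_vec n (r - 1) r \<in> conv ` P) = (r \<notin> R)"
        by (rule bspec[OF iffD1[OF root[OF conjunct1[OF P]] conjunct2[OF conjunct2[OF P]]]])
    qed
    then show "P = unc (2 * n) (tp ` parf n R)" using unc_conv[OF L(1)] by simp
  qed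
qed

section \<open>The index of the seaweed\<close>

lemma phi_C_pair: "phi_C n [a, b] = simple_root n ` {a, a + b}"
proof -
  have "{k. 1 \<le> k \<and> k \<le> length [a, b]} = {1, 2}" by auto
  then have "phi_C n [a, b] = (\<lambda>k. simple_root n (sum_list (take k [a, b]))) ` {1, 2}"
    unfolding phi_C_def image_def by blast
  then show ?thesis by (simp add: numeral_2_eq_2)
qed

lemma phi_C_single: "phi_C n [c] = simple_root n ` {c}"
proof -
  have "{k. 1 \<le> k \<and> k \<le> length [c]} = {1}" by auto
  then have "phi_C n [c] = (\<lambda>k. simple_root n (sum_list (take k [c]))) ` {1}"
    unfolding phi_C_def image_def by blast
  then show ?thesis by simp
qed

text \<open>The break \<open>n\<close> is its own mirror image, which leaves exactly the breaks of
  \<open>swf\<close>.\<close>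

lemma parf_seaweed:
  assumes "a \<le> n" "c \<le> n"
  shows "parf n {a, n} \<inter> tp ` parf n {c} = swf n a c"
proof -
  have "X \<in> tp ` parf n {c} \<longleftrightarrow> X \<in> spf n \<and> (\<forall>i j. ent X i j \<noteq> 0 \<longrightarrow> \<not> crosses {c, 2 * n - c} j i)" for X :: "'a fmat"
  proof -
    have "tp X \<in> spf n \<longleftrightarrow> X \<in> spf n" using tp_spf[of X n] tp_spf[of "tp X" n] by auto
    moreover have "{c} \<union> (\<lambda>r. 2 * n - r) ` {c} = {c, 2 * n - c}" by auto
    ultimately show ?thesis unfolding tp_image_iff parf_def mem_Collect_eq ent_tp by auto
  qed
  moreover have "{a, n} \<union> (\<lambda>r. 2 * n - r) ` {a, n} = {a, n, 2 * n - a}" by auto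
  ultimately show ?thesis unfolding swf_def parf_def by auto
qed

text \<open>As \<open>a + b = n\<close>, the second break of \<open>[a, b]\<close> is
  \<open>n\<close>: the seaweed stabilises the isotropic span of the first \<open>n\<close>
  coordinates, which is what makes its upper right corner an abelian ideal.\<close>

lemma index_seaweed_C_eq:
  fixes a b c n :: nat
  assumes "a > 0" "a + b = n" "c > 0" "c \<le> n" and ind: "index_is (swf n a c :: 'k::field_char_0 fmat set) e"
  shows "index_seaweed_C TYPE('k) n [a, b] [c] = e"
proof -
  have R: "{a, n} \<subseteq> {1..n}" "{c} \<subseteq> {1..n}" using assms by auto
  let ?L = "parf n {a, n} \<inter> tp ` parf n {c} :: 'k fmat set"
  have Q: "seaweed_C n [a, b] [c] = (unc (2 * n) ?L :: 'k mat set)"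
    unfolding seaweed_C_def seaweed_def phi_C_pair phi_C_single assms(2) parabolic_plus_eq[OF R(1)] parabolic_minus_eq[OF R(2)]
    unfolding unc_def by blast
  have sl: "sub_lie n (parf n {a, n} :: 'k fmat set)" "sub_lie n (tp ` parf n {c} :: 'k fmat set)"
    by (rule sub_lie_parf, rule sub_lie_tp[OF sub_lie_parf])
  have "sub_lie n ?L"
    unfolding sub_lie_def
  proof (intro conjI ballI)
    show "fs.subspace ?L" using sl unfolding sub_lie_def by (intro fs.subspace_inter) auto
    show "?L \<subseteq> spf n" unfolding parf_def by blast
    show "x * y - y * x \<in> ?L" if "x \<in> ?L" "y \<in> ?L" for x y
      using that sl unfolding sub_lie_def by blast
  qed
  note u = sub_lie_unc[OF this]
  show ?thesis unfolding index_seaweed_C_def Q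
  proof (rule lie_index_conv)
    show "unc (2 * n) ?L \<subseteq> carrier_mat (2 * n) (2 * n)" unfolding unc_def by blast
    show "fs.subspace (conv ` unc (2 * n) ?L)" using u(1) unfolding lie_subalgebra_iff sub_lie_def by blast
    show "commutator x y \<in> unc (2 * n) ?L" if "x \<in> unc (2 * n) ?L" "y \<in> unc (2 * n) ?L" for x y
      using u(1) that unfolding lie_subalgebra_def by blast
    show "index_is (conv ` unc (2 * n) ?L) e" unfolding u(2) using parf_seaweed[of a n c, where ?'a = 'k] assms ind by simp
  qed
qed

theorem theorem5p2:
  fixes a b c n :: nat
  assumes "a > 0" and "b > 0" and "c > 0" and "n > 0"
    and "a + b = n"
    and "c = n - 1 \<or> c = n - 2"
  shows "index_seaweed_C TYPE('k::{alg_closed_field, field_char_0}) n [a, b] [c]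
           = gcd (a + b) (b + c) - 1"
proof (rule index_seaweed_C_eq[OF assms(1,5,3)])
  \<comment> \<open>\<open>k\<close> is the corner size and \<open>d = b - k\<close>. Since
    \<open>b + c = (a + b) + d\<close> and \<open>a + b = (a + k) + d\<close>, two subtractions turn
    one gcd into the other.\<close>
  have shift: "gcd (a + b) (b + c) = gcd (a + k) d" if "b = k + d" "c + k = n" for k d
  proof -
    have 1: "b + c = a + b + d" "a + b = (a + k) + d" using that assms(5) by auto
    then show ?thesis by (metis gcd_add1 gcd.commute gcd_add2)
  qed
  show "c \<le> n" using assms by auto
  \<comment> \<open>The case \<open>b = 1\<close> is separate for a corner of size two, because
    diagonal blocks of sizes \<open>a\<close>, 2 and \<open>b - 2\<close> require
    \<open>b \<ge> 2\<close>.\<close>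
  consider "c + 1 = n" | "c + 2 = n" "2 \<le> b" | "c + 2 = n" "b = 1" using assms by linarith
  then show "index_is (swf n a c :: 'k fmat set) (gcd (a + b) (b + c) - 1)"
  proof cases
    case 1
    have "c = n - 1" "n - 1 - a = b - 1" "a < n" using 1 assms by auto
    then show ?thesis using index_swf_minus_one[of a n, where ?'a = 'k] shift[of 1 "b - 1"] 1 assms by simp
  next
    case 2
    have "c = n - 2" "n - 2 - a = b - 2" "a + 2 \<le> n" using 2 assms by auto
    then show ?thesis using index_swf_minus_two[of a n, where ?'a = 'k] shift[of 2 "b - 2"] 2 assms by simp
  next
    case 3
    have e: "c = n - 2" "a = n - 1" "2 \<le> n" using 3 assms by auto
    have "a + b = Suc (b + c)" using 3 assms by auto
    then have "gcd (a + b) (b + c) = 1" by (metis coprime_Suc_left_nat coprime_imp_gcd_eq_1)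
    then show ?thesis using index_swf_minus_two_narrow[OF e(3,2), where ?'a = 'k] e(1) by simp
  qed
qed

end
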